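(* There exist constants $c,C>0$ (depending only on $d$ and $\mu$) such that for every finite set $K\subseteq\mathbb Z^d$, $$\|Ge_K\|_\infty:=\max_{x\in\mathbb Z^d}\sum_{y\in K}G(x,y)\,e_K(y)\le C,$$ and, if moreover $K\neq\emptyset$, $$\min_{x\in K}\sum_{y\in K}G(x,y)\,e_K(y)\ge c.$$
   Context: Fix $d\ge 5$. Let $\mu$ be a probability distribution on $\{0,1,2,\dots\}$ with mean $1$ and finite variance $\sigma^2>0$. Trees are rooted ordered (plane) trees. For a (possibly random) such tree $T$ and $x\in\mathbb Z^d$, the random walk indexed by $T$ started at $x$ is the family $(S^x_u)_{u\in T}$ with $S^x_{\mathrm{root}}=x$ such that, conditionally on $T$, the increments $S^x_u-S^x_{u^-}$ ($u^-$ the parent of $u$) are i.i.d. uniform on the $2d$ neighbours of $0$; $T^x=\{S^x_u:u\in T\}$ denotes its range. The infinite tree $\mathcal T$ is built as follows: the root has $i$ children with probability $\mu(i-1)$ ($i\ge1$), its first child is special and the others are normal; each special vertex has $i$ children with probability $i\mu(i)$, exactly one of which, chosen uniformly, is special, the others being normal; normal vertices have offspring law $\mu$; everything independent. The root and the special vertices form the spine (an infinite ray). Vertices of $\mathcal T$ are labelled by $\mathbb Z$: the root gets label $0$, the vertices on the side of the spine reached clockwise from the root get positive labels in depth-first order from the root, and all other vertices (including all spine vertices other than the root) get negative labels in depth-first order from infinity. $\mathcal T_-$ (the past) is the set of vertices with negative labels and $\mathcal T_+$ (the future) the set of vertices with nonnegative labels; $\mathcal T^x_-,\mathcal T^x_+$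 denote the corresponding ranges of the walk indexed by $\mathcal T$ started at $x$. $G(x,y)=G(y-x)=\mathbb E\big[\sum_{u\in\mathcal T_-}\mathbf 1(S^x_u=y)\big]$. For finite $K\subset\mathbb Z^d$ the equilibrium measure is $e_K(x)=\mathbf 1(x\in K)\,\mathbb P(\mathcal T^x_-\cap K=\emptyset)$. *)

theory Defs
  imports "HOL-Probability.Probability"
begin

text \<open>Lattice points of Z^d are vectors of type int^'d (d = CARD('d)).
  Vertices of plane trees are Ulam-Harris words (nat lists): the children of u are
  u@[0], u@[1], ..., ordered from first (leftmost) to last.\<close>

definition nbrs :: "(int^'d::finite) set" where
  "nbrs = {v. \<exists>i. v = (\<chi> j. if j = i then 1 else 0) \<or> v = (\<chi> j. if j = i then -1 else 0)}"

text \<open>Size-biased law: i with probability i*mu(i), together with a uniform index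
  in {0..<i} (the position of the special child).\<close>
definition sizebiased :: "nat pmf \<Rightarrow> (nat \<times> nat) pmf" where
  "sizebiased \<mu> = bind_pmf (embed_pmf (\<lambda>i. real i * pmf \<mu> i))
                     (\<lambda>i. map_pmf (\<lambda>j. (i, j)) (pmf_of_set {0..<i}))"

text \<open>Per-vertex randomness: (offspring if normal, (offspring, special index) if special,
  offspring if root, walk increment).\<close>
type_synonym 'd vdata = "nat \<times> (nat \<times> nat) \<times> nat \<times> (int^'d)"

definition vlaw :: "nat pmf \<Rightarrow> ('d::finite) vdata pmf" where
  "vlaw \<mu> = pair_pmf \<mu> (pair_pmf (sizebiased \<mu>) (pair_pmf (map_pmf Suc \<mu>) (pmf_of_set nbrs)))"

definition Omega :: "nat pmf \<Rightarrow> (nat list \<Rightarrow> ('d::finite) vdata) measure" where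
  "Omega \<mu> = PiM UNIV (\<lambda>_. measure_pmf (vlaw \<mu>))"

definition nrm_off :: "('d::finite) vdata \<Rightarrow> nat" where "nrm_off v = fst v"
definition sp_off :: "('d::finite) vdata \<Rightarrow> nat" where "sp_off v = fst (fst (snd v))"
definition sp_idx :: "('d::finite) vdata \<Rightarrow> nat" where "sp_idx v = snd (fst (snd v))"
definition root_off :: "('d::finite) vdata \<Rightarrow> nat" where "root_off v = fst (snd (snd v))"
definition incr :: "('d::finite) vdata \<Rightarrow> int^'d" where "incr v = snd (snd (snd v))"

fun spine :: "(nat list \<Rightarrow> ('d::finite) vdata) \<Rightarrow> nat \<Rightarrow> nat list" where
  "spine \<omega> 0 = []"
| "spine \<omega> (Suc k) = spine \<omega> k @ [if k = 0 then 0 else sp_idx (\<omega> (spine \<omega> k))]"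

definition nchildren :: "(nat list \<Rightarrow> ('d::finite) vdata) \<Rightarrow> nat list \<Rightarrow> nat" where
  "nchildren \<omega> u = (if u = [] then root_off (\<omega> u)
                     else if u \<in> range (spine \<omega>) then sp_off (\<omega> u)
                     else nrm_off (\<omega> u))"

inductive_set tree :: "(nat list \<Rightarrow> ('d::finite) vdata) \<Rightarrow> nat list set" for \<omega> where
  root: "[] \<in> tree \<omega>"
| child: "u \<in> tree \<omega> \<Longrightarrow> i < nchildren \<omega> u \<Longrightarrow> u @ [i] \<in> tree \<omega>"

text \<open>The past T_-: spine vertices other than the root, and all descendants of children of
  spine vertices s_k (k >= 1) lying before (to the left of) the special child s_(k+1).
  The future (root, root's normal children = positions 1.., and the right-hand sides) is
  the complement.\<close>
definition past :: "(nat list \<Rightarrow> ('d::finite) vdata) \<Rightarrow> nat list set" where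
  "past \<omega> = {u \<in> tree \<omega>. (\<exists>k\<ge>1. u = spine \<omega> k) \<or>
      (\<exists>k\<ge>1. \<exists>j < sp_idx (\<omega> (spine \<omega> k)). \<exists>w. u = spine \<omega> k @ [j] @ w)}"

definition walk :: "(nat list \<Rightarrow> ('d::finite) vdata) \<Rightarrow> int^'d \<Rightarrow> nat list \<Rightarrow> int^'d" where
  "walk \<omega> x u = x + (\<Sum>k\<in>{1..length u}. incr (\<omega> (take k u)))"

definition Gf :: "nat pmf \<Rightarrow> int^'d \<Rightarrow> int^'d \<Rightarrow> ennreal" where
  "Gf \<mu> x y = (\<integral>\<^sup>+ \<omega>. (\<integral>\<^sup>+ u. indicator {y} (walk \<omega> x u) \<partial>count_space (past \<omega>)) \<partial>Omega \<mu>)"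

definition eqm :: "nat pmf \<Rightarrow> (int^'d) set \<Rightarrow> int^'d \<Rightarrow> ennreal" where
  "eqm \<mu> K x = indicator K x *
      emeasure (Omega \<mu>) {\<omega> \<in> space (Omega \<mu>). walk \<omega> x ` past \<omega> \<inter> K = {}}"

end

theory Submission
  imports Defs
begin

text \<open>
Write P for the averaging operator of simple random walk, p for the probability that a
normal branch hits K, and e for the probability that the past avoids K. Decomposing the
tree at its root gives p = 1 on K and p = \<phi> Pp off K, and e = P(Be) with B = \<phi> off K and
B = 0 on K, where 1 - \<phi> is comparable to Pp. Counting by generations, G(x,y) is the sum
over n of (1 + n v/2) P^(n+1)(x,y) with v the offspring variance, hence comparable to
(1 + |x-y|^2)^((4-d)/2).

The defect \<sigma> = e - Be is comparable to p e, and summing P^t \<sigma> telescopes, so the sum of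
(1 + |z|^2)^((2-d)/2) p(z) e(z) is bounded above, and below as well when 0 lies in K.
With A f = B Pf one has p = sum of A^s 1_K, and since e = P(Be) the sum of (A^s f) e over
Z^d does not depend on s. The points of K at distance about r contribute for about r^2 steps
before their branches have moved away, which turns the exponent (2-d)/2 into (4-d)/2.
What has to be excluded is a loss through distant scales: p restricted to branches that
travel far or live long is at most C/r^2 (displacement and survival estimates), it is spread
by comparison with explicit test functions, and e is at most a constant times its mean
at the scale considered, except on a set controlled by the variance of e^(3/4) along the walk.
\<close>

section \<open>Simple random walk averages\<close>

text \<open>The bound C/r^2 for branches that travel far is universal because the killing rate 1 -
  \<phi> is comparable to the hitting function itself: a part u of p satisfies u \<le> Pu - c1
  (Pu)^2 away from its sources, and such u lie below a barrier that blows up at the boundary of a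
  ball, whatever K is. The obstacle is that K may look different at every scale, so that m(t) = P^t
  e(0) may climb from near 0 to 1 over arbitrarily many scales. An estimate that loses a factor at
  each scale is useless; what is bounded is the sum of the deviations of e from m(t) over all
  scales. This explains e^(3/4): the increments of P^t(e^(3/2))(0) dominate the energy of e^(3/4),
  and weighted by m(t)^(-1/2) they still have a bounded sum. No local limit theorem is used: kernel
  bounds come from Taylor expansion of powers of A + |z|^2, and lower bounds concern sums over time
  windows, where the parity of the walk is harmless. In the lower bound a separation of k scales
  stays free: the loss is O(2^(-k)), the price depends on k alone, and k is fixed at the
  end.\<close>

definition srw :: "(int^'d::finite \<Rightarrow> real) \<Rightarrow> int^'d \<Rightarrow> real" where
  "srw f z = (\<Sum>v\<in>nbrs. f (z + v)) / (2 * real CARD('d))"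

definition sq :: "int^'d::finite \<Rightarrow> real" where
  "sq z = (\<Sum>i\<in>UNIV. (real_of_int (z $ i))\<^sup>2)"

text \<open>Values in \<open>ennreal\<close> allow sums to be exchanged without summability proofs;
  where a common term has to be cancelled, its finiteness is shown separately.\<close>

definition tot :: "(int^'d::finite \<Rightarrow> real) \<Rightarrow> ennreal" where
  "tot f = (\<integral>\<^sup>+z. ennreal (f z) \<partial>count_space UNIV)"

lemma nbrs_eq: "nbrs = range (\<lambda>i. axis i 1) \<union> range (\<lambda>i. axis i (-1))"
  by (auto simp: nbrs_def axis_def)

lemma finite_nbrs [simp]: "finite nbrs"
  by (simp add: nbrs_eq)

lemma sum_nbrs:
  "(\<Sum>v\<in>nbrs. g v) = (\<Sum>i\<in>UNIV. g (axis i 1) + g (axis i (-1)) :: real)"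
proof -
  have inj: "inj (\<lambda>i::'a. axis i (c::int))" if "c \<noteq> 0" for c
    using that by (auto simp: inj_def axis_eq_axis)
  have disj: "range (\<lambda>i::'a. axis i (1::int)) \<inter> range (\<lambda>i. axis i (-1)) = {}"
    by (auto simp: axis_eq_axis)
  show ?thesis
    unfolding nbrs_eq
    by (subst sum.union_disjoint)
       (use disj in \<open>auto simp: sum.reindex inj sum.distrib o_def\<close>)
qed

lemma card_nbrs: "card (nbrs :: (int^'d::finite) set) = 2 * CARD('d)"
proof -
  have "real (card (nbrs :: (int^'d) set)) = (\<Sum>v\<in>(nbrs :: (int^'d) set). 1)" by simp
  also have "\<dots> = 2 * CARD('d)" by (subst sum_nbrs) simp
  finally show ?thesis by linarith
qed

lemma uminus_nbrs: "v \<in> nbrs \<Longrightarrow> - v \<in> nbrs"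
  unfolding nbrs_def by (auto simp: vec_eq_iff)

lemma nbrs_ne: "nbrs \<noteq> {}" by (auto simp: nbrs_eq)

lemma srw_alt: "srw f (z::int^'d::finite) =
    (\<Sum>i\<in>UNIV. f (z + axis i 1) + f (z + axis i (-1))) / (2 * real CARD('d))"
  by (simp add: srw_def sum_nbrs)

lemma srw_add: "srw (\<lambda>z. f z + g z) z = srw f z + srw g z"
  by (simp add: srw_def sum.distrib add_divide_distrib)

lemma srw_diff: "srw (\<lambda>z. f z - g z) z = srw f z - srw g z"
  by (simp add: srw_def sum_subtractf diff_divide_distrib)

lemma srw_cmult: "srw (\<lambda>z. c * f z) z = c * srw f z"
  by (simp add: srw_def sum_distrib_left)

lemma srw_const [simp]: "srw (\<lambda>z::int^'d::finite. c) z = c"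
  by (simp add: srw_def card_nbrs)

lemma srw_sum: "srw (\<lambda>z. \<Sum>i\<in>I. f i z) z = (\<Sum>i\<in>I. srw (f i) z)"
  by (induction I rule: infinite_finite_induct) (simp_all add: srw_add)

lemma srw_mono: "(\<And>v. v \<in> nbrs \<Longrightarrow> f (z + v) \<le> g (z + v)) \<Longrightarrow> srw f z \<le> srw g z"
  by (simp add: srw_def divide_right_mono sum_mono)

lemma srw_cong: "(\<And>v. v \<in> nbrs \<Longrightarrow> f (z + v) = g (z + v)) \<Longrightarrow> srw f z = srw g z"
  by (simp add: srw_def)

lemma srw_nonneg: "(\<And>v. v \<in> nbrs \<Longrightarrow> 0 \<le> f (z + v)) \<Longrightarrow> 0 \<le> srw f z"
  using srw_mono[where f="\<lambda>_. 0" and g=f] by simp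

lemma srw_le: "(\<And>v. v \<in> nbrs \<Longrightarrow> f (z + v) \<le> c) \<Longrightarrow> srw f z \<le> c"
  using srw_mono[where f=f and g="\<lambda>_. c"] by simp

lemma srw_shift: "srw (\<lambda>z. f (z + a)) z = srw f (z + a)"
  by (simp add: srw_def add_ac)

lemma srw_square_le: "(srw f z)\<^sup>2 \<le> srw (\<lambda>z. (f z)\<^sup>2) z"
proof -
  have "0 \<le> srw (\<lambda>w. (f w - srw f z)\<^sup>2) z" by (intro srw_nonneg) simp
  also have "srw (\<lambda>w. (f w - srw f z)\<^sup>2) z = srw (\<lambda>w. ((f w)\<^sup>2 - (2 * srw f z) * f w) + (srw f z)\<^sup>2) z"
    by (intro srw_cong) (simp add: power2_eq_square algebra_simps)
  also have "\<dots> = srw (\<lambda>w. (f w)\<^sup>2) z - (srw f z)\<^sup>2"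
    by (simp only: srw_add srw_diff srw_cmult srw_const) (simp add: power2_eq_square)
  finally show ?thesis by simp
qed

section \<open>Iterates of the averaging operator\<close>

abbreviation srwn :: "nat \<Rightarrow> (int^'d::finite \<Rightarrow> real) \<Rightarrow> int^'d \<Rightarrow> real" where
  "srwn t f \<equiv> (srw ^^ t) f"

lemma srwn_Suc: "srwn (Suc t) f z = srw (srwn t f) z" by simp

lemma srwn_Suc2: "srwn (Suc t) f = srwn t (srw f)"
  by (metis comp_apply funpow_Suc_right)

lemma srwn_add_time: "srwn (s + t) f = srwn s (srwn t f)"
  by (simp add: funpow_add)

lemma srwn_add: "srwn t (\<lambda>z. f z + g z) z = srwn t f z + srwn t g z"
proof (induction t arbitrary: z)
  case (Suc t)
  have "srwn t (\<lambda>z. f z + g z) = (\<lambda>z. srwn t f z + srwn t g z)" using Suc by blast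
  then show ?case by (simp add: srw_add)
qed simp

lemma srwn_cmult: "srwn t (\<lambda>z. c * f z) z = c * srwn t f z"
proof (induction t arbitrary: z)
  case (Suc t)
  have "srwn t (\<lambda>z. c * f z) = (\<lambda>z. c * srwn t f z)" using Suc by blast
  then show ?case by (simp add: srw_cmult)
qed simp

lemma srwn_diff: "srwn t (\<lambda>z. f z - g z) z = srwn t f z - srwn t g z"
  using srwn_add[of t f "\<lambda>z. -1 * g z" z] srwn_cmult[of t "-1" g z] by simp

lemma srwn_const [simp]: "srwn t (\<lambda>z. c) (z::int^'d::finite) = c"
proof (induction t arbitrary: z)
  case (Suc t)
  have "srwn t (\<lambda>z::int^'d. c) = (\<lambda>z. c)" using Suc by blast
  then show ?case by simp
qed simp

lemma srwn_sum: "srwn t (\<lambda>z. \<Sum>i\<in>I. f i z) z = (\<Sum>i\<in>I. srwn t (f i) z)"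
  by (induction I rule: infinite_finite_induct) (simp_all add: srwn_add)

lemma srwn_mono: "(\<And>z. f z \<le> g z) \<Longrightarrow> srwn t f z \<le> srwn t g z"
  by (induction t arbitrary: z) (auto intro!: srw_mono)

lemma srwn_nonneg: "(\<And>z. 0 \<le> f z) \<Longrightarrow> 0 \<le> srwn t f z"
  using srwn_mono[of "\<lambda>_. 0" f t z] by simp

lemma srwn_le: "(\<And>z. f z \<le> c) \<Longrightarrow> srwn t f z \<le> c"
  using srwn_mono[of f "\<lambda>_. c" t z] by simp

lemma srwn_shift: "srwn t (\<lambda>z. f (z + a)) z = srwn t f (z + a)"
proof (induction t arbitrary: z)
  case (Suc t)
  have "srwn t (\<lambda>z. f (z + a)) = (\<lambda>z. srwn t f (z + a))" using Suc by blast
  then show ?case by (simp add: srw_shift)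
qed simp

section \<open>Sums over the lattice and self-adjointness\<close>

lemma tot_mono: "(\<And>z. f z \<le> g z) \<Longrightarrow> tot f \<le> tot g"
  by (auto simp: tot_def intro!: nn_integral_mono ennreal_leI)

lemma tot_add: "(\<And>z. 0 \<le> f z) \<Longrightarrow> (\<And>z. 0 \<le> g z) \<Longrightarrow> tot (\<lambda>z. f z + g z) = tot f + tot g"
  by (simp add: tot_def nn_integral_add)

lemma tot_cmult: "0 \<le> c \<Longrightarrow> tot (\<lambda>z. c * f z) = ennreal c * tot f"
  by (simp add: tot_def ennreal_mult' nn_integral_cmult)

lemma tot_zero [simp]: "tot (\<lambda>z. 0) = 0" by (simp add: tot_def)

lemma tot_sum: "(\<And>i z. i \<in> I \<Longrightarrow> 0 \<le> f i z) \<Longrightarrow> tot (\<lambda>z. \<Sum>i\<in>I. f i z) = (\<Sum>i\<in>I. tot (f i))"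
proof (induction I rule: infinite_finite_induct)
  case (insert i I)
  then show ?case by (simp add: tot_add sum_nonneg)
qed simp_all

lemma tot_shift: "tot (\<lambda>z. f (z + a)) = tot f"
proof -
  have "bij_betw (\<lambda>z. z + a) UNIV UNIV"
    by (rule bij_betwI[where g = "\<lambda>z. z - a"]) auto
  from nn_integral_bij_count_space[OF this, of "\<lambda>z. ennreal (f z)"] show ?thesis
    by (simp add: tot_def)
qed

text \<open>Self-adjointness of the walk for counting measure: translate the sum by each step and
  use that the set of steps is symmetric.\<close>

lemma tot_srw_swap:
  fixes f g :: "int^'d::finite \<Rightarrow> real"
  assumes f: "\<And>z. 0 \<le> f z" and g: "\<And>z. 0 \<le> g z"
  shows "tot (\<lambda>z. srw f z * g z) = tot (\<lambda>z. f z * srw g z)"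
proof -
  let ?c = "1 / (2 * real CARD('d))"
  have "tot (\<lambda>z. srw f z * g z) = tot (\<lambda>z. ?c * (\<Sum>v\<in>nbrs. f (z + v) * g z))"
    by (simp add: srw_def sum_distrib_right)
  also have "\<dots> = ennreal ?c * (\<Sum>v\<in>nbrs. tot (\<lambda>z. f (z + v) * g z))"
    by (subst tot_cmult) (simp_all add: tot_sum f g)
  also have "(\<Sum>v\<in>nbrs. tot (\<lambda>z. f (z + v) * g z)) = (\<Sum>v\<in>nbrs. tot (\<lambda>z. f z * g (z - v)))"
  proof (rule sum.cong[OF refl])
    fix v show "tot (\<lambda>z. f (z + v) * g z) = tot (\<lambda>z. f z * g (z - v))"
      using tot_shift[of "\<lambda>z. f z * g (z - v)" v] by simp
  qed
  also have "\<dots> = (\<Sum>v\<in>nbrs. tot (\<lambda>z. f z * g (z + v)))"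
    by (rule sum.reindex_bij_witness[of _ uminus uminus]) (auto simp: uminus_nbrs)
  also have "ennreal ?c * \<dots> = tot (\<lambda>z. ?c * (\<Sum>v\<in>nbrs. f z * g (z + v)))"
    by (subst tot_cmult) (simp_all add: tot_sum f g)
  also have "\<dots> = tot (\<lambda>z. f z * srw g z)"
    by (simp add: srw_def flip: sum_distrib_left)
  finally show ?thesis .
qed

lemma tot_srwn_swap:
  assumes f: "\<And>z. 0 \<le> f z" and g: "\<And>z. 0 \<le> g z"
  shows "tot (\<lambda>z. srwn t f z * g z) = tot (\<lambda>z. f z * srwn t g z)"
  using g
proof (induction t arbitrary: g)
  case (Suc t)
  have "tot (\<lambda>z. srwn (Suc t) f z * g z) = tot (\<lambda>z. srwn t f z * srw g z)"
    using tot_srw_swap[of "srwn t f" g] Suc.prems by (simp add: srwn_nonneg f)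
  also have "\<dots> = tot (\<lambda>z. f z * srwn t (srw g) z)"
    by (intro Suc.IH srw_nonneg Suc.prems)
  finally show ?case by (simp only: srwn_Suc2)
qed simp

lemma tot_indicator: "tot (\<lambda>z. indicat_real {a} z * f z) = ennreal (f a)"
proof -
  have "tot (\<lambda>z. indicat_real {a} z * f z) = (\<integral>\<^sup>+z. ennreal (f z) * indicator {a} z \<partial>count_space UNIV)"
    unfolding tot_def by (intro nn_integral_cong) (simp split: split_indicator)
  also have "\<dots> = ennreal (f a)"
    by (simp add: nn_integral_indicator_singleton)
  finally show ?thesis .
qed

text \<open>The heat kernel representation: self-adjointness moves the \<open>t\<close> steps onto
  the point mass at \<open>a\<close>.\<close>

lemma srwn_kernel:
  "(\<And>z. 0 \<le> g z) \<Longrightarrow> ennreal (srwn t g a) = tot (\<lambda>z. srwn t (indicat_real {a}) z * g z)"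
  by (simp add: tot_srwn_swap tot_indicator)

lemma tot_finite_support:
  assumes "finite {z. f z \<noteq> 0}"
  shows "tot f < \<top>"
proof -
  have "tot f = (\<integral>\<^sup>+z. ennreal (f z) \<partial>count_space {z. f z \<noteq> 0})"
    unfolding tot_def
    by (subst nn_integral_count_space_indicator) (auto intro!: nn_integral_cong simp: indicator_def)
  also have "\<dots> = (\<Sum>z | f z \<noteq> 0. ennreal (f z))"
    using assms by (rule nn_integral_count_space_finite)
  also have "\<dots> < \<top>" by (simp add: assms)
  finally show ?thesis .
qed

lemma tot_finite_set:
  assumes "finite S" "\<And>z. z \<notin> S \<Longrightarrow> f z = 0" "\<And>z. 0 \<le> f z"
  shows "tot f = ennreal (\<Sum>z\<in>S. f z)"
proof -
  have "tot f = (\<integral>\<^sup>+z. ennreal (f z) \<partial>count_space S)"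
    unfolding tot_def
    by (subst nn_integral_count_space_indicator) (auto intro!: nn_integral_cong simp: indicator_def assms)
  then show ?thesis using assms by (simp add: nn_integral_count_space_finite sum_ennreal)
qed

section \<open>The squared norm along the walk\<close>

lemma sq_nonneg [simp]: "0 \<le> sq z" by (simp add: sq_def sum_nonneg)

lemma sq_zero [simp]: "sq 0 = 0" by (simp add: sq_def)

lemma sq_uminus [simp]: "sq (- z) = sq z" by (simp add: sq_def)

lemma sq_eq_0 [simp]: "sq z = 0 \<longleftrightarrow> z = 0"
  by (simp add: sq_def sum_nonneg_eq_0_iff vec_eq_iff)

lemma comp_sq_le: "(real_of_int (z $ i))\<^sup>2 \<le> sq z"
  unfolding sq_def by (rule member_le_sum) auto

lemma comp_le: "\<bar>real_of_int (z $ i)\<bar> \<le> sqrt (sq z)"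
  using comp_sq_le[of z i] real_le_rsqrt by fastforce

lemma sq_axis: "sq (z + axis i c) = sq z + (real_of_int c)\<^sup>2 + 2 * c * z $ i"
proof -
  have "sq (z + axis i c) = (\<Sum>j\<in>UNIV. (real_of_int (z$j))\<^sup>2 + (if j = i then (real_of_int c)\<^sup>2 + 2 * c * z $ i else 0))"
    unfolding sq_def by (intro sum.cong refl) (auto simp: axis_def power2_eq_square algebra_simps)
  also have "\<dots> = sq z + (real_of_int c)\<^sup>2 + 2 * c * z $ i"
    by (simp add: sum.distrib sq_def)
  finally show ?thesis .
qed

lemma sqrt_sq_triangle: "sqrt (sq (z + w)) \<le> sqrt (sq z) + sqrt (sq w)"
proof -
  have "sqrt (sq a) = L2_set (\<lambda>i. real_of_int (a $ i)) UNIV" for a :: "int^'a"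
    by (simp add: sq_def L2_set_def)
  then show ?thesis using L2_set_triangle_ineq[of "\<lambda>i. real_of_int (z $ i)" "\<lambda>i. real_of_int (w $ i)" UNIV]
    by simp
qed

lemma sq_nbrs: "v \<in> nbrs \<Longrightarrow> sq v = 1"
  using sq_axis[of 0 _ 1] sq_axis[of 0 _ "-1"] by (auto simp: nbrs_eq)

lemma sqrt_sq_nbr_le: "v \<in> nbrs \<Longrightarrow> sqrt (sq (z + v)) \<le> sqrt (sq z) + 1"
  using sqrt_sq_triangle[of z v] by (simp add: sq_nbrs)

lemma sqrt_sq_nbr_ge: "v \<in> nbrs \<Longrightarrow> sqrt (sq (z + v)) \<ge> sqrt (sq z) - 1"
  using sqrt_sq_triangle[of "z + v" "- v"] by (simp add: sq_nbrs)

lemma srw_sq: "srw sq z = sq z + 1"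
  by (simp add: srw_alt sq_axis sum.distrib field_simps)

lemma srwn_sq: "srwn n sq (z::int^'d::finite) = sq z + real n"
proof (induction n arbitrary: z)
  case (Suc n)
  have "srwn n sq = (\<lambda>z::int^'d. sq z + real n)" using Suc by blast
  then show ?case by (simp add: srw_add srw_sq)
qed simp

lemma finite_sq_le: "finite {z :: int^'d::finite. sq z \<le> R}"
proof -
  have "{z :: int^'d. sq z \<le> R} \<subseteq> {z. \<forall>i. z $ i \<in> {- \<lceil>R\<rceil> .. \<lceil>R\<rceil>}}"
  proof safe
    fix z :: "int^'d" and i assume "sq z \<le> R"
    then have "(real_of_int (z $ i))\<^sup>2 \<le> R" using comp_sq_le[of z i] by linarith
    moreover have "\<bar>z $ i\<bar> \<le> (z $ i)\<^sup>2"
      by (metis abs_ge_zero abs_le_square_iff abs_mult_self_eq int_one_le_iff_zero_less linorder_not_less mult.commute mult_cancel_right1 mult_right_mono order_le_less power2_eq_square)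
    ultimately have "real_of_int \<bar>z $ i\<bar> \<le> R" by (smt (verit) of_int_le_iff of_int_power)
    then have "\<bar>z $ i\<bar> \<le> \<lceil>R\<rceil>" by linarith
    then show "z $ i \<in> {- \<lceil>R\<rceil> .. \<lceil>R\<rceil>}" by auto
  qed
  moreover have "finite {z :: int^'d. \<forall>i. z $ i \<in> {- \<lceil>R\<rceil> .. \<lceil>R\<rceil>}}"
  proof -
    have "finite ((\<lambda>f. \<chi> i. f i) ` (PiE (UNIV :: 'd set) (\<lambda>_. {- \<lceil>R\<rceil> .. \<lceil>R\<rceil>})))"
      by (intro finite_imageI finite_PiE) auto
    moreover have "{z :: int^'d. \<forall>i. z $ i \<in> {- \<lceil>R\<rceil> .. \<lceil>R\<rceil>}} \<subseteq> (\<lambda>f. \<chi> i. f i) ` (PiE (UNIV :: 'd set) (\<lambda>_. {- \<lceil>R\<rceil> .. \<lceil>R\<rceil>}))"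
    proof
      fix z :: "int^'d" assume "z \<in> {z. \<forall>i. z $ i \<in> {- \<lceil>R\<rceil> .. \<lceil>R\<rceil>}}"
      then show "z \<in> (\<lambda>f. \<chi> i. f i) ` (PiE (UNIV :: 'd set) (\<lambda>_. {- \<lceil>R\<rceil> .. \<lceil>R\<rceil>}))"
        by (intro image_eqI[of _ _ "\<lambda>i. z $ i"]) (auto simp: vec_eq_iff)
    qed
    ultimately show ?thesis by (rule finite_subset[rotated])
  qed
  ultimately show ?thesis by (rule finite_subset)
qed

section \<open>Powers of the squared norm as super- and subharmonic functions\<close>

text \<open>Restricting \<open>h\<close> to half of \<open>x\<close> keeps the intermediate point
  comparable to \<open>x\<close>, so that the remainder has the size of the first omitted
  term.\<close>

lemma powr_neg_Taylor:
  fixes x h b :: real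
  assumes x: "0 < x" and h: "\<bar>h\<bar> \<le> x / 2" and n: "0 < n"
  shows "\<exists>\<xi>. x / 2 \<le> \<xi> \<and> \<xi> \<le> 3 * x / 2 \<and>
    (x + h) powr (-b) = (\<Sum>m<n. (-1)^m * pochhammer b m * x powr (-b - m) / fact m * h^m)
      + (-1)^n * pochhammer b n * \<xi> powr (-b - n) / fact n * h^n"
proof (cases "h = 0")
  case True
  have "(\<Sum>m<n. (-1)^m * pochhammer b m * x powr (-b - m) / fact m * h^m) =
        (\<Sum>m\<in>{0}. (-1)^m * pochhammer b m * x powr (-b - m) / fact m * h^m)"
    using n True by (intro sum.mono_neutral_right) auto
  then show ?thesis using True n x by (intro exI[of _ x]) (auto simp: power_0_left)
next
  case False
  define df where "df m t = (-1)^m * pochhammer b m * t powr (-b - real m)" for m and t :: real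
  have "\<exists>t. (if x + h < x then x + h < t \<and> t < x else x < t \<and> t < x + h) \<and>
      (\<lambda>t. t powr (-b)) (x + h) = (\<Sum>m<n. df m x / fact m * (x + h - x)^m) + df n t / fact n * (x + h - x)^n"
  proof (rule Taylor[where a = "x / 2" and b = "3 * x / 2"])
    show "\<forall>m t. m < n \<and> x / 2 \<le> t \<and> t \<le> 3 * x / 2 \<longrightarrow> (df m has_real_derivative df (Suc m) t) (at t)"
    proof safe
      fix m t assume t: "x / 2 \<le> t"
      then have "t > 0" using x by linarith
      then show "(df m has_real_derivative df (Suc m) t) (at t)"
        unfolding df_def
        by (auto intro!: derivative_eq_intros simp: pochhammer_Suc algebra_simps)
    qed
  qed (use n h x False in \<open>auto simp: df_def abs_le_iff\<close>)
  then obtain t where t: "if x + h < x then x + h < t \<and> t < x else x < t \<and> t < x + h"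
    and eq: "(x + h) powr (-b) = (\<Sum>m<n. df m x / fact m * h^m) + df n t / fact n * h^n" by auto
  have "x / 2 \<le> t" "t \<le> 3 * x / 2" using t h by (auto split: if_splits)
  then show ?thesis using eq by (intro exI[of _ t]) (simp add: df_def)
qed

lemma powr_neg_antimono: "0 < x \<Longrightarrow> x \<le> y \<Longrightarrow> 0 \<le> c \<Longrightarrow> y powr (-c) \<le> x powr (-c :: real)"
  using powr_mono2[of c x y] by (simp add: powr_minus le_imp_inverse_le)

lemma powr_half: "0 < x \<Longrightarrow> (x / 2) powr (-c) = 2 powr c * x powr (-c :: real)"
  by (simp add: powr_divide powr_minus field_simps)

text \<open>Order four is what the superharmonic estimates need. The increment of the squared norm
  has size at most about sqrt \<open>x\<close>, so this remainder is smaller than the leading terms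
  by a factor 1/\<open>x\<close>, whereas a remainder of order two would spoil the coefficient of
  the second-order term.\<close>

lemma powr_neg_upper4:
  fixes x h b :: real
  assumes x: "0 < x" and h: "\<bar>h\<bar> \<le> x / 2" and b: "0 < b"
  shows "(x + h) powr (-b) \<le> x powr (-b) - b * x powr (-b-1) * h + b * (b+1) / 2 * x powr (-b-2) * h\<^sup>2
     - b * (b+1) * (b+2) / 6 * x powr (-b-3) * h^3 + pochhammer b 4 * 2 powr (b+4) / 24 * x powr (-b-4) * h^4"
proof -
  obtain t where t: "x / 2 \<le> t" and
    eq: "(x + h) powr (-b) = (\<Sum>m<4. (-1)^m * pochhammer b m * x powr (-b - m) / fact m * h^m)
      + (-1)^4 * pochhammer b 4 * t powr (-b - 4) / fact 4 * h^4"
    using powr_neg_Taylor[OF x h, of 4 b] by auto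
  have "t powr (-(b+4)) \<le> (x / 2) powr (-(b+4))"
    using t x b by (intro powr_neg_antimono) auto
  also have "\<dots> = 2 powr (b+4) * x powr (-(b+4))" using x by (rule powr_half)
  finally have "pochhammer b 4 * t powr (-b-4) / 24 * h^4 \<le> pochhammer b 4 * (2 powr (b+4) * x powr (-b-4)) / 24 * h^4"
    using b by (intro mult_right_mono divide_right_mono mult_left_mono)
      (auto simp: pochhammer_nonneg algebra_simps)
  then show ?thesis using eq
    by (simp add: eval_nat_numeral pochhammer_Suc lessThan_Suc field_simps)
qed

lemma powr_neg_lower3:
  fixes x h b :: real
  assumes x: "0 < x" and h: "\<bar>h\<bar> \<le> x / 2" and b: "0 < b"
  shows "(x + h) powr (-b) \<ge> x powr (-b) - b * x powr (-b-1) * h + b * (b+1) / 2 * x powr (-b-2) * h\<^sup>2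
     - b * (b+1) * (b+2) / 6 * x powr (-b-3) * h^3"
proof -
  obtain t where
    eq: "(x + h) powr (-b) = (\<Sum>m<4. (-1)^m * pochhammer b m * x powr (-b - m) / fact m * h^m)
      + (-1)^4 * pochhammer b 4 * t powr (-b - 4) / fact 4 * h^4"
    using powr_neg_Taylor[OF x h, of 4 b] by auto
  have "0 \<le> pochhammer b 4 * t powr (-b-4) / 24 * h^4"
    using b by (auto simp: pochhammer_nonneg)
  then show ?thesis using eq
    by (simp add: eval_nat_numeral pochhammer_Suc lessThan_Suc field_simps)
qed

lemma powr_neg_upper2:
  fixes x h b :: real
  assumes x: "0 < x" and h: "\<bar>h\<bar> \<le> x / 2" and b: "0 < b"
  shows "(x + h) powr (-b) \<le> x powr (-b) - b * x powr (-b-1) * h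
    + b * (b+1) * 2 powr (b+2) / 2 * x powr (-b-2) * h\<^sup>2"
proof -
  obtain t where t: "x / 2 \<le> t" and
    eq: "(x + h) powr (-b) = (\<Sum>m<2. (-1)^m * pochhammer b m * x powr (-b - m) / fact m * h^m)
      + (-1)^2 * pochhammer b 2 * t powr (-b - 2) / fact 2 * h^2"
    using powr_neg_Taylor[OF x h, of 2 b] by auto
  have "t powr (-(b+2)) \<le> (x / 2) powr (-(b+2))"
    using t x b by (intro powr_neg_antimono) auto
  also have "\<dots> = 2 powr (b+2) * x powr (-(b+2))" using x by (rule powr_half)
  finally have "b * (b+1) / 2 * t powr (-b-2) * h^2 \<le> b * (b+1) / 2 * (2 powr (b+2) * x powr (-b-2)) * h^2"
    using b by (intro mult_right_mono divide_right_mono mult_left_mono) auto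
  then show ?thesis using eq
    by (simp add: eval_nat_numeral pochhammer_Suc lessThan_Suc field_simps)
qed

lemma powr_neg_Lipschitz:
  fixes x h b :: real
  assumes x: "0 < x" and h: "\<bar>h\<bar> \<le> x / 2" and b: "0 < b"
  shows "\<bar>(x + h) powr (-b) - x powr (-b)\<bar> \<le> b * 2 powr (b+1) * x powr (-b-1) * \<bar>h\<bar>"
proof -
  obtain t where t: "x / 2 \<le> t" and
    eq: "(x + h) powr (-b) = x powr (-b) - b * t powr (-b - 1) * h"
    using powr_neg_Taylor[OF x h, of 1 b] by auto
  have "t powr (-(b+1)) \<le> (x / 2) powr (-(b+1))"
    using t x b by (intro powr_neg_antimono) auto
  also have "\<dots> = 2 powr (b+1) * x powr (-(b+1))" using x by (rule powr_half)
  finally have "b * t powr (-b-1) * \<bar>h\<bar> \<le> b * (2 powr (b+1) * x powr (-b-1)) * \<bar>h\<bar>"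
    using b by (intro mult_right_mono mult_left_mono) auto
  moreover have "\<bar>(x + h) powr (-b) - x powr (-b)\<bar> = b * t powr (-b-1) * \<bar>h\<bar>"
    using b unfolding eq by (simp add: abs_mult)
  ultimately show ?thesis by (simp add: algebra_simps)
qed

definition dsq :: "int^'d::finite \<Rightarrow> int^'d \<Rightarrow> real" where "dsq z w = sq w - sq z"

lemma srw_dsq: "srw (dsq z) z = 1"
  unfolding dsq_def by (simp add: srw_diff srw_sq)

text \<open>A step along coordinate i changes the squared norm by 1 plus or minus 2 z_i, so all
  moments of the change reduce to averages over i.\<close>

lemma srw_dsq2: "srw (\<lambda>w. (dsq z w)\<^sup>2) (z::int^'d::finite) = 1 + 4 * sq z / CARD('d)"
proof -
  have "srw (\<lambda>w. (dsq z w)\<^sup>2) z = (\<Sum>i\<in>UNIV. 2 + 8 * (real_of_int (z$i))\<^sup>2) / (2 * CARD('d))"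
    by (simp add: dsq_def srw_alt sq_axis) (rule sum.cong, auto simp: eval_nat_numeral algebra_simps)
  also have "(\<Sum>i\<in>UNIV. 2 + 8 * (real_of_int (z$i))\<^sup>2) = 2 * CARD('d) + 8 * sq z"
    by (simp add: sum.distrib sq_def sum_distrib_left)
  finally show ?thesis by (simp add: field_simps)
qed

lemma srw_dsq3: "srw (\<lambda>w. (dsq z w)^3) (z::int^'d::finite) = 1 + 12 * sq z / CARD('d)"
proof -
  have "srw (\<lambda>w. (dsq z w)^3) z = (\<Sum>i\<in>UNIV. 2 + 24 * (real_of_int (z$i))\<^sup>2) / (2 * CARD('d))"
    by (simp add: dsq_def srw_alt sq_axis) (rule sum.cong, auto simp: eval_nat_numeral algebra_simps)
  also have "(\<Sum>i\<in>UNIV. 2 + 24 * (real_of_int (z$i))\<^sup>2) = 2 * CARD('d) + 24 * sq z"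
    by (simp add: sum.distrib sq_def sum_distrib_left)
  finally show ?thesis by (simp add: field_simps)
qed

lemma srw_dsq4: "srw (\<lambda>w. (dsq z w)^4) (z::int^'d::finite) \<le> 1 + 24 * sq z + 16 * (sq z)\<^sup>2"
proof -
  have "srw (\<lambda>w. (dsq z w)^4) z = (\<Sum>i\<in>UNIV. 2 + 48 * (real_of_int (z$i))\<^sup>2 + 32 * (real_of_int (z$i))^4) / (2 * CARD('d))"
    by (simp add: dsq_def srw_alt sq_axis) (rule sum.cong, auto simp: eval_nat_numeral algebra_simps)
  also have "(\<Sum>i\<in>UNIV. 2 + 48 * (real_of_int (z$i))\<^sup>2 + 32 * (real_of_int (z$i))^4)
     \<le> (\<Sum>i\<in>(UNIV::'d set). 2 + 48 * sq z + 32 * (sq z)\<^sup>2)"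
  proof (intro sum_mono add_mono mult_left_mono order_refl comp_sq_le)
    fix i show "(real_of_int (z$i))^4 \<le> (sq z)\<^sup>2"
      using power_mono[OF comp_sq_le[of z i], of 2] by (simp add: power2_eq_square eval_nat_numeral algebra_simps)
  qed auto
  also have "\<dots> / (2 * CARD('d)) = 1 + 24 * sq z + 16 * (sq z)\<^sup>2" by (simp add: field_simps)
  finally show ?thesis by (simp add: divide_right_mono)
qed

lemma abs_dsq_le: "v \<in> nbrs \<Longrightarrow> \<bar>dsq z (z + v)\<bar> \<le> 1 + 2 * sqrt (sq z)"
  using comp_le[of z] by (auto simp: nbrs_eq dsq_def sq_axis abs_le_iff) (smt (verit, best) comp_le)+

lemma abs_dsq_half: "v \<in> nbrs \<Longrightarrow> 36 \<le> A \<Longrightarrow> \<bar>dsq z (z + v)\<bar> \<le> (A + sq z) / 2"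
proof -
  assume v: "v \<in> nbrs" and A: "36 \<le> A"
  have "0 \<le> (sqrt (sq z) - 2)\<^sup>2" by simp
  then have "4 * sqrt (sq z) \<le> sq z + 4" by (simp add: power2_eq_square algebra_simps)
  then have "1 + 2 * sqrt (sq z) \<le> (A + sq z) / 2" using A by (simp add: field_simps)
  with abs_dsq_le[OF v, of z] show ?thesis by (rule order_trans)
qed

text \<open>A smooth substitute for |z|^(-2b). With \<open>b\<close> = (d-2)/2 it plays the role of
  the Green function, with \<open>b\<close> lowered by 1 that of the Green function convolved with
  itself; a large \<open>A\<close> absorbs the lattice corrections.\<close>

definition bar :: "real \<Rightarrow> real \<Rightarrow> int^'d::finite \<Rightarrow> real" where
  "bar A b z = (A + sq z) powr (-b)"

lemma bar_nonneg [simp]: "0 \<le> bar A b z" by (simp add: bar_def)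

lemma bar_le_1: "1 \<le> A \<Longrightarrow> 0 \<le> b \<Longrightarrow> bar A b z \<le> 1"
  using powr_neg_antimono[of 1 "A + sq z" b] by (simp add: bar_def add_increasing2)

lemma powr_split: "0 < (s::real) \<Longrightarrow> s powr (-b-1) = s * s powr (-b-2)"
  "0 < s \<Longrightarrow> s powr (-b-2) = s * s powr (-b-3)" "0 < s \<Longrightarrow> s powr (-b-3) = s * s powr (-b-4)"
proof -
  have "s powr c = s * s powr (c - 1)" if "0 < s" for c using that by (simp add: powr_diff)
  from this[of "-b-1"] this[of "-b-2"] this[of "-b-3"]
  show "0 < s \<Longrightarrow> s powr (-b-1) = s * s powr (-b-2)"
    "0 < s \<Longrightarrow> s powr (-b-2) = s * s powr (-b-3)" "0 < s \<Longrightarrow> s powr (-b-3) = s * s powr (-b-4)"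
    by (auto simp: diff_diff_eq)
qed

text \<open>With s = \<open>A + sq z\<close>, the bracket collects -s from the mean 1 of the
  increment, the middle term from half of its second moment, and \<open>K\<close> from the
  fourth-order remainder. The third moment enters with a favourable sign.\<close>

lemma srw_bar_upper:
  assumes b: "0 < b"
  shows "\<exists>K>0. \<forall>A\<ge>36. \<forall>z::int^'d::finite. srw (bar A b) z \<le> bar A b z +
     b * (A + sq z) powr (-b-2) * (- (A + sq z) + (b+1) * (CARD('d) + 4 * sq z) / (2 * CARD('d)) + K)"
proof -
  define c where "c = pochhammer b 4 * 2 powr (b+4) / 24"
  have c: "0 < c" using b by (auto simp: c_def pochhammer_pos)
  show ?thesis
  proof (intro exI[of _ "41 * c / b"] conjI allI impI)
    show "0 < 41 * c / b" using b c by simp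
    fix A :: real and z :: "int^'d" assume A: "36 \<le> A"
    define s where "s = A + sq z"
    have s: "36 \<le> s" using A by (simp add: s_def add_increasing2)
    then have s0: "0 < s" by simp
    have qs: "sq z \<le> s" using A by (simp add: s_def)
    have "srw (bar A b) z \<le> srw (\<lambda>w. s powr (-b) - b * s powr (-b-1) * dsq z w + b * (b+1) / 2 * s powr (-b-2) * (dsq z w)\<^sup>2
     - b * (b+1) * (b+2) / 6 * s powr (-b-3) * (dsq z w)^3 + c * s powr (-b-4) * (dsq z w)^4) z"
    proof (rule srw_mono)
      fix v :: "int^'d" assume v: "v \<in> nbrs"
      have "bar A b (z + v) = (s + dsq z (z + v)) powr (-b)"
        by (simp add: bar_def s_def dsq_def)
      then show "bar A b (z + v) \<le> s powr (-b) - b * s powr (-b-1) * dsq z (z+v) + b * (b+1) / 2 * s powr (-b-2) * (dsq z (z+v))\<^sup>2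
     - b * (b+1) * (b+2) / 6 * s powr (-b-3) * (dsq z (z+v))^3 + c * s powr (-b-4) * (dsq z (z+v))^4"
        using powr_neg_upper4[OF s0 _ b, of "dsq z (z + v)"] abs_dsq_half[OF v A, of z]
        by (simp add: c_def s_def)
    qed
    also have "\<dots> = s powr (-b) - b * s powr (-b-1) + b * (b+1) / 2 * s powr (-b-2) * (1 + 4 * sq z / CARD('d))
     - b * (b+1) * (b+2) / 6 * s powr (-b-3) * (1 + 12 * sq z / CARD('d)) + c * s powr (-b-4) * srw (\<lambda>w. (dsq z w)^4) z"
      by (simp only: srw_add srw_diff srw_cmult srw_const srw_dsq srw_dsq2 srw_dsq3 mult_1_right)
    also have "\<dots> \<le> s powr (-b) - b * s powr (-b-1) + b * (b+1) / 2 * s powr (-b-2) * (1 + 4 * sq z / CARD('d))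
      + c * s powr (-b-4) * (41 * s\<^sup>2)"
    proof -
      have "0 \<le> b * (b+1) * (b+2) / 6 * s powr (-b-3) * (1 + 12 * sq z / CARD('d))"
        using b by simp
      moreover have "c * s powr (-b-4) * srw (\<lambda>w. (dsq z w)^4) z \<le> c * s powr (-b-4) * (41 * s\<^sup>2)"
      proof (rule mult_left_mono)
        have "1 + 24 * sq z + 16 * (sq z)\<^sup>2 \<le> s\<^sup>2 + 24 * s\<^sup>2 + 16 * s\<^sup>2"
        proof (intro add_mono mult_left_mono)
          show "1 \<le> s\<^sup>2" using s by (simp add: one_le_power)
          show "sq z \<le> s\<^sup>2" using qs s by (smt (verit) mult_le_cancel_left1 power2_eq_square)
          show "(sq z)\<^sup>2 \<le> s\<^sup>2" using qs by (simp add: power_mono)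
        qed auto
        then show "srw (\<lambda>w. (dsq z w)^4) z \<le> 41 * s\<^sup>2" using srw_dsq4[of z] by simp
      qed (use c in auto)
      ultimately show ?thesis by linarith
    qed
    also have "\<dots> = bar A b z + b * s powr (-b-2) * (- s + (b+1) * (CARD('d) + 4 * sq z) / (2 * CARD('d)) + 41 * c / b)"
    proof -
      have e1: "s powr (-b-1) = s * s powr (-b-2)" and e2: "s powr (-b-4) * s\<^sup>2 = s powr (-b-2)"
        using powr_split[OF s0, of b] by (simp_all add: power2_eq_square algebra_simps)
      have "c * s powr (-b-4) * (41 * s\<^sup>2) = 41 * c * s powr (-b-2)" using e2 by (simp add: algebra_simps)
      then show ?thesis unfolding e1 using b
        by (simp add: bar_def s_def[symmetric] field_simps)
    qed
    finally show "srw (bar A b) z \<le> bar A b z + b * (A + sq z) powr (-b-2) *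
        (- (A + sq z) + (b+1) * (CARD('d) + 4 * sq z) / (2 * CARD('d)) + 41 * c / b)"
      by (simp add: s_def)
  qed
qed

text \<open>Here the third moment is the term that costs; it is at most 13 s, which makes the
  constant explicit.\<close>

lemma srw_bar_lower:
  assumes b: "0 < b" and A: "36 \<le> A"
  shows "srw (bar A b) (z::int^'d::finite) \<ge> bar A b z +
     b * (A + sq z) powr (-b-2) * (- (A + sq z) + (b+1) * (CARD('d) + 4 * sq z) / (2 * CARD('d)) - 13 * (b+1) * (b+2) / 6)"
proof -
  define s where "s = A + sq z"
  have s: "36 \<le> s" using A by (simp add: s_def add_increasing2)
  then have s0: "0 < s" by simp
  have qs: "sq z \<le> s" using A by (simp add: s_def)
  have e1: "s powr (-b-1) = s * s powr (-b-2)" and e2: "s powr (-b-3) * s = s powr (-b-2)"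
    using powr_split[OF s0, of b] by (simp_all add: power2_eq_square algebra_simps)
  have "bar A b z + b * s powr (-b-2) * (- s + (b+1) * (CARD('d) + 4 * sq z) / (2 * CARD('d)) - 13 * (b+1) * (b+2) / 6)
    = s powr (-b) - b * s powr (-b-1) + b * (b+1) / 2 * s powr (-b-2) * (1 + 4 * sq z / CARD('d))
      - b * (b+1) * (b+2) / 6 * (s powr (-b-3) * s) * 13"
    unfolding e1 e2 by (simp add: bar_def s_def[symmetric] field_simps)
  also have "\<dots> \<le> s powr (-b) - b * s powr (-b-1) + b * (b+1) / 2 * s powr (-b-2) * (1 + 4 * sq z / CARD('d))
     - b * (b+1) * (b+2) / 6 * s powr (-b-3) * (1 + 12 * sq z / CARD('d))"
  proof -
    have "12 * sq z / CARD('d) \<le> 12 * sq z / 1"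
      by (intro divide_left_mono) (simp_all add: Suc_leI)
    then have "1 + 12 * sq z / CARD('d) \<le> 13 * s" using qs s by simp
    then have "b * (b+1) * (b+2) / 6 * s powr (-b-3) * (1 + 12 * sq z / CARD('d)) \<le> b * (b+1) * (b+2) / 6 * s powr (-b-3) * (13 * s)"
      using b by (intro mult_left_mono) auto
    then show ?thesis by (simp add: algebra_simps)
  qed
  also have "\<dots> = srw (\<lambda>w. s powr (-b) - b * s powr (-b-1) * dsq z w + b * (b+1) / 2 * s powr (-b-2) * (dsq z w)\<^sup>2
     - b * (b+1) * (b+2) / 6 * s powr (-b-3) * (dsq z w)^3) z"
    by (simp only: srw_add srw_diff srw_cmult srw_const srw_dsq srw_dsq2 srw_dsq3 mult_1_right)
  also have "\<dots> \<le> srw (bar A b) z"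
  proof (rule srw_mono)
    fix v :: "int^'d" assume v: "v \<in> nbrs"
    have "bar A b (z + v) = (s + dsq z (z + v)) powr (-b)"
      by (simp add: bar_def s_def dsq_def)
    then show "s powr (-b) - b * s powr (-b-1) * dsq z (z+v) + b * (b+1) / 2 * s powr (-b-2) * (dsq z (z+v))\<^sup>2
   - b * (b+1) * (b+2) / 6 * s powr (-b-3) * (dsq z (z+v))^3 \<le> bar A b (z + v)"
      using powr_neg_lower3[OF s0 _ b, of "dsq z (z + v)"] abs_dsq_half[OF v A, of z] by (simp add: s_def)
  qed
  finally show ?thesis by (simp add: s_def)
qed

text \<open>For \<open>b + 1\<close> = d/2 the |z|^2 terms of the bracket cancel exactly. What
  remains is -\<open>A\<close> + d/4 + \<open>K\<close>, at most -\<open>A\<close>/2 once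
  \<open>A\<close> is large.\<close>

lemma bar_superharmonic:
  assumes "CARD('d::finite) \<ge> 5" and b: "b = (real CARD('d) - 2) / 2"
  shows "\<exists>A0\<ge>36. \<forall>A\<ge>A0. \<forall>z::int^'d. srw (bar A b) z \<le> bar A b z - b * A / 2 * (A + sq z) powr (-b-2)"
proof -
  have b0: "0 < b" using assms by simp
  obtain K where K: "K > 0" and U: "\<And>A z::int^'d. A \<ge> 36 \<Longrightarrow> srw (bar A b) z \<le> bar A b z +
     b * (A + sq z) powr (-b-2) * (- (A + sq z) + (b+1) * (CARD('d) + 4 * sq z) / (2 * CARD('d)) + K)"
    using srw_bar_upper[OF b0, where 'd = 'd] by blast
  show ?thesis
  proof (intro exI[of _ "36 + 2 * K + CARD('d)"] conjI allI impI)
    show "36 \<le> 36 + 2 * K + CARD('d)" using K by simp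
    fix A and z :: "int^'d" assume A: "36 + 2 * K + CARD('d) \<le> A"
    have "b + 1 = CARD('d) / 2" using b by simp
    then have "(b+1) * (CARD('d) + 4 * sq z) / (2 * CARD('d)) = CARD('d) / 4 + sq z"
      using assms(1) by (simp only:) (simp add: field_simps)
    then have "- (A + sq z) + (b+1) * (CARD('d) + 4 * sq z) / (2 * CARD('d)) + K \<le> - A / 2"
      using A by simp
    then have "b * (A + sq z) powr (-b-2) * (- (A + sq z) + (b+1) * (CARD('d) + 4 * sq z) / (2 * CARD('d)) + K)
       \<le> b * (A + sq z) powr (-b-2) * (- A / 2)"
      using b0 by (intro mult_left_mono) auto
    then show "srw (bar A b) z \<le> bar A b z - b * A / 2 * (A + sq z) powr (-b-2)"
      using U[of A z] A K by (simp add: algebra_simps)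
  qed
qed

text \<open>For \<open>b + 1\<close> = (d-2)/2 the cancellation fails by -2|z|^2/d, so the decrease
  is of leading order: a multiple of the Green-type profile with exponent \<open>b + 1\<close>.
  Summed along the walk it bounds the Green operator applied twice.\<close>

lemma bar_superharmonic2:
  assumes d: "CARD('d::finite) \<ge> 5" and b: "b = (real CARD('d) - 4) / 2"
  shows "\<exists>A0\<ge>36. \<forall>A\<ge>A0. \<forall>z::int^'d. srw (bar A b) z \<le> bar A b z - b / CARD('d) * bar A (b+1) z"
proof -
  have b0: "0 < b" using assms by simp
  obtain K where K: "K > 0" and U: "\<And>A z::int^'d. A \<ge> 36 \<Longrightarrow> srw (bar A b) z \<le> bar A b z +
     b * (A + sq z) powr (-b-2) * (- (A + sq z) + (b+1) * (CARD('d) + 4 * sq z) / (2 * CARD('d)) + K)"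
    using srw_bar_upper[OF b0, where 'd = 'd] by blast
  define D where "D = real (CARD('d))"
  have D: "D \<ge> 5" using d by (simp add: D_def)
  show ?thesis
  proof (intro exI[of _ "36 + D * (K + D)"] conjI allI impI)
    show "36 \<le> 36 + D * (K + D)" using K D by simp
    fix A and z :: "int^'d" assume A: "36 + D * (K + D) \<le> A"
    have A36: "36 \<le> A" using A K D by (smt (verit) mult_nonneg_nonneg)
    define s where "s = A + sq z"
    have s0: "0 < s" using A36 by (simp add: s_def add_pos_nonneg)
    have "b + 1 = (D - 2) / 2" using b by (simp add: D_def)
    then have "(b+1) * (D + 4 * sq z) / (2 * D) = (D - 2) / 4 + sq z - 2 * sq z / D"
      using D by (simp only:) (simp add: field_simps)
    moreover have AD: "D / 4 + K \<le> A / D"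
    proof -
      have "K + D \<le> A / D" using A D by (simp add: pos_le_divide_eq algebra_simps)
      then show ?thesis using D by linarith
    qed
    moreover have "2 * sq z / D = 2 * s / D - 2 * A / D" by (simp add: s_def add_divide_distrib)
    moreover have "A / D \<le> s / D" using D by (simp add: s_def divide_right_mono)
    ultimately have "- s + (b+1) * (D + 4 * sq z) / (2 * D) + K \<le> - s + D / 4 + sq z - 2 * s / D + 2 * A / D + K"
      by simp
    also have "\<dots> \<le> - s / D"
    proof -
      have "A / D * 3 \<le> A" using D A36 by (simp add: field_simps)
      moreover have "s - sq z = A" by (simp add: s_def)
      moreover have "0 \<le> s / D" using s0 D by simp
      moreover have "2 * s / D = 2 * (s / D)" "2 * A / D = 2 * (A / D)" "- s / D = - (s / D)" by simp_all
      ultimately show ?thesis using AD by linarith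
    qed
    finally have "b * s powr (-b-2) * (- s + (b+1) * (D + 4 * sq z) / (2 * D) + K)
       \<le> b * s powr (-b-2) * (- s / D)"
      using b0 by (intro mult_left_mono) auto
    also have "\<dots> = - (b / D * s powr (-b-1))"
      using powr_split(1)[OF s0, of b] by simp
    finally have L: "b * s powr (-b-2) * (- s + (b+1) * (D + 4 * sq z) / (2 * D) + K) \<le> - (b / D * s powr (-b-1))" .
    show "srw (bar A b) z \<le> bar A b z - b / CARD('d) * bar A (b+1) z"
    proof -
      have "srw (bar A b) z \<le> bar A b z + b * s powr (-b-2) * (- s + (b+1) * (D + 4 * sq z) / (2 * D) + K)"
        using U[OF A36, of z] by (simp add: D_def s_def)
      moreover have "-(b+1) = -b-1" by simp
      then have "bar A (b+1) z = s powr (-b-1)" by (simp only: bar_def s_def)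
      ultimately show ?thesis using L unfolding D_def by simp
    qed
  qed
qed

text \<open>The defect of \<open>bar A b\<close> is at most of order s^(-b-2). The added profile has
  an exponent beyond the harmonic one and gains order s^(-b-3/2), which wins where s is large; the
  remaining finite set is left to \<open>green_lower\<close>.\<close>

lemma bar_subharmonic:
  assumes d: "CARD('d::finite) \<ge> 5" and b: "b = (real CARD('d) - 2) / 2" and A: "36 \<le> A"
  shows "\<exists>S0. \<forall>z::int^'d. S0 \<le> A + sq z \<longrightarrow>
     bar A b z + bar A (b+1/2) z \<le> srw (\<lambda>z. bar A b z + bar A (b+1/2) z) z"
proof -
  define D where "D = real (CARD('d))"
  have D: "D \<ge> 5" using d by (simp add: D_def)
  have b0: "0 < b" using assms by simp
  define c where "c = b + 1/2"
  have c0: "0 < c" using b0 by (simp add: c_def)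
  define K where "K = 13 * (b+1) * (b+2) / 6"
  define K' where "K' = 13 * (c+1) * (c+2) / 6"
  define K4 where "K4 = 2 * A + K'"
  have Kp: "0 < K" "0 < K'" using b0 c0 by (simp_all add: K_def K'_def)
  \<comment> \<open>In units of s^(-b-2) the loss is b (A + K) and the gain c sqrt(s) / (2 D); the
    gain prevails from s = \<open>R\<close>^2 on.\<close>
  define R where "R = 2 * D * b * (A + K) / c"
  have R: "0 \<le> R" using D b0 c0 A Kp by (simp add: R_def)
  show ?thesis
  proof (intro exI[of _ "max (2 * D * K4) (R\<^sup>2)"] allI impI)
    fix z :: "int^'d" assume S: "max (2 * D * K4) (R\<^sup>2) \<le> A + sq z"
    define s where "s = A + sq z"
    have s0: "0 < s" using A by (simp add: s_def add_pos_nonneg)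
    have s1: "2 * D * K4 \<le> s" "R\<^sup>2 \<le> s" using S by (simp_all add: s_def)
    have "b + 1 = D / 2" using b by (simp add: D_def)
    then have "(b+1) * (D + 4 * sq z) / (2 * D) = D / 4 + sq z"
      using D by (simp only:) (simp add: field_simps)
    then have "- s + (b+1) * (D + 4 * sq z) / (2 * D) - K \<ge> - (A + K)" using D by (simp add: s_def)
    then have l1: "b * s powr (-b-2) * (- (A + K)) \<le> b * s powr (-b-2) * (- s + (b+1) * (D + 4 * sq z) / (2 * D) - K)"
      using b0 by (intro mult_left_mono) auto
    have "c + 1 = (D + 1) / 2" using b by (simp add: D_def c_def)
    then have X: "(c+1) * (D + 4 * sq z) / (2 * D) = (D + 1) / 4 + sq z + sq z / D"
      using D by (simp only:) (simp add: field_simps)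
    have gen: "sD - (2 * A + K') \<le> - s + ((D + 1) / 4 + sq z + qD) - K'"
      if "aD \<le> A" "qD = sD - aD" for aD sD qD
    proof -
      have "0 \<le> (D + 1) / 4" using D by simp
      then show ?thesis using that unfolding s_def by linarith
    qed
    have "- s + (c+1) * (D + 4 * sq z) / (2 * D) - K' \<ge> s / D - K4"
      unfolding K4_def X
    proof (rule gen)
      show "A / D \<le> A" using A D by (simp add: field_simps)
      show "sq z / D = s / D - A / D" by (simp add: s_def add_divide_distrib)
    qed
    moreover have "K4 \<le> s / (2 * D)" using s1 D by (simp add: field_simps)
    ultimately have "- s + (c+1) * (D + 4 * sq z) / (2 * D) - K' \<ge> s / (2 * D)" by (simp add: field_simps)
    then have l2: "c * s powr (-c-2) * (s / (2 * D)) \<le> c * s powr (-c-2) * (- s + (c+1) * (D + 4 * sq z) / (2 * D) - K')"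
      using c0 by (intro mult_left_mono) auto
    have e: "s powr (-c-2) * s = s powr (-b-2) * sqrt s"
    proof -
      have "s powr (-c-2) * s = s powr (-c-2) * s powr 1" using s0 by simp
      also have "\<dots> = s powr (-b-2) * s powr (1/2)"
        unfolding powr_add[symmetric] by (simp add: c_def algebra_simps)
      finally show ?thesis using s0 by (simp add: powr_half_sqrt)
    qed
    have "R \<le> sqrt s" using s1(2) by (rule real_le_rsqrt)
    then have "b * (A + K) \<le> c * (sqrt s / (2 * D))" using c0 D by (simp add: R_def field_simps)
    then have "s powr (-b-2) * (b * (A + K)) \<le> s powr (-b-2) * (c * (sqrt s / (2 * D)))"
      by (intro mult_left_mono) auto
    also have "\<dots> = c * s powr (-c-2) * (s / (2 * D))" using e by (simp add: algebra_simps)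
    finally have "0 \<le> b * s powr (-b-2) * (- (A + K)) + c * s powr (-c-2) * (s / (2 * D))"
      by (simp add: algebra_simps)
    then show "bar A b z + bar A (b+1/2) z \<le> srw (\<lambda>z. bar A b z + bar A (b+1/2) z) z"
      using srw_bar_lower[OF b0 A, of z] srw_bar_lower[OF c0 A, of z] l1 l2
      by (simp add: srw_add D_def s_def K_def K'_def c_def algebra_simps)
  qed
qed

section \<open>Green function estimates\<close>

lemma bar_mono_const: "1 \<le> A \<Longrightarrow> 0 \<le> b \<Longrightarrow> bar A b z \<le> bar 1 b z"
  unfolding bar_def by (intro powr_neg_antimono) (auto simp: add_pos_nonneg)

lemma bar_1_le: "1 \<le> A \<Longrightarrow> 0 \<le> b \<Longrightarrow> bar 1 b z \<le> A powr b * bar A b z"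
proof -
  assume A: "1 \<le> A" and b: "0 \<le> b"
  have s: "0 < A + sq z" using A by (simp add: add_pos_nonneg)
  have "A + sq z \<le> A * (1 + sq z)" using A mult_right_mono[of 1 A "sq z"] by (simp add: algebra_simps)
  then have "(A * (1 + sq z)) powr (-b) \<le> (A + sq z) powr (-b)"
    using s b by (intro powr_neg_antimono) auto
  then have "A powr b * (A powr (-b) * bar 1 b z) \<le> A powr b * bar A b z"
    using A by (intro mult_left_mono) (auto simp: bar_def powr_mult)
  then show ?thesis using A by (simp add: powr_minus field_simps)
qed

lemma bar_Suc: "0 < A \<Longrightarrow> bar A (b - 1) z = (A + sq z) * bar A b z"
proof -
  assume "0 < A"
  then have s: "0 < A + sq z" by (simp add: add_pos_nonneg)
  have e: "-(b-1) = 1 + -b" by simp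
  show ?thesis unfolding bar_def e powr_add using s by simp
qed

text \<open>Telescoping: \<open>g\<close> is at most the decrease of \<open>F\<close> in one step,
  and iterates of \<open>F\<close> stay nonnegative.\<close>

lemma superharmonic_sum:
  assumes "\<And>z. srw F z \<le> F z - g z" "\<And>z. 0 \<le> F z"
  shows "(\<Sum>t<n. srwn t g z) \<le> F z"
proof -
  have "(\<Sum>t<n. srwn t g z) \<le> F z - srwn n F z"
  proof (induction n)
    case (Suc n)
    have "srwn n (\<lambda>z. srw F z + g z) z \<le> srwn n F z"
      using assms(1) by (intro srwn_mono) (simp add: le_diff_eq)
    then have "srwn n g z \<le> srwn n F z - srwn (Suc n) F z"
      unfolding srwn_add srwn_Suc2 by simp
    then show ?case using Suc by simp
  qed simp
  then show ?thesis using srwn_nonneg[of F n z] assms(2) by fastforce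
qed

text \<open>The inequality is unrolled \<open>n\<close> times. A positive \<open>l\<close> acts as a
  killing rate and makes the last term negligible for bounded \<open>u\<close>.\<close>

lemma subsolution_iterate:
  assumes "\<And>z. u z \<le> g z + (1 - l) * srw u z" "l \<le> 1"
  shows "u z \<le> (\<Sum>t<n. (1 - l)^t * srwn t g z) + (1 - l)^n * srwn n u z"
proof (induction n)
  case (Suc n)
  have "srwn n u z \<le> srwn n (\<lambda>z. g z + (1 - l) * srw u z) z" by (intro srwn_mono assms)
  also have "\<dots> = srwn n g z + (1 - l) * srwn (Suc n) u z"
    unfolding srwn_add srwn_cmult srwn_Suc2 ..
  finally have "(1 - l)^n * srwn n u z \<le> (1 - l)^n * (srwn n g z + (1 - l) * srwn (Suc n) u z)"
    using assms(2) by (intro mult_left_mono) auto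
  then show ?case using Suc by (simp add: algebra_simps)
qed simp

text \<open>Irreducibility, by induction on the l1 norm: some step lowers it. Because of parity only
  certain times can work.\<close>

lemma srwn_delta_pos: "\<exists>k. 0 < srwn k (indicat_real {0}) (z::int^'d::finite)"
proof (induction "\<Sum>i\<in>UNIV. nat \<bar>z $ i\<bar>" arbitrary: z rule: less_induct)
  case less
  show ?case
  proof (cases "z = 0")
    case True
    then show ?thesis by (intro exI[of _ 0]) simp
  next
    case False
    then obtain i where i: "z $ i \<noteq> 0" by (auto simp: vec_eq_iff)
    define v :: "int^'d" where "v = axis i (if z $ i > 0 then -1 else 1)"
    have v: "v \<in> nbrs" by (auto simp: v_def nbrs_eq)
    have "(\<Sum>j\<in>UNIV. nat \<bar>(z + v) $ j\<bar>) < (\<Sum>j\<in>UNIV. nat \<bar>z $ j\<bar>)"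
      by (rule sum_strict_mono2[where b = i] | rule sum_strict_mono_ex1)
         (use i in \<open>auto simp: v_def axis_def intro!: bexI[of _ i]\<close>)
    then obtain k where k: "0 < srwn k (indicat_real {0}) (z + v)" using less by blast
    have "srwn k (indicat_real {0}) (z + v) \<le> (\<Sum>v\<in>nbrs. srwn k (indicat_real {0}) (z + v))"
      by (rule member_le_sum) (auto simp: v srwn_nonneg)
    then have "0 < srwn (Suc k) (indicat_real {0}) z"
      using k by (simp add: srw_def divide_pos_pos)
    then show ?thesis by blast
  qed
qed

text \<open>Lets a finite exceptional set be replaced by the origin, at the price of boundedly many
  additional steps.\<close>

lemma finite_set_reach:
  assumes "finite (S :: (int^'d::finite) set)"
  shows "\<exists>C>0. \<exists>k0>0. \<forall>z. indicat_real S z \<le> C * (\<Sum>k<k0. srwn k (indicat_real {0}) z)"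
  using assms
proof (induction S)
  case empty
  then show ?case by (intro exI[of _ 1] conjI) (auto intro!: sum_nonneg srwn_nonneg exI[of _ 1])
next
  case (insert a S)
  then obtain C k0 where C: "C > 0" "k0 > 0"
    "\<And>z. indicat_real S z \<le> C * (\<Sum>k<k0. srwn k (indicat_real {0}) z)" by blast
  obtain k where k: "0 < srwn k (indicat_real {0}) a" using srwn_delta_pos by blast
  define q where "q = srwn k (indicat_real {0}) a"
  define m where "m = max (Suc k) k0"
  have ge: "(\<Sum>j<k0. srwn j (indicat_real {0}) z) \<le> (\<Sum>j<m. srwn j (indicat_real {0}) z)" for z :: "int^'d"
    by (intro sum_mono2) (auto simp: m_def srwn_nonneg)
  have ge2: "srwn k (indicat_real {0}) z \<le> (\<Sum>j<m. srwn j (indicat_real {0}) z)" for z :: "int^'d"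
    by (intro member_le_sum) (auto simp: m_def srwn_nonneg)
  have "indicat_real (insert a S) z \<le> (C + 1 / q) * (\<Sum>j<m. srwn j (indicat_real {0}) z)" for z
  proof -
    have "indicat_real (insert a S) z \<le> indicat_real {a} z + indicat_real S z"
      by (auto simp: indicator_def)
    moreover have "indicat_real {a} z \<le> 1 / q * (\<Sum>j<m. srwn j (indicat_real {0}) z)"
      using ge2[of a] k by (auto simp: indicator_def q_def field_simps intro!: sum_nonneg srwn_nonneg)
    moreover have "indicat_real S z \<le> C * (\<Sum>j<m. srwn j (indicat_real {0}) z)"
      using C(3)[of z] mult_left_mono[OF ge[of z], of C] C(1) by linarith
    ultimately show ?thesis by (simp add: algebra_simps)
  qed
  moreover have "C + 1 / q > 0" using C k by (simp add: q_def add_pos_pos)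
  ultimately show ?case using C(2) by (intro exI[of _ "C + 1/q"] conjI exI[of _ m]) (auto simp: m_def)
qed

text \<open>\<open>bar A b\<close> loses a fixed positive amount in one step from the origin, so it
  dominates a multiple of the Green function up to any time.\<close>

lemma green_upper:
  assumes d: "CARD('d::finite) \<ge> 5" and b: "b = (real CARD('d) - 2) / 2"
  shows "\<exists>C>0. \<forall>n. \<forall>z::int^'d. (\<Sum>t<n. srwn t (indicat_real {0}) z) \<le> C * bar 1 b z"
proof -
  have b0: "0 < b" using d b by simp
  obtain A where A: "36 \<le> A" and F: "\<And>z::int^'d. srw (bar A b) z \<le> bar A b z - b * A / 2 * (A + sq z) powr (-b-2)"
    using bar_superharmonic[OF d b] by blast
  define c where "c = b * A / 2 * A powr (-b-2)"
  have c: "0 < c" using b0 A by (simp add: c_def)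
  have "(\<Sum>t<n. srwn t (indicat_real {0}) z) \<le> 1 / c * bar 1 b z" for n and z :: "int^'d"
  proof -
    have "(\<Sum>t<n. srwn t (\<lambda>z. c * indicat_real {0} z) z) \<le> bar A b z"
    proof (rule superharmonic_sum)
      fix z :: "int^'d"
      have "c * indicat_real {0} z \<le> b * A / 2 * (A + sq z) powr (-b-2)"
        using b0 A by (auto simp: c_def indicator_def)
      then show "srw (bar A b) z \<le> bar A b z - c * indicat_real {0} z" using F[of z] by linarith
    qed simp
    also have "\<dots> \<le> bar 1 b z" using A b0 by (intro bar_mono_const) auto
    finally show ?thesis using c by (simp add: srwn_cmult field_simps flip: sum_distrib_left)
  qed
  then show ?thesis using c by (intro exI[of _ "1/c"]) auto
qed

text \<open>There are m + 1 ways to write m = t + k, so the left side is a double sum over a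
  triangle inside the square. The weight t + 1 thus amounts to applying the Green operator
  twice.\<close>

lemma sum_shift_square:
  fixes f :: "nat \<Rightarrow> real"
  assumes "\<And>k. 0 \<le> f k"
  shows "(\<Sum>m<n. (real m + 1) * f m) \<le> (\<Sum>t<n. \<Sum>k<n. f (t + k))"
proof -
  have "(\<Sum>m<n. (real m + 1) * f m) = (\<Sum>m<n. \<Sum>t\<le>m. f m)" by (simp add: algebra_simps)
  also have "\<dots> = (\<Sum>(m,t)\<in>(SIGMA m:{..<n}. {..m}). f m)" by (subst sum.Sigma) auto
  also have "\<dots> = (\<Sum>(t,k)\<in>(\<lambda>(m,t). (t, m - t)) ` (SIGMA m:{..<n}. {..m}). f (t + k))"
    by (subst sum.reindex) (auto simp: inj_on_def intro!: sum.cong)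
  also have "\<dots> \<le> (\<Sum>(t,k)\<in>{..<n}\<times>{..<n}. f (t + k))"
    by (rule sum_mono2) (auto simp: assms)
  also have "\<dots> = (\<Sum>t<n. \<Sum>k<n. f (t + k))" by (simp add: sum.cartesian_product)
  finally show ?thesis .
qed

text \<open>The inner sum is bounded by the profile with exponent \<open>b\<close>, which by
  \<open>bar_superharmonic2\<close> is the decrease of the profile with exponent
  \<open>b - 1\<close>.\<close>

lemma green2_upper:
  assumes d: "CARD('d::finite) \<ge> 5" and b: "b = (real CARD('d) - 2) / 2"
  shows "\<exists>C>0. \<forall>n. \<forall>z::int^'d. (\<Sum>t<n. (real t + 1) * srwn t (indicat_real {0}) z) \<le> C * bar 1 (b - 1) z"
proof -
  have b0: "0 < b - 1" using d b by simp
  have b': "b - 1 = (real CARD('d) - 4) / 2" using b by simp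
  obtain A where A: "36 \<le> A" and F: "\<And>z::int^'d. srw (bar A (b-1)) z \<le> bar A (b-1) z - (b-1) / CARD('d) * bar A (b-1+1) z"
    using bar_superharmonic2[OF d b'] by blast
  obtain C where C: "C > 0" "\<And>n (z::int^'d). (\<Sum>t<n. srwn t (indicat_real {0}) z) \<le> C * bar 1 b z"
    using green_upper[OF d b] by blast
  define c where "c = (b - 1) / CARD('d)"
  have c: "c > 0" using b0 by (simp add: c_def)
  define C' where "C' = C * A powr b"
  have C': "C' > 0" using C A by (simp add: C'_def)
  have "(\<Sum>t<n. (real t + 1) * srwn t (indicat_real {0}) z) \<le> C' / c * bar 1 (b - 1) z" for n and z :: "int^'d"
  proof -
    have "(\<Sum>t<n. (real t + 1) * srwn t (indicat_real {0}) z) \<le> (\<Sum>t<n. \<Sum>k<n. srwn (t + k) (indicat_real {0}) z)"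
      by (intro sum_shift_square srwn_nonneg) simp
    also have "\<dots> = (\<Sum>t<n. srwn t (\<lambda>z. \<Sum>k<n. srwn k (indicat_real {0}) z) z)"
      by (simp add: srwn_sum srwn_add_time)
    also have "\<dots> \<le> (\<Sum>t<n. srwn t (\<lambda>z. C' / c * (c * bar A b z)) z)"
    proof (intro sum_mono srwn_mono)
      fix z :: "int^'d"
      have "C * bar 1 b z \<le> C * (A powr b * bar A b z)"
        using A b0 C by (intro mult_left_mono bar_1_le) auto
      then show "(\<Sum>k<n. srwn k (indicat_real {0}) z) \<le> C' / c * (c * bar A b z)"
        using C(2)[of z n] c by (simp add: C'_def)
    qed
    also have "\<dots> = C' / c * (\<Sum>t<n. srwn t (\<lambda>z. c * bar A b z) z)"
      by (simp only: srwn_cmult sum_distrib_left)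
    also have "\<dots> \<le> C' / c * bar A (b - 1) z"
    proof (intro mult_left_mono superharmonic_sum)
      fix z :: "int^'d" show "srw (bar A (b-1)) z \<le> bar A (b-1) z - c * bar A b z"
        using F[of z] by (simp add: c_def)
    qed (use c C' in auto)
    also have "\<dots> \<le> C' / c * bar 1 (b - 1) z"
      using A b0 c C' by (intro mult_left_mono bar_mono_const) auto
    finally show ?thesis .
  qed
  then show ?thesis using c C' by (intro exI[of _ "C'/c"]) auto
qed

text \<open>The point is that times up to a multiple of 1 + |z|^2 suffice. A subharmonic profile
  minus a correction of relative size |z|^2/n is a subsolution of the walk killed at a rate of order
  1/n, outside a finite set that is charged to visits to 0; times beyond a large multiple of n then
  carry a small factor.\<close>

lemma green_lower:
  assumes d: "CARD('d::finite) \<ge> 5" and b: "b = (real CARD('d) - 2) / 2"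
  shows "\<exists>c>0. \<exists>T>0. \<forall>n>0. \<forall>z::int^'d. 1 + sq z \<le> real n \<longrightarrow>
     c * bar 1 b z \<le> (\<Sum>t<T*n. srwn t (indicat_real {0}) z)"
proof -
  let ?\<delta> = "indicat_real {0} :: int^'d \<Rightarrow> real"
  define D where "D = real CARD('d)"
  have D: "5 \<le> D" using d by (simp add: D_def)
  have b0: "0 < b - 1" using d b by simp
  have b': "b - 1 = (real CARD('d) - 4) / 2" using b by simp
  obtain A where A: "36 \<le> A" and F2: "\<And>z::int^'d. srw (bar A (b-1)) z \<le> bar A (b-1) z - (b-1) / D * bar A b z"
    using bar_superharmonic2[OF d b'] unfolding D_def by fastforce
  define F3 where "F3 z = bar A b z + bar A (b+1/2) z" for z :: "int^'d"
  obtain S0 where F3: "\<And>z. S0 \<le> A + sq z \<Longrightarrow> F3 z \<le> srw F3 z"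
    using bar_subharmonic[OF d b A] unfolding F3_def by blast
  have F3_le: "F3 z \<le> 2 * bar A b z" for z
  proof -
    have "(A + sq z) powr (-(b+1/2)) \<le> (A + sq z) powr (-b)"
      using A by (intro powr_mono) (auto simp: add_increasing2)
    then show ?thesis by (simp add: F3_def bar_def)
  qed
  have F3_le2: "F3 z \<le> 2" for z
    using bar_le_1[of A b z] bar_le_1[of A "b+1/2" z] A b0 by (simp add: F3_def)
  obtain C1 where C1: "C1 > 0" "\<And>n z. (\<Sum>t<n. srwn t ?\<delta> z) \<le> C1 * bar 1 b z"
    using green_upper[OF d b] by blast
  define B0 where "B0 = {z::int^'d. A + sq z < S0}"
  have "finite B0" unfolding B0_def by (rule finite_subset[OF _ finite_sq_le[of "S0 - A"]]) auto
  then obtain C3 k0 where C3: "C3 > 0" "k0 > 0" "\<And>z. indicat_real B0 z \<le> C3 * (\<Sum>k<k0. srwn k ?\<delta> z)"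
    using finite_set_reach by blast
  \<comment> \<open>Chosen so that the superharmonicity of the correction term yields a gain of
    exactly 4 \<open>l\<close> times \<open>bar A b\<close>.\<close>
  define C0 where "C0 = 4 * D / (b - 1)"
  have C0: "8 \<le> C0" using b0 D b by (simp add: C0_def D_def field_simps)
  \<comment> \<open>With this value the late times contribute at most \<open>bar 1 b z\<close> / (4
    A^b), half of the lower bound for \<open>u z\<close>.\<close>
  define \<eta> where "\<eta> = 1 / (8 * C3 * k0 * C1 * A powr b)"
  have \<eta>: "0 < \<eta>" using C3 C1 A by (simp add: \<eta>_def)
  obtain T0 :: nat where T0: "exp (- (real T0 / (2 * C0 * A))) \<le> \<eta>"
  proof -
    define N where "N = nat \<lceil>- ln \<eta> * (2 * C0 * A)\<rceil>"
    have "- ln \<eta> * (2 * C0 * A) \<le> real N" unfolding N_def by linarith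
    then have "- ln \<eta> \<le> real N / (2 * C0 * A)" using C0 A by (simp add: pos_le_divide_eq)
    then have "exp (- (real N / (2 * C0 * A))) \<le> exp (ln \<eta>)" by simp
    then show thesis using that[of N] \<eta> by simp
  qed
  show ?thesis
  proof (intro exI[of _ "1 / (8 * C3 * k0 * A powr b)"] conjI exI[of _ "T0 + k0"] allI impI)
    show "0 < 1 / (8 * C3 * real k0 * A powr b)" using C3 A by simp
    show "0 < T0 + k0" using C3 by simp
    fix n :: nat and z :: "int^'d" assume n: "0 < n" and z: "1 + sq z \<le> real n"
    define l where "l = 1 / (2 * C0 * A * n)"
    have CA: "1 \<le> C0 * A" using C0 A mult_mono[of 1 C0 1 A] by simp
    then have CAn: "1 \<le> C0 * A * n" using n mult_mono[of 1 "C0 * A" 1 "real n"] by simp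
    have l: "0 < l" "l \<le> 1/2" using CAn by (auto simp: l_def field_simps)
    define u where "u z = max 0 (F3 z - C0 * l * bar A (b-1) z)" for z
    have u0: "0 \<le> u z" and uF: "u z \<le> F3 z" for z
      using C0 l by (auto simp: u_def F3_def)
    have step: "u w \<le> 2 * indicat_real B0 w + (1 - l) * srw u w" for w
    proof (cases "w \<in> B0 \<or> u w = 0")
      case True
      have "0 \<le> (1 - l) * srw u w" using l by (intro mult_nonneg_nonneg srw_nonneg u0) auto
      then show ?thesis using True uF[of w] F3_le2[of w] by auto
    next
      case False
      then have uw: "u w = F3 w - C0 * l * bar A (b-1) w" and w: "S0 \<le> A + sq w"
        by (auto simp: u_def B0_def max_def split: if_splits)
      have "u w + 4 * l * bar A b w = F3 w - C0 * l * (bar A (b-1) w - (b-1) / D * bar A b w)"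
        using b0 D by (simp add: uw C0_def field_simps)
      also have "\<dots> \<le> srw F3 w - C0 * l * srw (bar A (b-1)) w"
        using F3[OF w] mult_left_mono[OF F2[of w], of "C0 * l"] C0 l by (intro diff_mono) auto
      also have "\<dots> = srw (\<lambda>z. F3 z - C0 * l * bar A (b-1) z) w"
        by (simp only: srw_diff srw_cmult)
      also have "\<dots> \<le> srw u w" by (intro srw_mono) (simp add: u_def)
      finally have "(1 - l) * (u w + 4 * l * bar A b w) \<le> (1 - l) * srw u w"
        using l by (intro mult_left_mono) auto
      \<comment> \<open>The gain pays for the killing, since \<open>u\<close> \<le> 2
        \<open>bar A b\<close> and 1 - \<open>l\<close> \<ge> 1/2.\<close>
      moreover have "u w \<le> (1 - l) * (u w + 4 * l * bar A b w)"
      proof -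
        have "l * u w \<le> l * (2 * bar A b w)"
          using uF[of w] F3_le[of w] l by (intro mult_left_mono) auto
        also have "\<dots> \<le> (1 - l) * (4 * l * bar A b w)"
          using l mult_right_mono[of "1/2" "1 - l" "4 * l * bar A b w"] by simp
        finally show ?thesis by (simp add: algebra_simps)
      qed
      moreover have "0 \<le> 2 * indicat_real B0 w" by simp
      ultimately show ?thesis by linarith
    qed
    define M where "M = T0 * n"
    define G where "G m = (\<Sum>t<m. srwn t ?\<delta> z)" for m
    have Gmono: "G i \<le> G j" if "i \<le> j" for i j
      unfolding G_def using that by (intro sum_mono2) (auto simp: srwn_nonneg)
    have kk: "(\<Sum>t\<in>I. \<Sum>k<k0. srwn (t + k) ?\<delta> z) \<le> k0 * G N" if "I \<subseteq> {..<N - k0}" "k0 \<le> N" for I N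
    proof -
      have "(\<Sum>t\<in>I. \<Sum>k<k0. srwn (t + k) ?\<delta> z) = (\<Sum>k<k0. \<Sum>t\<in>I. srwn (t + k) ?\<delta> z)"
        by (rule sum.swap)
      also have "\<dots> \<le> (\<Sum>k<k0. G N)"
      proof (rule sum_mono)
        fix k assume k: "k \<in> {..<k0}"
        have "(\<Sum>t\<in>I. srwn (t + k) ?\<delta> z) = (\<Sum>t\<in>(\<lambda>t. t + k) ` I. srwn t ?\<delta> z)"
          by (subst sum.reindex) auto
        also have "\<dots> \<le> G N" unfolding G_def using that k
          by (intro sum_mono2) (auto simp: srwn_nonneg)
        finally show "(\<Sum>t\<in>I. srwn (t + k) ?\<delta> z) \<le> G N" .
      qed
      finally show ?thesis by simp
    qed
    \<comment> \<open>Times before \<open>M\<close> are charged to the truncated Green function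
      \<open>G\<close>. Later ones carry the factor \<open>(1 - l)^M\<close> and are bounded by
      \<open>green_upper\<close>; the last term vanishes as \<open>N\<close> grows.\<close>
    have main: "u z \<le> 2 * C3 * k0 * (G (M + k0) + (1 - l)^M * (C1 * bar 1 b z)) + 2 * (1 - l)^N" if "M \<le> N" for N
    proof -
      have "u z \<le> (\<Sum>t<N. (1 - l)^t * srwn t (\<lambda>z. 2 * indicat_real B0 z) z) + (1 - l)^N * srwn N u z"
        using l by (intro subsolution_iterate step) auto
      also have "\<dots> \<le> (\<Sum>t<N. (1 - l)^t * (2 * C3 * (\<Sum>k<k0. srwn (t + k) ?\<delta> z))) + (1 - l)^N * 2"
      proof (intro add_mono sum_mono mult_left_mono)
        fix t
        have "srwn t (\<lambda>z. 2 * indicat_real B0 z) z \<le> srwn t (\<lambda>z. 2 * (C3 * (\<Sum>k<k0. srwn k ?\<delta> z))) z"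
          by (intro srwn_mono mult_left_mono C3) auto
        then show "srwn t (\<lambda>z. 2 * indicat_real B0 z) z \<le> 2 * C3 * (\<Sum>k<k0. srwn (t + k) ?\<delta> z)"
          by (simp only: srwn_cmult srwn_sum srwn_add_time mult.assoc)
      next
        show "srwn N u z \<le> 2" using uF F3_le2 order_trans by (intro srwn_le) blast
      qed (use l in auto)
      also have "(\<Sum>t<N. (1 - l)^t * (2 * C3 * (\<Sum>k<k0. srwn (t + k) ?\<delta> z))) =
          2 * C3 * (\<Sum>t<N. (1 - l)^t * (\<Sum>k<k0. srwn (t + k) ?\<delta> z))"
        by (simp add: sum_distrib_left mult_ac)
      also have "(\<Sum>t<N. (1 - l)^t * (\<Sum>k<k0. srwn (t + k) ?\<delta> z))
        = (\<Sum>t<M. (1 - l)^t * (\<Sum>k<k0. srwn (t + k) ?\<delta> z)) + (\<Sum>t=M..<N. (1 - l)^t * (\<Sum>k<k0. srwn (t + k) ?\<delta> z))"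
        using that by (subst sum.atLeastLessThan_concat[of 0 M N, symmetric, unfolded lessThan_atLeast0[symmetric]] | simp add: lessThan_atLeast0 sum.atLeastLessThan_concat)+
      also have "(\<Sum>t<M. (1 - l)^t * (\<Sum>k<k0. srwn (t + k) ?\<delta> z)) \<le> (\<Sum>t<M. 1 * (\<Sum>k<k0. srwn (t + k) ?\<delta> z))"
        using l by (intro sum_mono mult_right_mono sum_nonneg srwn_nonneg) (auto simp: power_le_one)
      also have "\<dots> \<le> k0 * G (M + k0)" using kk[of "{..<M}" "M + k0"] by simp
      also have "(\<Sum>t=M..<N. (1 - l)^t * (\<Sum>k<k0. srwn (t + k) ?\<delta> z)) \<le> (\<Sum>t=M..<N. (1 - l)^M * (\<Sum>k<k0. srwn (t + k) ?\<delta> z))"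
        using l by (intro sum_mono mult_right_mono sum_nonneg srwn_nonneg power_decreasing) auto
      also have "\<dots> \<le> (1 - l)^M * (k0 * G (N + k0))"
        using kk[of "{M..<N}" "N + k0"] l
        by (subst sum_distrib_left[symmetric]) (intro mult_left_mono, auto simp: subset_eq)
      also have "\<dots> \<le> (1 - l)^M * (k0 * (C1 * bar 1 b z))"
        using C1 l unfolding G_def by (intro mult_left_mono) auto
      finally show ?thesis using C3 by (simp add: algebra_simps)
    qed
    have "(\<lambda>N. 2 * C3 * k0 * (G (M + k0) + (1 - l)^M * (C1 * bar 1 b z)) + 2 * (1 - l)^N)
       \<longlonglongrightarrow> 2 * C3 * k0 * (G (M + k0) + (1 - l)^M * (C1 * bar 1 b z)) + 2 * 0"
      using l by (intro tendsto_intros LIMSEQ_power_zero) auto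
    then have u_le: "u z \<le> 2 * C3 * k0 * (G (M + k0) + (1 - l)^M * (C1 * bar 1 b z))"
      using main by (intro LIMSEQ_le_const[where X = "\<lambda>N. 2 * C3 * k0 * (G (M + k0) + (1 - l)^M * (C1 * bar 1 b z)) + 2 * (1 - l)^N"]) auto
    have pl: "(1 - l)^M \<le> \<eta>"
    proof -
      have "(1 - l)^M \<le> exp (- l)^M"
        using l exp_ge_add_one_self[of "- l"] by (intro power_mono) auto
      also have "\<dots> = exp (- (l * M))" by (simp add: exp_of_nat_mult[symmetric])
      also have "l * M = real T0 / (2 * C0 * A)" using n by (simp add: l_def M_def)
      finally show ?thesis using T0 by simp
    qed
    \<comment> \<open>Since 1 + |z|^2 \<le> n, the correction is at most half of the main
      term.\<close>
    have "bar A b z / 2 \<le> u z"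
    proof -
      have "A + sq z \<le> A * (1 + sq z)" using A mult_right_mono[of 1 A "sq z"] by (simp add: algebra_simps)
      also have "\<dots> \<le> A * n" using z A by (intro mult_left_mono) auto
      finally have "C0 * l * (A + sq z) \<le> C0 * l * (A * n)" using C0 l by (intro mult_left_mono) auto
      also have "\<dots> = 1/2" using n A C0 by (simp add: l_def)
      finally have "C0 * l * (A + sq z) * bar A b z \<le> 1/2 * bar A b z" by (intro mult_right_mono) auto
      moreover have "bar A (b-1) z = (A + sq z) * bar A b z" using A by (intro bar_Suc) auto
      moreover have "bar A b z \<le> F3 z" by (simp add: F3_def)
      ultimately show ?thesis by (simp add: u_def max_def algebra_simps)
    qed
    moreover have "bar 1 b z / A powr b \<le> bar A b z"
      using bar_1_le[of A b z] A b0 by (simp add: field_simps)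
    ultimately have low: "bar 1 b z / (2 * A powr b) \<le> u z" by (simp add: field_simps)
    have "(1 - l)^M * (C1 * bar 1 b z) \<le> \<eta> * (C1 * bar 1 b z)"
      using pl C1 by (intro mult_right_mono) auto
    then have "2 * C3 * k0 * ((1 - l)^M * (C1 * bar 1 b z)) \<le> 2 * C3 * k0 * (\<eta> * (C1 * bar 1 b z))"
      using C3 by (intro mult_left_mono) auto
    also have "\<dots> = bar 1 b z / (4 * A powr b)"
      using C3 C1 A by (simp add: \<eta>_def field_simps)
    finally have "bar 1 b z / (4 * A powr b) \<le> 2 * C3 * k0 * G (M + k0)"
      using u_le low by (simp add: field_simps)
    then have "1 / (8 * C3 * real k0 * A powr b) * bar 1 b z \<le> G (M + k0)"
      using C3 A by (simp add: field_simps)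
    also have "\<dots> \<le> G ((T0 + k0) * n)" using n by (intro Gmono) (simp add: M_def algebra_simps)
    finally show "1 / (8 * C3 * real k0 * A powr b) * bar 1 b z \<le> (\<Sum>t<(T0 + k0)*n. srwn t ?\<delta> z)"
      by (simp add: G_def)
  qed
qed

text \<open>After n steps the mean of |w|^2 is |z|^2 + n \<le> 17 n, so 1 - |w|^2/(100 n) still has
  mean at least 1/2. This function is negative beyond |w|^2 = 100 n, and within that radius the
  truncated Green function is at least of order n^(-b). Second moments suffice, and the window of
  times hides the parity of the walk.\<close>

lemma block_lower:
  assumes d: "CARD('d::finite) \<ge> 5" and b: "b = (real CARD('d) - 2) / 2"
  shows "\<exists>c>0. \<exists>B>1. \<forall>n>0. \<forall>z::int^'d. sq z \<le> 16 * real n \<longrightarrow>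
     c * real n powr (-b) \<le> (\<Sum>t=n..<B*n. srwn t (indicat_real {0}) z)"
proof -
  let ?\<delta> = "indicat_real {0} :: int^'d \<Rightarrow> real"
  have b0: "0 < b" using d b by simp
  obtain c T where c: "c > 0" "T > 0" and G: "\<And>n z::int^'d. n > 0 \<Longrightarrow> 1 + sq z \<le> real n \<Longrightarrow>
     c * bar 1 b z \<le> (\<Sum>t<T*n. srwn t ?\<delta> z)" using green_lower[OF d b] by blast
  show ?thesis
  proof (intro exI[of _ "c * 101 powr (-b) / 2"] conjI exI[of _ "1 + T * 101"] allI impI)
    show "0 < c * 101 powr (-b) / 2" using c by simp
    show "1 < 1 + T * 101" using c by simp
    fix n :: nat and z :: "int^'d" assume n: "0 < n" and z: "sq z \<le> 16 * real n"
    define N where "N = T * (101 * n)"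
    define k where "k = c * (101 * real n) powr (-b)"
    have k: "k > 0" using c n by (simp add: k_def)
    have "k * (1/2) \<le> k * (1 - (sq z + n) / (100 * n))"
      using z n k by (intro mult_left_mono) (auto simp: field_simps)
    also have "\<dots> = srwn n (\<lambda>w. k * (1 - 1 / (100 * n) * sq w)) z"
      by (simp only: srwn_cmult srwn_diff srwn_const srwn_sq) simp
    also have "\<dots> \<le> srwn n (\<lambda>w. \<Sum>t<N. srwn t ?\<delta> w) z"
    proof (rule srwn_mono)
      fix w :: "int^'d"
      have S0: "0 \<le> (\<Sum>t<N. srwn t ?\<delta> w)" by (intro sum_nonneg srwn_nonneg) auto
      show "k * (1 - 1 / (100 * n) * sq w) \<le> (\<Sum>t<N. srwn t ?\<delta> w)"
      proof (cases "sq w \<le> 100 * n")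
        case True
        have s1: "1 + sq w \<le> real (101 * n)" using True n by simp
        have "k * (1 - 1 / (100 * n) * sq w) \<le> k * 1" using k n by (intro mult_left_mono) auto
        also have "k * 1 \<le> c * bar 1 b w"
          unfolding k_def bar_def mult_1_right using s1 b0 c
          by (intro mult_left_mono powr_neg_antimono) (auto simp: add_pos_nonneg)
        also have "\<dots> \<le> (\<Sum>t<N. srwn t ?\<delta> w)" unfolding N_def using n s1 by (intro G) auto
        finally show ?thesis .
      next
        case False
        then have "1 - 1 / (100 * n) * sq w \<le> 0" using n by (simp add: field_simps)
        then have "k * (1 - 1 / (100 * n) * sq w) \<le> 0" using k by (simp add: mult_nonneg_nonpos)
        then show ?thesis using S0 by linarith
      qed
    qed
    also have "\<dots> = (\<Sum>t<N. srwn (n + t) ?\<delta> z)" by (simp add: srwn_sum srwn_add_time)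
    also have "\<dots> = (\<Sum>t=n..<n+N. srwn t ?\<delta> z)"
      by (rule sum.reindex_bij_witness[of _ "\<lambda>t. t - n" "\<lambda>t. n + t"]) auto
    also have "n + N = (1 + T * 101) * n" by (simp add: N_def algebra_simps)
    finally show "c * 101 powr (-b) / 2 * real n powr (-b) \<le> (\<Sum>t=n..<(1 + T * 101)*n. srwn t ?\<delta> z)"
      by (simp add: k_def powr_mult mult_ac)
  qed
qed

text \<open>One window at n of order 1 + |z|^2 is enough: the weight there is at least n, which
  turns n^(-b) into n^(1-b).\<close>

lemma green2_lower:
  assumes d: "CARD('d::finite) \<ge> 5" and b: "b = (real CARD('d) - 2) / 2"
  shows "\<exists>c>0. \<forall>z::int^'d. \<exists>N. c * bar 1 (b - 1) z \<le> (\<Sum>t=1..<N. (real t + 1) * srwn t (indicat_real {0}) z)"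
proof -
  let ?\<delta> = "indicat_real {0} :: int^'d \<Rightarrow> real"
  have b0: "0 < b - 1" using d b by simp
  obtain c B where c: "c > 0" "B > 1" and G: "\<And>n z::int^'d. n > 0 \<Longrightarrow> sq z \<le> 16 * real n \<Longrightarrow>
     c * real n powr (-b) \<le> (\<Sum>t=n..<B*n. srwn t ?\<delta> z)" using block_lower[OF d b] by blast
  show ?thesis
  proof (intro exI[of _ "c * 2 powr (-(b-1))"] conjI allI)
    show "0 < c * 2 powr (-(b-1))" using c by simp
    fix z :: "int^'d"
    define n where "n = nat \<lceil>1 + sq z\<rceil>"
    have 1: "0 \<le> sq z" by simp
    have 2: "real n = of_int \<lceil>1 + sq z\<rceil>" unfolding n_def using 1 by simp
    have 3: "1 + sq z \<le> real n" unfolding 2 by simp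
    have 4: "real n \<le> 1 + sq z + 1" unfolding 2 by (rule of_int_ceiling_le_add_one)
    have n: "1 + sq z \<le> real n" "real n \<le> 2 * (1 + sq z)" "0 < n"
      using 1 3 4 by (simp_all del: sq_nonneg)
    have "c * 2 powr (-(b-1)) * bar 1 (b-1) z = c * (2 * (1 + sq z)) powr (-(b-1))"
      unfolding bar_def by (subst powr_mult) simp_all
    also have "\<dots> \<le> c * real n powr (-(b-1))"
      using n b0 c by (intro mult_left_mono powr_neg_antimono) auto
    also have "\<dots> = real n * (c * real n powr (-b))"
      using n(3) powr_add[of "real n" 1 "-b"] by simp
    also have "\<dots> \<le> real n * (\<Sum>t=n..<B*n. srwn t ?\<delta> z)"
      using n by (intro mult_left_mono G) auto
    also have "\<dots> \<le> (\<Sum>t=n..<B*n. (real t + 1) * srwn t ?\<delta> z)"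
      unfolding sum_distrib_left by (intro sum_mono mult_right_mono srwn_nonneg) auto
    also have "\<dots> \<le> (\<Sum>t=1..<B*n. (real t + 1) * srwn t ?\<delta> z)"
      using n by (intro sum_mono2) (auto intro!: mult_nonneg_nonneg srwn_nonneg)
    finally show "\<exists>N. c * 2 powr (-(b-1)) * bar 1 (b-1) z \<le> (\<Sum>t=1..<N. (real t + 1) * srwn t ?\<delta> z)" by blast
  qed
qed

section \<open>Oscillation of a bounded subharmonic function along the walk\<close>

text \<open>The carre du champ of the walk, without the usual factor 1/2.\<close>

definition gam :: "(int^'d::finite \<Rightarrow> real) \<Rightarrow> int^'d \<Rightarrow> real" where
  "gam f z = srw (\<lambda>w. (f w - f z)\<^sup>2) z"

text \<open>Averaging commutes with translations, so the increment of Pf along a step is the average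
  of increments of f, and Jensen applies: the Bakry-Emery bound with zero curvature.\<close>

lemma gam_srw: "gam (srw f) (z::int^'d::finite) \<le> srw (gam f) z"
proof -
  have "(\<Sum>v\<in>nbrs. (srw f (z + v) - srw f z)\<^sup>2) \<le> (\<Sum>v\<in>nbrs. srw (\<lambda>x. (f (x + v) - f x)\<^sup>2) z)"
  proof (rule sum_mono)
    fix v :: "int^'d"
    have "srw f (z + v) - srw f z = srw (\<lambda>x. f (x + v) - f x) z"
      by (simp add: srw_diff srw_shift)
    then show "(srw f (z + v) - srw f z)\<^sup>2 \<le> srw (\<lambda>x. (f (x + v) - f x)\<^sup>2) z"
      using srw_square_le by metis
  qed
  also have "\<dots> = srw (\<lambda>x. \<Sum>v\<in>nbrs. (f (x + v) - f x)\<^sup>2) z" by (simp add: srw_sum)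
  finally have "gam (srw f) z \<le> srw (\<lambda>x. \<Sum>v\<in>nbrs. (f (x + v) - f x)\<^sup>2) z / (2 * CARD('d))"
    by (simp add: gam_def srw_def[of "\<lambda>w. (srw f w - srw f z)\<^sup>2"] divide_right_mono)
  also have "\<dots> = srw (gam f) z"
    using srw_cmult[of "1 / (2 * CARD('d))" "\<lambda>x. \<Sum>v\<in>nbrs. (f (x + v) - f x)\<^sup>2" z]
    by (simp add: gam_def[abs_def] srw_def[of "\<lambda>w. (f w - f _)\<^sup>2"])
  finally show ?thesis .
qed

lemma gam_srwn: "gam (srwn t f) z \<le> srwn t (gam f) z"
proof (induction t arbitrary: z)
  case (Suc t)
  have "gam (srwn (Suc t) f) z \<le> srw (gam (srwn t f)) z" using gam_srw[of "srwn t f" z] by simp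
  also have "\<dots> \<le> srw (srwn t (gam f)) z" by (intro srw_mono Suc)
  finally show ?case by simp
qed simp

lemma var_srwn_expand:
  "srwn t (\<lambda>z. (f z - c)\<^sup>2) x = srwn t (\<lambda>z. (f z)\<^sup>2) x - 2 * c * srwn t f x + c\<^sup>2"
proof -
  have "(\<lambda>z. (f z - c)\<^sup>2) = (\<lambda>z. ((f z)\<^sup>2 - (2 * c) * f z) + c\<^sup>2)"
    by (simp add: power2_eq_square algebra_simps)
  then show ?thesis by (simp only: srwn_add srwn_diff srwn_cmult srwn_const)
qed

lemma var_srw_le: "srw (\<lambda>z. (f z)\<^sup>2) x - (srw f x)\<^sup>2 \<le> gam f x"
proof -
  have "gam f x = srw (\<lambda>z. (f z)\<^sup>2) x - 2 * f x * srw f x + (f x)\<^sup>2"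
    using var_srwn_expand[of 1 f "f x" x] by (simp add: gam_def)
  moreover have "0 \<le> (srw f x - f x)\<^sup>2" by simp
  ultimately show ?thesis by (simp add: power2_eq_square algebra_simps)
qed

text \<open>The variance is split over the t steps, and \<open>gam_srwn\<close> moves every one-step
  contribution to time t - 1. For t = 0 both sides vanish, so the truncated subtraction does no
  harm.\<close>

lemma var_srwn_le: "srwn t (\<lambda>z. (f z)\<^sup>2) x - (srwn t f x)\<^sup>2 \<le> real t * srwn (t - 1) (gam f) x"
proof (induction t arbitrary: x)
  case (Suc t)
  have "srwn (Suc t) (\<lambda>z. (f z)\<^sup>2) x \<le> srw (\<lambda>w. real t * srwn (t - 1) (gam f) w + (srwn t f w)\<^sup>2) x"
    unfolding srwn_Suc by (intro srw_mono) (use Suc in \<open>simp add: diff_le_eq\<close>)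
  also have "\<dots> = real t * srw (srwn (t - 1) (gam f)) x + srw (\<lambda>w. (srwn t f w)\<^sup>2) x"
    by (simp only: srw_add srw_cmult)
  also have "real t * srw (srwn (t - 1) (gam f)) x = real t * srwn t (gam f) x"
    by (cases t) auto
  also have "srw (\<lambda>w. (srwn t f w)\<^sup>2) x \<le> (srwn (Suc t) f x)\<^sup>2 + gam (srwn t f) x"
    using var_srw_le[of "srwn t f" x] by simp
  also have "gam (srwn t f) x \<le> srwn t (gam f) x" by (rule gam_srwn)
  finally show ?case by (simp add: algebra_simps)
qed simp

text \<open>The right side is 4 times the Bregman divergence of x^(3/2) between x = v^4 and x = u^4.
  With e = q^4 this lets the growth of e^(3/2) control squared increments of e^(3/4).\<close>

lemma two_point:
  fixes u v :: real
  assumes "0 \<le> u" "0 \<le> v"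
  shows "(v^3 - u^3)\<^sup>2 \<le> 4 * (v^6 - u^6 - 3/2 * u\<^sup>2 * (v^4 - u^4))"
proof -
  have "(v^3 - u^3)\<^sup>2 = (v - u)\<^sup>2 * (v\<^sup>2 + u * v + u\<^sup>2)\<^sup>2"
    by (simp add: power2_eq_square power3_eq_cube algebra_simps)
  also have "\<dots> \<le> (v - u)\<^sup>2 * ((v + u)\<^sup>2 * (2 * (2 * v\<^sup>2 + u\<^sup>2)))"
  proof (rule mult_left_mono)
    have "(v\<^sup>2 + u * v + u\<^sup>2)\<^sup>2 \<le> ((v + u)\<^sup>2)\<^sup>2"
      using assms by (intro power_mono) (auto simp: power2_eq_square algebra_simps)
    also have "\<dots> = (v + u)\<^sup>2 * (v + u)\<^sup>2" by (simp add: power2_eq_square)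
    also have "\<dots> \<le> (v + u)\<^sup>2 * (2 * (2 * v\<^sup>2 + u\<^sup>2))"
    proof (rule mult_left_mono)
      have "0 \<le> (v - u)\<^sup>2 + 2 * v\<^sup>2" by simp
      then show "(v + u)\<^sup>2 \<le> 2 * (2 * v\<^sup>2 + u\<^sup>2)" by (simp add: power2_eq_square algebra_simps)
    qed simp
    finally show "(v\<^sup>2 + u * v + u\<^sup>2)\<^sup>2 \<le> (v + u)\<^sup>2 * (2 * (2 * v\<^sup>2 + u\<^sup>2))" .
  qed simp
  also have "\<dots> = 4 * (v^6 - u^6 - 3/2 * u\<^sup>2 * (v^4 - u^4))"
    by (simp add: eval_nat_numeral algebra_simps)
  finally show ?thesis .
qed

locale subharmonic01 =
  fixes e :: "int^'d::finite \<Rightarrow> real"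
  assumes e0: "0 \<le> e z" and e1: "e z \<le> 1" and sub: "e z \<le> srw e z"
begin

text \<open>With this fourth root, the functions e, e^(3/4) and e^(3/2) become the polynomial
  expressions q^4, q^3 and q^6.\<close>

definition q where "q z = sqrt (sqrt (e z))"
definition m where "m t = srwn t e 0"

lemma q0 [simp]: "0 \<le> q z" by (simp add: q_def e0)
lemma q4: "q z ^ 4 = e z"
proof -
  have "q z ^ 4 = ((q z)\<^sup>2)\<^sup>2" by (simp add: power_mult[symmetric])
  then show ?thesis using e0[of z] by (simp add: q_def)
qed
lemma m0 [simp]: "0 \<le> m t" by (simp add: m_def srwn_nonneg e0)
lemma m1: "m t \<le> 1" by (simp add: m_def srwn_le e1)
lemma m_Suc: "m t \<le> m (Suc t)"
  unfolding m_def srwn_Suc2 by (intro srwn_mono sub)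
lemma m_mono: "s \<le> t \<Longrightarrow> m s \<le> m t" by (rule lift_Suc_mono_le[of m, OF m_Suc])

lemma gam_q3: "gam (\<lambda>z. q z ^ 3) z \<le> 4 * (srw (\<lambda>z. q z ^ 6) z - q z ^ 6)"
proof -
  have "gam (\<lambda>z. q z ^ 3) z \<le> srw (\<lambda>w. 4 * ((q w ^ 6 - q z ^ 6) - 3/2 * (q z)\<^sup>2 * (q w ^ 4 - q z ^ 4))) z"
    unfolding gam_def using two_point by (intro srw_mono) auto
  also have "\<dots> = 4 * ((srw (\<lambda>z. q z ^ 6) z - q z ^ 6) - 3/2 * (q z)\<^sup>2 * (srw e z - e z))"
    by (simp only: srw_cmult srw_diff srw_const q4)
  also have "\<dots> \<le> 4 * (srw (\<lambda>z. q z ^ 6) z - q z ^ 6)"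
    using sub[of z] by simp
  finally show ?thesis .
qed

text \<open>Summation by parts for the means b(t) of q^6 with weights 1/sqrt m. The terms b (1/sqrt
  m(t) - 1/sqrt m(t+1)) are bounded by increments of sqrt m because b \<le> m, so the total does not
  depend on how many scales m needs to climb.\<close>

lemma energy_sum: "(\<Sum>t<n. 1 / sqrt (m (Suc t)) * srwn t (gam (\<lambda>z. q z ^ 3)) 0) \<le> 8"
proof -
  define b where "b t = srwn t (\<lambda>z. q z ^ 6) 0" for t
  have b: "0 \<le> b t" "b t \<le> m t" for t
  proof -
    show "0 \<le> b t" by (simp add: b_def srwn_nonneg)
    have "q z ^ 6 \<le> e z" for z
    proof -
      have "q z \<le> 1" using e1[of z] e0[of z] by (simp add: q_def)
      then have "q z ^ 6 \<le> q z ^ 4" by (intro power_decreasing) auto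
      then show ?thesis by (simp add: q4)
    qed
    then show "b t \<le> m t" unfolding b_def m_def by (intro srwn_mono)
  qed
  have inc: "srwn t (gam (\<lambda>z. q z ^ 3)) 0 \<le> 4 * (b (Suc t) - b t)" for t
  proof -
    have "srwn t (gam (\<lambda>z. q z ^ 3)) 0 \<le> srwn t (\<lambda>z. 4 * (srw (\<lambda>z. q z ^ 6) z - q z ^ 6)) 0"
      by (intro srwn_mono gam_q3)
    also have "\<dots> = 4 * (b (Suc t) - b t)"
      unfolding b_def srwn_Suc2 by (simp only: srwn_cmult srwn_diff)
    finally show ?thesis .
  qed
  have abel: "(\<Sum>t<n. 1 / sqrt (m (Suc t)) * (b (Suc t) - b t)) \<le> b n / sqrt (m n) + sqrt (m n)" for n
  proof (induction n)
    case 0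
    show ?case using b[of 0] by simp
  next
    case (Suc n)
    have "b n / sqrt (m n) + sqrt (m n) - b n / sqrt (m (Suc n)) \<le> sqrt (m (Suc n))"
    proof (cases "m n = 0")
      case True
      then show ?thesis using b[of n] by simp
    next
      case False
      then have mp: "0 < m n" "0 < m (Suc n)" using m0[of n] m_Suc[of n] by linarith+
      have "1 / sqrt (m (Suc n)) \<le> 1 / sqrt (m n)"
        using mp m_Suc[of n] by (intro divide_left_mono) auto
      then have "b n * (1 / sqrt (m n) - 1 / sqrt (m (Suc n))) \<le> m n * (1 / sqrt (m n) - 1 / sqrt (m (Suc n)))"
        using b by (intro mult_right_mono) auto
      also have "\<dots> = sqrt (m n) - m n / sqrt (m (Suc n))"
        using mp by (simp add: right_diff_distrib real_div_sqrt)
      \<comment> \<open>The arithmetic-geometric mean inequality, divided by sqrt m(n+1).\<close>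
      also have "\<dots> \<le> sqrt (m (Suc n)) - sqrt (m n)"
      proof -
        have "0 \<le> (sqrt (m (Suc n)) - sqrt (m n))\<^sup>2" by simp
        then have "2 * sqrt (m n) * sqrt (m (Suc n)) \<le> m (Suc n) + m n"
          using mp by (simp add: power2_eq_square algebra_simps)
        then have "2 * sqrt (m n) * sqrt (m (Suc n)) / sqrt (m (Suc n)) \<le> (m (Suc n) + m n) / sqrt (m (Suc n))"
          using mp by (intro divide_right_mono) auto
        then show ?thesis using mp by (simp add: add_divide_distrib real_div_sqrt)
      qed
      finally show ?thesis by (simp add: right_diff_distrib)
    qed
    then show ?case using Suc by (simp add: diff_divide_distrib)
  qed
  have "(\<Sum>t<n. 1 / sqrt (m (Suc t)) * srwn t (gam (\<lambda>z. q z ^ 3)) 0) \<le> (\<Sum>t<n. 4 * (1 / sqrt (m (Suc t)) * (b (Suc t) - b t)))"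
  proof (rule sum_mono)
    fix t show "1 / sqrt (m (Suc t)) * srwn t (gam (\<lambda>z. q z ^ 3)) 0 \<le> 4 * (1 / sqrt (m (Suc t)) * (b (Suc t) - b t))"
      using mult_left_mono[OF inc[of t], of "1 / sqrt (m (Suc t))"] m0[of "Suc t"]
      by (simp only: mult.left_commute[of 4]) simp
  qed
  also have "\<dots> = 4 * (\<Sum>t<n. 1 / sqrt (m (Suc t)) * (b (Suc t) - b t))" by (simp add: sum_distrib_left)
  also have "\<dots> \<le> 4 * (b n / sqrt (m n) + sqrt (m n))" using mult_left_mono[OF abel[of n], of 4] by simp
  also have "\<dots> \<le> 4 * (1 + 1)"
  proof -
    have "b n / sqrt (m n) \<le> m n / sqrt (m n)" using b by (intro divide_right_mono) auto
    also have "\<dots> = sqrt (m n)" by (simp add: real_div_sqrt)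
    finally have 1: "b n / sqrt (m n) \<le> sqrt (m n)" .
    have 2: "sqrt (m n) \<le> 1" using m1[of n] by simp
    show ?thesis by (intro mult_left_mono add_mono order_trans[OF 1 2] 2) auto
  qed
  finally show ?thesis by simp
qed

definition V where "V t = srwn t (\<lambda>z. (q z ^ 3)\<^sup>2) 0 - (srwn t (\<lambda>z. q z ^ 3) 0)\<^sup>2"

lemma V_alt: "V t = srwn t (\<lambda>z. (q z ^ 3 - srwn t (\<lambda>z. q z ^ 3) 0)\<^sup>2) 0"
  unfolding V_def var_srwn_expand by algebra

lemma V_sum: "(\<Sum>t=1..<n. 1 / real t * (1 / sqrt (m t)) * V t) \<le> 8"
proof -
  have "(\<Sum>t=1..<n. 1 / real t * (1 / sqrt (m t)) * V t)
     \<le> (\<Sum>t=1..<n. 1 / sqrt (m t) * srwn (t - 1) (gam (\<lambda>z. q z ^ 3)) 0)"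
  proof (rule sum_mono)
    fix t assume t: "t \<in> {1..<n}"
    have "1 / real t * (1 / sqrt (m t)) * V t \<le> 1 / real t * (1 / sqrt (m t)) * (real t * srwn (t - 1) (gam (\<lambda>z. q z ^ 3)) 0)"
      unfolding V_def by (intro mult_left_mono var_srwn_le) auto
    then show "1 / real t * (1 / sqrt (m t)) * V t \<le> 1 / sqrt (m t) * srwn (t - 1) (gam (\<lambda>z. q z ^ 3)) 0"
      using t by simp
  qed
  also have "\<dots> = (\<Sum>t<n-1. 1 / sqrt (m (Suc t)) * srwn t (gam (\<lambda>z. q z ^ 3)) 0)"
    by (rule sum.reindex_bij_witness[of _ Suc "\<lambda>t. t - 1"]) auto
  also have "\<dots> \<le> 8" by (rule energy_sum)
  finally show ?thesis .
qed

definition mu where "mu t = sqrt (sqrt (m t))"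

lemma mu0: "0 \<le> mu t" and mu2: "mu t ^ 2 = sqrt (m t)"
  by (simp_all add: mu_def)

lemma mu4: "mu t ^ 4 = m t"
proof -
  have "mu t ^ 4 = ((mu t)\<^sup>2)\<^sup>2" by (simp add: power_mult[symmetric])
  then show ?thesis by (simp add: mu2)
qed

text \<open>Jensen for the concave x^(3/4), written with the tangent line at
  \<open>m t\<close>.\<close>

lemma mean_q3: "0 < m t \<Longrightarrow> srwn t (\<lambda>z. q z ^ 3) 0 \<le> mu t ^ 3"
proof -
  assume "0 < m t"
  then have mu: "0 < mu t" by (simp add: mu_def)
  have "srwn t (\<lambda>z. q z ^ 3) 0 \<le> srwn t (\<lambda>z. mu t ^ 3 + 3 / (4 * mu t) * (q z ^ 4 - mu t ^ 4)) 0"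
  proof (rule srwn_mono)
    fix z
    define x where "x = q z"
    define u where "u = mu t"
    have x: "0 \<le> x" and u: "0 < u" using mu by (simp_all add: x_def u_def)
    have "u^4 + 3 * x^4 - 4 * x^3 * u = (u - x)\<^sup>2 * (u\<^sup>2 + 2 * u * x + 3 * x\<^sup>2)"
      by (simp add: eval_nat_numeral algebra_simps)
    also have "\<dots> \<ge> 0" using x u by simp
    finally have "4 * x^3 * u \<le> u^4 + 3 * x^4" by simp
    then have "x^3 \<le> (u^4 + 3 * x^4) / (4 * u)" using u by (simp add: field_simps)
    also have "\<dots> = u^3 + 3 / (4 * u) * (x^4 - u^4)"
      using u by (simp add: field_simps eval_nat_numeral)
    finally show "q z ^ 3 \<le> mu t ^ 3 + 3 / (4 * mu t) * (q z ^ 4 - mu t ^ 4)" by (simp add: x_def u_def)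
  qed
  also have "\<dots> = mu t ^ 3"
    by (simp only: srwn_add srwn_cmult srwn_diff srwn_const q4 mu4 m_def) simp
  finally show ?thesis .
qed

text \<open>Jensen for the convex x^(3/2); the nonnegativity of the Bregman divergence is read off
  from \<open>two_point\<close>.\<close>

lemma mean_q6: "mu t ^ 6 \<le> srwn t (\<lambda>z. (q z ^ 3)\<^sup>2) 0"
proof -
  have "mu t ^ 6 = srwn t (\<lambda>z. mu t ^ 6 + 3/2 * (mu t)\<^sup>2 * (q z ^ 4 - mu t ^ 4)) 0"
    by (simp only: srwn_add srwn_cmult srwn_diff srwn_const q4 mu4 m_def) simp
  also have "\<dots> \<le> srwn t (\<lambda>z. (q z ^ 3)\<^sup>2) 0"
  proof (rule srwn_mono)
    fix z
    have "0 \<le> (q z ^ 3 - mu t ^ 3)\<^sup>2" by simp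
    also have "\<dots> \<le> 4 * (q z ^ 6 - mu t ^ 6 - 3/2 * (mu t)\<^sup>2 * (q z ^ 4 - mu t ^ 4))"
      using mu0[of t] by (intro two_point) auto
    finally have "0 \<le> 4 * (q z ^ 6 - mu t ^ 6 - 3/2 * (mu t)\<^sup>2 * (q z ^ 4 - mu t ^ 4))" .
    then have "mu t ^ 6 + 3/2 * (mu t)\<^sup>2 * (q z ^ 4 - mu t ^ 4) \<le> q z ^ 6"
    proof -
      have "b + x \<le> a" if "0 \<le> 4 * (a - b - x)" for a b x :: real using that by simp
      then show ?thesis using \<open>0 \<le> 4 * (q z ^ 6 - mu t ^ 6 - 3/2 * (mu t)\<^sup>2 * (q z ^ 4 - mu t ^ 4))\<close> by blast
    qed
    then show "mu t ^ 6 + 3/2 * (mu t)\<^sup>2 * (q z ^ 4 - mu t ^ 4) \<le> (q z ^ 3)\<^sup>2"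
      by (simp add: power_mult[symmetric])
  qed
  finally show ?thesis .
qed

text \<open>If the mean of q^3 is at least 4/5 mu^3, every such point lies at least 1/5 mu^3 below
  it, because 2^(-3/4) < 3/5. Otherwise \<open>mean_q6\<close> already makes the variance at least
  9/25 mu^6.\<close>

lemma detect_low: "mu t ^ 6 * srwn t (\<lambda>z. if e z < m t / 2 then 1 else 0) 0 \<le> 25 * V t"
proof (cases "m t = 0")
  case True
  have "0 \<le> V t" unfolding V_alt by (intro srwn_nonneg) simp
  then show ?thesis using True by (simp add: mu_def)
next
  case False
  then have mp: "0 < m t" using m0[of t] by linarith
  define c where "c = srwn t (\<lambda>z. q z ^ 3) 0"
  define P where "P = srwn t (\<lambda>z. if e z < m t / 2 then 1 else 0) 0"
  have P: "0 \<le> P" "P \<le> 1" unfolding P_def by (auto intro!: srwn_nonneg srwn_le)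
  have c: "0 \<le> c" unfolding c_def by (intro srwn_nonneg) simp
  show ?thesis
  proof (cases "c \<ge> 4/5 * mu t ^ 3")
    case True
    have "mu t ^ 6 / 25 * P = srwn t (\<lambda>z. mu t ^ 6 / 25 * (if e z < m t / 2 then 1 else 0)) 0"
      unfolding P_def by (simp only: srwn_cmult)
    also have "\<dots> \<le> V t" unfolding V_alt c_def[symmetric]
    proof (rule srwn_mono)
      fix z
      show "mu t ^ 6 / 25 * (if e z < m t / 2 then 1 else 0) \<le> (q z ^ 3 - c)\<^sup>2"
      proof (cases "e z < m t / 2")
        case lt: True
        have "q z ^ 3 \<le> 3/5 * mu t ^ 3"
        proof (rule ccontr)
          assume "\<not> ?thesis"
          then have "(3/5 * mu t ^ 3)^4 \<le> (q z ^ 3)^4" using mu0[of t] by (intro power_mono) auto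
          also have "(q z ^ 3)^4 = (e z)^3" by (simp add: q4[symmetric] power_mult[symmetric])
          also have "\<dots> \<le> (m t / 2)^3" using lt e0[of z] by (intro power_mono) auto
          finally have "81/625 * (mu t ^ 4)^3 \<le> (m t)^3 / 8"
            by (simp add: power_mult_distrib power_divide power_mult[symmetric])
          then show False using mp by (simp add: mu4)
        qed
        then have "1/5 * mu t ^ 3 \<le> c - q z ^ 3" using True by simp
        then have "(1/5 * mu t ^ 3)\<^sup>2 \<le> (c - q z ^ 3)\<^sup>2" using mu0[of t] by (intro power_mono) auto
        then show ?thesis using lt by (simp add: power2_commute power_divide power_mult[symmetric])
      qed auto
    qed
    finally show ?thesis by (simp add: P_def)
  next
    case c2: False
    have "c\<^sup>2 \<le> (4/5 * mu t ^ 3)\<^sup>2" using c c2 by (intro power_mono) auto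
    then have "mu t ^ 6 * (9/25) \<le> V t"
      using mean_q6[of t] by (simp add: V_def c_def power_mult_distrib power_divide power_mult[symmetric])
    moreover have "mu t ^ 6 * P \<le> mu t ^ 6 * 1" using P mu0[of t] by (intro mult_left_mono) auto
    moreover have "0 \<le> mu t ^ 6" using mu0[of t] by simp
    ultimately show ?thesis unfolding P_def[symmetric] by linarith
  qed
qed

text \<open>A point with e > 3/2 m has q^3 \<ge> 4/3 mu^3, because (3/2)^3 > (4/3)^4, while the mean
  of q^3 is at most mu^3; so it deviates by at least q^3/4.\<close>

lemma detect_high: "0 < m t \<Longrightarrow> (mu t)\<^sup>2 * srwn t (\<lambda>z. if e z > 3/2 * m t then e z else 0) 0 \<le> 16 * V t"
proof -
  assume mp: "0 < m t"
  define c where "c = srwn t (\<lambda>z. q z ^ 3) 0"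
  have c: "c \<le> mu t ^ 3" unfolding c_def by (rule mean_q3[OF mp])
  have "(mu t)\<^sup>2 / 16 * srwn t (\<lambda>z. if e z > 3/2 * m t then e z else 0) 0 =
      srwn t (\<lambda>z. (mu t)\<^sup>2 / 16 * (if e z > 3/2 * m t then e z else 0)) 0"
    by (simp only: srwn_cmult)
  also have "\<dots> \<le> V t" unfolding V_alt c_def[symmetric]
  proof (rule srwn_mono)
    fix z
    show "(mu t)\<^sup>2 / 16 * (if e z > 3/2 * m t then e z else 0) \<le> (q z ^ 3 - c)\<^sup>2"
    proof (cases "e z > 3/2 * m t")
      case gt: True
      have "4/3 * mu t ^ 3 \<le> q z ^ 3"
      proof (rule ccontr)
        assume "\<not> ?thesis"
        then have "(q z ^ 3)^4 \<le> (4/3 * mu t ^ 3)^4" by (intro power_mono) auto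
        also have "\<dots> = 256/81 * (m t)^3" by (simp add: mu4[symmetric] power_mult_distrib power_divide power_mult[symmetric])
        finally have "(e z)^3 \<le> 256/81 * (m t)^3" by (simp add: q4[symmetric] power_mult[symmetric])
        moreover have "(3/2 * m t)^3 \<le> (e z)^3" using gt mp by (intro power_mono) auto
        moreover have "(3/2 * m t)^3 = 27/8 * (m t)^3" by (simp add: power_mult_distrib power_divide)
        moreover have "0 < (m t)^3" using mp by simp
        ultimately show False by linarith
      qed
      then have "q z ^ 3 / 4 \<le> q z ^ 3 - c" using c by simp
      then have "(q z ^ 3 / 4)\<^sup>2 \<le> (q z ^ 3 - c)\<^sup>2" by (intro power_mono) auto
      moreover have "(mu t)\<^sup>2 * e z \<le> (q z ^ 3)\<^sup>2"
      proof -
        have "mu t \<le> q z" unfolding mu_def q_def using gt mp by simp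
        then have "(mu t)\<^sup>2 * q z ^ 4 \<le> (q z)\<^sup>2 * q z ^ 4"
          using mu0[of t] by (intro mult_right_mono power_mono) auto
        then show ?thesis by (simp add: q4 power_mult[symmetric] power_add[symmetric] flip: q4)
      qed
      ultimately show ?thesis using gt by (simp add: power_divide)
    qed auto
  qed
  finally show ?thesis by simp
qed

text \<open>A window of times of order r^2 has weight of order 1 under 1/t, so this is a sum over
  scales: those at which e often drops below half of its mean are few when counted with weight
  m.\<close>

lemma bad_low: "(\<Sum>t=1..<n. 1 / real t * m t * srwn t (\<lambda>z. if e z < m t / 2 then 1 else 0) 0) \<le> 200"
proof -
  have "(\<Sum>t=1..<n. 1 / real t * m t * srwn t (\<lambda>z. if e z < m t / 2 then 1 else 0) 0)
    \<le> (\<Sum>t=1..<n. 25 * (1 / real t * (1 / sqrt (m t)) * V t))"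
  proof (rule sum_mono)
    fix t
    show "1 / real t * m t * srwn t (\<lambda>z. if e z < m t / 2 then 1 else 0) 0 \<le> 25 * (1 / real t * (1 / sqrt (m t)) * V t)"
    proof (cases "m t = 0")
      case False
      then have mp: "0 < m t" using m0[of t] by linarith
      have "mu t ^ 6 = m t * sqrt (m t)" 
      proof -
        have "mu t ^ 6 = mu t ^ 4 * mu t ^ 2" by (simp flip: power_add)
        then show ?thesis by (simp only: mu4 mu2)
      qed
      then have "m t * srwn t (\<lambda>z. if e z < m t / 2 then 1 else 0) 0 \<le> 25 * (1 / sqrt (m t)) * V t"
        using detect_low[of t] mp by (simp add: field_simps)
      then have "1 / real t * (m t * srwn t (\<lambda>z. if e z < m t / 2 then 1 else 0) 0) \<le> 1 / real t * (25 * (1 / sqrt (m t)) * V t)"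
        by (intro mult_left_mono) auto
      then show ?thesis by (simp add: algebra_simps)
    qed simp
  qed
  also have "\<dots> = 25 * (\<Sum>t=1..<n. 1 / real t * (1 / sqrt (m t)) * V t)" by (simp add: sum_distrib_left)
  also have "\<dots> \<le> 25 * 8" using V_sum[of n] by simp
  finally show ?thesis by simp
qed

text \<open>The counterpart for large values. The excess of e itself is summed, so no factor m is
  needed.\<close>

lemma bad_high: "(\<Sum>t=1..<n. 1 / real t * srwn t (\<lambda>z. if e z > 3/2 * m t then e z else 0) 0) \<le> 128"
proof -
  have "(\<Sum>t=1..<n. 1 / real t * srwn t (\<lambda>z. if e z > 3/2 * m t then e z else 0) 0)
    \<le> (\<Sum>t=1..<n. 16 * (1 / real t * (1 / sqrt (m t)) * V t))"
  proof (rule sum_mono)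
    fix t
    show "1 / real t * srwn t (\<lambda>z. if e z > 3/2 * m t then e z else 0) 0 \<le> 16 * (1 / real t * (1 / sqrt (m t)) * V t)"
    proof (cases "m t = 0")
      case True
      have "srwn t (\<lambda>z. if e z > 3/2 * m t then e z else 0) 0 \<le> srwn t e 0"
        using e0 by (intro srwn_mono) auto
      then have "srwn t (\<lambda>z. if e z > 3/2 * m t then e z else 0) 0 \<le> 0" using True by (simp add: m_def)
      then show ?thesis using True by (simp add: divide_nonpos_nonneg)
    next
      case False
      then have mp: "0 < m t" using m0[of t] by linarith
      then have "srwn t (\<lambda>z. if e z > 3/2 * m t then e z else 0) 0 \<le> 16 * (1 / sqrt (m t)) * V t"
        using detect_high[OF mp] by (simp add: field_simps mu2)
      then have "1 / real t * (srwn t (\<lambda>z. if e z > 3/2 * m t then e z else 0) 0) \<le> 1 / real t * (16 * (1 / sqrt (m t)) * V t)"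
        by (intro mult_left_mono) auto
      then show ?thesis by (simp add: algebra_simps)
    qed
  qed
  also have "\<dots> = 16 * (\<Sum>t=1..<n. 1 / real t * (1 / sqrt (m t)) * V t)" by (simp add: sum_distrib_left)
  also have "\<dots> \<le> 16 * 8" using V_sum[of n] by simp
  finally show ?thesis by simp
qed

end

section \<open>Killed walk and hitting function\<close>

text \<open>The parameters p, e and \<phi> are the hitting probability of a normal branch, the avoidance probability
  of the past, and the avoidance probability of the branches on one side of a spine vertex.\<close>

locale brw =
  fixes K :: "(int^'d::finite) set" and p \<phi> e :: "int^'d \<Rightarrow> real" and c1 C1 f0 :: real
  assumes d5: "CARD('d) \<ge> 5" and finK: "finite K"
    and c1: "0 < c1" "c1 \<le> 1/2" and C1: "0 < C1" and f0: "0 < f0"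
    and phi0: "0 \<le> \<phi> z" and phi1: "\<phi> z \<le> 1"
    and phi_f0: "z \<notin> K \<Longrightarrow> f0 \<le> \<phi> z"
    and phi_lower: "z \<notin> K \<Longrightarrow> c1 * srw p z \<le> 1 - \<phi> z"
    and phi_upper: "z \<notin> K \<Longrightarrow> 1 - \<phi> z \<le> C1 * srw p z"
    and p0: "0 \<le> p z" and p1: "p z \<le> 1"
    and pK: "z \<in> K \<Longrightarrow> p z = 1" and p_eq: "z \<notin> K \<Longrightarrow> p z = \<phi> z * srw p z"
    and e0: "0 \<le> e z" and e1: "e z \<le> 1"
    and e_eq: "e z = srw (\<lambda>w. (if w \<in> K then 0 else \<phi> w) * e w) z"
begin

definition B where "B z = (if z \<in> K then 0 else \<phi> z)"
definition A where "A f z = B z * srw f z"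

lemma B0: "0 \<le> B z" and B1: "B z \<le> 1" by (simp_all add: B_def phi0 phi1)

lemma e_eq': "e z = srw (\<lambda>w. B w * e w) z" using e_eq[of z] by (simp add: B_def)

lemma Be_le: "B z * e z \<le> e z" using mult_right_mono[OF B1[of z] e0[of z]] by simp

sublocale subharmonic01 e
proof
  fix z
  show "e z \<le> srw e z"
    by (subst e_eq') (intro srw_mono Be_le)
qed (auto simp: e0 e1)

lemma A_nonneg: "(\<And>z. 0 \<le> f z) \<Longrightarrow> 0 \<le> A f z"
  by (simp add: A_def B0 srw_nonneg)

lemma A_mono: "(\<And>z. f z \<le> g z) \<Longrightarrow> A f z \<le> A g z"
  by (simp add: A_def mult_left_mono B0 srw_mono)

lemma A_add: "A (\<lambda>z. f z + g z) z = A f z + A g z" by (simp add: A_def srw_add algebra_simps)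
lemma A_cmult: "A (\<lambda>z. c * f z) z = c * A f z" by (simp add: A_def srw_cmult)
lemma A_sum: "A (\<lambda>z. \<Sum>i\<in>I. f i z) z = (\<Sum>i\<in>I. A (f i) z)" by (simp add: A_def srw_sum sum_distrib_left)
lemma A_le_srw: "(\<And>z. 0 \<le> f z) \<Longrightarrow> A f z \<le> srw f z"
  using mult_right_mono[OF B1[of z], of "srw f z"] by (simp add: A_def srw_nonneg)

lemma An_nonneg: "(\<And>z. 0 \<le> f z) \<Longrightarrow> 0 \<le> (A ^^ n) f z"
  by (induction n arbitrary: z) (auto intro: A_nonneg)

lemma An_mono: "(\<And>z. f z \<le> g z) \<Longrightarrow> (A ^^ n) f z \<le> (A ^^ n) g z"
  by (induction n arbitrary: z) (auto intro: A_mono)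

lemma An_add: "(A ^^ n) (\<lambda>z. f z + g z) z = (A ^^ n) f z + (A ^^ n) g z"
proof (induction n arbitrary: z)
  case (Suc n)
  have "(A ^^ n) (\<lambda>z. f z + g z) = (\<lambda>z. (A ^^ n) f z + (A ^^ n) g z)" using Suc by blast
  then show ?case by (simp add: A_add)
qed simp

lemma An_cmult: "(A ^^ n) (\<lambda>z. c * f z) z = c * (A ^^ n) f z"
proof (induction n arbitrary: z)
  case (Suc n)
  have "(A ^^ n) (\<lambda>z. c * f z) = (\<lambda>z. c * (A ^^ n) f z)" using Suc by blast
  then show ?case by (simp add: A_cmult)
qed simp

lemma An_zero: "(A ^^ n) (\<lambda>z. 0) z = 0" using An_cmult[of n 0 "\<lambda>_. 0" z] by simp

lemma An_sum: "(A ^^ n) (\<lambda>z. \<Sum>i\<in>I. f i z) z = (\<Sum>i\<in>I. (A ^^ n) (f i) z)"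
  by (induction I rule: infinite_finite_induct) (simp_all add: An_add An_zero)

text \<open>e is invariant for the adjoint of \<open>A\<close>, because e = P(Be) and P is
  self-adjoint. Both main bounds rest on this conservation of mass against e.\<close>

lemma tot_A: "(\<And>z. 0 \<le> g z) \<Longrightarrow> tot (\<lambda>z. A g z * e z) = tot (\<lambda>z. g z * e z)"
proof -
  assume g: "\<And>z. 0 \<le> g z"
  have "tot (\<lambda>z. A g z * e z) = tot (\<lambda>z. srw g z * (B z * e z))" by (simp add: A_def mult_ac)
  also have "\<dots> = tot (\<lambda>z. g z * srw (\<lambda>w. B w * e w) z)"
    by (intro tot_srw_swap g mult_nonneg_nonneg B0 e0)
  finally show ?thesis by (simp flip: e_eq')
qed

lemma tot_An: "(\<And>z. 0 \<le> g z) \<Longrightarrow> tot (\<lambda>z. (A ^^ n) g z * e z) = tot (\<lambda>z. g z * e z)"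
  by (induction n) (simp_all add: tot_A An_nonneg)

lemma p_decomp: "p z = indicat_real K z + A p z"
  by (simp add: A_def B_def pK p_eq indicator_def)

lemma An_p_le: "(A ^^ n) p z \<le> p z"
proof (induction n arbitrary: z)
  case (Suc n)
  have "(A ^^ Suc n) p z \<le> A p z" using Suc by (auto intro: A_mono)
  also have "\<dots> \<le> p z" using p_decomp[of z] by (simp add: indicator_def split: if_splits)
  finally show ?case .
qed simp

lemma p_partial: "p z = (\<Sum>s<n. (A ^^ s) (indicat_real K) z) + (A ^^ n) p z"
proof (induction n arbitrary: z)
  case (Suc n)
  have "(A ^^ n) p z = (A ^^ n) (\<lambda>z. indicat_real K z + A p z) z" by (simp flip: p_decomp)
  also have "\<dots> = (A ^^ n) (indicat_real K) z + (A ^^ Suc n) p z"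
    by (simp only: An_add funpow_Suc_right comp_apply)
  finally show ?case using Suc[of z] by simp
qed simp

lemma p_partial_le: "Y \<subseteq> K \<Longrightarrow> (\<Sum>s<n. (A ^^ s) (indicat_real Y) z) \<le> p z"
proof -
  assume Y: "Y \<subseteq> K"
  have "(\<Sum>s<n. (A ^^ s) (indicat_real Y) z) \<le> (\<Sum>s<n. (A ^^ s) (indicat_real K) z)"
    using Y by (intro sum_mono An_mono) (auto simp: indicator_def)
  then show ?thesis using p_partial[of z n] An_nonneg[of p n z, OF p0] by linarith
qed

lemma srw_p_le_1: "srw p z \<le> 1" by (intro srw_le p1)

text \<open>Off K the factor \<phi> costs 1 - \<phi> \<ge> c1 Pp \<ge> c1 PD, which is the quadratic
  loss. On K the function D vanishes, and the right side is nonnegative since c1 PD \<le> 1.\<close>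

lemma damped: "0 \<le> D z \<Longrightarrow> 0 \<le> srw D z \<Longrightarrow> srw D z \<le> srw p z \<Longrightarrow> D z \<le> B z * srw D z \<Longrightarrow> D z \<le> srw D z - c1 * (srw D z)\<^sup>2"
proof -
  assume D0: "0 \<le> D z" and D: "0 \<le> srw D z" "srw D z \<le> srw p z" "D z \<le> B z * srw D z"
  show ?thesis
  proof (cases "z \<in> K")
    case True
    have "c1 * (srw D z)\<^sup>2 \<le> 1 * srw D z"
      unfolding power2_eq_square mult.assoc[symmetric]
      using D c1 srw_p_le_1[of z] mult_mono[of c1 1 "srw D z" 1] by (intro mult_right_mono) auto
    then show ?thesis using D True by (simp add: B_def)
  next
    case False
    have "D z \<le> (1 - c1 * srw p z) * srw D z"
      using D(3) phi_lower[OF False] mult_right_mono[of "\<phi> z" "1 - c1 * srw p z" "srw D z"] D(1) False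
      by (simp add: B_def)
    also have "\<dots> \<le> (1 - c1 * srw D z) * srw D z"
      using D c1 by (intro mult_right_mono diff_left_mono mult_left_mono) auto
    finally show ?thesis by (simp add: power2_eq_square algebra_simps)
  qed
qed

text \<open>A Kolmogorov-type survival estimate: each step acts at most like x - c1 x^2, for which
  1/(c1 (n+1)) is a supersolution.\<close>

lemma An_p_decay: "(A ^^ n) p z \<le> 1 / c1 / (n + 1)"
proof (induction n arbitrary: z)
  case 0
  have "p z \<le> 1" by (rule p1)
  also have "1 \<le> 1 / c1" using c1 by simp
  finally show ?case by simp
next
  case (Suc n)
  define h where "h = srw ((A ^^ n) p) z"
  define a where "a = 1 / c1 / (n + 1)"
  have h0: "0 \<le> h" unfolding h_def by (intro srw_nonneg An_nonneg p0)
  have ha: "h \<le> a" unfolding h_def a_def by (intro srw_le Suc)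
  have hp: "h \<le> srw p z" unfolding h_def by (intro srw_mono An_p_le)
  have eq: "(A ^^ Suc n) p z = B z * h" by (simp add: A_def h_def)
  have le: "B z * h \<le> h - c1 * h\<^sup>2"
  proof (cases "z \<in> K")
    case True
    have "c1 * h\<^sup>2 \<le> 1 * h"
      unfolding power2_eq_square mult.assoc[symmetric]
      using h0 hp c1 srw_p_le_1[of z] mult_mono[of c1 1 h 1] by (intro mult_right_mono) auto
    then show ?thesis using True by (simp add: B_def)
  next
    case False
    have "B z * h \<le> (1 - c1 * srw p z) * h"
      using phi_lower[OF False] False h0 by (intro mult_right_mono) (auto simp: B_def)
    also have "\<dots> \<le> (1 - c1 * h) * h"
      using hp h0 c1 by (intro mult_right_mono diff_left_mono mult_left_mono) auto
    finally show ?thesis by (simp add: power2_eq_square algebra_simps)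
  qed
  show ?case
  \<comment> \<open>x - c1 x^2 increases only up to 1/(2 c1), and the bound for \<open>n = 0\<close>
    lies beyond; there the maximum 1/(4 c1) of the parabola is used.\<close>
  proof (cases "n = 0")
    case True
    have "0 \<le> (2 * c1 * h - 1)\<^sup>2" by simp
    then have "4 * c1 * (h - c1 * h\<^sup>2) \<le> 1" by (simp add: power2_eq_square algebra_simps)
    then have "h - c1 * h\<^sup>2 \<le> 1 / (4 * c1)" using c1 by (simp add: field_simps)
    also have "\<dots> \<le> 1 / c1 / (Suc n + 1)" using c1 True by (simp add: field_simps)
    finally show ?thesis using le eq by simp
  next
    case False
    have ca: "c1 * a = 1 / (n + 1)" using c1 by (simp add: a_def)
    have "0 \<le> (a - h) * (1 - c1 * (a + h))"
    proof (intro mult_nonneg_nonneg)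
      have "c1 * (a + h) \<le> c1 * (a + a)" using ha c1 by (intro mult_left_mono) auto
      also have "\<dots> = 2 / (n + 1)" using ca by (simp add: algebra_simps)
      also have "\<dots> \<le> 1" using False by simp
      finally show "0 \<le> 1 - c1 * (a + h)" by simp
    qed (use ha in simp)
    then have "h - c1 * h\<^sup>2 \<le> a - c1 * a\<^sup>2" by (simp add: power2_eq_square algebra_simps)
    also have "\<dots> = a * (1 - 1 / (n + 1))" using ca by (simp add: power2_eq_square algebra_simps)
    also have "\<dots> \<le> 1 / c1 / (Suc n + 1)"
    proof -
      have "1 / (real n + 1) * (1 - 1 / (real n + 1)) = real n / (real n + 1)\<^sup>2"
        by (simp add: field_simps power2_eq_square)
      also have "\<dots> \<le> 1 / (real n + 2)"
      proof -
        have "real n * (real n + 2) \<le> (real n + 1)\<^sup>2" by (simp add: power2_eq_square algebra_simps)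
        then show ?thesis by (simp add: pos_divide_le_eq pos_le_divide_eq)
      qed
      finally have "1 / (real n + 1) * (1 - 1 / (real n + 1)) \<le> 1 / (real n + 2)" .
      then have "1 / c1 * (1 / (real n + 1) * (1 - 1 / (real n + 1))) \<le> 1 / c1 * (1 / (real n + 2))"
        using c1 by (intro mult_left_mono) auto
      moreover have "a * (1 - 1 / (n + 1)) = 1 / c1 * (1 / (real n + 1) * (1 - 1 / (real n + 1)))"
        by (simp add: a_def add.commute)
      moreover have "1 / c1 / (Suc n + 1) = 1 / c1 * (1 / (real n + 2))" by (simp add: add.commute)
      ultimately show ?thesis by (simp only:)
    qed
    finally show ?thesis using le eq by simp
  qed
qed

lemma inv_square_bound:
  fixes a h :: real
  assumes a: "0 < a" and h: "\<bar>h\<bar> \<le> a / 2"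
  shows "1 / (a - h)\<^sup>2 \<le> 1 / a\<^sup>2 + 2 * h / a^3 + 12 * h\<^sup>2 / a^4"
proof -
  define y where "y = h / a"
  have hy: "h = a * y" using a by (simp add: y_def)
  have y: "\<bar>y\<bar> \<le> 1/2" using h a by (simp add: y_def field_simps abs_mult)
  have "(1 - y)\<^sup>2 * (1 + 2 * y + 12 * y\<^sup>2) = 1 + y\<^sup>2 * (9 - 22 * y + 12 * y\<^sup>2)"
    by (simp add: power2_eq_square algebra_simps)
  moreover have "0 \<le> y\<^sup>2 * (9 - 22 * y + 12 * y\<^sup>2)"
  proof (intro mult_nonneg_nonneg)
    have "9 - 22 * y + 12 * y\<^sup>2 = 12 * (y - 1/2)\<^sup>2 + (6 - 10 * y)" by (simp add: power2_eq_square algebra_simps)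
    moreover have "0 \<le> 12 * (y - 1/2)\<^sup>2" "0 \<le> 6 - 10 * y" using y by (auto simp: abs_le_iff)
    ultimately show "0 \<le> 9 - 22 * y + 12 * y\<^sup>2" by (simp only: add_nonneg_nonneg)
  qed simp
  ultimately have "1 \<le> (1 - y)\<^sup>2 * (1 + 2 * y + 12 * y\<^sup>2)" by linarith
  then have "1 / (1 - y)\<^sup>2 \<le> 1 + 2 * y + 12 * y\<^sup>2" using y by (simp add: divide_le_eq mult.commute)
  then have "1 / a\<^sup>2 * (1 / (1 - y)\<^sup>2) \<le> 1 / a\<^sup>2 * (1 + 2 * y + 12 * y\<^sup>2)" by (intro mult_left_mono) auto
  moreover have "1 / a\<^sup>2 * (1 / (1 - y)\<^sup>2) = 1 / (a - h)\<^sup>2"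
    unfolding hy by (simp add: power_mult_distrib[symmetric] algebra_simps)
  moreover have "1 / a\<^sup>2 * (1 + 2 * y + 12 * y\<^sup>2) = 1 / a\<^sup>2 + 2 * h / a^3 + 12 * h\<^sup>2 / a^4"
    unfolding hy using a by (simp add: field_simps eval_nat_numeral)
  ultimately show ?thesis by simp
qed

text \<open>In \<open>displacement\<close>, 36 lifts the barrier above 1 near the sphere, and 62/c1
  pays for the growth of the barrier under averaging.\<close>

definition Cd where "Cd = 36 + 62 / c1"

lemma Cd: "0 < Cd" using c1 by (simp add: Cd_def add_pos_pos)

text \<open>Comparison with a barrier that blows up on the sphere of radius R, as for the equation
  \<Delta>u = u^2. The barrier has Pv \<le> v + c1 v^2, and \<open>damped\<close> gives D \<le> PD -
  c1 (PD)^2; at a positive maximum of D - v these contradict each other. At the boundary nothing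
  beyond D \<le> 1 is needed, because v \<ge> 1 there.\<close>

lemma displacement:
  assumes R: "1 \<le> R" and D0: "\<And>z. 0 \<le> D z" and Dp: "\<And>z. D z \<le> p z"
    and D: "\<And>z. sq (z - z0) < R\<^sup>2 \<Longrightarrow> D z \<le> B z * srw D z"
  shows "D z0 \<le> Cd / R\<^sup>2"
proof (cases "R < 6")
  case True
  have "R\<^sup>2 \<le> 6\<^sup>2" using True R by (intro power_mono) auto
  also have "\<dots> \<le> Cd" using c1 by (simp add: Cd_def)
  finally have "1 \<le> Cd / R\<^sup>2" using R by simp
  then show ?thesis using Dp[of z0] p1[of z0] by linarith
next
  case False
  then have R6: "6 \<le> R" by simp
  define a where "a z = R\<^sup>2 - sq (z - z0)" for z
  define v where "v z = Cd * R\<^sup>2 / (a z)\<^sup>2" for z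
  \<comment> \<open>From this set a step stays inside the ball, where \<open>a\<close> > 0; a point
    of the ball outside this set has v \<ge> 1.\<close>
  define \<Omega> where "\<Omega> = {z. 6 * R \<le> a z}"
  have fin: "finite \<Omega>"
  proof -
    have "\<Omega> \<subseteq> (\<lambda>w. w + z0) ` {w. sq w \<le> R\<^sup>2}"
    proof
      fix z assume "z \<in> \<Omega>"
      then have "sq (z - z0) \<le> R\<^sup>2" using R6 by (simp add: \<Omega>_def a_def)
      then show "z \<in> (\<lambda>w. w + z0) ` {w. sq w \<le> R\<^sup>2}" by (intro image_eqI[of _ _ "z - z0"]) auto
    qed
    then show ?thesis using finite_sq_le[of "R\<^sup>2"] finite_subset by blast
  qed
  have z0: "z0 \<in> \<Omega>" using R6 by (simp add: \<Omega>_def a_def power2_eq_square)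
  have v_big: "1 \<le> v z" if "0 < a z" "z \<notin> \<Omega>" for z
  proof -
    have "(a z)\<^sup>2 \<le> (6 * R)\<^sup>2" using that by (intro power_mono) (auto simp: \<Omega>_def)
    also have "\<dots> = 36 * R\<^sup>2" by (simp add: power_mult_distrib)
    also have "\<dots> \<le> Cd * R\<^sup>2" using c1 by (intro mult_right_mono) (auto simp: Cd_def)
    finally show ?thesis using that by (simp add: v_def)
  qed
  have vle: "srw v z \<le> v z + c1 * (v z)\<^sup>2" and vnb: "\<And>w. w \<in> nbrs \<Longrightarrow> 0 < a (z + w)" if z: "z \<in> \<Omega>" for z
  proof -
    define x where "x = z - z0"
    have az: "6 * R \<le> a z" using z by (simp add: \<Omega>_def)
    have a0: "0 < a z" using az R6 by linarith
    have sqx: "sq x \<le> R\<^sup>2" using az R6 by (simp add: a_def x_def)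
    have "sqrt (sq x) \<le> R" using sqx R6 by (simp add: real_le_lsqrt)
    have h: "\<bar>dsq x (x + w)\<bar> \<le> a z / 2" if "w \<in> nbrs" for w
      using abs_dsq_le[OF that, of x] \<open>sqrt (sq x) \<le> R\<close> az R6 by linarith
    have anb: "a (z + w) = a z - dsq x (x + w)" for w
      by (simp add: a_def dsq_def x_def algebra_simps)
    show "0 < a (z + w)" if "w \<in> nbrs" for w using h[OF that] anb[of w] a0 by linarith
    have "srw v z = srw (\<lambda>y. v (y + z0)) x"
      unfolding x_def by (subst srw_shift) simp
    also have "\<dots> \<le> srw (\<lambda>y. Cd * R\<^sup>2 * ((1 / (a z)\<^sup>2 + 2 / (a z)^3 * dsq x y) + 12 / (a z)^4 * (dsq x y)\<^sup>2)) x"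
    proof (rule srw_mono)
      fix w :: "int^'d" assume w: "w \<in> nbrs"
      have "x + w + z0 = z + w" by (simp add: x_def)
      then have "v (x + w + z0) = Cd * R\<^sup>2 * (1 / (a z - dsq x (x + w))\<^sup>2)"
        by (simp only: v_def anb) simp
      also have "\<dots> \<le> Cd * R\<^sup>2 * (1 / (a z)\<^sup>2 + 2 * dsq x (x + w) / (a z)^3 + 12 * (dsq x (x + w))\<^sup>2 / (a z)^4)"
        using Cd by (intro mult_left_mono inv_square_bound a0 h w) auto
      finally show "v (x + w + z0) \<le> Cd * R\<^sup>2 * ((1 / (a z)\<^sup>2 + 2 / (a z)^3 * dsq x (x+w)) + 12 / (a z)^4 * (dsq x (x+w))\<^sup>2)"
        by simp
    qed
    also have "\<dots> = Cd * R\<^sup>2 * ((1 / (a z)\<^sup>2 + 2 / (a z)^3) + 12 / (a z)^4 * (1 + 4 * sq x / CARD('d)))"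
      by (simp only: srw_cmult srw_add srw_const srw_dsq srw_dsq2 mult_1_right)
    also have "\<dots> \<le> Cd * R\<^sup>2 * (1 / (a z)\<^sup>2 + 2 * R\<^sup>2 / (a z)^4 + 12 / (a z)^4 * (5 * R\<^sup>2))"
    proof (intro mult_left_mono add_mono order_refl)
      have "a z \<le> R\<^sup>2" by (simp add: a_def)
      then have "2 * a z / (a z)^4 \<le> 2 * R\<^sup>2 / (a z)^4" by (intro divide_right_mono) auto
      then show "2 / (a z)^3 \<le> 2 * R\<^sup>2 / (a z)^4" using a0 by (simp add: eval_nat_numeral)
      have "4 * sq x / CARD('d) \<le> 4 * sq x / 1" by (intro divide_left_mono) (simp_all add: Suc_leI)
      moreover have "1 \<le> R\<^sup>2" using R by simp
      ultimately show "1 + 4 * sq x / CARD('d) \<le> 5 * R\<^sup>2" using sqx by simp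
    qed (use Cd in auto)
    also have "\<dots> = v z + 62 * (Cd * (R\<^sup>2)\<^sup>2 / (a z)^4)"
      by (simp add: v_def field_simps power2_eq_square)
    also have "62 * (Cd * (R\<^sup>2)\<^sup>2 / (a z)^4) \<le> (c1 * Cd) * (Cd * (R\<^sup>2)\<^sup>2 / (a z)^4)"
      using c1 Cd by (intro mult_right_mono) (auto simp: Cd_def distrib_left)
    also have "\<dots> = c1 * (v z)\<^sup>2"
      by (simp add: v_def power2_eq_square eval_nat_numeral algebra_simps)
    finally show "srw v z \<le> v z + c1 * (v z)\<^sup>2" by simp
  qed
  have "D z \<le> v z" if "z \<in> \<Omega>" for z
  proof (rule ccontr)
    assume "\<not> D z \<le> v z"
    define M where "M = Max ((\<lambda>z. D z - v z) ` \<Omega>)"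
    have Mz: "D z - v z \<le> M" unfolding M_def using fin that by (intro Max_ge) auto
    then have M: "0 < M" using \<open>\<not> D z \<le> v z\<close> by simp
    have "M \<in> (\<lambda>z. D z - v z) ` \<Omega>" unfolding M_def using fin that by (intro Max_in) auto
    then obtain y where y: "y \<in> \<Omega>" "M = D y - v y" by auto
    have "srw D y \<le> srw (\<lambda>z. v z + M) y"
    proof (rule srw_mono)
      fix w :: "int^'d" assume w: "w \<in> nbrs"
      show "D (y + w) \<le> v (y + w) + M"
      proof (cases "y + w \<in> \<Omega>")
        case True
        then have "D (y + w) - v (y + w) \<le> M" unfolding M_def using fin by (intro Max_ge) auto
        then show ?thesis by simp
      next
        case False
        then have "1 \<le> v (y + w)" using vnb[OF y(1) w] by (intro v_big)
        then show ?thesis using Dp[of "y + w"] p1[of "y + w"] M by linarith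
      qed
    qed
    also have "\<dots> = srw v y + M" by (simp add: srw_add)
    finally have PD: "srw D y \<le> v y + c1 * (v y)\<^sup>2 + M" using vle[OF y(1)] by linarith
    have "sq (y - z0) < R\<^sup>2" using y(1) R6 by (simp add: \<Omega>_def a_def)
    then have Dy: "D y \<le> srw D y - c1 * (srw D y)\<^sup>2"
      by (intro damped D D0 srw_nonneg srw_mono Dp)
    then have "D y \<le> srw D y" using c1 by (smt (verit) mult_nonneg_nonneg zero_le_power2)
    then have "(D y)\<^sup>2 \<le> (srw D y)\<^sup>2" using D0 by (intro power_mono)
    then have "c1 * (D y)\<^sup>2 \<le> c1 * (srw D y)\<^sup>2" using c1 by (intro mult_left_mono) auto
    then have "c1 * (D y)\<^sup>2 \<le> c1 * (v y)\<^sup>2" using Dy PD y(2) by linarith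
    then have "(D y)\<^sup>2 \<le> (v y)\<^sup>2" using c1 by simp
    moreover have "0 \<le> v y" using Cd by (simp add: v_def)
    ultimately have "D y \<le> v y" using power2_le_imp_le by blast
    then show False using y M by simp
  qed
  from this[OF z0] have "D z0 \<le> v z0" .
  also have "v z0 = Cd / R\<^sup>2" using R by (simp add: v_def a_def power2_eq_square)
  finally show ?thesis .
qed

text \<open>Measures how far e is from harmonic: e = P(Be) turns Pe - e into P\<sigma>.\<close>

definition \<sigma> where "\<sigma> z = e z - B z * e z"

lemma sigma_nonneg: "0 \<le> \<sigma> z" using Be_le[of z] by (simp add: \<sigma>_def)

lemma sigma_lower: "c1 * (p z * e z) \<le> \<sigma> z"
proof (cases "z \<in> K")
  case True
  then show ?thesis using mult_right_mono[of c1 1 "e z"] c1 e0[of z] by (simp add: \<sigma>_def B_def pK)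
next
  case False
  have "p z \<le> srw p z"
    using p_eq[OF False] mult_right_mono[OF phi1[of z], of "srw p z"] by (simp add: srw_nonneg p0)
  then have "c1 * p z \<le> 1 - \<phi> z" using phi_lower[OF False] c1 by (smt (verit) mult_left_mono)
  from mult_right_mono[OF this e0[of z]] show ?thesis using False by (simp add: \<sigma>_def B_def algebra_simps)
qed

text \<open>The lower bound \<open>f0\<close> for \<phi> converts Pp back into p off K.\<close>

lemma sigma_upper: "\<sigma> z \<le> (1 + C1 / f0) * (p z * e z)"
proof (cases "z \<in> K")
  case True
  then show ?thesis using C1 f0 e0[of z] by (simp add: \<sigma>_def B_def pK distrib_right)
next
  case False
  have "f0 * srw p z \<le> p z"
    using p_eq[OF False] mult_right_mono[OF phi_f0[OF False], of "srw p z"] by (simp add: srw_nonneg p0)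
  then have "srw p z \<le> p z / f0" using f0 by (simp add: field_simps)
  then have "1 - \<phi> z \<le> C1 * (p z / f0)" using phi_upper[OF False] C1 by (smt (verit) mult_left_mono)
  then have "(1 - \<phi> z) * e z \<le> C1 * (p z / f0) * e z" using e0 by (intro mult_right_mono)
  moreover have "0 \<le> p z * e z" by (simp add: p0 e0)
  ultimately show ?thesis using False by (simp add: \<sigma>_def B_def algebra_simps)
qed

lemma srw_e_diff: "srw e z - e z = srw \<sigma> z"
  using e_eq'[of z] by (simp add: \<sigma>_def[abs_def] srw_diff)

lemma sigma_sum: "(\<Sum>t<n. srwn (Suc t) \<sigma> x) = srwn n e x - e x"
proof (induction n)
  case (Suc n)
  have "srwn (Suc n) \<sigma> x = srwn n (\<lambda>z. srw e z - e z) x"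
    by (simp only: srwn_Suc2 srw_e_diff)
  also have "\<dots> = srwn (Suc n) e x - srwn n e x" by (simp only: srwn_diff srwn_Suc2)
  finally show ?case using Suc by simp
qed simp

text \<open>The sum of P^t \<sigma> at the origin telescopes and stays below 2 because e \<le>
  1.\<close>

lemma pe_sum: "(\<Sum>t<n. srwn t (\<lambda>z. p z * e z) 0) \<le> 2 / c1"
proof -
  have "(\<Sum>t<n. srwn t (\<lambda>z. p z * e z) 0) \<le> (\<Sum>t<Suc n. srwn t (\<lambda>z. p z * e z) 0)"
    by (intro sum_mono2) (auto intro!: srwn_nonneg mult_nonneg_nonneg p0 e0)
  also have "\<dots> \<le> (\<Sum>t<Suc n. 1 / c1 * srwn t \<sigma> 0)"
  proof (rule sum_mono)
    fix t
    have "srwn t (\<lambda>z. p z * e z) 0 \<le> srwn t (\<lambda>z. 1 / c1 * \<sigma> z) 0"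
      using sigma_lower c1 by (intro srwn_mono) (simp add: field_simps)
    then show "srwn t (\<lambda>z. p z * e z) 0 \<le> 1 / c1 * srwn t \<sigma> 0" by (simp only: srwn_cmult)
  qed
  also have "\<dots> = 1 / c1 * (\<sigma> 0 + (\<Sum>t<n. srwn (Suc t) \<sigma> 0))"
    by (simp only: sum_distrib_left[symmetric] sum.lessThan_Suc_shift) simp
  also have "\<dots> = 1 / c1 * (\<sigma> 0 + (srwn n e 0 - e 0))" by (simp only: sigma_sum)
  also have "\<dots> \<le> 1 / c1 * 2"
  proof (intro mult_left_mono)
    have "0 \<le> B 0 * e 0" by (simp add: B0 e0)
    then show "\<sigma> 0 + (srwn n e 0 - e 0) \<le> 2" using srwn_le[of e 1 n 0] e1 by (simp add: \<sigma>_def)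
  qed (use c1 in auto)
  finally show ?thesis by simp
qed

end

text \<open>The kernel estimates enter as assumptions with named constants, so that constants built
  from them depend on these parameters and not on K.\<close>

locale brw_kern = brw K p \<phi> e c1 C1 f0
  for K :: "(int^'d::finite) set" and p \<phi> e c1 C1 f0 +
  fixes b Cg cg cb :: real and Bk :: nat
  assumes b_eq: "b = (real CARD('d) - 2) / 2" and Cg: "0 < Cg" and cg: "0 < cg" and cb: "0 < cb" and Bk: "1 < Bk"
    and g_upper: "(\<Sum>t<n. srwn t (indicat_real {0}) z) \<le> Cg * bar 1 b (z :: int^'d)"
    and g_lower: "\<exists>N. cg * bar 1 b (z :: int^'d) \<le> (\<Sum>t<N. srwn t (indicat_real {0}) z)"
    and g_block: "0 < n \<Longrightarrow> sq (z :: int^'d) \<le> 16 * real n \<Longrightarrow> cb * real n powr (-b) \<le> (\<Sum>t=n..<Bk*n. srwn t (indicat_real {0}) z)"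
begin

lemma b_ge: "3/2 \<le> b" using d5 by (simp add: b_eq)

text \<open>Time window of scale i, during which the points with |z|^2 \<le> 16 * 4^i are visited
  often enough. \<open>mm i\<close> takes the mean of e at the end of the window, where it is
  largest. Windows of neighbouring scales may overlap.\<close>

definition blk where "blk i = {4^i ..< Bk * (4::nat)^i}"
definition M :: "nat \<Rightarrow> (int^'d \<Rightarrow> real) \<Rightarrow> real" where "M i g = (\<Sum>t\<in>blk i. srwn t g 0)"
definition mm where "mm i = m (Bk * 4^i)"
definition r2 where "r2 i = (4::real)^i"

lemma r2_pos [simp]: "0 < r2 i" by (simp add: r2_def)
lemma r2_ge1: "1 \<le> r2 i" by (simp add: r2_def)
lemma r2_add: "r2 (i + j) = r2 i * r2 j" by (simp add: r2_def power_add)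

lemma mm0: "0 \<le> mm i" by (simp add: mm_def)

lemma M_nonneg: "(\<And>z. 0 \<le> f z) \<Longrightarrow> 0 \<le> M i f"
  unfolding M_def by (intro sum_nonneg srwn_nonneg)

lemma srwn_sum_kernel:
  assumes "\<And>z. 0 \<le> g z" "finite T"
  shows "ennreal (\<Sum>t\<in>T. srwn t g 0) = tot (\<lambda>z. (\<Sum>t\<in>T. srwn t (indicat_real {0}) z) * g z)"
proof -
  have "ennreal (\<Sum>t\<in>T. srwn t g 0) = (\<Sum>t\<in>T. ennreal (srwn t g 0))"
    using assms by (intro sum_ennreal[symmetric] srwn_nonneg) auto
  also have "\<dots> = (\<Sum>t\<in>T. tot (\<lambda>z. srwn t (indicat_real {0}) z * g z))"
    using assms by (intro sum.cong refl srwn_kernel)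
  also have "\<dots> = tot (\<lambda>z. \<Sum>t\<in>T. srwn t (indicat_real {0}) z * g z)"
    using assms by (intro tot_sum[symmetric] mult_nonneg_nonneg srwn_nonneg) auto
  finally show ?thesis by (simp add: sum_distrib_right)
qed

text \<open>Converts a sum over a ball into a sum along the walk started at 0, so that the estimates
  of P^t at the origin apply to it.\<close>

lemma ball_le_M:
  assumes "\<And>z. 0 \<le> g z"
  shows "tot (\<lambda>z. if sq z \<le> 16 * r2 i then r2 i powr (-b) * g z else 0) \<le> ennreal (1 / cb * M i g)"
proof -
  have "tot (\<lambda>z. if sq z \<le> 16 * r2 i then r2 i powr (-b) * g z else 0) \<le>
      tot (\<lambda>z. 1 / cb * ((\<Sum>t\<in>blk i. srwn t (indicat_real {0}) z) * g z))"
  proof (rule tot_mono)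
    fix z :: "int^'d"
    have nn: "0 \<le> (\<Sum>t\<in>blk i. srwn t (indicat_real {0}) z)" by (intro sum_nonneg srwn_nonneg) auto
    show "(if sq z \<le> 16 * r2 i then r2 i powr (-b) * g z else 0) \<le> 1 / cb * ((\<Sum>t\<in>blk i. srwn t (indicat_real {0}) z) * g z)"
    proof (cases "sq z \<le> 16 * r2 i")
      case True
      then have "cb * r2 i powr (-b) \<le> (\<Sum>t\<in>blk i. srwn t (indicat_real {0}) z)"
        using g_block[of "4^i" z] by (simp add: r2_def blk_def)
      then have "cb * r2 i powr (-b) * g z \<le> (\<Sum>t\<in>blk i. srwn t (indicat_real {0}) z) * g z"
        using assms by (intro mult_right_mono)
      then show ?thesis using True cb by (simp add: field_simps)
    next
      case False
      then show ?thesis using nn assms[of z] cb by simp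
    qed
  qed
  also have "\<dots> = ennreal (1 / cb) * ennreal (M i g)"
    unfolding M_def using cb assms
    by (subst tot_cmult) (simp_all add: srwn_sum_kernel blk_def)
  also have "\<dots> = ennreal (1 / cb * M i g)" using cb by (intro ennreal_mult[symmetric] M_nonneg assms) auto
  finally show ?thesis .
qed

text \<open>Since 4^Bk \<ge> Bk, windows at least Bk generations apart are disjoint.\<close>

lemma card_blk: "card {i. i < n \<and> t \<in> blk i} \<le> Bk"
proof (cases "{i. i < n \<and> t \<in> blk i} = {}")
  case False
  define S where "S = {i. i < n \<and> t \<in> blk i}"
  have finS: "finite S" by (simp add: S_def)
  define i0 where "i0 = Min S"
  have i0: "i0 \<in> S" unfolding i0_def using False finS by (intro Min_in) (auto simp: S_def)
  have "S \<subseteq> {i0..<i0 + Bk}"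
  proof
    fix i assume i: "i \<in> S"
    have "i0 \<le> i" unfolding i0_def using finS i by (rule Min_le)
    moreover have "i < i0 + Bk"
    proof -
      have "(4::nat)^i \<le> t" using i by (simp add: S_def blk_def)
      also have "t < Bk * 4^i0" using i0 by (simp add: S_def blk_def)
      also have "\<dots> \<le> 4^Bk * 4^i0" using less_exp[of Bk] power_mono[of 2 4 Bk]
        by (intro mult_right_mono) (auto intro: order_trans less_imp_le)
      also have "\<dots> = 4^(i0 + Bk)" by (simp add: power_add)
      finally show ?thesis by (simp add: power_less_imp_less_exp)
    qed
    ultimately show "i \<in> {i0..<i0 + Bk}" by simp
  qed
  then have "card S \<le> card {i0..<i0 + Bk}" by (intro card_mono) auto
  then show ?thesis by (simp add: S_def)
next
  case True
  then show ?thesis by (simp only: card.empty)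
qed

lemma blk_sum_le:
  assumes f: "\<And>t. 0 \<le> f t" and S: "\<And>N. (\<Sum>t=1..<N. f t) \<le> S"
  shows "(\<Sum>i<n. \<Sum>t\<in>blk i. f t) \<le> real Bk * S"
proof -
  define N where "N = Bk * 4^n"
  have sub: "blk i \<subseteq> {1..<N}" if "i < n" for i
  proof -
    have "(4::nat)^i \<le> 4^n" using that by (intro power_increasing) auto
    then have "Bk * 4^i \<le> N" by (simp add: N_def)
    then show ?thesis by (auto simp: blk_def Suc_le_eq intro: less_le_trans[of 0 "4^i"])
  qed
  have "(\<Sum>i<n. \<Sum>t\<in>blk i. f t) = (\<Sum>i<n. \<Sum>t=1..<N. if t \<in> blk i then f t else 0)"
  proof (rule sum.cong[OF refl])
    fix i assume "i \<in> {..<n}"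
    then have "blk i = {1..<N} \<inter> blk i" using sub by auto
    then show "(\<Sum>t\<in>blk i. f t) = (\<Sum>t=1..<N. if t \<in> blk i then f t else 0)"
      by (metis finite_atLeastLessThan sum.inter_restrict)
  qed
  also have "\<dots> = (\<Sum>t=1..<N. \<Sum>i<n. if t \<in> blk i then f t else 0)" by (rule sum.swap)
  also have "\<dots> = (\<Sum>t=1..<N. real (card {i. i < n \<and> t \<in> blk i}) * f t)"
    by (intro sum.cong refl) (simp add: sum.If_cases lessThan_def Collect_conj_eq[symmetric] Int_def)
  also have "\<dots> \<le> (\<Sum>t=1..<N. real Bk * f t)"
    using card_blk f by (intro sum_mono mult_right_mono) auto
  also have "\<dots> = real Bk * (\<Sum>t=1..<N. f t)" by (simp add: sum_distrib_left)
  also have "\<dots> \<le> real Bk * S" by (intro mult_left_mono S) auto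
  finally show ?thesis .
qed

lemma telescope_le:
  fixes a :: "nat \<Rightarrow> real"
  assumes "\<And>i. 0 \<le> a i" "\<And>i. a i \<le> 1"
  shows "(\<Sum>i<n. a (i + k) - a i) \<le> real k"
proof -
  have "(\<Sum>i<n. a (i + k)) = (\<Sum>i=k..<n+k. a i)"
    by (rule sum.reindex_bij_witness[of _ "\<lambda>i. i - k" "\<lambda>i. i + k"]) auto
  also have "\<dots> \<le> (\<Sum>i\<in>{..<n} \<union> {n..<n+k}. a i)"
    using assms by (intro sum_mono2) auto
  also have "\<dots> = (\<Sum>i<n. a i) + (\<Sum>i=n..<n+k. a i)" by (intro sum.union_disjoint) auto
  also have "(\<Sum>i=n..<n+k. a i) \<le> (\<Sum>i=n..<n+k. 1)" by (intro sum_mono assms)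
  finally show ?thesis by (simp add: sum_subtractf)
qed

text \<open>m is nondecreasing with values in [0,1], so its increments across j + Bk generations add
  up to at most j + Bk; \<open>Bk\<close> \<le> 4^Bk turns the end of a window into a power of
  4.\<close>

lemma mm_gap_sum: "(\<Sum>i<n. mm (i + j) - m (4^i)) \<le> real (j + Bk)"
proof -
  have "mm (i + j) \<le> m (4^(i + (j + Bk)))" for i
  proof -
    have "Bk \<le> (4::nat)^Bk" using less_exp[of Bk] power_mono[of 2 "4::nat" Bk] by linarith
    then have "Bk * 4^(i+j) \<le> 4^Bk * (4::nat)^(i+j)" by (intro mult_right_mono) auto
    also have "\<dots> = 4^(i + (j + Bk))" by (simp add: power_add)
    finally show ?thesis unfolding mm_def by (rule m_mono)
  qed
  then have "(\<Sum>i<n. mm (i + j) - m (4^i)) \<le> (\<Sum>i<n. m (4^(i + (j + Bk))) - m (4^i))"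
    by (intro sum_mono diff_right_mono)
  also have "\<dots> \<le> real (j + Bk)" by (rule telescope_le[of "\<lambda>i. m (4^i)"]) (auto simp: m1)
  finally show ?thesis .
qed

definition C4 where "C4 = Bk * (4 / c1 + 200 * Bk) + Bk * (1 + Bk)"

lemma C4: "0 < C4" using c1 Bk by (simp add: C4_def add_pos_pos)

text \<open>Where e \<ge> m/2 the integrand is at most 2 p e, which \<open>pe_sum\<close> controls
  over all times at once; elsewhere the minimum is at most 1/r2 and \<open>bad_low\<close> applies.
  Replacing the later mean \<open>mm (i + j)\<close> by \<open>m t\<close> costs the gaps of
  \<open>mm_gap_sum\<close>, whence the linear growth in j, which later meets a factor
  4^(-j).\<close>

lemma scale_sum: "(\<Sum>i<n. mm (i + j) * M i (\<lambda>z. min (p z) (1 / r2 i))) \<le> C4 * (1 + j)"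
proof -
  let ?bad = "\<lambda>t. srwn t (\<lambda>z. if e z < m t / 2 then 1 else 0) 0"
  define f where "f t = 2 * srwn t (\<lambda>z. p z * e z) 0 + real Bk * (1 / real t * m t * ?bad t)" for t
  have f0: "0 \<le> f t" for t
    unfolding f_def by (intro add_nonneg_nonneg mult_nonneg_nonneg srwn_nonneg) (auto simp: p0 e0)
  have trm: "mm (i + j) * M i (\<lambda>z. min (p z) (1 / r2 i)) \<le> (\<Sum>t\<in>blk i. f t) + (mm (i + j) - m (4^i)) * Bk" for i
  proof -
    have gap: "0 \<le> mm (i + j) - m (4^i)"
    proof -
      have "(4::nat)^i \<le> 4^(i+j)" by (intro power_increasing) auto
      also have "\<dots> \<le> Bk * 4^(i+j)" using Bk by simp
      finally show ?thesis unfolding mm_def by (simp add: m_mono)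
    qed
    have "mm (i + j) * M i (\<lambda>z. min (p z) (1 / r2 i)) = (\<Sum>t\<in>blk i. mm (i + j) * srwn t (\<lambda>z. min (p z) (1 / r2 i)) 0)"
      by (simp add: M_def sum_distrib_left)
    also have "\<dots> \<le> (\<Sum>t\<in>blk i. f t + (mm (i + j) - m (4^i)) * (1 / r2 i))"
    proof (rule sum_mono)
      fix t assume t: "t \<in> blk i"
      then have t4: "4^i \<le> t" "t < Bk * 4^i" by (auto simp: blk_def)
      then have t0: "0 < t" by (meson less_le_trans zero_less_numeral zero_less_power)
      have mu: "1 / r2 i \<le> real Bk / real t"
      proof -
        have "real t \<le> real Bk * 4^i" using t4(2) by (metis less_imp_le of_nat_le_iff of_nat_mult of_nat_numeral of_nat_power)
        then show ?thesis using t0 by (simp add: r2_def field_simps)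
      qed
      have P: "srwn t (\<lambda>z. min (p z) (1 / r2 i)) 0 \<le> 1 / r2 i" by (intro srwn_le) auto
      have P0: "0 \<le> srwn t (\<lambda>z. min (p z) (1 / r2 i)) 0" by (intro srwn_nonneg) (auto simp: p0 less_imp_le)
      have "m t * srwn t (\<lambda>z. min (p z) (1 / r2 i)) 0 = srwn t (\<lambda>z. m t * min (p z) (1 / r2 i)) 0"
        by (simp add: srwn_cmult)
      also have "\<dots> \<le> srwn t (\<lambda>z. 2 * (p z * e z) + (m t * (real Bk / real t)) * (if e z < m t / 2 then 1 else 0)) 0"
      proof (rule srwn_mono)
        fix z
        show "m t * min (p z) (1 / r2 i) \<le> 2 * (p z * e z) + (m t * (real Bk / real t)) * (if e z < m t / 2 then 1 else 0)"
        proof (cases "e z < m t / 2")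
          case True
          have "m t * min (p z) (1 / r2 i) \<le> m t * (real Bk / real t)"
            using mu by (intro mult_left_mono) auto
          moreover have "0 \<le> p z * e z" by (simp add: p0 e0)
          ultimately show ?thesis using True by simp
        next
          case False
          have "m t * min (p z) (1 / r2 i) \<le> (2 * e z) * p z"
            using False p0[of z] e0[of z] by (intro mult_mono) (auto simp: less_imp_le)
          then show ?thesis using False by (simp add: mult_ac)
        qed
      qed
      also have "\<dots> = 2 * srwn t (\<lambda>z. p z * e z) 0 + (m t * (real Bk / real t)) * ?bad t"
        by (simp only: srwn_add srwn_cmult)
      also have "\<dots> = f t" by (simp add: f_def)
      finally have 1: "m t * srwn t (\<lambda>z. min (p z) (1 / r2 i)) 0 \<le> f t" .
      have "mm (i + j) - m t \<le> mm (i + j) - m (4^i)" using m_mono[OF t4(1)] by simp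
      then have "(mm (i + j) - m t) * srwn t (\<lambda>z. min (p z) (1 / r2 i)) 0 \<le> (mm (i + j) - m (4^i)) * (1 / r2 i)"
        using P P0 gap by (intro mult_mono) auto
      with 1 show "mm (i + j) * srwn t (\<lambda>z. min (p z) (1 / r2 i)) 0 \<le> f t + (mm (i + j) - m (4^i)) * (1 / r2 i)"
        by (simp only: left_diff_distrib)
    qed
    also have "\<dots> = (\<Sum>t\<in>blk i. f t) + (mm (i + j) - m (4^i)) * (card (blk i) / r2 i)"
      by (simp add: sum.distrib)
    also have "\<dots> \<le> (\<Sum>t\<in>blk i. f t) + (mm (i + j) - m (4^i)) * Bk"
    proof (intro add_left_mono mult_left_mono gap)
      have "card (blk i) \<le> Bk * 4^i" by (simp add: blk_def)
      then have "real (card (blk i)) \<le> real Bk * 4^i" by (metis of_nat_le_iff of_nat_mult of_nat_numeral of_nat_power)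
      then show "card (blk i) / r2 i \<le> Bk" by (simp add: r2_def pos_divide_le_eq)
    qed
    finally show ?thesis .
  qed
  have "(\<Sum>i<n. mm (i + j) * M i (\<lambda>z. min (p z) (1 / r2 i)))
     \<le> (\<Sum>i<n. (\<Sum>t\<in>blk i. f t) + (mm (i + j) - m (4^i)) * Bk)" by (intro sum_mono trm)
  also have "\<dots> = (\<Sum>i<n. \<Sum>t\<in>blk i. f t) + (\<Sum>i<n. mm (i + j) - m (4^i)) * Bk"
    by (simp add: sum.distrib sum_distrib_right)
  also have "\<dots> \<le> real Bk * (4 / c1 + 200 * Bk) + real (j + Bk) * Bk"
  proof (intro add_mono mult_right_mono mm_gap_sum blk_sum_le[OF f0])
    fix N
    have "(\<Sum>t=1..<N. f t) = 2 * (\<Sum>t=1..<N. srwn t (\<lambda>z. p z * e z) 0) + Bk * (\<Sum>t=1..<N. 1 / real t * m t * ?bad t)"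
      unfolding f_def by (simp only: sum.distrib sum_distrib_left)
    also have "\<dots> \<le> 2 * (2 / c1) + real Bk * 200"
    proof (intro add_mono mult_left_mono bad_low)
      have "(\<Sum>t=1..<N. srwn t (\<lambda>z. p z * e z) 0) \<le> (\<Sum>t<N. srwn t (\<lambda>z. p z * e z) 0)"
        by (intro sum_mono2) (auto intro!: srwn_nonneg mult_nonneg_nonneg p0 e0)
      also have "\<dots> \<le> 2 / c1" by (rule pe_sum)
      finally show "(\<Sum>t=1..<N. srwn t (\<lambda>z. p z * e z) 0) \<le> 2 / c1" .
    qed auto
    finally show "(\<Sum>t=1..<N. f t) \<le> 4 / c1 + 200 * Bk" by simp
  qed simp
  also have "real Bk * (4 / c1 + 200 * Bk) + real (j + Bk) * Bk \<le> C4 * (1 + j)"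
  proof -
    define X where "X = real Bk * (4 / c1 + 200 * Bk)"
    have "0 \<le> X * j" "0 \<le> real Bk * real Bk * real j" using c1 by (simp_all add: X_def)
    then show ?thesis unfolding C4_def X_def[symmetric] by (simp add: algebra_simps)
  qed
  finally show ?thesis by simp
qed

lemma high_sum: "(\<Sum>i<n. 1 / r2 i * (\<Sum>t\<in>blk i. srwn t (\<lambda>z. if e z > 3/2 * m t then e z else 0) 0)) \<le> 128 * Bk * Bk"
proof -
  let ?h = "\<lambda>t. srwn t (\<lambda>z. if e z > 3/2 * m t then e z else 0) 0"
  have h0: "0 \<le> ?h t" for t by (intro srwn_nonneg) (auto simp: e0)
  have "(\<Sum>i<n. 1 / r2 i * (\<Sum>t\<in>blk i. ?h t)) \<le> (\<Sum>i<n. \<Sum>t\<in>blk i. Bk * (1 / real t * ?h t))"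
    unfolding sum_distrib_left
  proof (intro sum_mono)
    fix i t assume "t \<in> blk i"
    then have t4: "4^i \<le> t" "t < Bk * 4^i" by (auto simp: blk_def)
    then have t0: "0 < t" by (meson less_le_trans zero_less_numeral zero_less_power)
    have "real t \<le> real Bk * 4^i" using t4(2) by (metis less_imp_le of_nat_le_iff of_nat_mult of_nat_numeral of_nat_power)
    then have "1 / r2 i \<le> real Bk / real t" using t0 by (simp add: r2_def field_simps)
    then have "1 / r2 i * ?h t \<le> real Bk / real t * ?h t" using h0 by (intro mult_right_mono)
    then show "1 / r2 i * ?h t \<le> Bk * (1 / real t * ?h t)" by simp
  qed
  also have "\<dots> \<le> real Bk * (128 * Bk)"
  proof (rule blk_sum_le)
    fix N
    have "(\<Sum>t=1..<N. Bk * (1 / real t * ?h t)) = Bk * (\<Sum>t=1..<N. 1 / real t * ?h t)"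
      by (simp add: sum_distrib_left)
    also have "\<dots> \<le> real Bk * 128" by (intro mult_left_mono bad_high) auto
    finally show "(\<Sum>t=1..<N. Bk * (1 / real t * ?h t)) \<le> 128 * Bk" by simp
  qed (intro mult_nonneg_nonneg h0, simp_all)
  finally show ?thesis by simp
qed

text \<open>The horizon provided by \<open>g_lower\<close> depends on z, so the passage from finite
  horizons to the full weight goes through monotone convergence.\<close>

lemma tot_green_upper:
  fixes g :: "int^'d \<Rightarrow> real"
  assumes g: "\<And>z. 0 \<le> g z" and S: "\<And>n. (\<Sum>t<n. srwn t g 0) \<le> S"
  shows "tot (\<lambda>z. bar 1 b z * g z) \<le> ennreal (S / cg)"
proof -
  let ?G = "\<lambda>n z::int^'d. \<Sum>t<n. srwn t (indicat_real {0}) z"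
  have G0: "0 \<le> ?G n z" for n and z :: "int^'d" by (intro sum_nonneg srwn_nonneg) auto
  have inc: "incseq (\<lambda>n z. ennreal (1 / cg * (?G n z * g z)))"
    by (intro incseq_SucI le_funI ennreal_leI mult_left_mono mult_right_mono g)
       (use cg in \<open>auto intro!: srwn_nonneg\<close>)
  have "tot (\<lambda>z. bar 1 b z * g z) \<le> (\<integral>\<^sup>+z. (SUP n. ennreal (1 / cg * (?G n z * g z))) \<partial>count_space UNIV)"
    unfolding tot_def
  proof (rule nn_integral_mono)
    fix z :: "int^'d"
    obtain N where "cg * bar 1 b z \<le> ?G N z" using g_lower by blast
    then have "cg * bar 1 b z * g z \<le> ?G N z * g z" using g by (intro mult_right_mono)
    then have "bar 1 b z * g z \<le> 1 / cg * (?G N z * g z)" using cg by (simp add: field_simps)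
    then show "ennreal (bar 1 b z * g z) \<le> (SUP n. ennreal (1 / cg * (?G n z * g z)))"
      by (intro SUP_upper2[of N] ennreal_leI) auto
  qed
  also have "\<dots> = (SUP n. tot (\<lambda>z. 1 / cg * (?G n z * g z)))"
    unfolding tot_def by (rule nn_integral_monotone_convergence_SUP[OF inc]) auto
  also have "\<dots> \<le> ennreal (S / cg)"
  proof (rule SUP_least)
    fix n
    have "tot (\<lambda>z. 1 / cg * (?G n z * g z)) = ennreal (1 / cg) * ennreal (\<Sum>t<n. srwn t g 0)"
      using cg g by (subst tot_cmult) (simp_all add: srwn_sum_kernel)
    also have "\<dots> = ennreal (1 / cg * (\<Sum>t<n. srwn t g 0))"
      using cg g by (intro ennreal_mult[symmetric] sum_nonneg srwn_nonneg) auto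
    also have "\<dots> \<le> ennreal (S / cg)"
      using S[of n] cg by (intro ennreal_leI) (simp add: divide_right_mono)
    finally show "tot (\<lambda>z. 1 / cg * (?G n z * g z)) \<le> ennreal (S / cg)" .
  qed
  finally show ?thesis .
qed

lemma tot_pe: "tot (\<lambda>z. bar 1 b z * (p z * e z)) \<le> ennreal (2 / c1 / cg)"
  by (intro tot_green_upper pe_sum mult_nonneg_nonneg p0 e0)

end

section \<open>Test functions\<close>

text \<open>Product rule for the discrete Laplacian, with an upper bound for the mixed carre du
  champ.\<close>

lemma srw_mult_le:
  "srw (\<lambda>w. f w * g w) z \<le> f z * srw g z + g z * (srw f z - f z) + srw (\<lambda>w. \<bar>f w - f z\<bar> * \<bar>g w - g z\<bar>) z"
proof -
  have "srw (\<lambda>w. f w * g w) z = srw (\<lambda>w. (f z * g w + g z * (f w - f z)) + (f w - f z) * (g w - g z)) z"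
    by (intro srw_cong) (simp add: algebra_simps)
  also have "\<dots> = f z * srw g z + g z * (srw f z - f z) + srw (\<lambda>w. (f w - f z) * (g w - g z)) z"
    by (simp only: srw_add srw_cmult srw_diff srw_const)
  also have "srw (\<lambda>w. (f w - f z) * (g w - g z)) z \<le> srw (\<lambda>w. \<bar>f w - f z\<bar> * \<bar>g w - g z\<bar>) z"
    by (intro srw_mono) (metis abs_ge_self abs_mult)
  finally show ?thesis by simp
qed

text \<open>Squaring removes the convex kink at 0, so that a second-order upper bound holds there;
  the kink left at 1 is concave and harmless for upper bounds.\<close>

definition clampsq :: "real \<Rightarrow> real" where "clampsq t = (min 1 (max 0 t))\<^sup>2"

lemma clampsq_range: "0 \<le> clampsq t" "clampsq t \<le> 1"
  by (auto simp: clampsq_def intro!: power_le_one)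

lemma clampsq_0: "t \<le> 0 \<Longrightarrow> clampsq t = 0" by (simp add: clampsq_def)
lemma clampsq_1: "1 \<le> t \<Longrightarrow> clampsq t = 1" by (simp add: clampsq_def)

lemma clampsq_Lipschitz: "\<bar>clampsq s - clampsq t\<bar> \<le> 2 * \<bar>s - t\<bar>"
proof -
  define x y where "x = min 1 (max 0 s)" and "y = min 1 (max 0 t)"
  have "clampsq s - clampsq t = (x + y) * (x - y)"
    by (simp add: clampsq_def x_def y_def power2_eq_square algebra_simps)
  moreover have "\<bar>x + y\<bar> \<le> 2" "\<bar>x - y\<bar> \<le> \<bar>s - t\<bar>" by (auto simp: x_def y_def min_def max_def)
  ultimately show ?thesis by (simp add: abs_mult mult_mono)
qed

lemma clampsq_upper: "t \<le> 1 \<Longrightarrow> clampsq s \<le> clampsq t + 2 * max 0 t * (s - t) + (s - t)\<^sup>2"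
proof -
  assume t: "t \<le> 1"
  have "clampsq s \<le> (max 0 s)\<^sup>2" by (auto simp: clampsq_def intro!: power_mono)
  also have "\<dots> \<le> (max 0 t)\<^sup>2 + 2 * max 0 t * (s - t) + (s - t)\<^sup>2"
  proof (cases "0 \<le> t")
    case True
    have "(max 0 s)\<^sup>2 \<le> s\<^sup>2" by (simp add: max_def)
    then show ?thesis using True by (simp add: power2_eq_square algebra_simps)
  next
    case False
    then have "(max 0 s)\<^sup>2 \<le> (s - t)\<^sup>2" by (cases "0 \<le> s") (auto intro!: power_mono)
    then show ?thesis using False by simp
  qed
  also have "(max 0 t)\<^sup>2 = clampsq t" using t by (auto simp: clampsq_def min_def max_def)
  finally show ?thesis by simp
qed

text \<open>Used with (\<alpha>, \<beta>) = (5, -1), which is 1 for |z|^2 \<le> 4 \<rho> and 0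
  beyond 5 \<rho>, and with (-4, 1), which is the opposite.\<close>

definition cutoff :: "real \<Rightarrow> real \<Rightarrow> real \<Rightarrow> int^'d::finite \<Rightarrow> real" where
  "cutoff \<alpha> \<beta> \<rho> z = clampsq (\<alpha> + \<beta> * (sq z / \<rho>))"

lemma cutoff_range: "0 \<le> cutoff \<alpha> \<beta> \<rho> z" "cutoff \<alpha> \<beta> \<rho> z \<le> 1"
  by (simp_all add: cutoff_def clampsq_range)

lemma cutoff_diff:
  assumes "\<bar>\<beta>\<bar> = 1" "0 < \<rho>"
  shows "\<bar>cutoff \<alpha> \<beta> \<rho> w - cutoff \<alpha> \<beta> \<rho> z\<bar> \<le> 2 * \<bar>dsq z w\<bar> / \<rho>"
proof -
  have "\<bar>cutoff \<alpha> \<beta> \<rho> w - cutoff \<alpha> \<beta> \<rho> z\<bar> \<le> 2 * \<bar>(\<alpha> + \<beta> * (sq w / \<rho>)) - (\<alpha> + \<beta> * (sq z / \<rho>))\<bar>"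
    unfolding cutoff_def by (rule clampsq_Lipschitz)
  also have "(\<alpha> + \<beta> * (sq w / \<rho>)) - (\<alpha> + \<beta> * (sq z / \<rho>)) = \<beta> * (dsq z w / \<rho>)"
    by (simp add: dsq_def diff_divide_distrib algebra_simps)
  finally show ?thesis using assms by (simp add: abs_mult)
qed

lemma abs_dsq_scale:
  assumes "v \<in> nbrs" "1 \<le> \<rho>" "sq z \<le> 9 * \<rho>"
  shows "\<bar>dsq z (z + v)\<bar> \<le> 9 * sqrt \<rho>"
proof -
  have "sqrt (sq z) \<le> sqrt (9 * \<rho>)" using assms by simp
  also have "\<dots> = 3 * sqrt \<rho>" by (simp add: real_sqrt_mult)
  finally show ?thesis using abs_dsq_le[OF assms(1), of z] assms(2) real_sqrt_ge_1_iff[of \<rho>] by linarith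
qed

text \<open>39 = 2 + 37: slope at most 2/\<rho> times the mean increment 1, and 1/\<rho>^2 times a
  second moment of at most 37 \<rho>.\<close>

lemma srw_cutoff:
  assumes \<beta>: "\<bar>\<beta>\<bar> = 1" and \<rho>: "1 \<le> \<rho>" and z: "sq z \<le> 9 * \<rho>"
  shows "srw (cutoff \<alpha> \<beta> \<rho>) (z::int^'d::finite) - cutoff \<alpha> \<beta> \<rho> z \<le> 39 / \<rho>"
proof (cases "\<alpha> + \<beta> * (sq z / \<rho>) \<le> 1")
  case False
  then have "cutoff \<alpha> \<beta> \<rho> z = 1" by (simp add: cutoff_def clampsq_1)
  moreover have "srw (cutoff \<alpha> \<beta> \<rho>) z \<le> 1" by (intro srw_le cutoff_range)
  ultimately show ?thesis using \<rho> by (smt (verit) divide_nonneg_nonneg)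
next
  case True
  define t where "t = \<alpha> + \<beta> * (sq z / \<rho>)"
  have t: "t \<le> 1" using True by (simp add: t_def)
  have \<beta>2: "\<beta>\<^sup>2 = 1" using \<beta> power2_abs[of \<beta>] by simp
  have "srw (cutoff \<alpha> \<beta> \<rho>) z \<le> srw (\<lambda>w. (cutoff \<alpha> \<beta> \<rho> z + (2 * max 0 t * \<beta> / \<rho>) * dsq z w) + 1 / \<rho>\<^sup>2 * (dsq z w)\<^sup>2) z"
  proof (rule srw_mono)
    fix v :: "int^'d"
    have "(\<alpha> + \<beta> * (sq (z+v) / \<rho>)) - t = \<beta> * (dsq z (z+v) / \<rho>)"
      by (simp add: t_def dsq_def diff_divide_distrib algebra_simps)
    then show "cutoff \<alpha> \<beta> \<rho> (z+v) \<le> (cutoff \<alpha> \<beta> \<rho> z + (2 * max 0 t * \<beta> / \<rho>) * dsq z (z+v)) + 1 / \<rho>\<^sup>2 * (dsq z (z+v))\<^sup>2"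
      using clampsq_upper[OF t, of "\<alpha> + \<beta> * (sq (z+v) / \<rho>)"] \<beta>2
      by (simp add: cutoff_def t_def power_mult_distrib power_divide mult.assoc)
  qed
  also have "\<dots> = cutoff \<alpha> \<beta> \<rho> z + 2 * max 0 t * \<beta> / \<rho> + 1 / \<rho>\<^sup>2 * (1 + 4 * sq z / CARD('d))"
    by (simp only: srw_add srw_cmult srw_const srw_dsq srw_dsq2 mult_1_right)
  also have "\<dots> \<le> cutoff \<alpha> \<beta> \<rho> z + 2 / \<rho> + 1 / \<rho>\<^sup>2 * (37 * \<rho>)"
  proof (intro add_mono order_refl mult_left_mono divide_right_mono)
    have "2 * max 0 t * \<beta> \<le> 2 * max 0 t * 1" using \<beta> by (intro mult_left_mono) auto
    then show "2 * max 0 t * \<beta> \<le> 2" using t by simp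
    have "4 * sq z / CARD('d) \<le> 4 * sq z / 1" by (intro divide_left_mono) (simp_all add: Suc_leI)
    then show "1 + 4 * sq z / CARD('d) \<le> 37 * \<rho>" using z \<rho> by simp
  qed (use \<rho> in auto)
  also have "\<dots> = cutoff \<alpha> \<beta> \<rho> z + 39 / \<rho>" using \<rho> by (simp add: power2_eq_square)
  finally show ?thesis by simp
qed

lemma nbr_sq_le: "v \<in> nbrs \<Longrightarrow> 1 \<le> \<rho> \<Longrightarrow> sq z < \<rho> \<Longrightarrow> sq (z + v) \<le> 4 * \<rho>"
proof -
  assume v: "v \<in> nbrs" and \<rho>: "1 \<le> \<rho>" and z: "sq z < \<rho>"
  have "sqrt (sq (z + v)) \<le> sqrt (sq z) + 1" by (rule sqrt_sq_nbr_le[OF v])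
  also have "\<dots> \<le> 2 * sqrt \<rho>" using z \<rho> by (smt (verit) real_sqrt_ge_1_iff real_sqrt_less_mono)
  also have "\<dots> = sqrt (4 * \<rho>)" by (simp add: real_sqrt_mult)
  finally show ?thesis by simp
qed

lemma nbr_sq_ge: "v \<in> nbrs \<Longrightarrow> 4 \<le> \<rho> \<Longrightarrow> 9 * \<rho> < sq z \<Longrightarrow> 5 * \<rho> \<le> sq (z + v)"
proof -
  assume v: "v \<in> nbrs" and \<rho>: "4 \<le> \<rho>" and z: "9 * \<rho> < sq z"
  have "2 \<le> sqrt \<rho>" using \<rho> by (simp add: real_le_rsqrt)
  then have "5/2 * sqrt \<rho> \<le> 3 * sqrt \<rho> - 1" by simp
  also have "3 * sqrt \<rho> = sqrt (9 * \<rho>)" by (simp add: real_sqrt_mult)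
  also have "sqrt (9 * \<rho>) - 1 \<le> sqrt (sq z) - 1" using z by simp
  also have "\<dots> \<le> sqrt (sq (z + v))" by (rule sqrt_sq_nbr_ge[OF v])
  finally have "(5/2 * sqrt \<rho>)\<^sup>2 \<le> (sqrt (sq (z + v)))\<^sup>2" using \<rho> by (intro power_mono) auto
  then show ?thesis using \<rho> by (simp add: power_mult_distrib power_divide)
qed

lemma srw_const_nbrs: "(\<And>v. v \<in> nbrs \<Longrightarrow> f (z + v) = c) \<Longrightarrow> srw f (z::int^'d::finite) = c"
  using srw_cong[where f=f and z=z and g="\<lambda>_. c"] by simp

text \<open>The annulus \<rho> \<le> |z|^2 \<le> 9 \<rho> is wider than the transition zone from 4
  \<rho> to 5 \<rho>, so a step started outside of it sees a constant cut-off. The error of the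
  product rule is therefore confined to the annulus.\<close>

lemma srw_cutoff_mult:
  assumes ab: "(\<alpha> = -4 \<and> \<beta> = 1) \<or> (\<alpha> = 5 \<and> \<beta> = -1)" and \<rho>: "4 \<le> \<rho>"
    and E0: "\<And>z. 0 \<le> E z"
    and L: "\<And>z v. v \<in> nbrs \<Longrightarrow> \<rho> \<le> sq z \<Longrightarrow> sq z \<le> 9 * \<rho> \<Longrightarrow> \<bar>E (z + v) - E z\<bar> \<le> L / sqrt \<rho>"
    and Eb: "\<And>z. \<rho> \<le> sq z \<Longrightarrow> sq z \<le> 9 * \<rho> \<Longrightarrow> E z \<le> b"
    and Lb: "0 \<le> L" "0 \<le> b"
  shows "srw (\<lambda>z. cutoff \<alpha> \<beta> \<rho> z * E z) (z::int^'d::finite) \<le> cutoff \<alpha> \<beta> \<rho> z * srw E z +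
    (if \<rho> \<le> sq z \<and> sq z \<le> 9 * \<rho> then (39 * b + 18 * L) / \<rho> else 0)"
proof (cases "\<rho> \<le> sq z \<and> sq z \<le> 9 * \<rho>")
  case True
  have \<beta>: "\<bar>\<beta>\<bar> = 1" using ab by auto
  have s0: "0 < sqrt \<rho>" using \<rho> by simp
  have "srw (\<lambda>w. \<bar>cutoff \<alpha> \<beta> \<rho> w - cutoff \<alpha> \<beta> \<rho> z\<bar> * \<bar>E w - E z\<bar>) z \<le> 18 * L / \<rho>"
  proof (rule srw_le)
    fix v :: "int^'d" assume v: "v \<in> nbrs"
    have "\<bar>cutoff \<alpha> \<beta> \<rho> (z+v) - cutoff \<alpha> \<beta> \<rho> z\<bar> \<le> 2 * \<bar>dsq z (z+v)\<bar> / \<rho>"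
      using \<beta> \<rho> by (intro cutoff_diff) auto
    also have "\<dots> \<le> 2 * (9 * sqrt \<rho>) / \<rho>"
      using v \<rho> True by (intro divide_right_mono mult_left_mono abs_dsq_scale) auto
    finally have "\<bar>cutoff \<alpha> \<beta> \<rho> (z+v) - cutoff \<alpha> \<beta> \<rho> z\<bar> * \<bar>E (z+v) - E z\<bar> \<le> 2 * (9 * sqrt \<rho>) / \<rho> * (L / sqrt \<rho>)"
      using L[OF v] True \<rho> by (intro mult_mono) auto
    then show "\<bar>cutoff \<alpha> \<beta> \<rho> (z+v) - cutoff \<alpha> \<beta> \<rho> z\<bar> * \<bar>E (z+v) - E z\<bar> \<le> 18 * L / \<rho>"
      using s0 by simp
  qed
  moreover have "E z * (srw (cutoff \<alpha> \<beta> \<rho>) z - cutoff \<alpha> \<beta> \<rho> z) \<le> E z * (39 / \<rho>)"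
    using True \<rho> \<beta> by (intro mult_left_mono E0 srw_cutoff) auto
  moreover have "E z * (39 / \<rho>) \<le> b * (39 / \<rho>)"
    using True \<rho> Eb by (intro mult_right_mono) auto
  ultimately have "srw (\<lambda>z. cutoff \<alpha> \<beta> \<rho> z * E z) z \<le> cutoff \<alpha> \<beta> \<rho> z * srw E z + b * (39 / \<rho>) + 18 * L / \<rho>"
    using srw_mult_le[of "cutoff \<alpha> \<beta> \<rho>" E z] by linarith
  then show ?thesis using True by (simp add: add_divide_distrib algebra_simps)
next
  case False
  have "cutoff \<alpha> \<beta> \<rho> (z + v) = cutoff \<alpha> \<beta> \<rho> z" if v: "v \<in> nbrs" for v
  proof (cases "sq z < \<rho>")
    case True
    have "sq (z + v) / \<rho> \<le> 4" "sq z / \<rho> \<le> 4"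
      using nbr_sq_le[OF v _ True] \<rho> True by (auto simp: pos_divide_le_eq)
    then show ?thesis using ab by (auto simp: cutoff_def clampsq_0 clampsq_1)
  next
    case F2: False
    then have "9 * \<rho> < sq z" using False by auto
    then have "5 \<le> sq (z + v) / \<rho>" "5 \<le> sq z / \<rho>"
      using nbr_sq_ge[OF v \<rho>, of z] \<rho> by (auto simp: pos_le_divide_eq)
    then show ?thesis using ab by (auto simp: cutoff_def clampsq_0 clampsq_1)
  qed
  then have "srw (\<lambda>w. cutoff \<alpha> \<beta> \<rho> w * E w) z = srw (\<lambda>w. cutoff \<alpha> \<beta> \<rho> z * E w) z"
    by (intro srw_cong) simp
  then show ?thesis using False by (auto simp: srw_cmult)
qed

text \<open>A Green-type profile regularised at scale \<rho> and cut off at scale \<rho>'.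
  Regularising with a multiple of \<rho> makes the decrease in the inner ball of order
  \<rho>^(-b-1), while the cut-off costs only \<rho>'^(-b-1), and only on its annulus.\<close>

lemma near_test:
  assumes d: "CARD('d::finite) \<ge> 5" and b: "b = (real CARD('d) - 2) / 2"
  shows "\<exists>c>0. \<exists>C>0. \<forall>\<rho>\<ge>1. \<forall>\<rho>'. \<rho> \<le> \<rho>' \<longrightarrow> 4 \<le> \<rho>' \<longrightarrow> (\<exists>T :: int^'d \<Rightarrow> real.
     (\<forall>z. 0 \<le> T z \<and> T z \<le> (\<rho> + sq z) powr (-b)) \<and> (\<forall>z. 5 * \<rho>' \<le> sq z \<longrightarrow> T z = 0) \<and>
     (\<forall>z. srw T z + (if sq z \<le> 4 * \<rho> then c * \<rho> powr (-b-1) else 0)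
        \<le> T z + (if \<rho>' \<le> sq z \<and> sq z \<le> 9 * \<rho>' then C * \<rho>' powr (-b-1) else 0)))"
proof -
  have b0: "0 < b" using d b by simp
  obtain A where A: "36 \<le> A" and F: "\<And>A' z::int^'d. A' \<ge> A \<Longrightarrow> srw (bar A' b) z \<le> bar A' b z - b * A' / 2 * (A' + sq z) powr (-b-2)"
    using bar_superharmonic[OF d b] by blast
  define C where "C = 39 + 18 * (b * 2 powr (b+1) * 9)"
  \<comment> \<open>Comes from the decrease at |z|^2 = 4 \<rho>, where it is smallest within the
    inner ball.\<close>
  define c where "c = b * A / 2 * (A + 4) powr (-b-2)"
  have c: "0 < c" using b0 A by (simp add: c_def)
  have C: "0 < C" using b0 by (simp add: C_def add_pos_pos)
  show ?thesis
  proof (rule exI[of _ c], intro conjI exI[of _ C] allI impI c C)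
    fix \<rho> \<rho>' :: real assume \<rho>: "1 \<le> \<rho>" and \<rho>': "\<rho> \<le> \<rho>'" "4 \<le> \<rho>'"
    define E :: "int^'d \<Rightarrow> real" where "E = bar (A * \<rho>) b"
    define T :: "int^'d \<Rightarrow> real" where "T z = cutoff 5 (-1) \<rho>' z * E z" for z
    have A\<rho>1: "A \<le> A * \<rho>" using A \<rho> mult_left_mono[of 1 \<rho> A] by simp
    then have A\<rho>: "A \<le> A * \<rho>" "36 \<le> A * \<rho>" using A by (simp_all only: order_trans[OF A])
    have E0: "0 \<le> E z" for z by (simp add: E_def)
    have sge: "\<rho>' \<le> A * \<rho> + sq z" if "\<rho>' \<le> sq z" for z :: "int^'d" using that A\<rho> by linarith
    have T1: "0 \<le> T z \<and> T z \<le> (\<rho> + sq z) powr (-b)" for z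
    proof -
      have "E z \<le> (\<rho> + sq z) powr (-b)"
        unfolding E_def bar_def using \<rho> A b0 mult_right_mono[of 1 A \<rho>]
        by (intro powr_neg_antimono) (auto simp: add_pos_nonneg)
      then show ?thesis
        using mult_right_mono[OF cutoff_range(2)[of 5 "-1" \<rho>' z] E0[of z]] E0[of z] cutoff_range(1)[of 5 "-1" \<rho>' z]
        by (auto simp: T_def)
    qed
    have T2: "T z = 0" if "5 * \<rho>' \<le> sq z" for z
      using that \<rho>' by (simp add: T_def cutoff_def clampsq_0 pos_le_divide_eq)
    have T3: "srw T z + (if sq z \<le> 4 * \<rho> then c * \<rho> powr (-b-1) else 0)
        \<le> T z + (if \<rho>' \<le> sq z \<and> sq z \<le> 9 * \<rho>' then C * \<rho>' powr (-b-1) else 0)" for z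
    proof -
      have "srw T z \<le> cutoff 5 (-1) \<rho>' z * srw E z +
         (if \<rho>' \<le> sq z \<and> sq z \<le> 9 * \<rho>' then (39 * \<rho>' powr (-b) + 18 * (b * 2 powr (b+1) * 9 * \<rho>' powr (-b))) / \<rho>' else 0)"
        unfolding T_def
      proof (rule srw_cutoff_mult)
        fix z v :: "int^'d" assume v: "v \<in> nbrs" and z: "\<rho>' \<le> sq z" "sq z \<le> 9 * \<rho>'"
        have s: "\<rho>' \<le> A * \<rho> + sq z" by (rule sge[OF z(1)])
        have "E (z + v) = (A * \<rho> + sq z + dsq z (z + v)) powr (-b)" by (simp add: E_def bar_def dsq_def)
        then have "\<bar>E (z + v) - E z\<bar> \<le> b * 2 powr (b+1) * (A * \<rho> + sq z) powr (-b-1) * \<bar>dsq z (z + v)\<bar>"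
          using powr_neg_Lipschitz[OF _ abs_dsq_half[OF v A\<rho>(2), of z] b0] s \<rho>' by (simp add: E_def bar_def)
        also have "\<dots> \<le> b * 2 powr (b+1) * \<rho>' powr (-b-1) * (9 * sqrt \<rho>')"
        proof (intro mult_mono mult_left_mono)
          show "(A * \<rho> + sq z) powr (-b-1) \<le> \<rho>' powr (-b-1)"
            using powr_neg_antimono[OF _ s, of "b+1"] \<rho>' b0 by simp
          show "\<bar>dsq z (z + v)\<bar> \<le> 9 * sqrt \<rho>'" using z \<rho>' v by (intro abs_dsq_scale) auto
        qed (use b0 in auto)
        also have "\<rho>' powr (-b-1) = \<rho>' powr (-b) / \<rho>'" using \<rho>' by (simp add: powr_diff)
        also have "b * 2 powr (b+1) * (\<rho>' powr (-b) / \<rho>') * (9 * sqrt \<rho>') = b * 2 powr (b+1) * 9 * \<rho>' powr (-b) / sqrt \<rho>'"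
          using \<rho>' real_sqrt_mult_self[of \<rho>'] by (simp add: field_simps)
        finally show "\<bar>E (z + v) - E z\<bar> \<le> b * 2 powr (b+1) * 9 * \<rho>' powr (-b) / sqrt \<rho>'" .
      next
        fix z :: "int^'d" assume "\<rho>' \<le> sq z"
        then show "E z \<le> \<rho>' powr (-b)" unfolding E_def bar_def
          using sge[of z] \<rho>' b0 by (intro powr_neg_antimono) auto
      qed (use \<rho>' b0 E0 in auto)
      also have "(39 * \<rho>' powr (-b) + 18 * (b * 2 powr (b+1) * 9 * \<rho>' powr (-b))) / \<rho>' = C * \<rho>' powr (-b-1)"
        using \<rho>' by (simp add: C_def powr_diff algebra_simps add_divide_distrib)
      finally have s1: "srw T z \<le> cutoff 5 (-1) \<rho>' z * srw E z + (if \<rho>' \<le> sq z \<and> sq z \<le> 9 * \<rho>' then C * \<rho>' powr (-b-1) else 0)" .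
      have FE: "srw E z \<le> E z - b * (A * \<rho>) / 2 * (A * \<rho> + sq z) powr (-b-2)" unfolding E_def by (rule F[OF A\<rho>(1)])
      have "cutoff 5 (-1) \<rho>' z * srw E z + (if sq z \<le> 4 * \<rho> then c * \<rho> powr (-b-1) else 0) \<le> T z"
      proof (cases "sq z \<le> 4 * \<rho>")
        case True
        then have "sq z / \<rho>' \<le> 4" using \<rho>' by (simp add: pos_divide_le_eq)
        then have "cutoff 5 (-1) \<rho>' z = 1" by (simp add: cutoff_def clampsq_1)
        moreover have "c * \<rho> powr (-b-1) \<le> b * (A * \<rho>) / 2 * (A * \<rho> + sq z) powr (-b-2)"
        proof -
          have pos: "0 < A * \<rho> + sq z" by (rule add_pos_nonneg) (use A\<rho>(2) in linarith, simp)
          have "((A + 4) * \<rho>) powr (-(b+2)) \<le> (A * \<rho> + sq z) powr (-(b+2))"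
            using True b0 by (intro powr_neg_antimono pos) (auto simp: algebra_simps)
          then have "b * (A * \<rho>) / 2 * ((A + 4) * \<rho>) powr (-(b+2)) \<le> b * (A * \<rho>) / 2 * (A * \<rho> + sq z) powr (-(b+2))"
            using b0 A \<rho> by (intro mult_left_mono) auto
          moreover have "b * (A * \<rho>) / 2 * ((A + 4) * \<rho>) powr (-(b+2)) = c * (\<rho> * \<rho> powr (-b-2))"
            using A \<rho> by (subst powr_mult) (auto simp: c_def)
          moreover have "\<rho> * \<rho> powr (-b-2) = \<rho> powr (-b-1)" using \<rho> by (simp add: powr_split)
          ultimately show ?thesis by simp
        qed
        ultimately show ?thesis using FE True by (simp add: T_def)
      next
        case False
        have "srw E z \<le> E z" using FE b0 A \<rho> by (smt (verit) divide_nonneg_nonneg mult_nonneg_nonneg powr_ge_zero)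
        then show ?thesis using False cutoff_range(1)[of 5 "-1" \<rho>' z] by (simp add: T_def mult_left_mono)
      qed
      with s1 show ?thesis by linarith
    qed
    show "\<exists>T :: int^'d \<Rightarrow> real.
     (\<forall>z. 0 \<le> T z \<and> T z \<le> (\<rho> + sq z) powr (-b)) \<and> (\<forall>z. 5 * \<rho>' \<le> sq z \<longrightarrow> T z = 0) \<and>
     (\<forall>z. srw T z + (if sq z \<le> 4 * \<rho> then c * \<rho> powr (-b-1) else 0)
        \<le> T z + (if \<rho>' \<le> sq z \<and> sq z \<le> 9 * \<rho>' then C * \<rho>' powr (-b-1) else 0))"
      using T1 T2 T3 by (intro exI[of _ T]) blast
  qed
qed

text \<open>A profile for the walk killed at a rate of order \<open>k\<close>. Polynomial decay
  beyond distance k^(-1/2) replaces the exponential decay of the true killed kernel; it suffices and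
  keeps increments small relative to the value.\<close>

definition kbar :: "real \<Rightarrow> real \<Rightarrow> real \<Rightarrow> real \<Rightarrow> int^'d::finite \<Rightarrow> real" where
  "kbar A b k N z = bar A b z * (1 + k * (A + sq z)) powr (-N)"

lemma kbar_nonneg [simp]: "0 \<le> kbar A b k N z" by (simp add: kbar_def)

text \<open>The bounds are uniform in \<open>k\<close>: since k/(1 + k s) \<le> 1/s, the second
  factor varies no faster, in relative terms, than a power of s does.\<close>

lemma kbar_increment:
  assumes b: "0 < b" and N: "0 < N" and A: "36 \<le> A" and k: "0 < k" and v: "v \<in> nbrs"
  shows "\<bar>kbar A b k N (z + v) - kbar A b k N z\<bar> \<le> (b * 2 powr (b+1) * 2 powr N + N * 2 powr (N+1)) * 3 * (kbar A b k N z / sqrt (A + sq z))"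
    and "\<bar>(1 + k * (A + sq (z + v))) powr (-N) - (1 + k * (A + sq z)) powr (-N)\<bar> \<le> N * 2 powr (N+1) * (1 + k * (A + sq z)) powr (-N-1) * (k * \<bar>dsq z (z + v)\<bar>)"
    and "(1 + k * (A + sq (z + v))) powr (-N) \<le> (1 + k * (A + sq z)) powr (-N) - N * (1 + k * (A + sq z)) powr (-N-1) * k * dsq z (z+v)
      + N * (N+1) * 2 powr (N+2) / 2 * (1 + k * (A + sq z)) powr (-N-2) * k\<^sup>2 * (dsq z (z+v))\<^sup>2"
    and "\<bar>bar A b (z + v) - bar A b z\<bar> \<le> b * 2 powr (b+1) * (A + sq z) powr (-b-1) * \<bar>dsq z (z + v)\<bar>"
proof -
  define s where "s = A + sq z"
  define h where "h = dsq z (z + v)"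
  define x where "x = 1 + k * s"
  have s: "36 \<le> s" using A by (simp add: s_def add_increasing2)
  have hs: "\<bar>h\<bar> \<le> s / 2" unfolding h_def s_def by (rule abs_dsq_half[OF v A])
  have x: "0 < x" "1 \<le> x" using k s by (auto simp: x_def add_pos_nonneg)
  have ks: "k * s \<le> x" by (simp add: x_def)
  have hx: "\<bar>k * h\<bar> \<le> x / 2"
  proof -
    have "k * \<bar>h\<bar> \<le> k * (s / 2)" using hs k by (intro mult_left_mono) auto
    also have "\<dots> \<le> x / 2" using ks by simp
    finally show ?thesis using k by (simp add: abs_mult)
  qed
  have e1: "A + sq (z + v) = s + h" by (simp add: s_def h_def dsq_def)
  have e2: "1 + k * (A + sq (z + v)) = x + k * h" unfolding e1 by (simp add: x_def algebra_simps)
  have J: "\<bar>(x + k * h) powr (-N) - x powr (-N)\<bar> \<le> N * 2 powr (N+1) * x powr (-N-1) * (k * \<bar>h\<bar>)"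
    using powr_neg_Lipschitz[OF x(1) hx N] k by (simp add: abs_mult)
  then show "\<bar>(1 + k * (A + sq (z + v))) powr (-N) - (1 + k * (A + sq z)) powr (-N)\<bar> \<le> N * 2 powr (N+1) * (1 + k * (A + sq z)) powr (-N-1) * (k * \<bar>dsq z (z + v)\<bar>)"
    unfolding e2 by (simp add: x_def s_def h_def)
  show "(1 + k * (A + sq (z + v))) powr (-N) \<le> (1 + k * (A + sq z)) powr (-N) - N * (1 + k * (A + sq z)) powr (-N-1) * k * dsq z (z+v)
      + N * (N+1) * 2 powr (N+2) / 2 * (1 + k * (A + sq z)) powr (-N-2) * k\<^sup>2 * (dsq z (z+v))\<^sup>2"
    unfolding e2 using powr_neg_upper2[OF x(1) hx N]
    by (simp add: x_def s_def h_def power_mult_distrib mult_ac)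
  have F: "\<bar>(s + h) powr (-b) - s powr (-b)\<bar> \<le> b * 2 powr (b+1) * s powr (-b-1) * \<bar>h\<bar>"
    using powr_neg_Lipschitz[OF _ hs b] s by simp
  then show "\<bar>bar A b (z + v) - bar A b z\<bar> \<le> b * 2 powr (b+1) * (A + sq z) powr (-b-1) * \<bar>dsq z (z + v)\<bar>"
    by (simp add: bar_def e1 s_def h_def)
  have h3: "\<bar>h\<bar> \<le> 3 * sqrt s"
  proof -
    have "sqrt (sq z) \<le> sqrt s" "1 \<le> sqrt s" using A s by (simp_all add: s_def)
    then show ?thesis using abs_dsq_le[OF v, of z] unfolding h_def by linarith
  qed
  have Jx: "(x + k * h) powr (-N) \<le> 2 powr N * x powr (-N)"
  proof -
    have "(x + k * h) powr (-N) \<le> (x / 2) powr (-N)" using hx x N by (intro powr_neg_antimono) (auto simp: abs_le_iff)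
    then show ?thesis using powr_half[OF x(1), of N] by simp
  qed
  have "\<bar>kbar A b k N (z + v) - kbar A b k N z\<bar> = \<bar>((s + h) powr (-b) - s powr (-b)) * (x + k * h) powr (-N) + s powr (-b) * ((x + k * h) powr (-N) - x powr (-N))\<bar>"
    unfolding kbar_def bar_def e2 unfolding e1
    by (simp add: x_def s_def left_diff_distrib right_diff_distrib)
  also have "\<dots> \<le> \<bar>(s + h) powr (-b) - s powr (-b)\<bar> * (x + k * h) powr (-N) + s powr (-b) * \<bar>(x + k * h) powr (-N) - x powr (-N)\<bar>"
    by (rule order_trans[OF abs_triangle_ineq]) (simp add: abs_mult)
  also have "\<dots> \<le> (b * 2 powr (b+1) * s powr (-b-1) * \<bar>h\<bar>) * (2 powr N * x powr (-N)) + s powr (-b) * (N * 2 powr (N+1) * x powr (-N-1) * (k * \<bar>h\<bar>))"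
    using b by (intro add_mono mult_mono F Jx J mult_left_mono) auto
  also have "s powr (-b-1) = s powr (-b) / s" using s by (simp add: powr_diff)
  also have Y: "x powr (-N-1) * (k * \<bar>h\<bar>) \<le> x powr (-N) * (\<bar>h\<bar> / s)" 
  proof -
    have "x powr (-N-1) = x powr (-N) / x" using x by (simp add: powr_diff)
    moreover have "k / x \<le> 1 / s" using ks x s by (simp add: field_simps)
    then have "k / x * \<bar>h\<bar> \<le> 1 / s * \<bar>h\<bar>" by (intro mult_right_mono) auto
    then have "x powr (-N) * (k / x * \<bar>h\<bar>) \<le> x powr (-N) * (1 / s * \<bar>h\<bar>)" by (intro mult_left_mono) auto
    ultimately show ?thesis by simp
  qed
  then have "(b * 2 powr (b+1) * (s powr (-b) / s) * \<bar>h\<bar>) * (2 powr N * x powr (-N)) + s powr (-b) * (N * 2 powr (N+1) * x powr (-N-1) * (k * \<bar>h\<bar>))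
     \<le> (b * 2 powr (b+1) * (s powr (-b) / s) * \<bar>h\<bar>) * (2 powr N * x powr (-N)) + s powr (-b) * (N * 2 powr (N+1) * (x powr (-N) * (\<bar>h\<bar> / s)))"
    using N mult_left_mono[OF Y, of "N * 2 powr (N+1)"]
    by (intro add_left_mono mult_left_mono) (simp_all add: mult.assoc)
  also have "\<dots> = (b * 2 powr (b+1) * 2 powr N + N * 2 powr (N+1)) * (s powr (-b) * x powr (-N)) * (\<bar>h\<bar> / s)"
    by (simp add: algebra_simps)
  also have "\<dots> \<le> (b * 2 powr (b+1) * 2 powr N + N * 2 powr (N+1)) * (s powr (-b) * x powr (-N)) * (3 / sqrt s)"
  proof (intro mult_left_mono)
    have "\<bar>h\<bar> / s \<le> 3 * sqrt s / s" using h3 s by (intro divide_right_mono) auto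
    also have "\<dots> = 3 / sqrt s" using s real_sqrt_mult_self[of s] by (simp add: field_simps)
    finally show "\<bar>h\<bar> / s \<le> 3 / sqrt s" .
  qed (use b N in auto)
  finally show "\<bar>kbar A b k N (z + v) - kbar A b k N z\<bar> \<le> (b * 2 powr (b+1) * 2 powr N + N * 2 powr (N+1)) * 3 * (kbar A b k N z / sqrt (A + sq z))"
    by (simp add: kbar_def bar_def x_def s_def algebra_simps)
qed

lemma one_plus_le_five: "X \<le> 4 * y \<Longrightarrow> 36 \<le> A \<Longrightarrow> 0 \<le> y \<Longrightarrow> 1 + X \<le> 5 * (A + y)" for X y A :: real
  by (simp add: distrib_left)

text \<open>The second factor disturbs the superharmonicity of \<open>bar A b\<close> by a relative
  error of at most Cs k. With k = \<epsilon> l and \<epsilon> = 1/Cs the killing rate l pays for it,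
  and the strict decrease of \<open>bar A b\<close> leaves the point mass at 0.\<close>

lemma kbar_superharmonic:
  assumes d: "CARD('d::finite) \<ge> 5" and b: "b = (real CARD('d) - 2) / 2" and N: "0 < N"
  shows "\<exists>A\<ge>36. \<exists>\<epsilon>>0. \<exists>c>0. \<epsilon> \<le> 1 \<and> (\<forall>l. 0 < l \<longrightarrow> l \<le> 1/2 \<longrightarrow> (\<forall>z::int^'d.
     (1 - l) * srw (kbar A b (\<epsilon> * l) N) z + c * indicat_real {0} z \<le> kbar A b (\<epsilon> * l) N z))"
proof -
  have b0: "0 < b" using d b by simp
  obtain A where A: "36 \<le> A" and F: "\<And>z::int^'d. srw (bar A b) z \<le> bar A b z - b * A / 2 * (A + sq z) powr (-b-2)"
    using bar_superharmonic[OF d b] by blast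
  define CN CJ CF where "CN = N * (N+1) * 2 powr (N+2) / 2" and "CJ = N * 2 powr (N+1)" and "CF = b * 2 powr (b+1)"
  have C0: "0 < CN" "0 < CJ" "0 < CF" using N b0 by (simp_all add: CN_def CJ_def CF_def)
  define Cs where "Cs = 5 * CN + 5 * (CF * CJ) + 1"
  have Cs: "1 \<le> Cs" using C0 by (simp add: Cs_def)
  define \<epsilon> where "\<epsilon> = 1 / Cs"
  have \<epsilon>: "0 < \<epsilon>" "\<epsilon> \<le> 1" using Cs by (simp_all add: \<epsilon>_def)
  define c where "c = (1 + A) powr (-N) * (b * A / 2 * A powr (-b-2)) / 2"
  have c: "0 < c" using A b0 by (simp add: c_def)
  have main: "(1 - l) * srw (kbar A b (\<epsilon> * l) N) z + c * indicat_real {0} z \<le> kbar A b (\<epsilon> * l) N z"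
    if l: "0 < l" "l \<le> 1/2" for l and z :: "int^'d"
  proof -
    define k where "k = \<epsilon> * l"
    have k: "0 < k" using \<epsilon> l by (simp add: k_def)
    define s where "s = A + sq z"
    define x where "x = 1 + k * s"
    have s: "36 \<le> s" using A by (simp add: s_def add_increasing2)
    have x: "1 \<le> x" using k s by (simp add: x_def)
    have ks: "k * s \<le> x" by (simp add: x_def)
    define J where "J w = (1 + k * (A + sq w)) powr (-N)" for w :: "int^'d"
    define FJ where "FJ = bar A b z * J z"
    have Jz: "J z = x powr (-N)" by (simp add: J_def x_def s_def)
    have J0: "0 \<le> J w" for w by (simp add: J_def)
    have sqs: "1 + 4 * sq z / CARD('d) \<le> 5 * s"
    proof -
      have "4 * sq z / CARD('d) \<le> 4 * sq z / 1" by (intro divide_left_mono) (simp_all add: Suc_leI)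
      then have "4 * sq z / CARD('d) \<le> 4 * sq z" by simp
      then show ?thesis unfolding s_def using A by (intro one_plus_le_five) auto
    qed
    have xN: "x powr (-N-1) = x powr (-N) / x" "x powr (-N-2) = x powr (-N) / x / x"
      using x powr_split(1,2)[of x "N"] powr_split(1)[of x "N-1"] by (simp_all add: field_simps powr_diff power2_eq_square)
    have "srw J z \<le> srw (\<lambda>w. (J z + (- (N * x powr (-N-1) * k)) * dsq z w) + (CN * x powr (-N-2) * k\<^sup>2) * (dsq z w)\<^sup>2) z"
    proof (rule srw_mono)
      fix v :: "int^'d" assume v: "v \<in> nbrs"
      show "J (z + v) \<le> (J z + (- (N * x powr (-N-1) * k)) * dsq z (z+v)) + (CN * x powr (-N-2) * k\<^sup>2) * (dsq z (z+v))\<^sup>2"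
        using kbar_increment(3)[OF b0 N A k v, of z] by (simp add: J_def x_def s_def CN_def)
    qed
    also have "\<dots> = J z - N * x powr (-N-1) * k + (CN * x powr (-N-2) * k\<^sup>2) * (1 + 4 * sq z / CARD('d))"
      by (simp only: srw_add srw_cmult srw_const srw_dsq srw_dsq2 mult_1_right)
    also have "\<dots> \<le> J z + (CN * x powr (-N-2) * k\<^sup>2) * (5 * s)"
    proof -
      have "0 \<le> N * x powr (-N-1) * k" using N k by simp
      moreover have "(CN * x powr (-N-2) * k\<^sup>2) * (1 + 4 * sq z / CARD('d)) \<le> (CN * x powr (-N-2) * k\<^sup>2) * (5 * s)"
        using sqs C0 by (intro mult_left_mono) auto
      ultimately show ?thesis by linarith
    qed
    also have "(CN * x powr (-N-2) * k\<^sup>2) * (5 * s) = 5 * CN * k * J z * ((k * s / x) * (1 / x))"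
      unfolding xN Jz by (simp add: power2_eq_square)
    also have "\<dots> \<le> 5 * CN * k * J z * (1 * 1)"
      using ks x k s C0 J0 by (intro mult_left_mono mult_mono) auto
    finally have dJ: "srw J z - J z \<le> 5 * CN * k * J z" by simp
    have cross: "srw (\<lambda>w. \<bar>J w - J z\<bar> * \<bar>bar A b w - bar A b z\<bar>) z \<le> 5 * (CF * CJ) * k * FJ"
    proof -
      have "srw (\<lambda>w. \<bar>J w - J z\<bar> * \<bar>bar A b w - bar A b z\<bar>) z \<le> srw (\<lambda>w. (CJ * x powr (-N-1) * k * (CF * s powr (-b-1))) * (dsq z w)\<^sup>2) z"
      proof (rule srw_mono)
        fix v :: "int^'d" assume v: "v \<in> nbrs"
        have "\<bar>J (z+v) - J z\<bar> * \<bar>bar A b (z+v) - bar A b z\<bar> \<le> (CJ * x powr (-N-1) * (k * \<bar>dsq z (z+v)\<bar>)) * (CF * s powr (-b-1) * \<bar>dsq z (z+v)\<bar>)"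
          using kbar_increment(2)[OF b0 N A k v, of z] kbar_increment(4)[OF b0 N A k v, of z] k C0
          by (intro mult_mono) (auto simp: J_def x_def s_def CF_def CJ_def)
        also have "\<dots> = (CJ * x powr (-N-1) * k * (CF * s powr (-b-1))) * (\<bar>dsq z (z+v)\<bar> * \<bar>dsq z (z+v)\<bar>)"
          by (simp only: mult_ac)
        also have "\<bar>dsq z (z+v)\<bar> * \<bar>dsq z (z+v)\<bar> = (dsq z (z+v))\<^sup>2" by (simp add: power2_eq_square)
        finally show "\<bar>J (z+v) - J z\<bar> * \<bar>bar A b (z+v) - bar A b z\<bar> \<le> (CJ * x powr (-N-1) * k * (CF * s powr (-b-1))) * (dsq z (z+v))\<^sup>2" .
      qed
      also have "\<dots> = (CJ * x powr (-N-1) * k * (CF * s powr (-b-1))) * (1 + 4 * sq z / CARD('d))"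
        by (simp only: srw_cmult srw_dsq2)
      also have "\<dots> \<le> (CJ * x powr (-N) * k * (CF * s powr (-b-1))) * (5 * s)"
      proof (intro mult_mono mult_left_mono mult_right_mono sqs)
        show "x powr (-N-1) \<le> x powr (-N)" using x by (intro powr_mono) auto
      qed (use C0 k s in auto)
      also have "\<dots> = 5 * (CF * CJ) * k * (x powr (-N) * (s * s powr (-b-1)))" by (simp only: mult_ac)
      also have "s * s powr (-b-1) = bar A b z" using s by (simp add: bar_def s_def powr_diff)
      finally show ?thesis by (simp add: FJ_def Jz mult_ac)
    qed
    have FJ0: "0 \<le> FJ" by (simp add: FJ_def J0)
    define g where "g = b * A / 2 * s powr (-b-2)"
    have g0: "0 \<le> g" using b0 A by (simp add: g_def)
    have kb: "kbar A b k N = (\<lambda>w. J w * bar A b w)" by (simp add: kbar_def J_def fun_eq_iff)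
    have "srw (kbar A b k N) z \<le> J z * srw (bar A b) z + bar A b z * (srw J z - J z) + srw (\<lambda>w. \<bar>J w - J z\<bar> * \<bar>bar A b w - bar A b z\<bar>) z"
      unfolding kb by (rule srw_mult_le)
    also have "\<dots> \<le> J z * (bar A b z - g) + bar A b z * (5 * CN * k * J z) + 5 * (CF * CJ) * k * FJ"
      using F[of z] by (intro add_mono mult_left_mono dJ cross J0) (auto simp: g_def s_def)
    also have "\<dots> = FJ + (5 * CN + 5 * (CF * CJ)) * k * FJ - J z * g"
      by (simp add: FJ_def algebra_simps)
    also have "\<dots> \<le> FJ + l * FJ - J z * g"
    proof -
      have "(5 * CN + 5 * (CF * CJ)) * k \<le> Cs * k" using k by (intro mult_right_mono) (auto simp: Cs_def)
      also have "\<dots> = l" using Cs by (simp add: k_def \<epsilon>_def)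
      finally have "(5 * CN + 5 * (CF * CJ)) * k * FJ \<le> l * FJ" using FJ0 by (rule mult_right_mono)
      then show ?thesis by simp
    qed
    finally have "(1 - l) * srw (kbar A b k N) z \<le> (1 - l) * (FJ + l * FJ - J z * g)"
      using l by (intro mult_left_mono) auto
    also have "\<dots> = FJ - l * l * FJ - (1 - l) * (J z * g)" by (simp add: algebra_simps)
    also have "\<dots> \<le> FJ - J z * g / 2"
    proof -
      have "0 \<le> l * l * FJ" using l FJ0 by simp
      moreover have "1/2 * (J z * g) \<le> (1 - l) * (J z * g)" using l J0 g0 by (intro mult_right_mono) auto
      ultimately show ?thesis by simp
    qed
    also have "\<dots> \<le> FJ - c * indicat_real {0} z"
    proof (cases "z = 0")
      case True
      have "k \<le> 1" using \<epsilon> l mult_mono[of \<epsilon> 1 l 1] by (simp add: k_def)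
      then have "1 + k * A \<le> 1 + A" using A by (simp add: mult_left_le_one_le k less_imp_le)
      then have "(1 + A) powr (-N) \<le> J z"
        unfolding J_def using True A k N by (intro powr_neg_antimono) (auto simp: add_pos_nonneg)
      then have "(1 + A) powr (-N) * g \<le> J z * g" using g0 by (rule mult_right_mono)
      then show ?thesis using True by (simp add: c_def g_def s_def)
    next
      case False
      then show ?thesis using J0[of z] g0 by simp
    qed
    also have "FJ = kbar A b k N z" by (simp add: kb FJ_def)
    finally show ?thesis by (simp add: k_def)
  qed
  show ?thesis using A \<epsilon> c main by (intro exI[of _ A] conjI exI[of _ \<epsilon>] exI[of _ c]) auto
qed

text \<open>A killed profile around w, cut out of the ball |z|^2 \<le> 4 \<rho>. Paired with a
  killed subsolution outside that ball it bounds the value at w by the values on the annulus times a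
  kernel that decays like (1 + |w|^2/\<rho>)^(-d).\<close>

lemma far_test:
  assumes d: "CARD('d::finite) \<ge> 5" and b: "b = (real CARD('d) - 2) / 2"
  shows "\<exists>c>0. \<exists>C>0. \<forall>\<rho>\<ge>4. \<forall>w :: int^'d. 16 * \<rho> < sq w \<longrightarrow> (\<exists>T :: int^'d \<Rightarrow> real.
     (\<forall>z. 0 \<le> T z \<and> T z \<le> 1) \<and> (\<forall>z. sq z \<le> 4 * \<rho> \<longrightarrow> T z = 0) \<and>
     (\<forall>z. (1 - 1 / \<rho>) * srw T z + c * indicat_real {w} z
        \<le> T z + (if \<rho> \<le> sq z \<and> sq z \<le> 9 * \<rho> then C * \<rho> powr (-b-1) * (1 + sq w / \<rho>) powr (- real CARD('d)) else 0)))"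
proof -
  have b0: "0 < b" using d b by simp
  define N where "N = real CARD('d)"
  have N: "0 < N" by (simp add: N_def)
  obtain A \<epsilon> c where A: "36 \<le> A" and \<epsilon>: "0 < \<epsilon>" "\<epsilon> \<le> 1" and c: "0 < c" and
    S: "\<And>l z::int^'d. 0 < l \<Longrightarrow> l \<le> 1/2 \<Longrightarrow> (1 - l) * srw (kbar A b (\<epsilon> * l) N) z + c * indicat_real {0} z \<le> kbar A b (\<epsilon> * l) N z"
    using kbar_superharmonic[OF d b N] by blast
  define CL where "CL = (b * 2 powr (b+1) * 2 powr N + N * 2 powr (N+1)) * 3"
  have CL: "0 < CL" using b0 N by (simp add: CL_def add_pos_pos)
  define C where "C = (39 + 18 * CL) * (16 / \<epsilon>) powr N"
  have C: "0 < C" using CL \<epsilon> by (simp add: C_def add_pos_pos)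
  show ?thesis
  proof (rule exI[of _ c], intro conjI exI[of _ C] allI impI c C)
    fix \<rho> :: real and w :: "int^'d" assume \<rho>: "4 \<le> \<rho>" and w: "16 * \<rho> < sq w"
    define l where "l = 1 / \<rho>"
    have l: "0 < l" "l \<le> 1/2" using \<rho> by (auto simp: l_def field_simps)
    define k where "k = \<epsilon> * l"
    have k: "0 < k" using \<epsilon> l by (simp add: k_def)
    define E :: "int^'d \<Rightarrow> real" where "E z = kbar A b k N (z - w)" for z
    define T :: "int^'d \<Rightarrow> real" where "T z = cutoff (-4) 1 \<rho> z * E z" for z
    define e1 where "e1 = \<rho> powr (-b) * ((16 / \<epsilon>) powr N * (1 + sq w / \<rho>) powr (-N))"
    have e1: "0 \<le> e1" by (simp add: e1_def)
    have E0: "0 \<le> E z" and E1: "E z \<le> 1" for z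
    proof -
      show "0 \<le> E z" by (simp add: E_def)
      have "(1 + k * (A + sq (z - w))) powr (-N) \<le> 1 powr (-N)"
        using k A N by (intro powr_neg_antimono) (auto simp: add_nonneg_nonneg)
      moreover have "bar A b (z - w) \<le> 1" using A b0 by (intro bar_le_1) auto
      ultimately have "bar A b (z - w) * (1 + k * (A + sq (z - w))) powr (-N) \<le> 1 * 1" by (intro mult_mono) auto
      then show "E z \<le> 1" by (simp add: E_def kbar_def)
    qed
    \<comment> \<open>Here |z| \<le> 3/4 |w|, hence |z - w| \<ge> |w|/4.\<close>
    have away: "sq w / 16 \<le> sq (z - w)" if "sq z \<le> 9 * \<rho>" for z
    proof -
      have "sq z \<le> 9/16 * sq w" using that w by simp
      then have "sqrt (sq z) \<le> sqrt (9/16 * sq w)" by simp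
      also have "\<dots> = 3/4 * sqrt (sq w)"
        by (simp add: real_sqrt_mult real_sqrt_divide)
      finally have "sqrt (sq z) \<le> 3/4 * sqrt (sq w)" .
      moreover have "sqrt (sq w) \<le> sqrt (sq z) + sqrt (sq (z - w))"
        using sqrt_sq_triangle[of z "- (z - w)"] by (simp del: minus_diff_eq)
      ultimately have "sqrt (sq w) / 4 \<le> sqrt (sq (z - w))" by simp
      then have "(sqrt (sq w) / 4)\<^sup>2 \<le> (sqrt (sq (z - w)))\<^sup>2" by (intro power_mono) auto
      then show ?thesis by (simp add: power_divide)
    qed
    have Eb: "E z \<le> e1" if z: "sq z \<le> 9 * \<rho>" for z
    proof -
      have a: "sq w / 16 \<le> sq (z - w)" by (rule away[OF z])
      have "(A + sq (z - w)) powr (-b) \<le> \<rho> powr (-b)"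
        using a w \<rho> A b0 by (intro powr_neg_antimono) auto
      moreover have "(1 + k * (A + sq (z - w))) powr (-N) \<le> (\<epsilon> / 16 * (1 + sq w / \<rho>)) powr (-N)"
      proof (intro powr_neg_antimono)
        show "0 < \<epsilon> / 16 * (1 + sq w / \<rho>)" using \<epsilon> \<rho> by (simp add: add_pos_nonneg)
        have "\<epsilon> / 16 * (1 + sq w / \<rho>) = \<epsilon> / 16 + k * (sq w / 16)" by (simp add: k_def l_def algebra_simps)
        also have "\<dots> \<le> 1 + k * (A + sq (z - w))"
          using a A k \<epsilon> by (intro add_mono mult_left_mono) auto
        finally show "\<epsilon> / 16 * (1 + sq w / \<rho>) \<le> 1 + k * (A + sq (z - w))" .
      qed (use N in simp)
      moreover have "(\<epsilon> / 16 * (1 + sq w / \<rho>)) powr (-N) = (16 / \<epsilon>) powr N * (1 + sq w / \<rho>) powr (-N)"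
        using \<epsilon> \<rho> by (subst powr_mult) (auto simp: powr_minus powr_divide field_simps add_nonneg_nonneg)
      ultimately show ?thesis unfolding E_def kbar_def bar_def e1_def by (intro mult_mono) auto
    qed
    have T1: "0 \<le> T z \<and> T z \<le> 1" for z
      using mult_mono[OF cutoff_range(2)[of "-4" 1 \<rho> z] E1[of z]] E0[of z] cutoff_range(1)[of "-4" 1 \<rho> z]
      by (auto simp: T_def)
    have T2: "T z = 0" if "sq z \<le> 4 * \<rho>" for z
      using that \<rho> by (simp add: T_def cutoff_def clampsq_0 pos_divide_le_eq)
    have T3: "(1 - 1 / \<rho>) * srw T z + c * indicat_real {w} z
        \<le> T z + (if \<rho> \<le> sq z \<and> sq z \<le> 9 * \<rho> then C * \<rho> powr (-b-1) * (1 + sq w / \<rho>) powr (-N) else 0)" for z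
    proof -
      define X where "X = (if \<rho> \<le> sq z \<and> sq z \<le> 9 * \<rho> then (39 * e1 + 18 * (CL * e1)) / \<rho> else 0)"
      have X0: "0 \<le> X" using e1 CL \<rho> by (simp add: X_def)
      have "srw T z \<le> cutoff (-4) 1 \<rho> z * srw E z + X"
        unfolding T_def X_def
      proof (rule srw_cutoff_mult)
        fix z v :: "int^'d" assume v: "v \<in> nbrs" and z: "\<rho> \<le> sq z" "sq z \<le> 9 * \<rho>"
        have "\<bar>E (z + v) - E z\<bar> \<le> CL * (E z / sqrt (A + sq (z - w)))"
          using kbar_increment(1)[OF b0 N A k v, of "z - w"] by (simp add: E_def CL_def algebra_simps)
        also have "\<dots> \<le> CL * (e1 / sqrt \<rho>)"
          using CL Eb[OF z(2)] away[OF z(2)] w A \<rho> E0 e1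
          by (intro mult_left_mono frac_le) auto
        finally show "\<bar>E (z + v) - E z\<bar> \<le> CL * e1 / sqrt \<rho>" by simp
      qed (use \<rho> E0 Eb e1 CL in auto)
      then have "(1 - l) * srw T z \<le> (1 - l) * (cutoff (-4) 1 \<rho> z * srw E z + X)"
        using l by (intro mult_left_mono) auto
      also have "\<dots> = cutoff (-4) 1 \<rho> z * ((1 - l) * srw E z) + (1 - l) * X" by (simp add: algebra_simps)
      also have "(1 - l) * X \<le> X" using l X0 by (simp add: mult_left_le_one_le)
      also have "cutoff (-4) 1 \<rho> z * ((1 - l) * srw E z) \<le> cutoff (-4) 1 \<rho> z * (E z - c * indicat_real {w} z)"
      proof (intro mult_left_mono cutoff_range)
        have "srw E z = srw (kbar A b k N) (z - w)"
          using srw_shift[of "kbar A b k N" "- w" z] by (simp add: E_def[abs_def])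
        moreover have "indicat_real {0} (z - w) = indicat_real {w} z" by (simp add: indicator_def)
        ultimately show "(1 - l) * srw E z \<le> E z - c * indicat_real {w} z"
          using S[OF l, of "z - w"] by (simp add: E_def k_def)
      qed
      also have "\<dots> = T z - c * indicat_real {w} z"
      proof (cases "z = w")
        case True
        have "16 < sq w / \<rho>" using w \<rho> by (simp add: pos_less_divide_eq)
        then have "cutoff (-4) 1 \<rho> z = 1" using True by (simp add: cutoff_def clampsq_1)
        then show ?thesis by (simp add: T_def)
      qed (simp add: T_def)
      also have "X = (if \<rho> \<le> sq z \<and> sq z \<le> 9 * \<rho> then C * \<rho> powr (-b-1) * (1 + sq w / \<rho>) powr (-N) else 0)"
        using \<rho> by (simp add: X_def C_def e1_def powr_diff algebra_simps add_divide_distrib)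
      finally show ?thesis by (simp add: l_def)
    qed
    show "\<exists>T :: int^'d \<Rightarrow> real.
     (\<forall>z. 0 \<le> T z \<and> T z \<le> 1) \<and> (\<forall>z. sq z \<le> 4 * \<rho> \<longrightarrow> T z = 0) \<and>
     (\<forall>z. (1 - 1 / \<rho>) * srw T z + c * indicat_real {w} z
        \<le> T z + (if \<rho> \<le> sq z \<and> sq z \<le> 9 * \<rho> then C * \<rho> powr (-b-1) * (1 + sq w / \<rho>) powr (- real CARD('d)) else 0))"
      using T1 T2 T3 unfolding N_def by (intro exI[of _ T]) blast
  qed
qed

section \<open>Upper bound\<close>

locale brw_test = brw_kern K p \<phi> e c1 C1 f0 b Cg cg cb Bk
  for K :: "(int^'d::finite) set" and p \<phi> e c1 C1 f0 b Cg cg cb Bk +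
  fixes ct Ct cn Cn :: real
  assumes ct: "0 < ct" and Ct: "0 < Ct" and cn: "0 < cn" and Cn: "0 < Cn"
    and far: "4 \<le> \<rho> \<Longrightarrow> 16 * \<rho> < sq (w :: int^'d) \<Longrightarrow> \<exists>T :: int^'d \<Rightarrow> real.
     (\<forall>z. 0 \<le> T z \<and> T z \<le> 1) \<and> (\<forall>z. sq z \<le> 4 * \<rho> \<longrightarrow> T z = 0) \<and>
     (\<forall>z. (1 - 1 / \<rho>) * srw T z + ct * indicat_real {w} z
        \<le> T z + (if \<rho> \<le> sq z \<and> sq z \<le> 9 * \<rho> then Ct * \<rho> powr (-b-1) * (1 + sq w / \<rho>) powr (- real CARD('d)) else 0))"
    and near: "1 \<le> \<rho> \<Longrightarrow> \<rho> \<le> \<rho>' \<Longrightarrow> 4 \<le> \<rho>' \<Longrightarrow> \<exists>T :: int^'d \<Rightarrow> real.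
     (\<forall>z. 0 \<le> T z \<and> T z \<le> (\<rho> + sq z) powr (-b)) \<and> (\<forall>z. 5 * \<rho>' \<le> sq z \<longrightarrow> T z = 0) \<and>
     (\<forall>z. srw T z + (if sq z \<le> 4 * \<rho> then cn * \<rho> powr (-b-1) else 0)
        \<le> T z + (if \<rho>' \<le> sq z \<and> sq z \<le> 9 * \<rho>' then Cn * \<rho>' powr (-b-1) else 0))"
begin

text \<open>Finite supports give finite sums, which cancellation in \<open>ennreal\<close>
  requires.\<close>

lemma finite_support_An: "finite {z. f z \<noteq> 0} \<Longrightarrow> finite {z. (A ^^ n) f z \<noteq> 0}"
proof (induction n)
  case (Suc n)
  define S where "S = {z. (A ^^ n) f z \<noteq> 0}"
  have "{z. (A ^^ Suc n) f z \<noteq> 0} \<subseteq> (\<Union>v\<in>nbrs. (\<lambda>z. z - v) ` S)"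
  proof
    fix z assume "z \<in> {z. (A ^^ Suc n) f z \<noteq> 0}"
    then have "srw ((A ^^ n) f) z \<noteq> 0" by (auto simp: A_def)
    then obtain v where "v \<in> nbrs" "(A ^^ n) f (z + v) \<noteq> 0"
      using srw_const_nbrs[of "(A ^^ n) f" z 0] by blast
    then show "z \<in> (\<Union>v\<in>nbrs. (\<lambda>z. z - v) ` S)"
      by (intro UN_I[of v] image_eqI[of _ _ "z + v"]) (auto simp: S_def)
  qed
  moreover have "finite S" using Suc by (simp add: S_def)
  ultimately show ?case by (meson finite_UN_I finite_imageI finite_nbrs finite_subset)
qed simp

definition shell where "shell i = {y \<in> K. r2 i \<le> 1 + sq y \<and> 1 + sq y < r2 (i + 1)}"
text \<open>Hitting function of a shell, discounted so that only about r2 (i+2) steps count; the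
  discount also supplies the killing that \<open>far\<close> asks for. With the index i + 2 the
  shell lies within |y|^2 < \<rho>/4 for \<rho> = r2 (i+2), which leaves room for
  \<open>displacement\<close>.\<close>

definition U where "U i S z = (\<Sum>s<S. (1 - 1 / r2 (i + 2))^s * (A ^^ s) (indicat_real (shell i)) z)"

lemma shell_sub: "shell i \<subseteq> K" by (auto simp: shell_def)

lemma lam: "0 < 1 / r2 (i + 2)" "1 / r2 (i + 2) \<le> 1/16" "16 \<le> r2 (i + 2)"
proof -
  have "r2 (i + 2) = 16 * r2 i" by (simp add: r2_def power_add)
  then show "16 \<le> r2 (i + 2)" using r2_ge1[of i] by simp
  then show "0 < 1 / r2 (i + 2)" "1 / r2 (i + 2) \<le> 1/16" by (auto simp: field_simps)
qed

lemma U_nonneg: "0 \<le> U i S z"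
  unfolding U_def using lam[of i] by (intro sum_nonneg mult_nonneg_nonneg An_nonneg) auto

lemma U_le: "U i S z \<le> (\<Sum>s<S. (A ^^ s) (indicat_real (shell i)) z)"
  unfolding U_def
proof (rule sum_mono)
  fix s
  have "(1 - 1 / r2 (i + 2))^s \<le> 1" using lam[of i] by (intro power_le_one) auto
  then show "(1 - 1 / r2 (i + 2))^s * (A ^^ s) (indicat_real (shell i)) z \<le> (A ^^ s) (indicat_real (shell i)) z"
    by (intro mult_left_le_one_le An_nonneg) (use lam[of i] in auto)
qed

lemma U_le_p: "U i S z \<le> p z"
  using U_le[of i S z] p_partial_le[OF shell_sub[of i], where n=S and z=z] by linarith

text \<open>The shells are disjoint, so their hitting expansions add up to a part of that of K. This
  avoids a loss in the number of scales.\<close>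

lemma U_sum_le_p: "(\<Sum>i<n. U i S z) \<le> p z"
proof -
  have "(\<Sum>i<n. U i S z) \<le> (\<Sum>i<n. \<Sum>s<S. (A ^^ s) (indicat_real (shell i)) z)"
    by (intro sum_mono U_le)
  also have "\<dots> = (\<Sum>s<S. (A ^^ s) (\<lambda>z. \<Sum>i<n. indicat_real (shell i) z) z)"
    by (subst sum.swap) (simp add: An_sum)
  also have "\<dots> \<le> (\<Sum>s<S. (A ^^ s) (indicat_real K) z)"
  proof (intro sum_mono An_mono)
    fix z
    show "(\<Sum>i<n. indicat_real (shell i) z) \<le> indicat_real K z"
    proof (cases "\<exists>i<n. z \<in> shell i")
      case True
      then obtain i where i: "i < n" "z \<in> shell i" by blast
      have "z \<notin> shell j" if "j \<noteq> i" for j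
      proof
        assume z: "z \<in> shell j"
        have "i < j + 1"
        proof (rule ccontr)
          assume "\<not> ?thesis"
          then have "r2 (j + 1) \<le> r2 i" unfolding r2_def by (intro power_increasing) auto
          then show False using z i by (auto simp: shell_def)
        qed
        moreover have "j < i + 1"
        proof (rule ccontr)
          assume "\<not> ?thesis"
          then have "r2 (i + 1) \<le> r2 j" unfolding r2_def by (intro power_increasing) auto
          then show False using z i by (auto simp: shell_def)
        qed
        ultimately show False using that by simp
      qed
      then have "(\<Sum>j<n. indicat_real (shell j) z) = (\<Sum>j<n. if j = i then 1 else 0)"
        using i by (intro sum.cong) (auto simp: indicator_def)
      then show ?thesis using i shell_sub[of i] by (auto simp: indicator_def)
    next
      case False
      then show ?thesis by (auto simp: indicator_def)
    qed
  qed
  also have "\<dots> \<le> p z" by (intro p_partial_le) auto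
  finally show ?thesis .
qed

text \<open>The term s = 0 vanishes off the shell; after the index shift only the nonnegative last
  term is missing from the full sum.\<close>

lemma U_sub: "z \<notin> shell i \<Longrightarrow> U i S z \<le> (1 - 1 / r2 (i + 2)) * (B z * srw (U i S) z)"
proof (cases S)
  case 0
  have "U i 0 = (\<lambda>z. 0)" by (simp add: U_def[abs_def])
  then show ?thesis using 0 by simp
next
  case (Suc S')
  assume z: "z \<notin> shell i"
  let ?l = "1 - 1 / r2 (i + 2)"
  have l: "0 \<le> ?l" using lam[of i] by simp
  have "U i S z = (\<Sum>s<S'. ?l ^ Suc s * (A ^^ Suc s) (indicat_real (shell i)) z)"
    using z unfolding U_def Suc sum.lessThan_Suc_shift by simp
  also have "\<dots> = ?l * A (\<lambda>z. \<Sum>s<S'. ?l ^ s * (A ^^ s) (indicat_real (shell i)) z) z"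
    by (simp only: A_sum A_cmult sum_distrib_left power_Suc funpow.simps comp_apply mult.assoc)
  also have "\<dots> \<le> ?l * A (U i S) z"
  proof (intro mult_left_mono l A_mono)
    fix z show "(\<Sum>s<S'. ?l ^ s * (A ^^ s) (indicat_real (shell i)) z) \<le> U i S z"
      unfolding U_def Suc using l by (intro sum_mono2) (auto intro!: mult_nonneg_nonneg A_nonneg An_nonneg)
  qed
  finally show ?thesis by (simp add: A_def)
qed

lemma U_sub': "z \<notin> shell i \<Longrightarrow> U i S z \<le> (1 - 1 / r2 (i + 2)) * srw (U i S) z"
proof -
  assume z: "z \<notin> shell i"
  have "B z * srw (U i S) z \<le> srw (U i S) z"
    using mult_right_mono[OF B1[of z], of "srw (U i S) z"] by (simp add: srw_nonneg U_nonneg)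
  then have "(1 - 1 / r2 (i + 2)) * (B z * srw (U i S) z) \<le> (1 - 1 / r2 (i + 2)) * srw (U i S) z"
    using lam[of i] by (intro mult_left_mono) auto
  then show ?thesis using U_sub[OF z, of S] by linarith
qed

lemma U_finite: "finite {z. U i S z \<noteq> 0}"
proof -
  have "{z. U i S z \<noteq> 0} \<subseteq> (\<Union>s<S. {z. (A ^^ s) (indicat_real (shell i)) z \<noteq> 0})"
    by (auto simp: U_def elim!: sum.not_neutral_contains_not_neutral)
  moreover have "finite {z. (A ^^ s) (indicat_real (shell i)) z \<noteq> 0}" for s
  proof (rule finite_support_An)
    show "finite {z. indicat_real (shell i) z \<noteq> 0}"
      using finK by (rule finite_subset[rotated]) (auto simp: shell_def indicator_def)
  qed
  ultimately show ?thesis by (meson finite_UN_I finite_lessThan finite_subset)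
qed

text \<open>No point of the shell lies within distance sqrt(\<rho>)/2 of z for \<rho> = r2 (i+2), so
  \<open>displacement\<close> applies with this radius.\<close>

lemma U_displacement: "r2 (i + 2) \<le> sq z \<Longrightarrow> U i S z \<le> (4 * Cd + 1) * min (p z) (1 / r2 (i + 2))"
proof -
  assume z: "r2 (i + 2) \<le> sq z"
  define R where "R = sqrt (r2 (i + 2)) / 2"
  have R2: "R\<^sup>2 = r2 (i + 2) / 4" by (simp add: R_def power_divide less_imp_le[OF r2_pos])
  have "2 \<le> sqrt (r2 (i + 2))" by (rule real_le_rsqrt) (use lam(3)[of i] in simp)
  then have R1: "1 \<le> R" by (simp add: R_def)
  have "U i S z \<le> Cd / R\<^sup>2"
  proof (rule displacement[OF R1 U_nonneg U_le_p])
    fix x assume x: "sq (x - z) < R\<^sup>2"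
    have "sqrt (sq (x - z)) < R" using x R1 by (simp add: real_less_lsqrt)
    moreover have "sqrt (sq z) \<le> sqrt (sq x) + sqrt (sq (x - z))"
      using sqrt_sq_triangle[of x "- (x - z)"] by (simp del: minus_diff_eq)
    moreover have "2 * R \<le> sqrt (sq z)" using z by (simp add: R_def)
    ultimately have "R < sqrt (sq x)" by linarith
    then have "R\<^sup>2 < (sqrt (sq x))\<^sup>2" using R1 by (intro power_strict_mono) auto
    then have "r2 (i + 2) / 4 < sq x" by (simp add: R2)
    then have "x \<notin> shell i" by (auto simp: shell_def r2_def)
    then have "U i S x \<le> (1 - 1 / r2 (i + 2)) * (B x * srw (U i S) x)" by (rule U_sub)
    also have "\<dots> \<le> B x * srw (U i S) x"
      using lam[of i] by (intro mult_left_le_one_le mult_nonneg_nonneg B0 srw_nonneg U_nonneg) auto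
    finally show "U i S x \<le> B x * srw (U i S) x" .
  qed
  also have "\<dots> = 4 * Cd * (1 / r2 (i + 2))" by (simp add: R2)
  also have "\<dots> \<le> (4 * Cd + 1) * (1 / r2 (i + 2))" using lam[of i] by (intro mult_right_mono) auto
  finally have 1: "U i S z \<le> (4 * Cd + 1) * (1 / r2 (i + 2))" .
  have "p z \<le> (4 * Cd + 1) * p z" using Cd p0[of z] by (simp add: distrib_right)
  then have 2: "U i S z \<le> (4 * Cd + 1) * p z" using U_le_p[of i S z] by linarith
  show ?thesis using 1 2 by (auto simp: min_def)
qed

text \<open>On the support of T, U is a killed subsolution, and T is a killed supersolution up to
  its annulus. By self-adjointness both pairings contain the same term X; cancelling it leaves the
  value at w against the annulus.\<close>

lemma U_far:
  assumes w: "16 * r2 (i + 2) < sq w"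
  shows "ennreal (ct * U i S w) \<le> ennreal (Ct * r2 (i + 2) powr (-b-1) * (1 + sq w / r2 (i + 2)) powr (- real CARD('d)))
     * tot (\<lambda>z. if sq z \<le> 16 * r2 (i + 2) then (4 * Cd + 1) * min (p z) (1 / r2 (i + 2)) else 0)"
proof -
  define \<rho> where "\<rho> = r2 (i + 2)"
  have \<rho>: "16 \<le> \<rho>" using lam[of i] by (simp add: \<rho>_def)
  define q where "q = Ct * \<rho> powr (-b-1) * (1 + sq w / \<rho>) powr (- real CARD('d))"
  have q: "0 \<le> q" using Ct by (simp add: q_def)
  obtain T where T01: "\<And>z. 0 \<le> T z" "\<And>z. T z \<le> 1" and T0: "\<And>z. sq z \<le> 4 * \<rho> \<Longrightarrow> T z = 0"
    and T: "\<And>z. (1 - 1 / \<rho>) * srw T z + ct * indicat_real {w} z \<le> T z + (if \<rho> \<le> sq z \<and> sq z \<le> 9 * \<rho> then q else 0)"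
    using far[of \<rho> w] w \<rho> unfolding \<rho>_def[symmetric] q_def by auto
  let ?U = "U i S"
  let ?G = "\<lambda>z. if sq z \<le> 16 * \<rho> then (4 * Cd + 1) * min (p z) (1 / \<rho>) else 0"
  have l0: "0 \<le> 1 - 1 / \<rho>" using \<rho> by simp
  define X where "X = tot (\<lambda>z. ?U z * ((1 - 1 / \<rho>) * srw T z))"
  \<comment> \<open>The cancellation at the end is legitimate only for finite X.\<close>
  have Xfin: "X \<noteq> \<top>" unfolding X_def
    using tot_finite_support[of "\<lambda>z. ?U z * ((1 - 1 / \<rho>) * srw T z)"] U_finite[of i S]
    by (auto intro: finite_subset[rotated] simp: less_top)
  have UT: "tot (\<lambda>z. ?U z * T z) \<le> X"
  proof -
    have "tot (\<lambda>z. ?U z * T z) \<le> tot (\<lambda>z. (1 - 1 / \<rho>) * (srw ?U z * T z))"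
    proof (rule tot_mono)
      fix z
      show "?U z * T z \<le> (1 - 1 / \<rho>) * (srw ?U z * T z)"
      proof (cases "sq z \<le> 4 * \<rho>")
        case True
        then show ?thesis by (simp add: T0)
      next
        case False
        then have "z \<notin> shell i" using \<rho> by (auto simp: shell_def \<rho>_def r2_def)
        from mult_right_mono[OF U_sub'[OF this, of S] T01(1)[of z]] show ?thesis
          by (simp add: \<rho>_def mult_ac)
      qed
    qed
    also have "\<dots> = ennreal (1 - 1 / \<rho>) * tot (\<lambda>z. ?U z * srw T z)"
      using l0 tot_srw_swap[of ?U T] by (simp add: tot_cmult U_nonneg T01)
    also have "\<dots> = X" unfolding X_def using l0
      by (subst tot_cmult[symmetric]) (auto simp: mult_ac)
    finally show ?thesis .
  qed
  have "X + ennreal (ct * ?U w) = tot (\<lambda>z. ?U z * ((1 - 1 / \<rho>) * srw T z) + ct * (indicat_real {w} z * ?U z))"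
    unfolding X_def using l0 ct
    by (subst tot_add)
       (auto simp: U_nonneg tot_cmult tot_indicator ennreal_mult T01 intro!: mult_nonneg_nonneg srw_nonneg)
  also have "\<dots> \<le> tot (\<lambda>z. ?U z * T z + q * ?G z)"
  proof (rule tot_mono)
    fix z
    have "?U z * ((1 - 1 / \<rho>) * srw T z + ct * indicat_real {w} z) \<le> ?U z * (T z + (if \<rho> \<le> sq z \<and> sq z \<le> 9 * \<rho> then q else 0))"
      by (intro mult_left_mono T U_nonneg)
    moreover have "?U z * (if \<rho> \<le> sq z \<and> sq z \<le> 9 * \<rho> then q else 0) \<le> q * ?G z"
    proof (cases "\<rho> \<le> sq z \<and> sq z \<le> 9 * \<rho>")
      case True
      then have "?U z \<le> ?G z" using U_displacement[of i z S] \<rho> by (auto simp: \<rho>_def)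
      then have "q * ?U z \<le> q * ?G z" using q by (rule mult_left_mono)
      then show ?thesis using True by (simp add: mult.commute)
    next
      case False
      have "0 \<le> ?G z" using Cd \<rho> p0[of z] by auto
      then show ?thesis using False q by auto
    qed
    ultimately show "?U z * ((1 - 1 / \<rho>) * srw T z) + ct * (indicat_real {w} z * ?U z) \<le> ?U z * T z + q * ?G z"
      by (simp add: distrib_left mult_ac)
  qed
  also have "\<dots> = tot (\<lambda>z. ?U z * T z) + ennreal q * tot ?G"
    using q Cd \<rho> p0 by (subst tot_add) (auto simp: U_nonneg T01 tot_cmult)
  also have "\<dots> \<le> X + ennreal q * tot ?G" by (intro add_right_mono UT)
  finally have "ennreal (ct * ?U w) \<le> ennreal q * tot ?G"
    using Xfin by (simp add: ennreal_add_left_cancel_le)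
  then show ?thesis by (simp only: q_def \<rho>_def)
qed

lemma M_e_le: "M i e \<le> Bk * r2 i * mm i"
proof -
  have "M i e \<le> (\<Sum>t\<in>blk i. mm i)"
    unfolding M_def mm_def by (intro sum_mono) (simp add: m_def[symmetric] m_mono blk_def)
  also have "\<dots> = card (blk i) * mm i" by simp
  also have "\<dots> \<le> (Bk * r2 i) * mm i"
  proof (intro mult_right_mono mm0)
    have "card (blk i) \<le> Bk * 4^i" by (simp add: blk_def)
    then have "real (card (blk i)) \<le> real (Bk * 4^i)" by (simp only: of_nat_le_iff)
    then show "card (blk i) \<le> real Bk * r2 i" by (simp add: r2_def)
  qed
  finally show ?thesis .
qed

text \<open>The first dyadic ball that contains w is enough: its index satisfies 4^j \<le> 1 +
  |w|^2/\<rho>.\<close>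

lemma weight_decomp:
  assumes "0 < \<rho>"
  shows "ennreal ((1 + sq w / \<rho>) powr (- real CARD('d)) * e w) \<le>
     (\<Sum>j. ennreal (if sq w \<le> 16 * (\<rho> * 4^j) then (4^j) powr (- real CARD('d)) * e w else 0))"
proof -
  define j where "j = (LEAST j. sq w \<le> 16 * (\<rho> * 4^j))"
  have ex: "\<exists>j. sq w \<le> 16 * (\<rho> * 4^j)"
  proof -
    obtain j where "sq w / (16 * \<rho>) < 4^j" using real_arch_pow[of 4 "sq w / (16 * \<rho>)"] by auto
    then show ?thesis using assms by (intro exI[of _ j]) (simp add: field_simps)
  qed
  then have j: "sq w \<le> 16 * (\<rho> * 4^j)" unfolding j_def by (rule LeastI_ex)
  have "4^j \<le> 1 + sq w / \<rho>"
  proof (cases j)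
    case 0
    then show ?thesis using assms by simp
  next
    case (Suc j')
    then have "j' < (LEAST j. sq w \<le> 16 * (\<rho> * 4^j))" by (simp add: j_def)
    then have "\<not> sq w \<le> 16 * (\<rho> * 4^j')" by (rule not_less_Least)
    then have "4 * 4^j \<le> sq w / \<rho>" using assms Suc by (simp add: field_simps)
    then show ?thesis by (smt (verit) zero_le_power)
  qed
  then have "(1 + sq w / \<rho>) powr (- real CARD('d)) \<le> (4^j) powr (- real CARD('d))"
    by (intro powr_neg_antimono) auto
  then have "ennreal ((1 + sq w / \<rho>) powr (- real CARD('d)) * e w) \<le> ennreal ((4^j) powr (- real CARD('d)) * e w)"
    by (intro ennreal_leI mult_right_mono e0)
  also have "\<dots> = (\<Sum>k\<in>{j}. ennreal (if sq w \<le> 16 * (\<rho> * 4^k) then (4^k) powr (- real CARD('d)) * e w else 0))"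
    using j by simp
  also have "\<dots> \<le> (\<Sum>k. ennreal (if sq w \<le> 16 * (\<rho> * 4^k) then (4^k) powr (- real CARD('d)) * e w else 0))"
    by (intro sum_le_suminf) auto
  finally show ?thesis .
qed

text \<open>A ball sum of e at squared radius R is at most of order R^(b+1) times the mean of e at
  that scale. The decay power d leaves (4^j)^(b+1-d) = (4^j)^(-d/2), which is at most
  4^(-j).\<close>

lemma weight_sum:
  "ennreal (r2 k powr (-b-1)) * tot (\<lambda>w. (1 + sq w / r2 k) powr (- real CARD('d)) * e w) \<le> (\<Sum>j. ennreal (Bk / cb * (1/4)^j * mm (k + j)))"
proof -
  have "tot (\<lambda>w. (1 + sq w / r2 k) powr (- real CARD('d)) * e w) \<le>
    (\<integral>\<^sup>+w. (\<Sum>j. ennreal (if sq w \<le> 16 * (r2 k * 4^j) then (4^j) powr (- real CARD('d)) * e w else 0)) \<partial>count_space UNIV)"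
    unfolding tot_def by (intro nn_integral_mono weight_decomp) simp
  also have "\<dots> = (\<Sum>j. tot (\<lambda>w. if sq w \<le> 16 * (r2 k * 4^j) then (4^j) powr (- real CARD('d)) * e w else 0))"
    unfolding tot_def by (rule nn_integral_suminf) auto
  finally have "ennreal (r2 k powr (-b-1)) * tot (\<lambda>w. (1 + sq w / r2 k) powr (- real CARD('d)) * e w) \<le>
     ennreal (r2 k powr (-b-1)) * (\<Sum>j. tot (\<lambda>w. if sq w \<le> 16 * (r2 k * 4^j) then (4^j) powr (- real CARD('d)) * e w else 0))"
    by (intro mult_left_mono) auto
  also have "\<dots> = (\<Sum>j. ennreal (r2 k powr (-b-1)) * tot (\<lambda>w. if sq w \<le> 16 * (r2 k * 4^j) then (4^j) powr (- real CARD('d)) * e w else 0))"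
    by (rule ennreal_suminf_cmult[symmetric])
  also have "\<dots> \<le> (\<Sum>j. ennreal (Bk / cb * (1/4)^j * mm (k + j)))"
  proof (intro suminf_le summableI)
    fix j
    define R where "R = r2 (k + j)"
    have R: "R = r2 k * 4^j" by (simp add: R_def r2_def power_add)
    have R0: "0 < R" by (simp add: R_def)
    define q :: real where "q = (4^j) powr (b + 1) * (4^j) powr (- real CARD('d)) / R"
    have q0: "0 \<le> q" using R0 by (simp add: q_def)
    have q: "q * R \<le> (1/4)^j"
    proof -
      have "q * R = (4^j) powr (b + 1 - real CARD('d))" using R0 by (simp add: q_def powr_add[symmetric])
      also have "\<dots> \<le> (4^j) powr (-1)" using d5 by (intro powr_mono) (auto simp: b_eq field_simps)
      also have "\<dots> = (1/4)^j" by (simp add: powr_minus power_one_over inverse_eq_divide)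
      finally show ?thesis .
    qed
    have eq: "r2 k powr (-b-1) * ((4^j) powr (- real CARD('d)) * e w) = q * (R powr (-b) * e w)" for w
    proof -
      have "r2 k powr (-b-1) = R powr (-b-1) * (4^j) powr (b+1)"
        unfolding R by (subst powr_mult) (auto simp: powr_add[symmetric] mult.assoc)
      also have "R powr (-b-1) = R powr (-b) / R" using R0 by (simp add: powr_diff)
      finally show ?thesis by (simp add: q_def)
    qed
    have "ennreal (r2 k powr (-b-1)) * tot (\<lambda>w. if sq w \<le> 16 * (r2 k * 4^j) then (4^j) powr (- real CARD('d)) * e w else 0)
      = tot (\<lambda>w. r2 k powr (-b-1) * (if sq w \<le> 16 * R then (4^j) powr (- real CARD('d)) * e w else 0))"
      by (subst tot_cmult) (auto simp: R)
    also have "\<dots> = tot (\<lambda>w. q * (if sq w \<le> 16 * R then R powr (-b) * e w else 0))"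
      by (intro arg_cong[of _ _ tot] ext) (simp add: eq)
    also have "\<dots> = ennreal q * tot (\<lambda>w. if sq w \<le> 16 * R then R powr (-b) * e w else 0)"
      by (rule tot_cmult[OF q0])
    also have "\<dots> \<le> ennreal q * ennreal (1 / cb * M (k + j) e)"
      unfolding R_def by (intro mult_left_mono ball_le_M e0) simp
    also have "\<dots> = ennreal (q * (1 / cb * M (k + j) e))"
      using q0 cb by (intro ennreal_mult[symmetric] mult_nonneg_nonneg M_nonneg e0) auto
    also have "\<dots> \<le> ennreal (Bk / cb * (1/4)^j * mm (k + j))"
    proof (rule ennreal_leI)
      have "q * (1 / cb * M (k + j) e) \<le> q * (1 / cb * (Bk * R * mm (k + j)))"
        unfolding R_def using q0 cb by (intro mult_left_mono M_e_le) auto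
      also have "\<dots> = (q * R) * (Bk / cb * mm (k + j))" by simp
      also have "\<dots> \<le> (1/4)^j * (Bk / cb * mm (k + j))"
        using cb mm0 by (intro mult_right_mono q) auto
      finally show "q * (1 / cb * M (k + j) e) \<le> Bk / cb * (1/4)^j * mm (k + j)" by (simp add: mult_ac)
    qed
    finally show "ennreal (r2 k powr (-b-1)) * tot (\<lambda>w. if sq w \<le> 16 * (r2 k * 4^j) then (4^j) powr (- real CARD('d)) * e w else 0) \<le> ennreal (Bk / cb * (1/4)^j * mm (k + j))" .
  qed
  finally show ?thesis .
qed

end

context brw_test
begin

text \<open>Every iterate of \<open>A\<close> keeps the mass against e, so U carries the mass of the
  shell times a geometric sum, at least \<rho>/2 once the discount has fallen to 1/2. This is the
  factor of order r^2 between the two exponents.\<close>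

lemma shell_tot:
  assumes S: "(1 - 1 / r2 (i + 2))^S \<le> 1/2"
  shows "tot (\<lambda>z. indicat_real (shell i) z * e z) \<le> ennreal (2 / r2 (i + 2)) * tot (\<lambda>z. U i S z * e z)"
proof -
  define \<rho> where "\<rho> = r2 (i + 2)"
  define l where "l = 1 - 1 / \<rho>"
  have \<rho>: "16 \<le> \<rho>" using lam[of i] by (simp add: \<rho>_def)
  have l: "0 \<le> l" "l \<noteq> 1" using \<rho> by (simp_all add: l_def)
  let ?I = "tot (\<lambda>z. indicat_real (shell i) z * e z)"
  have gsum: "\<rho> / 2 \<le> (\<Sum>s<S. l^s)"
  proof -
    have "(\<Sum>s<S. l^s) = (1 - l^S) / (1 - l)" using l(2) by (simp add: sum_gp_strict)
    also have "1 - l = 1 / \<rho>" by (simp add: l_def)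
    finally have "(\<Sum>s<S. l^s) = \<rho> * (1 - l^S)" by simp
    moreover have "\<rho> * (1/2) \<le> \<rho> * (1 - l^S)"
      using S \<rho> unfolding l_def \<rho>_def by (intro mult_left_mono) auto
    ultimately show ?thesis by simp
  qed
  have "tot (\<lambda>z. U i S z * e z) = tot (\<lambda>z. \<Sum>s<S. l^s * ((A ^^ s) (indicat_real (shell i)) z * e z))"
    by (simp add: U_def l_def \<rho>_def sum_distrib_right mult.assoc)
  also have "\<dots> = (\<Sum>s<S. tot (\<lambda>z. l^s * ((A ^^ s) (indicat_real (shell i)) z * e z)))"
    using l by (intro tot_sum mult_nonneg_nonneg An_nonneg e0) auto
  also have "\<dots> = (\<Sum>s<S. ennreal (l^s) * ?I)"
    using l by (intro sum.cong refl) (simp add: tot_cmult tot_An)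
  also have "\<dots> = ennreal (\<Sum>s<S. l^s) * ?I"
    using l by (simp add: sum_distrib_right[symmetric])
  finally have eq: "tot (\<lambda>z. U i S z * e z) = ennreal (\<Sum>s<S. l^s) * ?I" .
  have "?I = ennreal (2 / \<rho> * (\<rho> / 2)) * ?I" using \<rho> by simp
  also have "\<dots> \<le> ennreal (2 / \<rho> * (\<Sum>s<S. l^s)) * ?I"
    using gsum \<rho> by (intro mult_right_mono ennreal_leI mult_left_mono) auto
  also have "\<dots> = ennreal (2 / \<rho>) * tot (\<lambda>z. U i S z * e z)"
    unfolding eq using \<rho> l by (subst ennreal_mult) (auto simp: mult.assoc intro!: sum_nonneg)
  finally show ?thesis by (simp add: \<rho>_def)
qed

lemma ex_shell:
  assumes "z \<in> K" "1 + sq z < r2 n"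
  shows "\<exists>i<n. z \<in> shell i"
proof -
  define j where "j = (LEAST j. 1 + sq z < r2 j)"
  have j: "1 + sq z < r2 j" unfolding j_def using assms(2) by (rule LeastI)
  have jn: "j \<le> n" unfolding j_def using assms(2) by (rule Least_le)
  have "j \<noteq> 0"
  proof
    assume "j = 0"
    then show False using j sq_nonneg[of z] by (simp add: r2_def)
  qed
  then obtain i where i: "j = Suc i" by (cases j) auto
  then have "i < (LEAST j. 1 + sq z < r2 j)" by (simp add: j_def)
  then have "\<not> 1 + sq z < r2 i" by (rule not_less_Least)
  then show ?thesis using i j jn assms(1) by (intro exI[of _ i]) (auto simp: shell_def)
qed

text \<open>\<open>U_far\<close> factors into a ball sum of min(p, 1/\<rho>) and a weight in w.
  Summing the weight against e yields the products of \<open>mm (i + 2 + j)\<close> and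
  \<open>M (i + 2)\<close> for which \<open>scale_sum\<close> is made.\<close>

lemma far_tot:
  "ennreal (r2 (i + 2) powr (-b)) * tot (\<lambda>w. (if 16 * r2 (i + 2) < sq w then U i S w else 0) * e w) \<le>
    (\<Sum>j. ennreal (Ct / ct * (4 * Cd + 1) / cb * Bk / cb * ((1/4)^j * (mm (i + 2 + j) * M (i + 2) (\<lambda>z. min (p z) (1 / r2 (i + 2)))))))"
proof -
  define \<rho> where "\<rho> = r2 (i + 2)"
  have \<rho>: "16 \<le> \<rho>" using lam[of i] by (simp add: \<rho>_def)
  let ?min = "\<lambda>z. min (p z) (1 / \<rho>)"
  let ?Q = "\<lambda>w. (1 + sq w / \<rho>) powr (- real CARD('d)) * e w"
  define \<Theta> where "\<Theta> = tot (\<lambda>z. if sq z \<le> 16 * \<rho> then (4 * Cd + 1) * ?min z else 0)"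
  have min0: "0 \<le> ?min z" for z using \<rho> p0[of z] by simp
  have pt: "ennreal ((if 16 * \<rho> < sq w then U i S w else 0) * e w) \<le> ennreal (Ct / ct * \<rho> powr (-b-1) * ?Q w) * \<Theta>" for w
  proof (cases "16 * \<rho> < sq w")
    case True
    have "ennreal (U i S w * e w) = ennreal (e w / ct) * ennreal (ct * U i S w)"
      using ct e0[of w] by (subst ennreal_mult[symmetric]) (auto simp: U_nonneg)
    also have "\<dots> \<le> ennreal (e w / ct) * (ennreal (Ct * \<rho> powr (-b-1) * (1 + sq w / \<rho>) powr (- real CARD('d))) * \<Theta>)"
      using U_far[of i w S] True unfolding \<Theta>_def \<rho>_def by (intro mult_left_mono) auto
    also have "\<dots> = ennreal (e w / ct * (Ct * \<rho> powr (-b-1) * (1 + sq w / \<rho>) powr (- real CARD('d)))) * \<Theta>"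
      using ct Ct e0[of w] by (subst ennreal_mult) (auto simp: mult.assoc)
    also have "e w / ct * (Ct * \<rho> powr (-b-1) * (1 + sq w / \<rho>) powr (- real CARD('d))) = Ct / ct * \<rho> powr (-b-1) * ?Q w"
      by simp
    finally show ?thesis using True by simp
  qed simp
  have th: "ennreal (\<rho> powr (-b)) * \<Theta> \<le> ennreal ((4 * Cd + 1) / cb * M (i + 2) ?min)"
  proof -
    have "ennreal (\<rho> powr (-b)) * \<Theta> = tot (\<lambda>z. \<rho> powr (-b) * (if sq z \<le> 16 * \<rho> then (4 * Cd + 1) * ?min z else 0))"
      unfolding \<Theta>_def by (rule tot_cmult[symmetric]) simp
    also have "\<dots> = tot (\<lambda>z. (4 * Cd + 1) * (if sq z \<le> 16 * \<rho> then \<rho> powr (-b) * ?min z else 0))"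
      by (intro arg_cong[of _ _ tot] ext) simp
    also have "\<dots> = ennreal (4 * Cd + 1) * tot (\<lambda>z. if sq z \<le> 16 * \<rho> then \<rho> powr (-b) * ?min z else 0)"
      using Cd by (intro tot_cmult) auto
    also have "\<dots> \<le> ennreal (4 * Cd + 1) * ennreal (1 / cb * M (i + 2) ?min)"
      unfolding \<rho>_def by (intro mult_left_mono ball_le_M) (use min0 in \<open>auto simp: \<rho>_def\<close>)
    also have "\<dots> = ennreal ((4 * Cd + 1) * (1 / cb * M (i + 2) ?min))"
      using Cd cb by (intro ennreal_mult[symmetric] mult_nonneg_nonneg M_nonneg min0) auto
    finally show ?thesis by simp
  qed
  have ws: "ennreal (\<rho> powr (-b-1)) * tot ?Q \<le> (\<Sum>j. ennreal (Bk / cb * (1/4)^j * mm (i + 2 + j)))"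
    unfolding \<rho>_def by (rule weight_sum)
  have "tot (\<lambda>w. (if 16 * \<rho> < sq w then U i S w else 0) * e w) \<le> (\<integral>\<^sup>+w. ennreal (Ct / ct * \<rho> powr (-b-1) * ?Q w) * \<Theta> \<partial>count_space UNIV)"
    unfolding tot_def by (intro nn_integral_mono pt)
  also have "\<dots> = tot (\<lambda>w. Ct / ct * \<rho> powr (-b-1) * ?Q w) * \<Theta>"
    unfolding tot_def by (rule nn_integral_multc) auto
  also have "tot (\<lambda>w. Ct / ct * \<rho> powr (-b-1) * ?Q w) = ennreal (Ct / ct * \<rho> powr (-b-1)) * tot ?Q"
    using Ct ct by (intro tot_cmult) auto
  also have "\<dots> = ennreal (Ct / ct) * (ennreal (\<rho> powr (-b-1)) * tot ?Q)"
    using Ct ct by (subst ennreal_mult) (auto simp: mult.assoc)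
  finally have 1: "tot (\<lambda>w. (if 16 * \<rho> < sq w then U i S w else 0) * e w) \<le> ennreal (Ct / ct) * (ennreal (\<rho> powr (-b-1)) * tot ?Q) * \<Theta>" .
  define X where "X = Ct / ct * ((4 * Cd + 1) / cb * M (i + 2) ?min)"
  have Y0: "0 \<le> (4 * Cd + 1) / cb * M (i + 2) ?min"
    using Cd cb by (intro mult_nonneg_nonneg M_nonneg min0) auto
  have X0: "0 \<le> X" unfolding X_def using Ct ct Cd cb by (intro mult_nonneg_nonneg M_nonneg min0) auto
  have "ennreal (\<rho> powr (-b)) * tot (\<lambda>w. (if 16 * \<rho> < sq w then U i S w else 0) * e w)
    \<le> ennreal (\<rho> powr (-b)) * (ennreal (Ct / ct) * (ennreal (\<rho> powr (-b-1)) * tot ?Q) * \<Theta>)"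
    by (intro mult_left_mono 1) simp
  also have "\<dots> = ennreal (Ct / ct) * (ennreal (\<rho> powr (-b)) * \<Theta>) * (ennreal (\<rho> powr (-b-1)) * tot ?Q)"
    by (simp only: mult_ac)
  also have "\<dots> \<le> ennreal (Ct / ct) * ennreal ((4 * Cd + 1) / cb * M (i + 2) ?min) * (\<Sum>j. ennreal (Bk / cb * (1/4)^j * mm (i + 2 + j)))"
    by (intro mult_mono th ws) auto
  also have "\<dots> = ennreal X * (\<Sum>j. ennreal (Bk / cb * (1/4)^j * mm (i + 2 + j)))"
    unfolding X_def by (subst ennreal_mult[OF _ Y0]) (use Ct ct in auto)
  also have "\<dots> = (\<Sum>j. ennreal X * ennreal (Bk / cb * (1/4)^j * mm (i + 2 + j)))"
    by (rule ennreal_suminf_cmult[symmetric])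
  also have "\<dots> = (\<Sum>j. ennreal (X * (Bk / cb * (1/4)^j * mm (i + 2 + j))))"
    using X0 cb mm0 by (intro suminf_cong ennreal_mult[symmetric]) auto
  also have "\<dots> = (\<Sum>j. ennreal (Ct / ct * (4 * Cd + 1) / cb * Bk / cb * ((1/4)^j * (mm (i + 2 + j) * M (i + 2) ?min))))"
    by (intro suminf_cong arg_cong[of _ _ ennreal]) (simp add: X_def mult_ac)
  finally show ?thesis by (simp only: \<rho>_def)
qed

lemma geometric_linear: "(\<Sum>j. ennreal ((1/4)^j * (1 + real j))) \<le> 2"
proof -
  have "(\<Sum>j. ennreal ((1/4)^j * (1 + real j))) \<le> (\<Sum>j. ennreal ((1/2)^j))"
  proof (intro suminf_le summableI ennreal_leI)
    fix j :: nat
    have "1 + j \<le> 2^j" using Suc_leI[OF less_exp[of j]] by simp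
    then have "real (1 + j) \<le> 2^j" by (metis of_nat_le_iff of_nat_numeral of_nat_power)
    then have "(1/4)^j * (1 + real j) \<le> (1/4)^j * 2^j" by (intro mult_left_mono) auto
    also have "\<dots> = (1/2)^j" by (simp add: power_mult_distrib[symmetric])
    finally show "(1/4)^j * (1 + real j) \<le> (1/2)^j" .
  qed
  also have "\<dots> = ennreal (\<Sum>j. (1/2)^j)"
    by (intro suminf_ennreal2) (auto intro: summable_geometric)
  also have "(\<Sum>j. (1/2::real)^j) = 2" by (subst suminf_geometric) auto
  finally show ?thesis by simp
qed

definition Cf where "Cf = Ct / ct * (4 * Cd + 1) / cb * Bk / cb"
definition CU where "CU = 2 * 16 powr (b - 1) * (17 powr b * (2 / c1 / cg) + Cf * C4 * 2)"

text \<open>With the sums over i and j exchanged, \<open>scale_sum\<close> bounds each inner sum by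
  C4 (1 + j), which is summable against 4^(-j).\<close>

lemma far_tot_sum:
  "(\<Sum>i<n. ennreal (r2 (i + 2) powr (-b)) * tot (\<lambda>w. (if 16 * r2 (i + 2) < sq w then U i S w else 0) * e w)) \<le> ennreal (Cf * C4 * 2)"
proof -
  let ?g = "\<lambda>i. M i (\<lambda>z. min (p z) (1 / r2 i))"
  have Cf: "0 \<le> Cf" using Ct ct Cd cb by (simp add: Cf_def)
  have g0: "0 \<le> ?g i" for i by (intro M_nonneg) (simp add: p0 less_imp_le)
  have "(\<Sum>i<n. ennreal (r2 (i + 2) powr (-b)) * tot (\<lambda>w. (if 16 * r2 (i + 2) < sq w then U i S w else 0) * e w))
    \<le> (\<Sum>i<n. \<Sum>j. ennreal (Cf * ((1/4)^j * (mm (i + 2 + j) * ?g (i + 2)))))"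
    unfolding Cf_def by (intro sum_mono far_tot)
  also have "\<dots> = (\<Sum>j. \<Sum>i<n. ennreal (Cf * ((1/4)^j * (mm (i + 2 + j) * ?g (i + 2)))))"
    by (rule suminf_sum[symmetric]) auto
  also have "\<dots> \<le> (\<Sum>j. ennreal (Cf * C4) * ennreal ((1/4)^j * (1 + real j)))"
  proof (intro suminf_le summableI)
    fix j
    have "(\<Sum>i<n. ennreal (Cf * ((1/4)^j * (mm (i + 2 + j) * ?g (i + 2))))) = ennreal (\<Sum>i<n. Cf * ((1/4)^j * (mm (i + 2 + j) * ?g (i + 2))))"
      using Cf mm0 g0 by (intro sum_ennreal) (auto intro!: mult_nonneg_nonneg)
    also have "\<dots> \<le> ennreal (Cf * C4 * ((1/4)^j * (1 + real j)))"
    proof (rule ennreal_leI)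
      have "(\<Sum>i<n. mm (i + 2 + j) * ?g (i + 2)) = (\<Sum>i=2..<n+2. mm (i + j) * ?g i)"
        by (rule sum.reindex_bij_witness[of _ "\<lambda>i. i - 2" "\<lambda>i. i + 2"]) auto
      also have "\<dots> \<le> (\<Sum>i<n+2. mm (i + j) * ?g i)"
        using mm0 g0 by (intro sum_mono2) (auto intro!: mult_nonneg_nonneg)
      also have "\<dots> \<le> C4 * (1 + j)" by (rule scale_sum)
      finally have "Cf * ((1/4)^j * (\<Sum>i<n. mm (i + 2 + j) * ?g (i + 2))) \<le> Cf * ((1/4)^j * (C4 * (1 + j)))"
        using Cf by (intro mult_left_mono) auto
      then show "(\<Sum>i<n. Cf * ((1/4)^j * (mm (i + 2 + j) * ?g (i + 2)))) \<le> Cf * C4 * ((1/4)^j * (1 + real j))"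
        by (simp add: sum_distrib_left mult_ac)
    qed
    also have "\<dots> = ennreal (Cf * C4) * ennreal ((1/4)^j * (1 + real j))"
      using Cf C4 by (intro ennreal_mult) auto
    finally show "(\<Sum>i<n. ennreal (Cf * ((1/4)^j * (mm (i + 2 + j) * ?g (i + 2))))) \<le> ennreal (Cf * C4) * ennreal ((1/4)^j * (1 + real j))" .
  qed
  also have "\<dots> = ennreal (Cf * C4) * (\<Sum>j. ennreal ((1/4)^j * (1 + real j)))" by (rule ennreal_suminf_cmult)
  also have "\<dots> \<le> ennreal (Cf * C4) * 2" by (intro mult_left_mono geometric_linear) simp
  also have "\<dots> = ennreal (Cf * C4 * 2)" using Cf C4 by (subst ennreal_mult) auto
  finally show ?thesis .
qed

text \<open>For |w|^2 \<le> 16 r2 one has 1 + |w|^2 \<le> 17 r2, so r2^(-b) is at most 17^b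
  \<open>bar 1 b w\<close>. The U then add up to at most p, and one application of
  \<open>tot_pe\<close> covers all scales.\<close>

lemma near_tot_sum:
  "(\<Sum>i<n. ennreal (r2 (i + 2) powr (-b)) * tot (\<lambda>w. (if 16 * r2 (i + 2) < sq w then 0 else U i S w) * e w)) \<le> ennreal (17 powr b * (2 / c1 / cg))"
proof -
  have "(\<Sum>i<n. ennreal (r2 (i + 2) powr (-b)) * tot (\<lambda>w. (if 16 * r2 (i + 2) < sq w then 0 else U i S w) * e w))
    = (\<Sum>i<n. tot (\<lambda>w. r2 (i + 2) powr (-b) * ((if 16 * r2 (i + 2) < sq w then 0 else U i S w) * e w)))"
    by (intro sum.cong refl tot_cmult[symmetric]) simp
  also have "\<dots> = tot (\<lambda>w. \<Sum>i<n. r2 (i + 2) powr (-b) * ((if 16 * r2 (i + 2) < sq w then 0 else U i S w) * e w))"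
    by (intro tot_sum[symmetric] mult_nonneg_nonneg e0) (auto simp: U_nonneg)
  also have "\<dots> \<le> tot (\<lambda>w. 17 powr b * (bar 1 b w * (p w * e w)))"
  proof (rule tot_mono)
    fix w :: "int^'d"
    have "(\<Sum>i<n. r2 (i + 2) powr (-b) * ((if 16 * r2 (i + 2) < sq w then 0 else U i S w) * e w))
      \<le> (\<Sum>i<n. 17 powr b * bar 1 b w * (U i S w * e w))"
    proof (rule sum_mono)
      fix i
      have "r2 (i + 2) powr (-b) \<le> 17 powr b * bar 1 b w" if "\<not> 16 * r2 (i + 2) < sq w"
      proof -
        have "(17 * r2 (i + 2)) powr (-b) \<le> (1 + sq w) powr (-b)"
          using that r2_ge1[of "i+2"] b_ge by (intro powr_neg_antimono) (auto simp: add_pos_nonneg)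
        then have "17 powr b * (17 * r2 (i + 2)) powr (-b) \<le> 17 powr b * (1 + sq w) powr (-b)" by (intro mult_left_mono) auto
        moreover have "17 powr b * (17 * r2 (i + 2)) powr (-b) = r2 (i + 2) powr (-b)"
          using less_imp_le[OF r2_pos[of "i+2"]] by (subst powr_mult) (auto simp: powr_minus field_simps)
        ultimately show ?thesis unfolding bar_def by linarith
      qed
      then show "r2 (i + 2) powr (-b) * ((if 16 * r2 (i + 2) < sq w then 0 else U i S w) * e w) \<le> 17 powr b * bar 1 b w * (U i S w * e w)"
        by (cases "16 * r2 (i + 2) < sq w")
          (auto intro!: mult_nonneg_nonneg mult_right_mono simp: U_nonneg e0 bar_nonneg)
    qed
    also have "\<dots> = 17 powr b * bar 1 b w * ((\<Sum>i<n. U i S w) * e w)"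
      by (simp add: sum_distrib_left sum_distrib_right)
    also have "\<dots> \<le> 17 powr b * bar 1 b w * (p w * e w)"
      by (intro mult_left_mono mult_right_mono U_sum_le_p e0 mult_nonneg_nonneg bar_nonneg) auto
    finally show "(\<Sum>i<n. r2 (i + 2) powr (-b) * ((if 16 * r2 (i + 2) < sq w then 0 else U i S w) * e w)) \<le> 17 powr b * (bar 1 b w * (p w * e w))"
      by (simp add: mult_ac)
  qed
  also have "\<dots> = ennreal (17 powr b) * tot (\<lambda>w. bar 1 b w * (p w * e w))" by (rule tot_cmult) simp
  also have "\<dots> \<le> ennreal (17 powr b) * ennreal (2 / c1 / cg)" by (intro mult_left_mono tot_pe) simp
  also have "\<dots> = ennreal (17 powr b * (2 / c1 / cg))" using c1 cg by (intro ennreal_mult[symmetric]) auto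
  finally show ?thesis .
qed

theorem upper: "tot (\<lambda>z. bar 1 (b - 1) z * (indicat_real K z * e z)) \<le> ennreal CU"
proof -
  \<comment> \<open>K is finite, so finitely many shells and a common truncation time
    \<open>S\<close> suffice; the bound contains neither.\<close>
  obtain n where n: "\<And>z. z \<in> K \<Longrightarrow> 1 + sq z < r2 n"
  proof -
    obtain n where n: "1 + (\<Sum>z\<in>K. sq z) < 4^n" using real_arch_pow[of 4 "1 + (\<Sum>z\<in>K. sq z)"] by auto
    have "1 + sq z < r2 n" if "z \<in> K" for z
    proof -
      have "sq z \<le> (\<Sum>z\<in>K. sq z)" using that finK by (intro member_le_sum) auto
      then show ?thesis using n by (simp add: r2_def)
    qed
    then show ?thesis by (rule that)
  qed
  have lb: "0 < 1 - 1 / r2 (n + 2)" "1 - 1 / r2 (n + 2) < 1" using lam[of n] by auto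
  obtain S where S: "(1 - 1 / r2 (n + 2))^S < 1/2"
    using real_arch_pow_inv[of "1/2" "1 - 1 / r2 (n + 2)"] lb by auto
  have Si: "(1 - 1 / r2 (i + 2))^S \<le> 1/2" if "i < n" for i
  proof -
    have "r2 (i + 2) \<le> r2 (n + 2)" unfolding r2_def using that by (intro power_increasing) auto
    then have "1 / r2 (n + 2) \<le> 1 / r2 (i + 2)" by (intro divide_left_mono) auto
    then have "(1 - 1 / r2 (i + 2))^S \<le> (1 - 1 / r2 (n + 2))^S" using lam[of i] by (intro power_mono) auto
    then show ?thesis using S by simp
  qed
  let ?a = "2 * 16 powr (b - 1)"
  have "tot (\<lambda>z. bar 1 (b - 1) z * (indicat_real K z * e z)) \<le> tot (\<lambda>z. \<Sum>i<n. r2 i powr (-(b-1)) * (indicat_real (shell i) z * e z))"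
  proof (rule tot_mono)
    fix z
    have nn: "0 \<le> (\<Sum>i<n. r2 i powr (-(b-1)) * (indicat_real (shell i) z * e z))"
      by (intro sum_nonneg mult_nonneg_nonneg e0) auto
    show "bar 1 (b - 1) z * (indicat_real K z * e z) \<le> (\<Sum>i<n. r2 i powr (-(b-1)) * (indicat_real (shell i) z * e z))"
    proof (cases "z \<in> K")
      case True
      then obtain i where i: "i < n" "z \<in> shell i" using ex_shell n by blast
      have "bar 1 (b - 1) z \<le> r2 i powr (-(b-1))"
        unfolding bar_def using i(2) b_ge by (intro powr_neg_antimono) (auto simp: shell_def)
      then have "bar 1 (b - 1) z * e z \<le> r2 i powr (-(b-1)) * e z" by (intro mult_right_mono e0)
      also have "\<dots> = r2 i powr (-(b-1)) * (indicat_real (shell i) z * e z)" using i by simp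
      also have "\<dots> \<le> (\<Sum>i<n. r2 i powr (-(b-1)) * (indicat_real (shell i) z * e z))"
        using i(1) by (intro member_le_sum mult_nonneg_nonneg e0) auto
      finally show ?thesis using True by simp
    qed (use nn in simp)
  qed
  also have "\<dots> = (\<Sum>i<n. tot (\<lambda>z. r2 i powr (-(b-1)) * (indicat_real (shell i) z * e z)))"
    by (intro tot_sum mult_nonneg_nonneg e0) auto
  also have "\<dots> \<le> (\<Sum>i<n. ennreal ?a * (ennreal (r2 (i + 2) powr (-b)) * tot (\<lambda>z. U i S z * e z)))"
  proof (rule sum_mono)
    fix i assume "i \<in> {..<n}"
    then have i: "i < n" by simp
    have "tot (\<lambda>z. r2 i powr (-(b-1)) * (indicat_real (shell i) z * e z)) = ennreal (r2 i powr (-(b-1))) * tot (\<lambda>z. indicat_real (shell i) z * e z)"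
      by (rule tot_cmult) simp
    also have "\<dots> \<le> ennreal (r2 i powr (-(b-1))) * (ennreal (2 / r2 (i + 2)) * tot (\<lambda>z. U i S z * e z))"
      by (intro mult_left_mono shell_tot Si i) simp
    also have "\<dots> = ennreal (r2 i powr (-(b-1)) * (2 / r2 (i + 2))) * tot (\<lambda>z. U i S z * e z)"
      using less_imp_le[OF r2_pos[of "i+2"]] by (subst ennreal_mult) (auto simp: mult.assoc)
    also have "r2 i powr (-(b-1)) * (2 / r2 (i + 2)) = ?a * r2 (i + 2) powr (-b)"
    proof -
      have r: "r2 (i + 2) = 16 * r2 i" by (simp add: r2_def power_add)
      have "r2 (i + 2) powr (-b) = 16 powr (-b) * r2 i powr (-b)"
        unfolding r using less_imp_le[OF r2_pos[of i]] by (subst powr_mult) auto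
      moreover have "r2 i powr (-(b-1)) = r2 i * r2 i powr (-b)" by (simp add: powr_diff powr_minus field_simps abs_of_pos[OF r2_pos])
      moreover have "16 powr (b - 1) * 16 powr (-b) = (1/16 :: real)" by (simp add: powr_diff powr_minus)
      ultimately show ?thesis unfolding r by (simp add: mult_ac)
    qed
    also have "ennreal (?a * r2 (i + 2) powr (-b)) * tot (\<lambda>z. U i S z * e z) = ennreal ?a * (ennreal (r2 (i + 2) powr (-b)) * tot (\<lambda>z. U i S z * e z))"
      by (subst ennreal_mult) (auto simp: mult.assoc)
    finally show "tot (\<lambda>z. r2 i powr (-(b-1)) * (indicat_real (shell i) z * e z)) \<le> ennreal ?a * (ennreal (r2 (i + 2) powr (-b)) * tot (\<lambda>z. U i S z * e z))" .
  qed
  also have "\<dots> = ennreal ?a * (\<Sum>i<n. ennreal (r2 (i + 2) powr (-b)) * tot (\<lambda>z. U i S z * e z))"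
    by (rule sum_distrib_left[symmetric])
  also have "(\<Sum>i<n. ennreal (r2 (i + 2) powr (-b)) * tot (\<lambda>z. U i S z * e z))
     = (\<Sum>i<n. ennreal (r2 (i + 2) powr (-b)) * tot (\<lambda>w. (if 16 * r2 (i + 2) < sq w then 0 else U i S w) * e w))
     + (\<Sum>i<n. ennreal (r2 (i + 2) powr (-b)) * tot (\<lambda>w. (if 16 * r2 (i + 2) < sq w then U i S w else 0) * e w))"
    unfolding sum.distrib[symmetric] distrib_left[symmetric]
  proof (intro sum.cong refl arg_cong2[of _ _ _ _ times])
    fix i
    show "tot (\<lambda>z. U i S z * e z) = tot (\<lambda>w. (if 16 * r2 (i + 2) < sq w then 0 else U i S w) * e w) + tot (\<lambda>w. (if 16 * r2 (i + 2) < sq w then U i S w else 0) * e w)"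
      by (subst tot_add[symmetric]) (auto simp: U_nonneg e0 intro!: arg_cong[of _ _ tot])
  qed
  also have "ennreal ?a * \<dots> \<le> ennreal ?a * (ennreal (17 powr b * (2 / c1 / cg)) + ennreal (Cf * C4 * 2))"
    by (intro mult_left_mono add_mono near_tot_sum far_tot_sum) simp
  also have "\<dots> = ennreal CU"
  proof -
    have "0 \<le> 17 powr b * (2 / c1 / cg)" "0 \<le> Cf * C4 * 2" using c1 cg Ct ct Cd cb C4 by (auto simp: Cf_def)
    then show ?thesis unfolding CU_def by (subst ennreal_mult) (auto simp del: ennreal_plus simp: ennreal_plus[symmetric])
  qed
  finally show ?thesis .
qed

end

section \<open>Lower bound\<close>

context brw_test
begin

text \<open>With 0 in K one has \<sigma>(0) = e(0), so the telescoped sum of P^t \<sigma> is exactly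
  P^n e(0). It tends to 1, and \<sigma> is at most a multiple of p e.\<close>

lemma harnack_mass:
  assumes "0 \<in> K" "(\<lambda>t. srwn t e 0) \<longlonglongrightarrow> 1"
  shows "ennreal (1 / (Cg * (1 + C1 / f0))) \<le> tot (\<lambda>z. bar 1 b z * (p z * e z))"
proof -
  define X where "X = tot (\<lambda>z. bar 1 b z * (p z * e z))"
  define c where "c = Cg * (1 + C1 / f0)"
  have c: "0 < c" using Cg C1 f0 by (simp add: c_def add_pos_pos)
  have "ennreal (srwn n e 0) \<le> ennreal c * X" for n
  proof -
    have "srwn n e 0 = (\<Sum>t<Suc n. srwn t \<sigma> 0)"
      using sigma_sum[where n=n and x=0] assms(1) by (simp only: sum.lessThan_Suc_shift) (simp add: \<sigma>_def B_def)
    then have "ennreal (srwn n e 0) = tot (\<lambda>z. (\<Sum>t<Suc n. srwn t (indicat_real {0}) z) * \<sigma> z)"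
      using srwn_sum_kernel[of \<sigma> "{..<Suc n}"] sigma_nonneg by simp
    also have "\<dots> \<le> tot (\<lambda>z. c * (bar 1 b z * (p z * e z)))"
    proof (rule tot_mono)
      fix z
      have "(\<Sum>t<Suc n. srwn t (indicat_real {0}) z) * \<sigma> z \<le> (Cg * bar 1 b z) * ((1 + C1 / f0) * (p z * e z))"
        using Cg by (intro mult_mono g_upper sigma_upper sigma_nonneg mult_nonneg_nonneg bar_nonneg) auto
      then show "(\<Sum>t<Suc n. srwn t (indicat_real {0}) z) * \<sigma> z \<le> c * (bar 1 b z * (p z * e z))"
        by (simp add: c_def mult_ac)
    qed
    also have "\<dots> = ennreal c * X" using c unfolding X_def by (intro tot_cmult) auto
    finally show ?thesis .
  qed
  moreover have "(\<lambda>n. ennreal (srwn n e 0)) \<longlonglongrightarrow> ennreal 1" using assms(2) by (rule tendsto_ennrealI)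
  ultimately have "ennreal 1 \<le> ennreal c * X" by (intro LIMSEQ_le_const2[of _ "ennreal 1"]) auto
  then have "ennreal (1 / c) * ennreal 1 \<le> ennreal (1 / c) * (ennreal c * X)" by (intro mult_left_mono) auto
  also have "\<dots> = X" using c by (simp add: mult.assoc[symmetric] ennreal_mult[symmetric])
  finally show ?thesis by (simp add: c_def X_def)
qed

text \<open>The margin 4^3 keeps the remaining points of K out of the ball of squared radius 16 r2
  (i+k), where \<open>rest\<close> is examined.\<close>

definition near_K where "near_K k i = {y \<in> K. 1 + sq y < r2 (i + k + 3)}"
text \<open>Averaging over the cut-off generation j makes the remainder harmonic for the killed walk, away from
  distant points of K, up to an error of order 1/r2 times a term that is small as well.\<close>

definition avg where "avg k i z = 1 / r2 (i + k) * (\<Sum>j=4^(i+k)..<2*4^(i+k). \<Sum>s<j. (A ^^ s) (indicat_real (near_K k i)) z)"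
definition rest where "rest k i z = p z - avg k i z"

lemma near_K_sub: "near_K k i \<subseteq> K" by (auto simp: near_K_def)

lemma ind_near_nonneg: "0 \<le> (A ^^ s) (indicat_real Y) z" by (intro An_nonneg) auto

lemma r2_nat: "r2 i = real (4^i)" by (simp add: r2_def)

lemma avg_nonneg: "0 \<le> avg k i z"
  unfolding avg_def by (intro mult_nonneg_nonneg sum_nonneg ind_near_nonneg) (simp add: less_imp_le)

lemma avg_le: "avg k i z \<le> (\<Sum>s<2*4^(i+k). (A ^^ s) (indicat_real (near_K k i)) z)"
proof -
  let ?S = "\<Sum>s<2*4^(i+k). (A ^^ s) (indicat_real (near_K k i)) z"
  have "(\<Sum>j=4^(i+k)..<2*4^(i+k). \<Sum>s<j. (A ^^ s) (indicat_real (near_K k i)) z) \<le> (\<Sum>j=4^(i+k)..<2*(4::nat)^(i+k). ?S)"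
    by (intro sum_mono sum_mono2 ind_near_nonneg) auto
  also have "\<dots> = r2 (i + k) * ?S" by (simp add: r2_nat)
  finally have "1 / r2 (i + k) * (\<Sum>j=4^(i+k)..<2*4^(i+k). \<Sum>s<j. (A ^^ s) (indicat_real (near_K k i)) z) \<le> 1 / r2 (i + k) * (r2 (i + k) * ?S)"
    by (intro mult_left_mono) (simp_all add: less_imp_le)
  then show ?thesis by (simp add: avg_def less_imp_neq[OF r2_pos, symmetric])
qed

lemma avg_ge: "(\<Sum>s<4^(i+k). (A ^^ s) (indicat_real (near_K k i)) z) \<le> avg k i z"
proof -
  let ?S = "\<Sum>s<4^(i+k). (A ^^ s) (indicat_real (near_K k i)) z"
  have "r2 (i + k) * ?S = (\<Sum>j=4^(i+k)..<2*(4::nat)^(i+k). ?S)" by (simp add: r2_nat)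
  also have "\<dots> \<le> (\<Sum>j=4^(i+k)..<2*4^(i+k). \<Sum>s<j. (A ^^ s) (indicat_real (near_K k i)) z)"
    by (intro sum_mono sum_mono2 ind_near_nonneg) auto
  finally have "1 / r2 (i + k) * (r2 (i + k) * ?S) \<le> avg k i z"
    unfolding avg_def by (intro mult_left_mono) (simp_all add: less_imp_le)
  then show ?thesis by (simp add: less_imp_neq[OF r2_pos, symmetric])
qed

lemma rest_nonneg: "0 \<le> rest k i z"
  using avg_le[of k i z] p_partial_le[OF near_K_sub[of k i], where n="2*4^(i+k)" and z=z] by (simp add: rest_def)

lemma rest_le_p: "rest k i z \<le> p z"
  using avg_nonneg[of k i z] by (simp add: rest_def)

text \<open>\<open>A\<close> applied to a partial sum adds A^j h - h. The term -h cancels the source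
  1_K, with which h agrees at z. The boundary terms A^j h, for j from \<tau> up to 2\<tau>, add up
  to at most A^\<tau> p, and the average divides this by r.\<close>

lemma rest_sub:
  assumes z: "1 + sq z < r2 (i + k + 3)"
  shows "rest k i z \<le> srw (rest k i) z + 1 / r2 (i + k) * (A ^^ (4^(i+k))) p z"
proof -
  define \<tau> where "\<tau> = (4::nat)^(i+k)"
  define r where "r = r2 (i + k)"
  have r: "0 < r" "real \<tau> = r" by (simp_all add: r_def \<tau>_def r2_nat)
  define h where "h = indicat_real (near_K k i)"
  have av: "avg k i = (\<lambda>z. 1 / r * (\<Sum>j=\<tau>..<2*\<tau>. \<Sum>s<j. (A ^^ s) h z))"
    by (simp add: avg_def[abs_def] r_def \<tau>_def h_def)
  have sh: "A (\<lambda>z. \<Sum>s<j. (A ^^ s) h z) z = (\<Sum>s<j. (A ^^ s) h z) + ((A ^^ j) h z - h z)" for j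
    by (induction j) (simp_all add: A_sum A_add A_cmult[of 0, simplified])
  have "A (avg k i) z = 1 / r * (\<Sum>j=\<tau>..<2*\<tau>. A (\<lambda>z. \<Sum>s<j. (A ^^ s) h z) z)"
    unfolding av by (simp only: A_cmult A_sum)
  also have "\<dots> = avg k i z + (1 / r * (\<Sum>j=\<tau>..<2*\<tau>. (A ^^ j) h z) - 1 / r * (r * h z))"
    unfolding sh av using r(2) by (simp add: sum.distrib sum_subtractf distrib_left right_diff_distrib)
  finally have Aavg: "A (avg k i) z = avg k i z + 1 / r * (\<Sum>j=\<tau>..<2*\<tau>. (A ^^ j) h z) - h z" using r by simp
  have "A p z = A (\<lambda>z. rest k i z + avg k i z) z" by (simp add: rest_def)
  then have Ap: "A p z = A (rest k i) z + A (avg k i) z" by (simp only: A_add)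
  have hK: "h z = indicat_real K z" using z by (auto simp: h_def near_K_def indicator_def)
  have "(\<Sum>j=\<tau>..<2*\<tau>. (A ^^ j) h z) \<le> (A ^^ \<tau>) p z"
  proof -
    have "(\<Sum>j=\<tau>..<2*\<tau>. (A ^^ j) h z) = (\<Sum>j<\<tau>. (A ^^ (\<tau> + j)) h z)"
      by (rule sum.reindex_bij_witness[of _ "\<lambda>j. \<tau> + j" "\<lambda>j. j - \<tau>"]) auto
    also have "\<dots> = (A ^^ \<tau>) (\<lambda>z. \<Sum>j<\<tau>. (A ^^ j) h z) z"
      by (simp only: An_sum funpow_add comp_apply)
    also have "\<dots> \<le> (A ^^ \<tau>) p z"
      unfolding h_def by (intro An_mono p_partial_le near_K_sub)
    finally show ?thesis .
  qed
  then have "1 / r * (\<Sum>j=\<tau>..<2*\<tau>. (A ^^ j) h z) \<le> 1 / r * (A ^^ \<tau>) p z" using r by (intro mult_left_mono) auto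
  moreover have "A (rest k i) z \<le> srw (rest k i) z" by (intro A_le_srw rest_nonneg)
  ultimately show ?thesis
    using Ap Aavg hK p_decomp[of z] unfolding rest_def \<tau>_def[symmetric] r_def[symmetric] by linarith
qed

definition Cu where "Cu = Cd + 1 / c1"

lemma Cu: "0 < Cu" using Cd c1 by (simp add: Cu_def add_pos_pos)

text \<open>What \<open>avg\<close> can miss is a hit on distant points of K, controlled by
  \<open>displacement\<close> with R = sqrt r, or a hit after time \<tau>, controlled by
  \<open>An_p_decay\<close>.\<close>

lemma rest_small:
  assumes z: "sq z \<le> 9 * r2 (i + k)"
  shows "rest k i z \<le> Cu / r2 (i + k)"
proof -
  define \<tau> where "\<tau> = (4::nat)^(i+k)"
  define r where "r = r2 (i + k)"
  have r: "1 \<le> r" "real \<tau> = r" by (simp_all add: r_def \<tau>_def r2_nat)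
  define far where "far = K - near_K k i"
  define D where "D z = (\<Sum>s<\<tau>. (A ^^ s) (indicat_real far) z)" for z
  have sp: "indicat_real K = (\<lambda>z. indicat_real (near_K k i) z + indicat_real far z)"
    using near_K_sub[of k i] by (auto simp: far_def indicator_def fun_eq_iff)
  have "p z = (\<Sum>s<\<tau>. (A ^^ s) (indicat_real K) z) + (A ^^ \<tau>) p z" by (rule p_partial)
  also have "(\<Sum>s<\<tau>. (A ^^ s) (indicat_real K) z) = (\<Sum>s<\<tau>. (A ^^ s) (indicat_real (near_K k i)) z) + D z"
    unfolding sp D_def by (simp only: An_add sum.distrib)
  finally have "rest k i z \<le> D z + (A ^^ \<tau>) p z"
    using avg_ge[where k=k and i=i and z=z] by (simp add: rest_def \<tau>_def)
  moreover have "D z \<le> Cd / (sqrt r)\<^sup>2"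
  proof (rule displacement)
    show "1 \<le> sqrt r" using r by simp
    show D0: "0 \<le> D x" for x unfolding D_def by (intro sum_nonneg ind_near_nonneg)
    show "D x \<le> p x" for x unfolding D_def by (intro p_partial_le) (auto simp: far_def)
    fix x assume x: "sq (x - z) < (sqrt r)\<^sup>2"
    have "sqrt (sq (x - z)) < sqrt r" using x r by simp
    moreover have "sqrt (sq x) \<le> sqrt (sq z) + sqrt (sq (x - z))"
      using sqrt_sq_triangle[of z "x - z"] by simp
    moreover have "sqrt (sq z) \<le> 3 * sqrt r"
      using real_sqrt_le_mono[OF z] by (simp add: r_def real_sqrt_mult)
    ultimately have "sqrt (sq x) \<le> 4 * sqrt r" by linarith
    then have "(sqrt (sq x))\<^sup>2 \<le> (4 * sqrt r)\<^sup>2" by (intro power_mono) auto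
    then have "sq x \<le> 16 * r" using r by (simp add: power_mult_distrib)
    moreover have "r2 (i + k + 3) = 64 * r" by (simp add: r_def r2_def power_add)
    ultimately have "x \<notin> far" using r by (auto simp: far_def near_K_def)
    have "D x \<le> A D x"
    proof (cases \<tau>)
      case 0
      then show ?thesis by (simp add: D_def A_nonneg)
    next
      case (Suc n)
      have "D x = (\<Sum>s<n. (A ^^ Suc s) (indicat_real far) x)"
        using \<open>x \<notin> far\<close> unfolding D_def Suc sum.lessThan_Suc_shift by simp
      also have "\<dots> = A (\<lambda>x. \<Sum>s<n. (A ^^ s) (indicat_real far) x) x" by (simp add: A_sum)
      also have "\<dots> \<le> A D x" unfolding D_def Suc by (intro A_mono) (simp add: ind_near_nonneg)
      finally show ?thesis .
    qed
    then show "D x \<le> B x * srw D x" by (simp add: A_def)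
  qed
  moreover have "(A ^^ \<tau>) p z \<le> 1 / c1 / r"
  proof -
    have "(A ^^ \<tau>) p z \<le> 1 / c1 / (\<tau> + 1)" by (rule An_p_decay)
    also have "\<dots> \<le> 1 / c1 / r" using c1 r by (intro divide_left_mono) auto
    finally show ?thesis .
  qed
  ultimately show ?thesis using r by (simp add: Cu_def r_def[symmetric] add_divide_distrib)
qed

text \<open>Each point is assigned to the first of k + 1 dyadic balls that contains it. In the l-th
  one T is at most r2(i+l)^(-b), and the iterate of p is bounded, up to a constant, both by p and by
  1/r2(i+l), because the survival time 4^(i+k) is the longest of these scales.\<close>

lemma tot_near_T:
  fixes T :: "int^'d \<Rightarrow> real"
  assumes T: "\<And>z. 0 \<le> T z" "\<And>z. T z \<le> (r2 i + sq z) powr (-b)" "\<And>z. 5 * r2 (i + k) \<le> sq z \<Longrightarrow> T z = 0"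
  shows "tot (\<lambda>z. (A ^^ (4^(i+k))) p z * T z) \<le> ennreal (\<Sum>l\<le>k. (1 + 1 / c1) / cb * M (i + l) (\<lambda>z. min (p z) (1 / r2 (i + l))))"
proof -
  define f where "f = (A ^^ (4^(i+k))) p"
  have f0: "0 \<le> f z" for z unfolding f_def by (intro An_nonneg p0)
  have cc: "0 < 1 + 1 / c1" using c1 by (simp add: add_pos_pos)
  have fle: "f z \<le> (1 + 1 / c1) * min (p z) (1 / r2 (i + l))" if "l \<le> k" for z l
  proof -
    have "f z \<le> p z" unfolding f_def by (rule An_p_le)
    also have "\<dots> \<le> (1 + 1 / c1) * p z" using c1 p0[of z] by (simp add: distrib_right)
    finally have 1: "f z \<le> (1 + 1 / c1) * p z" .
    have rr: "r2 (i + l) \<le> r2 (i + k)" unfolding r2_def using that by (intro power_increasing) auto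
    have "f z \<le> 1 / c1 / (real (4^(i+k)) + 1)" using An_p_decay[of "4^(i+k)" z] by (simp add: f_def add.commute)
    also have "\<dots> \<le> 1 / c1 / r2 (i + l)"
      unfolding r2_nat[symmetric] using c1 rr r2_pos[of "i+k"] r2_pos[of "i+l"]
      by (intro divide_left_mono mult_pos_pos) (linarith | simp)+
    also have "\<dots> \<le> (1 + 1 / c1) / r2 (i + l)" by (intro divide_right_mono) (auto simp: less_imp_le)
    finally have "f z \<le> (1 + 1 / c1) * (1 / r2 (i + l))" by simp
    with 1 show ?thesis by (auto simp: min_def)
  qed
  let ?g = "\<lambda>l z. if sq z \<le> 16 * r2 (i + l) then r2 (i + l) powr (-b) * min (p z) (1 / r2 (i + l)) else 0"
  have g0: "0 \<le> ?g l z" for l z by (simp add: p0 less_imp_le)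
  have "tot (\<lambda>z. f z * T z) \<le> tot (\<lambda>z. \<Sum>l\<le>k. (1 + 1 / c1) * ?g l z)"
  proof (rule tot_mono)
    fix z
    show "f z * T z \<le> (\<Sum>l\<le>k. (1 + 1 / c1) * ?g l z)"
    proof (cases "5 * r2 (i + k) \<le> sq z")
      case True
      have "0 \<le> (\<Sum>l\<le>k. (1 + 1 / c1) * ?g l z)" using cc g0 by (intro sum_nonneg mult_nonneg_nonneg) auto
      then show ?thesis using T(3)[OF True] by simp
    next
      case False
      define l where "l = (LEAST l. sq z \<le> 16 * r2 (i + l))"
      have kk: "sq z \<le> 16 * r2 (i + k)" using False r2_pos[of "i+k"] by linarith
      then have l1: "sq z \<le> 16 * r2 (i + l)" unfolding l_def by (rule LeastI)
      have lk: "l \<le> k" unfolding l_def using kk by (rule Least_le)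
      have "r2 (i + l) \<le> r2 i + sq z"
      proof (cases l)
        case 0 then show ?thesis by simp
      next
        case (Suc l')
        then have "l' < (LEAST l. sq z \<le> 16 * r2 (i + l))" by (simp add: l_def)
        then have "\<not> sq z \<le> 16 * r2 (i + l')" by (rule not_less_Least)
        moreover have "r2 (i + l) = 4 * r2 (i + l')" using Suc by (simp add: r2_def)
        ultimately show ?thesis using r2_pos[of i] r2_pos[of "i+l'"] by linarith
      qed
      then have "T z \<le> r2 (i + l) powr (-b)"
        using b_ge by (intro order_trans[OF T(2)[of z]] powr_neg_antimono) auto
      then have "f z * T z \<le> ((1 + 1 / c1) * min (p z) (1 / r2 (i + l))) * r2 (i + l) powr (-b)"
        using fle[OF lk] f0 T(1) cc p0[of z] by (intro mult_mono) (auto simp: less_imp_le)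
      also have "\<dots> = (1 + 1 / c1) * ?g l z" using l1 by simp
      also have "\<dots> \<le> (\<Sum>l\<le>k. (1 + 1 / c1) * ?g l z)"
        using lk cc g0 by (intro member_le_sum mult_nonneg_nonneg) auto
      finally show ?thesis .
    qed
  qed
  also have "\<dots> = (\<Sum>l\<le>k. ennreal (1 + 1 / c1) * tot (?g l))"
    using cc g0 by (subst tot_sum) (auto simp: tot_cmult intro!: mult_nonneg_nonneg)
  also have "\<dots> \<le> (\<Sum>l\<le>k. ennreal (1 + 1 / c1) * ennreal (1 / cb * M (i + l) (\<lambda>z. min (p z) (1 / r2 (i + l)))))"
    by (intro sum_mono mult_left_mono ball_le_M) (simp_all add: p0 less_imp_le)
  also have "\<dots> = (\<Sum>l\<le>k. ennreal ((1 + 1 / c1) / cb * M (i + l) (\<lambda>z. min (p z) (1 / r2 (i + l)))))"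
    using cc cb by (intro sum.cong refl)
      (subst ennreal_mult[symmetric], auto intro!: mult_nonneg_nonneg divide_nonneg_nonneg M_nonneg simp: p0 less_imp_le)
  also have "\<dots> = ennreal (\<Sum>l\<le>k. (1 + 1 / c1) / cb * M (i + l) (\<lambda>z. min (p z) (1 / r2 (i + l))))"
    using cc cb by (intro sum_ennreal mult_nonneg_nonneg M_nonneg) (auto simp: p0 less_imp_le)
  finally show ?thesis by (simp add: f_def)
qed

text \<open>\<open>rest\<close> is tested against the function from \<open>near\<close> with \<rho>
  = r2 i and \<rho>' = r2 (i+k). After multiplication by \<rho>^(-b) the gain is of order 1/\<rho>,
  whereas both errors carry 1/\<rho>'; their ratio is 4^(-k), so a wide separation of scales makes
  \<open>rest\<close> small.\<close>

lemma rest_ball: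
  assumes k: "1 \<le> k"
  shows "ennreal (r2 i powr (-b)) * tot (\<lambda>z. if sq z \<le> 4 * r2 i then rest k i z else 0)
    \<le> ennreal ((1/4)^k / cn * ((\<Sum>l\<le>k. (1 + 1 / c1) / cb * M (i + l) (\<lambda>z. min (p z) (1 / r2 (i + l))))
        + Cn * (Cu + 1) / cb * M (i + k) (\<lambda>z. min (p z) (1 / r2 (i + k)))))"
proof -
  define \<rho> \<rho>' where "\<rho> = r2 i" and "\<rho>' = r2 (i + k)"
  have \<rho>\<rho>': "\<rho>' = \<rho> * 4^k" by (simp add: \<rho>_def \<rho>'_def r2_def power_add)
  have r0: "0 < \<rho>" "0 < \<rho>'" by (simp_all add: \<rho>_def \<rho>'_def)
  have r1: "1 \<le> \<rho>" by (simp add: \<rho>_def r2_ge1)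
  have k4: "(4::real) \<le> 4^k" using power_increasing[OF k, of "4::real"] by simp
  have r4: "4 \<le> \<rho>'" and rr: "\<rho> \<le> \<rho>'"
    using mult_mono[OF r1 k4] mult_left_mono[OF order_trans[OF _ k4], of 1 \<rho>] r0 by (auto simp: \<rho>\<rho>')
  obtain T where T: "\<And>z. 0 \<le> T z" "\<And>z. T z \<le> (\<rho> + sq z) powr (-b)" "\<And>z. 5 * \<rho>' \<le> sq z \<Longrightarrow> T z = 0"
    and Ts: "\<And>z::int^'d. srw T z + (if sq z \<le> 4 * \<rho> then cn * \<rho> powr (-b-1) else 0) \<le> T z + (if \<rho>' \<le> sq z \<and> sq z \<le> 9 * \<rho>' then Cn * \<rho>' powr (-b-1) else 0)"
    using near[OF r1 rr r4] by auto
  let ?u = "rest k i"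
  let ?N = "tot (\<lambda>z. if sq z \<le> 4 * \<rho> then ?u z else 0)"
  let ?S = "\<Sum>l\<le>k. (1 + 1 / c1) / cb * M (i + l) (\<lambda>z. min (p z) (1 / r2 (i + l)))"
  let ?m = "\<lambda>z. min (p z) (1 / \<rho>')"
  have m0: "0 \<le> ?m z" for z using r0 p0[of z] by simp
  have S0: "0 \<le> ?S" using c1 cb by (intro sum_nonneg mult_nonneg_nonneg M_nonneg) (auto simp: p0 less_imp_le)
  define X where "X = tot (\<lambda>z. ?u z * srw T z)"
  have Xeq: "X = tot (\<lambda>z. srw ?u z * T z)"
    unfolding X_def by (rule tot_srw_swap[symmetric]) (auto simp: rest_nonneg T)
  have Xfin: "X \<noteq> \<top>"
  proof -
    have "{z. srw ?u z * T z \<noteq> 0} \<subseteq> {z. sq z \<le> 5 * \<rho>'}" using T(3) by (auto simp: not_le less_imp_le) (meson linear)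
    then show ?thesis unfolding Xeq using tot_finite_support[of "\<lambda>z. srw ?u z * T z"] finite_sq_le finite_subset
      by (metis less_top)
  qed
  have uT: "tot (\<lambda>z. ?u z * T z) \<le> X + ennreal (1 / \<rho>' * ?S)"
  proof -
    have "tot (\<lambda>z. ?u z * T z) \<le> tot (\<lambda>z. srw ?u z * T z + 1 / \<rho>' * ((A ^^ (4^(i+k))) p z * T z))"
    proof (rule tot_mono)
      fix z
      show "?u z * T z \<le> srw ?u z * T z + 1 / \<rho>' * ((A ^^ (4^(i+k))) p z * T z)"
      proof (cases "5 * \<rho>' \<le> sq z")
        case True then show ?thesis by (simp add: T(3))
      next
        case False
        moreover have "r2 (i + k + 3) = 64 * \<rho>'" by (simp add: \<rho>'_def r2_def power_add)
        ultimately have "1 + sq z < r2 (i + k + 3)" using r4 by linarith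
        from mult_right_mono[OF rest_sub[OF this] T(1)[of z]] show ?thesis
          by (simp add: \<rho>'_def distrib_right)
      qed
    qed
    also have "\<dots> = X + ennreal (1 / \<rho>') * tot (\<lambda>z. (A ^^ (4^(i+k))) p z * T z)"
      unfolding Xeq using r0
      by (subst tot_add) (auto simp: tot_cmult[of "1/\<rho>'", simplified] T rest_nonneg An_nonneg p0 intro!: mult_nonneg_nonneg srw_nonneg divide_nonneg_nonneg)
    also have "\<dots> \<le> X + ennreal (1 / \<rho>') * ennreal ?S"
      using T unfolding \<rho>_def \<rho>'_def by (intro add_left_mono mult_left_mono tot_near_T) auto
    also have "ennreal (1 / \<rho>') * ennreal ?S = ennreal (1 / \<rho>' * ?S)"
      using r0 S0 by (intro ennreal_mult[symmetric]) auto
    finally show ?thesis .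
  qed
  let ?G = "\<lambda>z. if sq z \<le> 16 * \<rho>' then (Cu + 1) * ?m z else 0"
  have G0: "0 \<le> ?G z" for z using Cu m0[of z] by simp
  have "X + ennreal (cn * \<rho> powr (-b-1)) * ?N = tot (\<lambda>z. ?u z * srw T z + cn * \<rho> powr (-b-1) * (if sq z \<le> 4 * \<rho> then ?u z else 0))"
    unfolding X_def using cn by (subst tot_add) (auto simp: rest_nonneg T tot_cmult intro!: mult_nonneg_nonneg srw_nonneg)
  also have "\<dots> \<le> tot (\<lambda>z. ?u z * T z + Cn * \<rho>' powr (-b-1) * ?G z)"
  proof (rule tot_mono)
    fix z
    have "?u z * (srw T z + (if sq z \<le> 4 * \<rho> then cn * \<rho> powr (-b-1) else 0)) \<le> ?u z * (T z + (if \<rho>' \<le> sq z \<and> sq z \<le> 9 * \<rho>' then Cn * \<rho>' powr (-b-1) else 0))"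
      by (intro mult_left_mono Ts rest_nonneg)
    moreover have "?u z * (if \<rho>' \<le> sq z \<and> sq z \<le> 9 * \<rho>' then Cn * \<rho>' powr (-b-1) else 0) \<le> Cn * \<rho>' powr (-b-1) * ?G z"
    proof (cases "\<rho>' \<le> sq z \<and> sq z \<le> 9 * \<rho>'")
      case True
      have "?u z \<le> Cu / \<rho>'" unfolding \<rho>'_def using True by (intro rest_small) (simp add: \<rho>'_def)
      also have "\<dots> \<le> (Cu + 1) * (1 / \<rho>')" using r0 by (simp add: divide_right_mono)
      finally have "?u z \<le> (Cu + 1) * (1 / \<rho>')" .
      moreover have "?u z \<le> (Cu + 1) * p z"
        using rest_le_p[of k i z] Cu p0[of z] by (simp add: distrib_right add_increasing)
      ultimately have "?u z \<le> (Cu + 1) * ?m z" by (auto simp: min_def)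
      then have "(Cn * \<rho>' powr (-b-1)) * ?u z \<le> (Cn * \<rho>' powr (-b-1)) * ((Cu + 1) * ?m z)" using Cn by (intro mult_left_mono) auto
      then show ?thesis using True r0 by (simp add: mult.commute)
    next
      case False
      have "0 \<le> Cn * \<rho>' powr (-b-1) * ?G z" by (intro mult_nonneg_nonneg G0) (use Cn in auto)
      then show ?thesis using False by auto
    qed
    ultimately show "?u z * srw T z + cn * \<rho> powr (-b-1) * (if sq z \<le> 4 * \<rho> then ?u z else 0) \<le> ?u z * T z + Cn * \<rho>' powr (-b-1) * ?G z"
      by (auto simp: distrib_left mult_ac split: if_splits)
  qed
  also have "\<dots> = tot (\<lambda>z. ?u z * T z) + ennreal (Cn * \<rho>' powr (-b-1)) * tot ?G"
    using Cn G0 by (subst tot_add) (auto simp: tot_cmult rest_nonneg T intro!: mult_nonneg_nonneg)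
  also have "\<dots> \<le> (X + ennreal (1 / \<rho>' * ?S)) + ennreal (Cn * (Cu + 1) / cb * M (i + k) ?m / \<rho>')"
  proof (rule add_mono[OF uT])
    have "ennreal (Cn * \<rho>' powr (-b-1)) * tot ?G = tot (\<lambda>z. (Cn * \<rho>' powr (-b-1)) * ?G z)"
      using Cn by (intro tot_cmult[symmetric]) auto
    also have "\<dots> = tot (\<lambda>z. (Cn * (Cu + 1) / \<rho>') * (if sq z \<le> 16 * \<rho>' then \<rho>' powr (-b) * ?m z else 0))"
      using r0 by (intro arg_cong[of _ _ tot] ext) (simp add: powr_diff)
    also have "\<dots> = ennreal (Cn * (Cu + 1) / \<rho>') * tot (\<lambda>z. if sq z \<le> 16 * \<rho>' then \<rho>' powr (-b) * ?m z else 0)"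
      using Cn Cu r0 by (intro tot_cmult) auto
    also have "\<dots> \<le> ennreal (Cn * (Cu + 1) / \<rho>') * ennreal (1 / cb * M (i + k) ?m)"
      using m0 unfolding \<rho>'_def by (intro mult_left_mono ball_le_M) auto
    also have "\<dots> = ennreal (Cn * (Cu + 1) / \<rho>' * (1 / cb * M (i + k) ?m))"
      using Cn Cu r0 cb m0 by (intro ennreal_mult[symmetric] mult_nonneg_nonneg M_nonneg) auto
    finally show "ennreal (Cn * \<rho>' powr (-b-1)) * tot ?G \<le> ennreal (Cn * (Cu + 1) / cb * M (i + k) ?m / \<rho>')" by (simp add: mult_ac)
  qed
  finally have "X + ennreal (cn * \<rho> powr (-b-1)) * ?N \<le> X + (ennreal (1 / \<rho>' * ?S) + ennreal (Cn * (Cu + 1) / cb * M (i + k) ?m / \<rho>'))"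
    by (simp only: add.assoc)
  then have "ennreal (cn * \<rho> powr (-b-1)) * ?N \<le> ennreal (1 / \<rho>' * ?S) + ennreal (Cn * (Cu + 1) / cb * M (i + k) ?m / \<rho>')"
    using Xfin by (simp add: ennreal_add_left_cancel_le)
  also have "\<dots> = ennreal (1 / \<rho>' * ?S + Cn * (Cu + 1) / cb * M (i + k) ?m / \<rho>')"
    using r0 S0 Cn Cu cb m0 by (intro ennreal_plus[symmetric] mult_nonneg_nonneg divide_nonneg_nonneg M_nonneg) auto
  finally have main: "ennreal (cn * \<rho> powr (-b-1)) * ?N \<le> ennreal (1 / \<rho>' * (?S + Cn * (Cu + 1) / cb * M (i + k) ?m))"
    by (simp add: add_divide_distrib)
  have "\<rho> powr (-b) = \<rho> / cn * (cn * \<rho> powr (-b-1))" using r0 cn by (simp add: powr_diff)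
  then have "ennreal (\<rho> powr (-b)) * ?N = ennreal (\<rho> / cn) * (ennreal (cn * \<rho> powr (-b-1)) * ?N)"
    using r0 cn by (subst mult.assoc[symmetric], subst ennreal_mult[symmetric]) auto
  also have "\<dots> \<le> ennreal (\<rho> / cn) * ennreal (1 / \<rho>' * (?S + Cn * (Cu + 1) / cb * M (i + k) ?m))"
    by (intro mult_left_mono main) simp
  also have "\<dots> = ennreal (\<rho> / cn * (1 / \<rho>' * (?S + Cn * (Cu + 1) / cb * M (i + k) ?m)))"
    using r0 cn S0 Cn Cu cb m0 by (intro ennreal_mult[symmetric] mult_nonneg_nonneg add_nonneg_nonneg M_nonneg divide_nonneg_nonneg) auto
  also have "\<rho> / cn * (1 / \<rho>' * (?S + Cn * (Cu + 1) / cb * M (i + k) ?m)) = (1/4)^k / cn * (?S + Cn * (Cu + 1) / cb * M (i + k) ?m)"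
    unfolding \<rho>\<rho>' using r0 by (simp add: power_one_over)
  finally show ?thesis by (simp only: \<rho>_def \<rho>'_def)
qed

end

context brw_test
begin

definition Cbad where "Cbad = 3/2 / cn * ((1 + 1 / c1) / cb * C4 + Cn * (Cu + 1) / cb * C4) + Cu / cb * (128 * Bk * Bk)"

lemma factor_out: "X * (a * C * q + d * C * q) + Y * Z * q = (X * (a * C + d * C) + Y * Z) * q" for X Y Z a d C q :: real
  by (simp add: algebra_simps)

text \<open>e is split at 3/2 of its mean. The main part meets \<open>rest_ball\<close> and
  \<open>scale_sum\<close>, where about k terms stand against 4^(-k). The excess meets
  \<open>rest_small\<close>, whose factor 1/r2(i+k) again contains 4^(-k), and
  \<open>high_sum\<close>.\<close>

lemma bad_sum:
  assumes k: "1 \<le> k"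
  shows "(\<Sum>i<n. ennreal (r2 i powr (-b)) * tot (\<lambda>z. if sq z \<le> 4 * r2 i then rest k i z * e z else 0)) \<le> ennreal (Cbad * (1/2)^k)"
proof -
  define W where "W i = M i (\<lambda>z. min (p z) (1 / r2 i))" for i
  define H where "H i z = (if e z > 3/2 * mm i then e z else 0)" for i z
  define a where "a = (1 + 1 / c1) / cb"
  define d where "d = Cn * (Cu + 1) / cb"
  have W0: "0 \<le> W i" for i unfolding W_def by (intro M_nonneg) (simp add: p0 less_imp_le)
  have H0: "0 \<le> H i z" for i z by (simp add: H_def e0)
  have MH0: "0 \<le> M i (H i)" for i by (intro M_nonneg H0)
  have a0: "0 \<le> a" "0 \<le> d" using c1 cb Cn Cu by (simp_all add: a_def d_def)
  define F where "F i = 3/2 * mm i * ((1/4)^k / cn * ((\<Sum>l\<le>k. a * W (i + l)) + d * W (i + k))) + Cu / r2 (i + k) / cb * M i (H i)" for i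
  have bn: "0 \<le> (1/4)^k / cn * ((\<Sum>l\<le>k. a * W (i + l)) + d * W (i + k))" for i
    using a0 cn W0 by (intro mult_nonneg_nonneg add_nonneg_nonneg sum_nonneg) auto
  have pt: "ennreal (r2 i powr (-b)) * tot (\<lambda>z. if sq z \<le> 4 * r2 i then rest k i z * e z else 0) \<le> ennreal (F i)" for i
  proof -
    let ?R = "\<lambda>z. if sq z \<le> 4 * r2 i then rest k i z else 0"
    let ?Q = "\<lambda>z. if sq z \<le> 16 * r2 i then r2 i powr (-b) * H i z else 0"
    have Q0: "0 \<le> ?Q z" for z by (simp add: H0)
    have R0: "0 \<le> ?R z" for z by (simp add: rest_nonneg)
    have "ennreal (r2 i powr (-b)) * tot (\<lambda>z. if sq z \<le> 4 * r2 i then rest k i z * e z else 0)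
      = tot (\<lambda>z. r2 i powr (-b) * (if sq z \<le> 4 * r2 i then rest k i z * e z else 0))"
      by (rule tot_cmult[symmetric]) simp
    also have "\<dots> \<le> tot (\<lambda>z. 3/2 * mm i * (r2 i powr (-b) * ?R z) + Cu / r2 (i + k) * ?Q z)"
    proof (rule tot_mono)
      fix z
      show "r2 i powr (-b) * (if sq z \<le> 4 * r2 i then rest k i z * e z else 0) \<le> 3/2 * mm i * (r2 i powr (-b) * ?R z) + Cu / r2 (i + k) * ?Q z"
      proof (cases "sq z \<le> 4 * r2 i")
        case True
        have "r2 i \<le> r2 (i + k)" unfolding r2_def by (intro power_increasing) auto
        then have "sq z \<le> 9 * r2 (i + k)" using True r2_pos[of i] by linarith
        then have u: "rest k i z \<le> Cu / r2 (i + k)" by (rule rest_small)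
        have "rest k i z * e z \<le> rest k i z * (3/2 * mm i + H i z)"
          using mm0[of i] by (intro mult_left_mono rest_nonneg) (auto simp: H_def e0)
        also have "\<dots> = 3/2 * mm i * rest k i z + rest k i z * H i z" by (simp add: algebra_simps)
        also have "\<dots> \<le> 3/2 * mm i * rest k i z + Cu / r2 (i + k) * H i z"
          by (intro add_left_mono mult_right_mono u H0)
        finally have "r2 i powr (-b) * (rest k i z * e z) \<le> r2 i powr (-b) * (3/2 * mm i * rest k i z + Cu / r2 (i + k) * H i z)"
          by (intro mult_left_mono) auto
        also have "\<dots> = 3/2 * mm i * (r2 i powr (-b) * rest k i z) + Cu / r2 (i + k) * (r2 i powr (-b) * H i z)" by (simp add: algebra_simps)
        finally show ?thesis using True less_imp_le[OF r2_pos[of i]] by (simp add: order_trans[OF True])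
      next
        case False
        have "0 \<le> Cu / r2 (i + k) * ?Q z" using Cu by (intro mult_nonneg_nonneg Q0) (auto simp: less_imp_le)
        then show ?thesis using False by simp
      qed
    qed
    also have "\<dots> = ennreal (3/2 * mm i) * (ennreal (r2 i powr (-b)) * tot ?R) + ennreal (Cu / r2 (i + k)) * tot ?Q"
      using mm0[of i] Cu R0 Q0 less_imp_le[OF r2_pos[of "i+k"]]
      by (subst tot_add) (auto simp: tot_cmult[of "3/2 * mm i"] tot_cmult[of "r2 i powr (-b)"] tot_cmult[of "Cu / r2 (i + k)"] simp del: times_divide_eq_left times_divide_eq_right intro!: mult_nonneg_nonneg)
    also have "\<dots> \<le> ennreal (3/2 * mm i) * ennreal ((1/4)^k / cn * ((\<Sum>l\<le>k. a * W (i + l)) + d * W (i + k))) + ennreal (Cu / r2 (i + k)) * ennreal (1 / cb * M i (H i))"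
      unfolding a_def d_def W_def
      by (intro add_mono mult_left_mono rest_ball k ball_le_M H0) auto
    also have "\<dots> = ennreal (F i)"
    proof -
      have "ennreal (3/2 * mm i) * ennreal ((1/4)^k / cn * ((\<Sum>l\<le>k. a * W (i + l)) + d * W (i + k))) = ennreal (3/2 * mm i * ((1/4)^k / cn * ((\<Sum>l\<le>k. a * W (i + l)) + d * W (i + k))))"
        by (rule ennreal_mult[symmetric]) (use mm0 bn in auto)
      moreover have "ennreal (Cu / r2 (i + k)) * ennreal (1 / cb * M i (H i)) = ennreal (Cu / r2 (i + k) / cb * M i (H i))"
        using Cu cb MH0[of i] less_imp_le[OF r2_pos[of "i+k"]] by (subst ennreal_mult[symmetric]) auto
      moreover have "0 \<le> 3/2 * mm i * ((1/4)^k / cn * ((\<Sum>l\<le>k. a * W (i + l)) + d * W (i + k)))"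
        by (intro bn mult_nonneg_nonneg) (simp_all add: mm0)
      moreover have "0 \<le> Cu / r2 (i + k) / cb * M i (H i)"
        using Cu cb MH0[of i] less_imp_le[OF r2_pos[of "i+k"]] by simp
      ultimately show ?thesis unfolding F_def by (simp only: ennreal_plus)
    qed
    finally show ?thesis .
  qed
  have F0: "0 \<le> F i" for i
    unfolding F_def using mm0[of i] bn[of i] Cu cb MH0[of i] less_imp_le[OF r2_pos[of "i+k"]] by (intro bn add_nonneg_nonneg mult_nonneg_nonneg) auto
  have Wl: "(\<Sum>i<n. mm (i + l) * W (i + l)) \<le> C4" for l
  proof -
    have "(\<Sum>i<n. mm (i + l) * W (i + l)) = (\<Sum>i=l..<n+l. mm i * W i)"
      by (rule sum.reindex_bij_witness[of _ "\<lambda>i. i - l" "\<lambda>i. i + l"]) auto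
    also have "\<dots> \<le> (\<Sum>i<n+l. mm i * W i)" using mm0 W0 by (intro sum_mono2) auto
    also have "\<dots> \<le> C4" using scale_sum[where n="n+l" and j=0] by (simp add: W_def)
    finally show ?thesis .
  qed
  \<comment> \<open>Monotonicity lets \<open>scale_sum\<close> with j = 0 serve every shift l, so no
    growth in l arises here.\<close>
  have mmm: "mm i \<le> mm (i + l)" for i l
    unfolding mm_def by (intro m_mono mult_left_mono power_increasing) auto
  have Wl': "(\<Sum>i<n. mm i * W (i + l)) \<le> C4" for l
    by (rule order_trans[OF _ Wl[of l]]) (intro sum_mono mult_right_mono mmm W0)
  have MH: "(\<Sum>i<n. 1 / r2 i * M i (H i)) \<le> 128 * Bk * Bk"
  proof (rule order_trans[OF _ high_sum[of n]], unfold M_def, intro sum_mono mult_left_mono)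
    fix i t assume "t \<in> blk i"
    then have mt: "m t \<le> mm i" unfolding mm_def by (intro m_mono) (simp add: blk_def)
    show "srwn t (H i) 0 \<le> srwn t (\<lambda>z. if e z > 3/2 * m t then e z else 0) 0"
      using mt by (intro srwn_mono) (auto simp: H_def e0)
  qed (simp add: less_imp_le)
  have "(\<Sum>i<n. F i) = 3/2 * ((1/4)^k / cn) * ((\<Sum>l\<le>k. a * (\<Sum>i<n. mm i * W (i + l))) + d * (\<Sum>i<n. mm i * W (i + k)))
      + Cu / cb * (1/4)^k * (\<Sum>i<n. 1 / r2 i * M i (H i))"
  proof -
    have "(\<Sum>l\<le>k. a * (\<Sum>i<n. mm i * W (i + l))) = (\<Sum>i<n. mm i * (\<Sum>l\<le>k. a * W (i + l)))"
      unfolding sum_distrib_left by (subst sum.swap) (simp add: mult_ac)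
    moreover define S where "S i = (\<Sum>l\<le>k. a * W (i + l))" for i
    ultimately have "(\<Sum>l\<le>k. a * (\<Sum>i<n. mm i * W (i + l))) = (\<Sum>i<n. mm i * S i)" by simp
    then have "3/2 * ((1/4)^k / cn) * ((\<Sum>l\<le>k. a * (\<Sum>i<n. mm i * W (i + l))) + d * (\<Sum>i<n. mm i * W (i + k)))
      = (\<Sum>i<n. 3/2 * mm i * ((1/4)^k / cn * ((\<Sum>l\<le>k. a * W (i + l)) + d * W (i + k))))"
      unfolding S_def[symmetric] by (simp only: sum_distrib_left sum.distrib[symmetric] distrib_left distrib_right mult_ac)
    moreover have "Cu / cb * (1/4)^k * (\<Sum>i<n. 1 / r2 i * M i (H i)) = (\<Sum>i<n. Cu / r2 (i + k) / cb * M i (H i))"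
      unfolding sum_distrib_left by (intro sum.cong refl) (simp add: r2_add r2_def power_one_over field_simps power_add)
    ultimately show ?thesis by (simp add: F_def sum.distrib)
  qed
  also have "\<dots> \<le> 3/2 * ((1/4)^k / cn) * ((\<Sum>l\<le>k. a * C4) + d * C4) + Cu / cb * (1/4)^k * (128 * Bk * Bk)"
    using a0 cn cb Cu by (intro add_mono mult_left_mono sum_mono Wl' MH) auto
  also have "\<dots> = 3/2 / cn * (a * C4 * ((1/4)^k * (1 + real k)) + d * C4 * (1/4)^k) + Cu / cb * (128 * Bk * Bk) * (1/4)^k"
    by (simp add: algebra_simps add_divide_distrib)
  also have "\<dots> \<le> 3/2 / cn * (a * C4 * (1/2)^k + d * C4 * (1/2)^k) + Cu / cb * (128 * Bk * Bk) * (1/2)^k"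
  proof -
    have "1 + real k \<le> 2^k"
    proof -
      have "real (Suc k) \<le> real (2^k)" using Suc_leI[OF less_exp[of k]] by (simp only: of_nat_le_iff)
      then show ?thesis by simp
    qed
    then have "(1/4)^k * (1 + real k) \<le> (1/4)^k * 2^k" by (intro mult_left_mono) auto
    then have 1: "(1/4)^k * (1 + real k) \<le> (1/2)^k" by (simp add: power_mult_distrib[symmetric])
    have 2: "(1/4::real)^k \<le> (1/2)^k" by (intro power_mono) auto
    show ?thesis using a0 cn cb Cu C4 by (intro add_mono mult_left_mono 1 2 mult_nonneg_nonneg) auto
  qed
  also have "\<dots> = Cbad * (1/2)^k" unfolding Cbad_def a_def[symmetric] d_def[symmetric] by (rule factor_out)
  finally have le: "(\<Sum>i<n. F i) \<le> Cbad * (1/2)^k" .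
  have "(\<Sum>i<n. ennreal (r2 i powr (-b)) * tot (\<lambda>z. if sq z \<le> 4 * r2 i then rest k i z * e z else 0)) \<le> (\<Sum>i<n. ennreal (F i))"
    by (intro sum_mono pt)
  also have "\<dots> = ennreal (\<Sum>i<n. F i)" by (intro sum_ennreal F0)
  also have "\<dots> \<le> ennreal (Cbad * (1/2)^k)" by (rule ennreal_leI[OF le])
  finally show ?thesis .
qed

text \<open>A geometric series of ratio 4^(1-b), at most 1/2 because d \<ge> 5 gives b \<ge>
  3/2.\<close>

lemma scale_tail:
  assumes X: "0 < X"
  shows "(\<Sum>i<n. r2 i powr (1 - b) * (if X < r2 i then 1 else 0)) \<le> 2 * X powr (1 - b)"
proof -
  define q where "q = (4::real) powr (1 - b)"
  have q0: "0 < q" by (simp add: q_def)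
  have "q \<le> 4 powr (- 1/2)" unfolding q_def using b_ge by (intro powr_mono) auto
  also have "\<dots> = 1/2" by (simp add: powr_minus powr_half_sqrt inverse_eq_divide)
  finally have q: "q \<le> 1/2" .
  have rq: "r2 i powr (1 - b) = q^i" for i
    by (simp add: r2_def q_def powr_powr powr_realpow[symmetric] mult.commute)
  define j where "j = (LEAST j. X < r2 j)"
  have "\<exists>j. X < r2 j" unfolding r2_def using real_arch_pow[of 4 X] by simp
  then have j: "X < r2 j" unfolding j_def by (rule LeastI_ex)
  have lt: "j \<le> i" if "X < r2 i" for i unfolding j_def using that by (rule Least_le)
  have "(\<Sum>i<n. r2 i powr (1 - b) * (if X < r2 i then 1 else 0)) \<le> (\<Sum>i<n. if j \<le> i then q^i else 0)"
    unfolding rq using q0 lt by (intro sum_mono) auto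
  also have "\<dots> \<le> (\<Sum>i<n+j. if j \<le> i then q^i else 0)" using q0 by (intro sum_mono2) auto
  also have "\<dots> = (\<Sum>i\<in>{j..<n+j}. q^i)" by (subst sum.inter_filter[symmetric]) (auto intro!: sum.cong)
  also have "\<dots> = (\<Sum>i<n. q^(i+j))"
    by (rule sum.reindex_bij_witness[of _ "\<lambda>i. i + j" "\<lambda>i. i - j"]) auto
  also have "\<dots> = q^j * (\<Sum>i<n. q^i)" by (simp add: power_add sum_distrib_left mult.commute)
  also have "\<dots> \<le> q^j * 2"
  proof (intro mult_left_mono)
    have "(\<Sum>i<n. q^i) \<le> (\<Sum>i<n. (1/2)^i)" using q q0 by (intro sum_mono power_mono) auto
    also have "\<dots> \<le> 2" by (simp add: sum_gp_strict)
    finally show "(\<Sum>i<n. q^i) \<le> 2" .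
  qed (use q0 in simp)
  also have "q^j \<le> X powr (1 - b)"
    using powr_neg_antimono[of X "r2 j" "b - 1"] X j b_ge by (simp add: rq[symmetric])
  finally show ?thesis by simp
qed

definition Cgood where "Cgood k = 2 * 4^k * (2 * (64 * 4^k) powr (b - 1))"

text \<open>By invariance all iterates in \<open>avg\<close> have the mass of \<open>near_K\<close>
  against e, and there are at most 2 * 4^(i+k) of them. A point z of K counts for the scales with
  4^i above a multiple of 1 + |z|^2, and \<open>scale_tail\<close> sums these to the weight (1 +
  |z|^2)^(1-b), with a factor depending on k.\<close>

lemma good_sum:
  "(\<Sum>i<n. ennreal (r2 i powr (-b)) * tot (\<lambda>z. avg k i z * e z)) \<le> ennreal (Cgood k) * tot (\<lambda>z. bar 1 (b - 1) z * (indicat_real K z * e z))"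
proof -
  let ?h = "\<lambda>i. indicat_real (near_K k i)"
  have one: "ennreal (r2 i powr (-b)) * tot (\<lambda>z. avg k i z * e z) \<le> tot (\<lambda>z. 2 * 4^k * r2 i powr (1 - b) * (?h i z * e z))" for i
  proof -
    let ?t = "2 * (4::nat)^(i+k)"
    have "tot (\<lambda>z. avg k i z * e z) \<le> tot (\<lambda>z. \<Sum>s<?t. (A ^^ s) (?h i) z * e z)"
      unfolding sum_distrib_right[symmetric] by (intro tot_mono mult_right_mono avg_le e0)
    also have "\<dots> = (\<Sum>s<?t. tot (\<lambda>z. (A ^^ s) (?h i) z * e z))"
      by (intro tot_sum mult_nonneg_nonneg ind_near_nonneg e0)
    also have "\<dots> = (\<Sum>s<?t. tot (\<lambda>z. ?h i z * e z))"
      by (intro sum.cong refl tot_An) simp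
    also have "\<dots> = ennreal (real ?t) * tot (\<lambda>z. ?h i z * e z)"
      by (simp only: sum_constant card_lessThan ennreal_of_nat_eq_real_of_nat)
    finally have "ennreal (r2 i powr (-b)) * tot (\<lambda>z. avg k i z * e z) \<le> ennreal (r2 i powr (-b)) * (ennreal (real ?t) * tot (\<lambda>z. ?h i z * e z))"
      by (intro mult_left_mono) auto
    also have "\<dots> = tot (\<lambda>z. r2 i powr (-b) * real ?t * (?h i z * e z))"
      by (subst tot_cmult) (simp_all add: ennreal_mult mult.assoc)
    also have "r2 i powr (-b) * real ?t = 2 * 4^k * r2 i powr (1 - b)"
      using powr_mult_base[of "r2 i" "-b"] by (simp add: power_add r2_def mult.commute)
    finally show ?thesis .
  qed
  have "(\<Sum>i<n. ennreal (r2 i powr (-b)) * tot (\<lambda>z. avg k i z * e z)) \<le> (\<Sum>i<n. tot (\<lambda>z. 2 * 4^k * r2 i powr (1 - b) * (?h i z * e z)))"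
    by (intro sum_mono one)
  also have "\<dots> = tot (\<lambda>z. \<Sum>i<n. 2 * 4^k * r2 i powr (1 - b) * (?h i z * e z))"
    by (intro tot_sum[symmetric] mult_nonneg_nonneg e0) auto
  also have "\<dots> \<le> tot (\<lambda>z. Cgood k * (bar 1 (b - 1) z * (indicat_real K z * e z)))"
  proof (rule tot_mono)
    fix z
    show "(\<Sum>i<n. 2 * 4^k * r2 i powr (1 - b) * (?h i z * e z)) \<le> Cgood k * (bar 1 (b - 1) z * (indicat_real K z * e z))"
    proof (cases "z \<in> K")
      case True
      define X where "X = (1 + sq z) / (64 * 4^k)"
      have X: "0 < X" by (simp add: X_def add_pos_nonneg)
      have hX: "?h i z = (if X < r2 i then 1 else 0)" for i
      proof -
        have "r2 (i + k + 3) = r2 i * (64 * 4^k)" by (simp add: r2_def power_add)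
        then show ?thesis using True by (simp add: near_K_def X_def pos_divide_less_eq)
      qed
      have "(\<Sum>i<n. 2 * 4^k * r2 i powr (1 - b) * (?h i z * e z)) = 2 * 4^k * ((\<Sum>i<n. r2 i powr (1 - b) * (if X < r2 i then 1 else 0)) * e z)"
        unfolding hX by (simp add: sum_distrib_left sum_distrib_right mult_ac)
      also have "\<dots> \<le> 2 * 4^k * ((2 * X powr (1 - b)) * e z)"
        by (rule mult_left_mono[OF mult_right_mono[OF scale_tail[OF X] e0]]) simp
      also have "X powr (1 - b) = (64 * 4^k) powr (b - 1) * bar 1 (b - 1) z"
      proof -
        have "X powr (1 - b) = (1 + sq z) powr (1 - b) / (64 * 4^k) powr (1 - b)" unfolding X_def by (rule powr_divide)
        also have "\<dots> = (1 + sq z) powr (1 - b) * (64 * 4^k) powr (b - 1)"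
          using powr_minus_divide[of "64 * 4^k :: real" "1 - b"] by simp
        finally show ?thesis by (simp add: bar_def)
      qed
      finally show ?thesis using True by (simp add: Cgood_def mult_ac)
    next
      case False
      then have "?h i z = 0" for i by (simp add: near_K_def)
      then show ?thesis using False by simp
    qed
  qed
  also have "\<dots> = ennreal (Cgood k) * tot (\<lambda>z. bar 1 (b - 1) z * (indicat_real K z * e z))"
    by (intro tot_cmult) (simp add: Cgood_def)
  finally show ?thesis .
qed

text \<open>k stays free: the factor of the wanted sum depends on k, the last term decays in k, and
  a suitable k lets the latter be absorbed on the left.\<close>

theorem lower:
  assumes K: "0 \<in> K" and lim: "(\<lambda>t. srwn t e 0) \<longlonglongrightarrow> 1" and k: "1 \<le> k"
  shows "ennreal (1 / (Cg * (1 + C1 / f0))) \<le> ennreal (Cgood k) * tot (\<lambda>z. bar 1 (b - 1) z * (indicat_real K z * e z)) + ennreal (Cbad * (1/2)^k)"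
proof -
  define f where "f z = bar 1 b z * (p z * e z)" for z
  have f0: "0 \<le> f z" for z by (simp add: f_def bar_nonneg p0 e0)
  define Z where "Z i = {z :: int^'d. r2 i \<le> 1 + sq z \<and> 1 + sq z < r2 (i + 1)}" for i
  have "tot f \<le> (\<integral>\<^sup>+z. (\<Sum>i. ennreal (if z \<in> Z i then f z else 0)) \<partial>count_space UNIV)"
    unfolding tot_def
  proof (intro nn_integral_mono)
    fix z :: "int^'d"
    define j where "j = (LEAST j. 1 + sq z < r2 j)"
    have "\<exists>j. 1 + sq z < r2 j" unfolding r2_def using real_arch_pow[of 4 "1 + sq z"] by simp
    then have j: "1 + sq z < r2 j" unfolding j_def by (rule LeastI_ex)
    have "j \<noteq> 0"
    proof
      assume "j = 0"
      then show False using j sq_nonneg[of z] by (simp add: r2_def)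
    qed
    then obtain i where i: "j = Suc i" by (cases j) auto
    then have "i < (LEAST j. 1 + sq z < r2 j)" by (simp add: j_def)
    then have "\<not> 1 + sq z < r2 i" by (rule not_less_Least)
    then have "z \<in> Z i" using i j by (simp add: Z_def)
    then have "ennreal (f z) = (\<Sum>i\<in>{i}. ennreal (if z \<in> Z i then f z else 0))" by simp
    also have "\<dots> \<le> (\<Sum>i. ennreal (if z \<in> Z i then f z else 0))" by (intro sum_le_suminf) auto
    finally show "ennreal (f z) \<le> (\<Sum>i. ennreal (if z \<in> Z i then f z else 0))" .
  qed
  also have "\<dots> = (\<Sum>i. tot (\<lambda>z. if z \<in> Z i then f z else 0))"
    unfolding tot_def by (rule nn_integral_suminf) auto
  also have "\<dots> \<le> ennreal (Cgood k) * tot (\<lambda>z. bar 1 (b - 1) z * (indicat_real K z * e z)) + ennreal (Cbad * (1/2)^k)"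
    unfolding suminf_eq_SUP
  proof (rule SUP_least)
    fix n
    have one: "tot (\<lambda>z. if z \<in> Z i then f z else 0) \<le> ennreal (r2 i powr (-b)) * tot (\<lambda>z. avg k i z * e z)
      + ennreal (r2 i powr (-b)) * tot (\<lambda>z. if sq z \<le> 4 * r2 i then rest k i z * e z else 0)" for i
    proof -
      have "tot (\<lambda>z. if z \<in> Z i then f z else 0) \<le> tot (\<lambda>z. r2 i powr (-b) * (avg k i z * e z + (if sq z \<le> 4 * r2 i then rest k i z * e z else 0)))"
      proof (rule tot_mono)
        fix z
        have av0: "0 \<le> avg k i z * e z" by (intro mult_nonneg_nonneg avg_nonneg e0)
        have re0: "0 \<le> rest k i z * e z" by (intro mult_nonneg_nonneg rest_nonneg e0)
        show "(if z \<in> Z i then f z else 0) \<le> r2 i powr (-b) * (avg k i z * e z + (if sq z \<le> 4 * r2 i then rest k i z * e z else 0))"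
        proof (cases "z \<in> Z i")
          case True
          have "bar 1 b z \<le> r2 i powr (-b)"
            unfolding bar_def using True b_ge by (intro powr_neg_antimono) (auto simp: Z_def)
          then have "f z \<le> r2 i powr (-b) * (p z * e z)"
            unfolding f_def by (intro mult_right_mono mult_nonneg_nonneg p0 e0)
          moreover have "p z * e z = avg k i z * e z + rest k i z * e z" by (simp add: rest_def algebra_simps)
          moreover have "sq z \<le> 4 * r2 i" using True by (simp add: Z_def r2_def)
          ultimately show ?thesis using True by simp
        next
          case False
          then show ?thesis using av0 re0 by simp
        qed
      qed
      also have "\<dots> = ennreal (r2 i powr (-b)) * (tot (\<lambda>z. avg k i z * e z) + tot (\<lambda>z. if sq z \<le> 4 * r2 i then rest k i z * e z else 0))"
        by (subst tot_cmult) (auto simp: tot_add avg_nonneg rest_nonneg e0)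
      finally show ?thesis by (simp only: distrib_left)
    qed
    have "(\<Sum>i<n. tot (\<lambda>z. if z \<in> Z i then f z else 0)) \<le> (\<Sum>i<n. ennreal (r2 i powr (-b)) * tot (\<lambda>z. avg k i z * e z)
      + ennreal (r2 i powr (-b)) * tot (\<lambda>z. if sq z \<le> 4 * r2 i then rest k i z * e z else 0))" by (intro sum_mono one)
    also have "\<dots> \<le> ennreal (Cgood k) * tot (\<lambda>z. bar 1 (b - 1) z * (indicat_real K z * e z)) + ennreal (Cbad * (1/2)^k)"
      unfolding sum.distrib by (intro add_mono good_sum bad_sum k)
    finally show "(\<Sum>i<n. tot (\<lambda>z. if z \<in> Z i then f z else 0)) \<le> \<dots>" .
  qed
  finally show ?thesis using harnack_mass[OF K lim] unfolding f_def by (rule order_trans[rotated])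
qed

end

section \<open>Branching structure of the random tree\<close>

definition sub :: "nat \<Rightarrow> (nat list \<Rightarrow> 'a) \<Rightarrow> nat list \<Rightarrow> 'a" where
  "sub j \<omega> = (\<lambda>u. \<omega> (j # u))"

lemma space_Omega [simp]: "space (Omega \<mu>) = UNIV"
  by (simp add: Omega_def space_PiM)

lemma prob_space_Omega: "prob_space (Omega \<mu>)"
  unfolding Omega_def by (intro prob_space_PiM) (simp add: measure_pmf.prob_space_axioms)

lemma measurable_coord [measurable]: "(\<lambda>\<omega>. \<omega> u) \<in> Omega \<mu> \<rightarrow>\<^sub>M count_space UNIV"
proof -
  have "(\<lambda>\<omega>. \<omega> u) \<in> Omega \<mu> \<rightarrow>\<^sub>M measure_pmf (vlaw \<mu>)"
    unfolding Omega_def by (intro measurable_component_singleton) simp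
  then show ?thesis by simp
qed

lemma measurable_sub [measurable]: "sub j \<in> Omega \<mu> \<rightarrow>\<^sub>M Omega \<mu>"
  unfolding sub_def[abs_def] using measurable_coord[of _ \<mu>]
  by (subst (2) Omega_def) (intro measurable_abs_UNIV, simp)

lemma distr_sub: "distr (Omega \<mu>) (Omega \<mu>) (sub j) = Omega (\<mu> :: nat pmf)"
  using distr_PiM_reindex[of UNIV "\<lambda>_. measure_pmf (vlaw \<mu>)" "Cons j" UNIV]
  by (simp add: Omega_def sub_def[abs_def] measure_pmf.prob_space_axioms restrict_def)

lemma nn_integral_sub:
  "F \<in> borel_measurable (Omega \<mu>) \<Longrightarrow> (\<integral>\<^sup>+\<omega>. F (sub j \<omega>) \<partial>Omega \<mu>) = (\<integral>\<^sup>+\<omega>. F \<omega> \<partial>Omega \<mu>)"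
  by (subst (2) distr_sub[of \<mu> j, symmetric]) (simp add: nn_integral_distr)

lemma indep_coords: "prob_space.indep_vars (Omega \<mu>) (\<lambda>_. measure_pmf (vlaw \<mu>)) (\<lambda>u \<omega>. \<omega> u) UNIV"
proof -
  interpret prob_space "Omega \<mu>" by (rule prob_space_Omega)
  have 1: "distr (Omega \<mu>) (measure_pmf (vlaw \<mu>)) (\<lambda>\<omega>. \<omega> u) = measure_pmf (vlaw \<mu>)" for u
    unfolding Omega_def by (rule distr_PiM_component) (simp_all add: measure_pmf.prob_space_axioms)
  have 2: "distr (Omega \<mu>) (PiM UNIV (\<lambda>_. measure_pmf (vlaw \<mu>))) (\<lambda>x. \<lambda>i\<in>UNIV. x i) = Omega \<mu>"
    unfolding Omega_def by (simp add: restrict_def)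
  show ?thesis
  proof (subst indep_vars_iff_distr_eq_PiM)
    show "distr (Omega \<mu>) (PiM UNIV (\<lambda>i. measure_pmf (vlaw \<mu>))) (\<lambda>x. \<lambda>i\<in>UNIV. x i) = PiM UNIV (\<lambda>i. distr (Omega \<mu>) (measure_pmf (vlaw \<mu>)) (\<lambda>x. x i))"
      unfolding 1 2 by (rule Omega_def)
  qed (auto simp: measurable_coord)
qed

text \<open>The label of the root and the subtrees at its children use disjoint blocks of
  independent coordinates.\<close>

lemma root_product_fixed:
  fixes F :: "nat \<Rightarrow> (nat list \<Rightarrow> ('d::finite) vdata) \<Rightarrow> ennreal"
  assumes F: "\<And>j. F j \<in> borel_measurable (Omega \<mu>)"
  shows "(\<integral>\<^sup>+\<omega>. indicator {v} (\<omega> []) * (\<Prod>j<n. F j (sub j \<omega>)) \<partial>Omega \<mu>) = ennreal (pmf (vlaw \<mu>) v) * (\<Prod>j<n. \<integral>\<^sup>+\<omega>. F j \<omega> \<partial>Omega \<mu>)"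
proof -
  interpret prob_space "Omega \<mu>" by (rule prob_space_Omega)
  let ?V = "\<lambda>_::nat list. measure_pmf (vlaw \<mu> :: 'd vdata pmf)"
  define K where "K i = (case i of 0 \<Rightarrow> {[]} | Suc j \<Rightarrow> range (Cons j))" for i :: nat
  define Y :: "nat \<Rightarrow> (nat list \<Rightarrow> 'd vdata) \<Rightarrow> ennreal" where
    "Y i r = (case i of 0 \<Rightarrow> indicator {v} (r []) | Suc j \<Rightarrow> F j (sub j r))" for i r
  have "indep_vars (\<lambda>j. PiM (K j) ?V) (\<lambda>j \<omega>. restrict (\<lambda>i. \<omega> i) (K j)) {..<Suc n}"
    by (rule indep_vars_restrict[OF indep_coords])
       (auto simp: disjoint_family_on_def K_def split: nat.splits)
  then have "indep_vars (\<lambda>_. borel) (\<lambda>i \<omega>. Y i (restrict \<omega> (K i))) {..<Suc n}"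
  proof (rule indep_vars_compose2)
    fix i
    show "Y i \<in> borel_measurable (PiM (K i) ?V)"
    proof (cases i)
      case 0
      have "(\<lambda>r. r []) \<in> PiM (K i) ?V \<rightarrow>\<^sub>M measure_pmf (vlaw \<mu>)"
        using 0 by (intro measurable_component_singleton) (simp add: K_def)
      then have "(\<lambda>r. indicator {v} (r []) :: ennreal) \<in> borel_measurable (PiM (K i) ?V)"
        by (rule measurable_compose) simp
      then show ?thesis using 0 by (simp add: Y_def[abs_def])
    next
      case (Suc j)
      have "(\<lambda>r. r (j # u)) \<in> PiM (K i) ?V \<rightarrow>\<^sub>M measure_pmf (vlaw \<mu>)" for u
        using Suc by (intro measurable_component_singleton) (simp add: K_def)
      then have "(\<lambda>r u. r (j # u)) \<in> PiM (K i) ?V \<rightarrow>\<^sub>M Omega \<mu>"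
        unfolding Omega_def by (intro measurable_abs_UNIV)
      then have "(\<lambda>r. F j (\<lambda>u. r (j # u))) \<in> borel_measurable (PiM (K i) ?V)"
        by (rule measurable_compose) (rule F)
      then show ?thesis using Suc by (simp add: Y_def[abs_def] sub_def)
    qed
  qed
  then have "(\<integral>\<^sup>+\<omega>. (\<Prod>i<Suc n. Y i (restrict \<omega> (K i))) \<partial>Omega \<mu>) = (\<Prod>i<Suc n. \<integral>\<^sup>+\<omega>. Y i (restrict \<omega> (K i)) \<partial>Omega \<mu>)"
    by (intro indep_vars_nn_integral) auto
  moreover have Y0: "Y 0 (restrict \<omega> (K 0)) = indicator {v} (\<omega> [])" for \<omega>
    by (simp add: Y_def K_def)
  moreover have YS: "Y (Suc j) (restrict \<omega> (K (Suc j))) = F j (sub j \<omega>)" for j \<omega>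
    by (simp add: Y_def K_def sub_def)
  moreover have "(\<integral>\<^sup>+\<omega>. indicator {v} (\<omega> []) \<partial>Omega \<mu>) = ennreal (pmf (vlaw \<mu>) v)"
  proof -
    have eq: "distr (Omega \<mu>) (measure_pmf (vlaw \<mu>)) (\<lambda>\<omega>. \<omega> []) = measure_pmf (vlaw \<mu>)"
      unfolding Omega_def by (rule distr_PiM_component) (simp_all add: measure_pmf.prob_space_axioms)
    have "(\<integral>\<^sup>+w. indicator {v} w \<partial>measure_pmf (vlaw \<mu>)) = (\<integral>\<^sup>+w. indicator {v} w \<partial>distr (Omega \<mu>) (measure_pmf (vlaw \<mu>)) (\<lambda>\<omega>. \<omega> []))"
      by (simp only: eq)
    also have "\<dots> = (\<integral>\<^sup>+\<omega>. indicator {v} (\<omega> []) \<partial>Omega \<mu>)"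
      by (rule nn_integral_distr) (simp_all add: measurable_coord)
    finally show ?thesis by (simp add: emeasure_pmf_single)
  qed
  ultimately show ?thesis by (simp only: prod.lessThan_Suc_shift nn_integral_sub[OF F])
qed

text \<open>Now the number of factors and the factors themselves may depend on the label of the
  root; the label takes countably many values, and conditioning means summing over them.\<close>

lemma root_product:
  fixes F :: "('d::finite) vdata \<Rightarrow> nat \<Rightarrow> (nat list \<Rightarrow> 'd vdata) \<Rightarrow> ennreal"
  assumes F: "\<And>v j. F v j \<in> borel_measurable (Omega \<mu>)"
  shows "(\<integral>\<^sup>+\<omega>. g (\<omega> []) * (\<Prod>j<m (\<omega> []). F (\<omega> []) j (sub j \<omega>)) \<partial>Omega \<mu>) =
    (\<integral>\<^sup>+v. g v * (\<Prod>j<m v. \<integral>\<^sup>+\<omega>. F v j \<omega> \<partial>Omega \<mu>) \<partial>vlaw \<mu>)"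
proof -
  have [measurable]: "(\<lambda>\<omega>. F v j (sub j \<omega>)) \<in> borel_measurable (Omega \<mu>)" for v j
    by (rule measurable_compose[OF measurable_sub F])
  have [measurable]: "(\<lambda>\<omega>. indicator {v} (\<omega> []) :: ennreal) \<in> borel_measurable (Omega \<mu>)" for v :: "'d vdata"
    by (rule measurable_compose[OF measurable_coord]) simp
  have "(\<integral>\<^sup>+\<omega>. g (\<omega> []) * (\<Prod>j<m (\<omega> []). F (\<omega> []) j (sub j \<omega>)) \<partial>Omega \<mu>)
    = (\<integral>\<^sup>+\<omega>. (\<integral>\<^sup>+v. g v * (indicator {v} (\<omega> []) * (\<Prod>j<m v. F v j (sub j \<omega>))) \<partial>count_space UNIV) \<partial>Omega \<mu>)"
  proof (rule nn_integral_cong)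
    fix \<omega> :: "nat list \<Rightarrow> 'd vdata"
    have "(\<integral>\<^sup>+v. g v * (indicator {v} (\<omega> []) * (\<Prod>j<m v. F v j (sub j \<omega>))) \<partial>count_space UNIV)
      = (\<integral>\<^sup>+v. (g v * (\<Prod>j<m v. F v j (sub j \<omega>))) * indicator {\<omega> []} v \<partial>count_space UNIV)"
      by (intro nn_integral_cong) (simp split: split_indicator)
    also have "\<dots> = g (\<omega> []) * (\<Prod>j<m (\<omega> []). F (\<omega> []) j (sub j \<omega>))"
      by (simp add: nn_integral_indicator_singleton)
    finally show "g (\<omega> []) * (\<Prod>j<m (\<omega> []). F (\<omega> []) j (sub j \<omega>)) = (\<integral>\<^sup>+v. g v * (indicator {v} (\<omega> []) * (\<Prod>j<m v. F v j (sub j \<omega>))) \<partial>count_space UNIV)" ..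
  qed
  also have "\<dots> = (\<integral>\<^sup>+v. (\<integral>\<^sup>+\<omega>. g v * (indicator {v} (\<omega> []) * (\<Prod>j<m v. F v j (sub j \<omega>))) \<partial>Omega \<mu>) \<partial>count_space UNIV)"
    by (rule nn_integral_count_space_nn_integral) auto
  also have "\<dots> = (\<integral>\<^sup>+v. ennreal (pmf (vlaw \<mu>) v) * (g v * (\<Prod>j<m v. \<integral>\<^sup>+\<omega>. F v j \<omega> \<partial>Omega \<mu>)) \<partial>count_space UNIV)"
  proof (rule nn_integral_cong)
    fix v
    have "(\<integral>\<^sup>+\<omega>. g v * (indicator {v} (\<omega> []) * (\<Prod>j<m v. F v j (sub j \<omega>))) \<partial>Omega \<mu>) = g v * (\<integral>\<^sup>+\<omega>. indicator {v} (\<omega> []) * (\<Prod>j<m v. F v j (sub j \<omega>)) \<partial>Omega \<mu>)"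
      by (rule nn_integral_cmult) measurable
    then show "(\<integral>\<^sup>+\<omega>. g v * (indicator {v} (\<omega> []) * (\<Prod>j<m v. F v j (sub j \<omega>))) \<partial>Omega \<mu>) = ennreal (pmf (vlaw \<mu>) v) * (g v * (\<Prod>j<m v. \<integral>\<^sup>+\<omega>. F v j \<omega> \<partial>Omega \<mu>))"
      by (simp add: root_product_fixed F mult_ac)
  qed
  also have "\<dots> = (\<integral>\<^sup>+v. g v * (\<Prod>j<m v. \<integral>\<^sup>+\<omega>. F v j \<omega> \<partial>Omega \<mu>) \<partial>vlaw \<mu>)"
    by (rule nn_integral_measure_pmf[symmetric])
  finally show ?thesis .
qed

text \<open>Even the chosen child may depend on the label of the root: all other factors are set to
  1.\<close>

lemma root_single:
  fixes F :: "('d::finite) vdata \<Rightarrow> (nat list \<Rightarrow> 'd vdata) \<Rightarrow> ennreal"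
  assumes F: "\<And>v. F v \<in> borel_measurable (Omega \<mu>)"
  shows "(\<integral>\<^sup>+\<omega>. F (\<omega> []) (sub (j (\<omega> [])) \<omega>) \<partial>Omega \<mu>) = (\<integral>\<^sup>+v. (\<integral>\<^sup>+\<omega>. F v \<omega> \<partial>Omega \<mu>) \<partial>vlaw \<mu>)"
proof -
  let ?F = "\<lambda>v i \<omega>. if i = j v then F v \<omega> else 1"
  interpret prob_space "Omega \<mu> :: (nat list \<Rightarrow> 'd vdata) measure" by (rule prob_space_Omega)
  have p: "(\<Prod>i<Suc (j v). if i = j v then a else 1) = (a :: ennreal)" for v a
    by (simp add: prod.delta)
  have "(\<integral>\<^sup>+\<omega>. 1 * (\<Prod>i<Suc (j (\<omega> [])). ?F (\<omega> []) i (sub i \<omega>)) \<partial>Omega \<mu>)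
     = (\<integral>\<^sup>+v. 1 * (\<Prod>i<Suc (j v). \<integral>\<^sup>+\<omega>. ?F v i \<omega> \<partial>Omega \<mu>) \<partial>vlaw \<mu>)"
  proof (rule root_product)
    show "?F v i \<in> borel_measurable (Omega \<mu>)" for v i using F[of v] by (cases "i = j v") auto
  qed
  moreover have "(\<Prod>i<Suc (j v). ?F v i (sub i \<omega>)) = F v (sub (j v) \<omega>)" for v and \<omega> :: "nat list \<Rightarrow> 'd vdata"
    using prod.delta[of "{..<Suc (j v)}" "j v" "\<lambda>i. F v (sub i \<omega>)"] by simp
  moreover have "(\<Prod>i<Suc (j v). \<integral>\<^sup>+\<omega>. ?F v i \<omega> \<partial>Omega \<mu>) = (\<integral>\<^sup>+\<omega>. F v \<omega> \<partial>Omega \<mu>)" for v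
  proof -
    have "(\<integral>\<^sup>+\<omega>. ?F v i \<omega> \<partial>Omega \<mu>) = (if i = j v then \<integral>\<^sup>+\<omega>. F v \<omega> \<partial>Omega \<mu> else 1)" for i
      using emeasure_space_1 by simp
    then show ?thesis by (simp only: p)
  qed
  ultimately show ?thesis by (simp only: mult_1)
qed

lemma nn_integral_nat_list:
  "(\<integral>\<^sup>+u. F u \<partial>count_space (UNIV :: nat list set)) = F [] + (\<Sum>j. \<integral>\<^sup>+u. F (j # u) \<partial>count_space UNIV)"
proof -
  have "(\<integral>\<^sup>+u. F u \<partial>count_space UNIV) = (\<integral>\<^sup>+u. F u * indicator {[]} u + (\<Sum>j. F u * indicator (range (Cons j)) u) \<partial>count_space UNIV)"
  proof (rule nn_integral_cong)
    fix u :: "nat list"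
    show "F u = F u * indicator {[]} u + (\<Sum>j. F u * indicator (range (Cons j)) u)"
    proof (cases u)
      case Nil
      then have "(\<Sum>j. F u * indicator (range (Cons j)) u) = (\<Sum>j. 0 :: ennreal)"
        by (intro suminf_cong) (auto simp: indicator_def)
      then show ?thesis using Nil by simp
    next
      case (Cons i w)
      have "(\<Sum>j. F u * indicator (range (Cons j)) u) = (\<Sum>j\<in>{i}. F u * indicator (range (Cons j)) u)"
        using Cons by (intro suminf_finite) (auto simp: indicator_def)
      then show ?thesis using Cons by simp
    qed
  qed
  also have "\<dots> = (\<integral>\<^sup>+u. F u * indicator {[]} u \<partial>count_space UNIV) + (\<Sum>j. \<integral>\<^sup>+u. F u * indicator (range (Cons j)) u \<partial>count_space UNIV)"
    by (subst nn_integral_add, simp, simp, subst nn_integral_suminf, simp, rule refl)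
  also have "(\<integral>\<^sup>+u. F u * indicator {[]} u \<partial>count_space UNIV) = F []"
    by (simp add: nn_integral_indicator_singleton)
  also have "(\<lambda>j. \<integral>\<^sup>+u. F u * indicator (range (Cons j)) u \<partial>count_space UNIV) = (\<lambda>j. \<integral>\<^sup>+u. F (j # u) \<partial>count_space UNIV)"
  proof
    fix j show "(\<integral>\<^sup>+u. F u * indicator (range (Cons j)) u \<partial>count_space UNIV) = (\<integral>\<^sup>+u. F (j # u) \<partial>count_space UNIV)"
    by (subst nn_integral_bij_count_space[of "Cons j" UNIV "range (Cons j)"])
       (auto simp: bij_betw_def inj_on_def nn_integral_count_space_indicator)
  qed
  finally show ?thesis .
qed

section \<open>Recursive description of normal trees and of the past\<close>

fun ntr :: "(nat list \<Rightarrow> ('d::finite) vdata) \<Rightarrow> nat list \<Rightarrow> bool" where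
  "ntr \<omega> [] = True"
| "ntr \<omega> (j # u) = (j < nrm_off (\<omega> []) \<and> ntr (sub j \<omega>) u)"

text \<open>Trees are re-rooted at the child 0 of the root, i.e. at the first vertex of the spine; ltr describes the
  past seen from there, and positions include the increment of the new root.\<close>

fun ltr :: "(nat list \<Rightarrow> ('d::finite) vdata) \<Rightarrow> nat list \<Rightarrow> bool" where
  "ltr \<omega> [] = True"
| "ltr \<omega> (j # u) = (if j < sp_idx (\<omega> []) then ntr (sub j \<omega>) u else j = sp_idx (\<omega> []) \<and> ltr (sub j \<omega>) u)"

fun pos :: "(nat list \<Rightarrow> ('d::finite) vdata) \<Rightarrow> int^'d \<Rightarrow> nat list \<Rightarrow> int^'d" where
  "pos \<omega> x [] = x + incr (\<omega> [])"
| "pos \<omega> x (j # u) = pos (sub j \<omega>) (x + incr (\<omega> [])) u"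

lemma pos_eq: "pos \<omega> x u = x + (\<Sum>k\<le>length u. incr (\<omega> (take k u)))"
  by (induction u arbitrary: \<omega> x) (simp_all add: sum.atMost_Suc_shift sub_def add.assoc del: sum.atMost_Suc)

lemma walk_Cons: "walk \<omega> x (i # u) = pos (sub i \<omega>) x u"
proof -
  have "(\<Sum>k\<in>{1..length (i # u)}. incr (\<omega> (take k (i # u)))) = (\<Sum>k\<le>length u. incr (\<omega> (take (Suc k) (i # u))))"
    by (rule sum.reindex_bij_witness[of _ Suc "\<lambda>k. k - 1"]) auto
  then show ?thesis by (simp add: walk_def pos_eq sub_def)
qed

text \<open>The spine seen from the new root, where the exceptional first step is gone.\<close>

fun sps :: "(nat list \<Rightarrow> ('d::finite) vdata) \<Rightarrow> nat \<Rightarrow> nat list" where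
  "sps \<omega> 0 = []"
| "sps \<omega> (Suc k) = sps \<omega> k @ [sp_idx (\<omega> (sps \<omega> k))]"

lemma spine_sps: "spine \<omega> (Suc k) = 0 # sps (sub 0 \<omega>) k"
  by (induction k) (auto simp: sub_def)

lemma sps_Suc: "sps \<omega> (Suc k) = sp_idx (\<omega> []) # sps (sub (sp_idx (\<omega> [])) \<omega>) k"
  by (induction k) (auto simp: sub_def)

lemma length_spine [simp]: "length (spine \<omega> k) = k"
  by (induction k) auto

lemma take_spine: "k \<le> m \<Longrightarrow> take k (spine \<omega> m) = spine \<omega> k"
  by (induction m) (auto simp: le_Suc_eq)

text \<open>Links the recursion on words to the description by spine vertices and their left
  siblings that \<open>past\<close> uses.\<close>

lemma ltr_iff: "ltr \<omega> u \<longleftrightarrow> (\<exists>k. u = sps \<omega> k) \<or>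
   (\<exists>k j w. j < sp_idx (\<omega> (sps \<omega> k)) \<and> u = sps \<omega> k @ [j] @ w \<and> ntr (\<lambda>v. \<omega> (sps \<omega> k @ [j] @ v)) w)"
proof (induction u arbitrary: \<omega>)
  case Nil
  show ?case by (auto intro: exI[of _ 0])
next
  case (Cons i u)
  define I where "I = sp_idx (\<omega> [])"
  have split: "(\<exists>k. P k) \<longleftrightarrow> P 0 \<or> (\<exists>k. P (Suc k))" for P :: "nat \<Rightarrow> bool"
    by (metis not0_implies_Suc)
  have ap: "\<omega> (I # v) = sub I \<omega> v" for v by (simp add: sub_def)
  have 1: "(\<exists>k. i # u = sps \<omega> k) \<longleftrightarrow> i = I \<and> (\<exists>k. u = sps (sub I \<omega>) k)"
    by (subst split) (auto simp del: sps.simps(2) simp: sps_Suc I_def)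
  have 2: "(\<exists>k j w. j < sp_idx (\<omega> (sps \<omega> k)) \<and> i # u = sps \<omega> k @ [j] @ w \<and> ntr (\<lambda>v. \<omega> (sps \<omega> k @ [j] @ v)) w)
    \<longleftrightarrow> (i < I \<and> ntr (sub i \<omega>) u) \<or> (i = I \<and> (\<exists>k j w. j < sp_idx (sub I \<omega> (sps (sub I \<omega>) k)) \<and> u = sps (sub I \<omega>) k @ [j] @ w \<and> ntr (\<lambda>v. sub I \<omega> (sps (sub I \<omega>) k @ [j] @ v)) w))"
    by (subst split) (auto simp del: sps.simps(2) simp: sps_Suc I_def sub_def)
  show ?case unfolding 1 2 using Cons[of "sub I \<omega>"] by (auto simp: I_def)
qed

lemma ntr_snoc: "ntr \<omega> (w @ [i]) \<longleftrightarrow> ntr \<omega> w \<and> i < nrm_off (\<omega> w)"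
  by (induction w arbitrary: \<omega>) (auto simp: sub_def)

lemma tree_snoc: "u @ [i] \<in> tree \<omega> \<longleftrightarrow> u \<in> tree \<omega> \<and> i < nchildren \<omega> u"
proof
  assume "u @ [i] \<in> tree \<omega>"
  then show "u \<in> tree \<omega> \<and> i < nchildren \<omega> u" by (cases rule: tree.cases) auto
qed (auto intro: tree.intros)

text \<open>An almost sure event on which the special index points to an actual child and the root
  has a child 0, so that the spine lies in the tree.\<close>

definition proper :: "(nat list \<Rightarrow> ('d::finite) vdata) \<Rightarrow> bool" where
  "proper \<omega> \<longleftrightarrow> (\<forall>u. sp_idx (\<omega> u) < sp_off (\<omega> u) \<and> 0 < root_off (\<omega> u))"

lemma spine_tree: "proper \<omega> \<Longrightarrow> spine \<omega> k \<in> tree \<omega>"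
proof (induction k)
  case (Suc k)
  show ?case
  proof (cases k)
    case 0
    then show ?thesis using Suc tree_snoc[of "[]" 0 \<omega>] by (simp add: nchildren_def proper_def tree.root)
  next
    case (Suc k')
    have "spine \<omega> k \<noteq> []" using Suc by (metis length_spine length_0_conv nat.distinct(1))
    then have "nchildren \<omega> (spine \<omega> k) = sp_off (\<omega> (spine \<omega> k))" by (simp add: nchildren_def)
    then show ?thesis using Suc.IH Suc.prems \<open>k = Suc k'\<close>
      by (simp only: spine.simps tree_snoc) (simp add: proper_def)
  qed
qed (simp add: tree.root)

text \<open>Left of the spine all vertices are normal: the spine has one word of each length and its
  words are prefixes of one another, so a word that has left it never meets it again.\<close>

lemma side_tree:
  assumes g: "proper \<omega>" and k: "1 \<le> k" and j: "j < sp_idx (\<omega> (spine \<omega> k))"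
  shows "spine \<omega> k @ [j] @ w \<in> tree \<omega> \<longleftrightarrow> ntr (\<lambda>v. \<omega> (spine \<omega> k @ [j] @ v)) w"
proof (induction w rule: rev_induct)
  case Nil
  have ne: "spine \<omega> k \<noteq> []" using k by (metis length_spine length_0_conv not_one_le_zero)
  then have "nchildren \<omega> (spine \<omega> k) = sp_off (\<omega> (spine \<omega> k))" by (simp add: nchildren_def)
  moreover have "sp_idx (\<omega> (spine \<omega> k)) < sp_off (\<omega> (spine \<omega> k))" using g by (simp add: proper_def)
  ultimately show ?case using j spine_tree[OF g, of k] by (simp add: tree_snoc)
next
  case (snoc i w)
  have "spine \<omega> k @ [j] @ w \<notin> range (spine \<omega>)"
  proof
    assume "spine \<omega> k @ [j] @ w \<in> range (spine \<omega>)"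
    then obtain m where m: "spine \<omega> k @ [j] @ w = spine \<omega> m" by auto
    have "m = length (spine \<omega> k @ [j] @ w)" unfolding m by simp
    then have "Suc k \<le> m" by simp
    from take_spine[OF this, of \<omega>] have "take (Suc k) (spine \<omega> k @ [j] @ w) = spine \<omega> (Suc k)" unfolding m .
    then have "spine \<omega> k @ [j] = spine \<omega> (Suc k)" by simp
    then show False using j k by simp
  qed
  then have nc: "nchildren \<omega> (spine \<omega> k @ [j] @ w) = nrm_off (\<omega> (spine \<omega> k @ [j] @ w))" by (simp add: nchildren_def)
  have "spine \<omega> k @ [j] @ w @ [i] = (spine \<omega> k @ [j] @ w) @ [i]" by simp
  then show ?case using snoc nc by (simp only: tree_snoc ntr_snoc)
qed

lemma past_eq: "proper \<omega> \<Longrightarrow> past \<omega> = Cons 0 ` {u. ltr (sub 0 \<omega>) u}"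
proof -
  assume g: "proper \<omega>"
  have ex1: "(\<exists>k\<ge>1. P k) \<longleftrightarrow> (\<exists>k. P (Suc k))" for P :: "nat \<Rightarrow> bool"
    by (auto simp: Suc_le_eq gr0_conv_Suc)
  have past_iff: "u \<in> past \<omega> \<longleftrightarrow> (\<exists>k\<ge>1. u = spine \<omega> k) \<or>
    (\<exists>k\<ge>1. \<exists>j w. j < sp_idx (\<omega> (spine \<omega> k)) \<and> u = spine \<omega> k @ [j] @ w \<and> ntr (\<lambda>v. \<omega> (spine \<omega> k @ [j] @ v)) w)"
    (is "_ \<longleftrightarrow> ?A \<or> ?B") for u
  proof
    assume "u \<in> past \<omega>"
    then consider (a) "?A" | (b) k j w where "u \<in> tree \<omega>" "1 \<le> k" "j < sp_idx (\<omega> (spine \<omega> k))" "u = spine \<omega> k @ [j] @ w"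
      unfolding past_def by blast
    then show "?A \<or> ?B"
    proof cases
      case b
      then have "ntr (\<lambda>v. \<omega> (spine \<omega> k @ [j] @ v)) w" using side_tree[OF g b(2,3), of w] by simp
      then show ?thesis using b by blast
    qed blast
  next
    assume "?A \<or> ?B"
    then consider (a) k where "1 \<le> k" "u = spine \<omega> k"
      | (b) k j w where "1 \<le> k" "j < sp_idx (\<omega> (spine \<omega> k))" "u = spine \<omega> k @ [j] @ w" "ntr (\<lambda>v. \<omega> (spine \<omega> k @ [j] @ v)) w"
      by blast
    then show "u \<in> past \<omega>"
    proof cases
      case a
      then show ?thesis using spine_tree[OF g, of k] unfolding past_def by blast
    next
      case b
      then have "u \<in> tree \<omega>" using side_tree[OF g b(1,2), of w] by simp
      then show ?thesis using b unfolding past_def by blast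
    qed
  qed
  have "u \<in> past \<omega> \<longleftrightarrow> (\<exists>w. u = 0 # w \<and> ltr (sub 0 \<omega>) w)" for u
  proof -
    have 1: "(\<exists>k\<ge>1. u = spine \<omega> k) \<longleftrightarrow> (\<exists>w. u = 0 # w \<and> (\<exists>k. w = sps (sub 0 \<omega>) k))"
      unfolding ex1 spine_sps by blast
    have 2: "(\<exists>k\<ge>1. \<exists>j w. j < sp_idx (\<omega> (spine \<omega> k)) \<and> u = spine \<omega> k @ [j] @ w \<and> ntr (\<lambda>v. \<omega> (spine \<omega> k @ [j] @ v)) w)
      \<longleftrightarrow> (\<exists>x. u = 0 # x \<and> (\<exists>k j w. j < sp_idx (sub 0 \<omega> (sps (sub 0 \<omega>) k)) \<and> x = sps (sub 0 \<omega>) k @ [j] @ w \<and> ntr (\<lambda>v. sub 0 \<omega> (sps (sub 0 \<omega>) k @ [j] @ v)) w))"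
      unfolding ex1 spine_sps sub_def append_Cons by blast
    show ?thesis unfolding past_iff 1 2 by (subst ltr_iff) blast
  qed
  then show ?thesis by (auto simp: image_def)
qed

text \<open>\<open>C1\<close> is half of the offspring variance, since the mean is 1. It is also the
  mean number of left siblings of the special child at a spine vertex.\<close>

locale crit =
  fixes \<mu> :: "nat pmf" and C1 :: real
  assumes mean: "(\<integral>\<^sup>+n. of_nat n \<partial>measure_pmf \<mu>) = 1"
    and C1_eq: "(\<integral>\<^sup>+n. (\<Sum>j<n. of_nat j) \<partial>measure_pmf \<mu>) = ennreal C1" and C1_nonneg: "0 \<le> C1"
begin

lemma size_mass: "(\<integral>\<^sup>+x. ennreal (real x * pmf \<mu> x) \<partial>count_space UNIV) = 1"
proof -
  have "(\<integral>\<^sup>+x. ennreal (real x * pmf \<mu> x) \<partial>count_space UNIV) = (\<integral>\<^sup>+x. ennreal (pmf \<mu> x) * of_nat x \<partial>count_space UNIV)"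
    by (intro nn_integral_cong) (simp add: ennreal_mult ennreal_of_nat_eq_real_of_nat mult.commute)
  also have "\<dots> = 1" unfolding nn_integral_measure_pmf[symmetric] by (rule mean)
  finally show ?thesis .
qed

lemma pmf_size: "pmf (embed_pmf (\<lambda>i. real i * pmf \<mu> i)) x = real x * pmf \<mu> x"
  by (rule pmf_embed_pmf) (simp_all add: size_mass)

lemma set_size: "set_pmf (embed_pmf (\<lambda>i. real i * pmf \<mu> i)) \<subseteq> {i. 0 < i}"
  by (auto simp: set_pmf_iff pmf_size intro: gr0I)

text \<open>The factor i of the size bias cancels the 1/i of the uniform choice, so the special
  index equals j with probability \<mu>{n. n > j}.\<close>

lemma nn_integral_sizebiased:
  "(\<integral>\<^sup>+q. h (snd q) \<partial>sizebiased \<mu>) = (\<integral>\<^sup>+n. (\<Sum>j<n. h j) \<partial>measure_pmf \<mu>)"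
proof -
  have "(\<integral>\<^sup>+q. h (snd q) \<partial>sizebiased \<mu>) = (\<integral>\<^sup>+i. \<integral>\<^sup>+j. h j \<partial>pmf_of_set {0..<i} \<partial>embed_pmf (\<lambda>i. real i * pmf \<mu> i))"
    by (simp add: sizebiased_def)
  also have "\<dots> = (\<integral>\<^sup>+i. ennreal (pmf \<mu> i) * (\<Sum>j<i. h j) \<partial>count_space UNIV)"
    unfolding nn_integral_measure_pmf[of "embed_pmf _"] pmf_size
  proof (rule nn_integral_cong)
    fix i
    show "ennreal (real i * pmf \<mu> i) * (\<integral>\<^sup>+j. h j \<partial>pmf_of_set {0..<i}) = ennreal (pmf \<mu> i) * (\<Sum>j<i. h j)"
    proof (cases "i = 0")
      case False
      then have "(\<integral>\<^sup>+j. h j \<partial>pmf_of_set {0..<i}) = (\<Sum>j<i. h j) / of_nat i"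
        by (subst nn_integral_pmf_of_set) (auto simp: lessThan_atLeast0)
      moreover have "of_nat i * (\<Sum>j<i. h j) / of_nat i = (\<Sum>j<i. h j)"
        using False ennreal_mult_divide_eq[of "of_nat i" "\<Sum>j<i. h j"] by (simp add: mult.commute)
      moreover have "of_nat i * ennreal (pmf \<mu> i) * ((\<Sum>j<i. h j) / of_nat i) = ennreal (pmf \<mu> i) * (of_nat i * (\<Sum>j<i. h j) / of_nat i)"
        by (simp add: ennreal_times_divide mult_ac)
      ultimately show ?thesis
        by (simp add: ennreal_mult ennreal_of_nat_eq_real_of_nat[symmetric])
    qed simp
  qed
  finally show ?thesis by (simp only: nn_integral_measure_pmf)
qed

lemma nn_integral_normal:
  "(\<integral>\<^sup>+v. H (nrm_off v) (incr v) \<partial>vlaw \<mu>) = (\<integral>\<^sup>+x. \<integral>\<^sup>+n. H n x \<partial>measure_pmf \<mu> \<partial>pmf_of_set (nbrs :: (int^'d::finite) set))"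
  by (simp add: vlaw_def nrm_off_def incr_def nn_integral_pair_pmf' nn_integral_pmf_of_set nbrs_ne measure_pmf.emeasure_space_1 nn_integral_divide nn_integral_sum del: space_measure_pmf)

lemma nn_integral_special:
  "(\<integral>\<^sup>+v. H (sp_idx v) (incr v) \<partial>vlaw \<mu>) = (\<integral>\<^sup>+x. \<integral>\<^sup>+n. (\<Sum>j<n. H j x) \<partial>measure_pmf \<mu> \<partial>pmf_of_set (nbrs :: (int^'d::finite) set))"
proof -
  have "(\<integral>\<^sup>+v. H (sp_idx v) (incr v) \<partial>vlaw \<mu>) = (\<integral>\<^sup>+q. (\<Sum>x\<in>nbrs. H (snd q) x) / of_nat (card (nbrs :: (int^'d) set)) \<partial>sizebiased \<mu>)"
    by (simp add: vlaw_def sp_idx_def incr_def nn_integral_pair_pmf' nn_integral_pmf_of_set nbrs_ne measure_pmf.emeasure_space_1 del: space_measure_pmf)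
  also have "\<dots> = (\<Sum>x\<in>nbrs. \<integral>\<^sup>+q. H (snd q) x \<partial>sizebiased \<mu>) / of_nat (card (nbrs :: (int^'d) set))"
    by (simp add: nn_integral_divide nn_integral_sum)
  also have "\<dots> = (\<Sum>x\<in>nbrs. \<integral>\<^sup>+n. (\<Sum>j<n. H j x) \<partial>measure_pmf \<mu>) / of_nat (card (nbrs :: (int^'d) set))"
    by (simp only: nn_integral_sizebiased[where h="\<lambda>j. H j x" for x])
  finally show ?thesis by (simp add: nn_integral_pmf_of_set nbrs_ne)
qed

lemma nn_integral_nbrs:
  assumes "\<And>z. 0 \<le> f z"
  shows "(\<integral>\<^sup>+v. ennreal (f (z + v)) \<partial>pmf_of_set (nbrs :: (int^'d::finite) set)) = ennreal (srw f z)"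
proof -
  have "(\<integral>\<^sup>+v. ennreal (f (z + v)) \<partial>pmf_of_set (nbrs :: (int^'d::finite) set)) = ennreal (\<Sum>v\<in>nbrs. f (z + v)) / ennreal (real (card (nbrs :: (int^'d) set)))"
    using assms by (simp add: nn_integral_pmf_of_set nbrs_ne ennreal_of_nat_eq_real_of_nat)
  also have "\<dots> = ennreal ((\<Sum>v\<in>nbrs. f (z + v)) / real (card (nbrs :: (int^'d) set)))"
    using assms by (intro divide_ennreal sum_nonneg) (auto simp: card_nbrs)
  finally show ?thesis by (simp add: srw_def card_nbrs)
qed

lemma AE_proper: "AE \<omega> in Omega \<mu>. proper (\<omega> :: nat list \<Rightarrow> ('d::finite) vdata)"
proof -
  have "AE v in measure_pmf (vlaw \<mu> :: 'd vdata pmf). sp_idx v < sp_off v \<and> 0 < root_off v"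
  proof (rule AE_pmfI)
    fix v :: "'d vdata" assume "v \<in> set_pmf (vlaw \<mu>)"
    then have q: "fst (snd v) \<in> set_pmf (sizebiased \<mu>)" and r: "fst (snd (snd v)) \<in> set_pmf (map_pmf Suc \<mu>)"
      by (auto simp: vlaw_def set_pair_pmf)
    from q obtain i where i: "i \<in> set_pmf (embed_pmf (\<lambda>i. real i * pmf \<mu> i))"
      and iq: "fst (snd v) \<in> (\<lambda>j. (i, j)) ` set_pmf (pmf_of_set {0..<i})"
      by (auto simp: sizebiased_def)
    have "0 < i" using i set_size by auto
    then have "set_pmf (pmf_of_set {0..<i}) = {0..<i}" by (intro set_pmf_of_set) auto
    then have "sp_idx v < sp_off v" using iq by (auto simp: sp_idx_def sp_off_def)
    moreover have "0 < root_off v" using r by (auto simp: root_off_def)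
    ultimately show "sp_idx v < sp_off v \<and> 0 < root_off v" ..
  qed
  then have "AE \<omega> in Omega \<mu>. sp_idx (\<omega> u) < sp_off (\<omega> u) \<and> 0 < root_off (\<omega> u :: 'd vdata)" for u
    unfolding Omega_def by (intro AE_PiM_component) (auto simp: measure_pmf.prob_space_axioms)
  then show ?thesis unfolding proper_def AE_all_countable by blast
qed

end

section \<open>Expected occupation and avoidance probabilities\<close>

context crit
begin

text \<open>The label of the root takes countably many values, so measurability can be checked with
  the label frozen.\<close>

lemma measurable_root:
  fixes F :: "('d::finite) vdata \<Rightarrow> (nat list \<Rightarrow> 'd vdata) \<Rightarrow> 'a"
  assumes "\<And>v. F v \<in> Omega \<mu> \<rightarrow>\<^sub>M N"
  shows "(\<lambda>\<omega>. F (\<omega> []) \<omega>) \<in> Omega \<mu> \<rightarrow>\<^sub>M N"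
  by (rule measurable_compose_countable[OF assms measurable_coord])

lemma measurable_sub': "f \<in> Omega \<mu> \<rightarrow>\<^sub>M N \<Longrightarrow> (\<lambda>\<omega>. f (sub j \<omega>)) \<in> Omega \<mu> \<rightarrow>\<^sub>M N"
  by (rule measurable_compose[OF measurable_sub])

lemma nn_integral_incr:
  "(\<integral>\<^sup>+v. h (incr v) \<partial>vlaw \<mu>) = (\<integral>\<^sup>+x. h x \<partial>pmf_of_set (nbrs :: (int^'d::finite) set))"
  using nn_integral_normal[of "\<lambda>_. h"] by (simp add: measure_pmf.emeasure_space_1 del: space_measure_pmf)

text \<open>Counting by generation permits induction on \<open>n\<close>. The counts are
  \<open>ennreal\<close> integrals, so no finiteness is required beforehand.\<close>

definition Yc :: "int^'d::finite \<Rightarrow> nat \<Rightarrow> int^'d \<Rightarrow> (nat list \<Rightarrow> 'd vdata) \<Rightarrow> ennreal" where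
  "Yc y n x \<omega> = (\<integral>\<^sup>+u. (if length u = n \<and> ntr \<omega> u \<and> pos \<omega> x u = y then 1 else 0) \<partial>count_space UNIV)"
definition Zc :: "int^'d::finite \<Rightarrow> nat \<Rightarrow> int^'d \<Rightarrow> (nat list \<Rightarrow> 'd vdata) \<Rightarrow> ennreal" where
  "Zc y n x \<omega> = (\<integral>\<^sup>+u. (if length u = n \<and> ltr \<omega> u \<and> pos \<omega> x u = y then 1 else 0) \<partial>count_space UNIV)"

lemma Yc_0: "Yc y 0 x \<omega> = (if x + incr (\<omega> []) = y then 1 else 0)"
  unfolding Yc_def by (subst nn_integral_nat_list) simp
lemma Zc_0: "Zc y 0 x \<omega> = (if x + incr (\<omega> []) = y then 1 else 0)"
  unfolding Zc_def by (subst nn_integral_nat_list) simp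

lemma Yc_Suc: "Yc y (Suc n) x \<omega> = (\<Sum>j. if j < nrm_off (\<omega> []) then Yc y n (x + incr (\<omega> [])) (sub j \<omega>) else 0)"
  unfolding Yc_def by (subst nn_integral_nat_list) (auto intro!: suminf_cong)

lemma Zc_Suc: "Zc y (Suc n) x \<omega> = (\<Sum>j. if j < sp_idx (\<omega> []) then Yc y n (x + incr (\<omega> [])) (sub j \<omega>)
    else if j = sp_idx (\<omega> []) then Zc y n (x + incr (\<omega> [])) (sub j \<omega>) else 0)"
  unfolding Yc_def Zc_def by (subst nn_integral_nat_list) (auto intro!: suminf_cong)

lemma measurable_Yc: "Yc y n x \<in> borel_measurable (Omega \<mu>)"
proof (induction n arbitrary: x)
  case 0
  show ?case unfolding Yc_0[abs_def] by (rule measurable_root) simp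
next
  case (Suc n)
  have "(\<lambda>\<omega>. if j < nrm_off (\<omega> []) then Yc y n (x + incr (\<omega> [])) (sub j \<omega>) else 0) \<in> borel_measurable (Omega \<mu>)" for j
  proof (rule measurable_root[where F = "\<lambda>v \<omega>. if j < nrm_off v then Yc y n (x + incr v) (sub j \<omega>) else 0"])
    fix v :: "'a vdata"
    show "(\<lambda>\<omega>. if j < nrm_off v then Yc y n (x + incr v) (sub j \<omega>) else 0) \<in> borel_measurable (Omega \<mu>)"
      using measurable_sub'[OF Suc] by (cases "j < nrm_off v") auto
  qed
  then show ?case unfolding Yc_Suc[abs_def] by (rule borel_measurable_suminf_order)
qed

lemma measurable_Zc: "Zc y n x \<in> borel_measurable (Omega \<mu>)"
proof (induction n arbitrary: x)
  case 0
  show ?case unfolding Zc_0[abs_def] by (rule measurable_root) simp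
next
  case (Suc n)
  have "(\<lambda>\<omega>. if j < sp_idx (\<omega> []) then Yc y n (x + incr (\<omega> [])) (sub j \<omega>)
    else if j = sp_idx (\<omega> []) then Zc y n (x + incr (\<omega> [])) (sub j \<omega>) else 0) \<in> borel_measurable (Omega \<mu>)" for j
  proof (rule measurable_root[where F = "\<lambda>v \<omega>. if j < sp_idx v then Yc y n (x + incr v) (sub j \<omega>)
    else if j = sp_idx v then Zc y n (x + incr v) (sub j \<omega>) else 0"])
    fix v :: "'a vdata"
    show "(\<lambda>\<omega>. if j < sp_idx v then Yc y n (x + incr v) (sub j \<omega>)
      else if j = sp_idx v then Zc y n (x + incr v) (sub j \<omega>) else 0) \<in> borel_measurable (Omega \<mu>)"
      using measurable_sub'[OF Suc] measurable_sub'[OF measurable_Yc] by (cases "j < sp_idx v"; cases "j = sp_idx v") auto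
  qed
  then show ?case unfolding Zc_Suc[abs_def] by (rule borel_measurable_suminf_order)
qed

lemma suminf_if_less: "(\<Sum>j. if j < n then c else 0) = of_nat n * (c :: ennreal)"
  by (subst suminf_finite[of "{..<n}"]) (auto simp: sum.If_cases)

lemma suminf_if_less_eq: "(\<Sum>j. if j < n then a else if j = n then b else 0) = of_nat n * a + (b :: ennreal)"
  by (subst suminf_finite[of "{..<Suc n}"]) (auto simp: sum.If_cases)

lemma root_const: "(\<integral>\<^sup>+\<omega>. h (incr (\<omega> [])) \<partial>Omega \<mu>) = (\<integral>\<^sup>+x. h x \<partial>pmf_of_set (nbrs :: (int^'d::finite) set))"
proof -
  interpret prob_space "Omega \<mu> :: (nat list \<Rightarrow> 'd vdata) measure" by (rule prob_space_Omega)
  have "(\<integral>\<^sup>+\<omega>. h (incr (\<omega> [])) \<partial>Omega \<mu>) = (\<integral>\<^sup>+v. (\<integral>\<^sup>+\<omega>. h (incr v) \<partial>(Omega \<mu> :: (nat list \<Rightarrow> 'd vdata) measure)) \<partial>vlaw \<mu>)"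
    by (rule root_single[where F="\<lambda>v _. h (incr v)"]) simp
  also have "\<dots> = (\<integral>\<^sup>+v. h (incr v) \<partial>vlaw \<mu>)" using emeasure_space_1 by simp
  finally show ?thesis by (simp only: nn_integral_incr)
qed

lemma step_0: "(\<integral>\<^sup>+\<omega>. (if x + incr (\<omega> []) = y then 1 else 0) \<partial>Omega \<mu>) = ennreal (srw (indicat_real {y}) (x :: int^'d::finite))"
proof -
  have "(\<integral>\<^sup>+\<omega>. (if x + incr (\<omega> []) = y then 1 else 0) \<partial>Omega \<mu>) = (\<integral>\<^sup>+v. ennreal (indicat_real {y} (x + v)) \<partial>pmf_of_set nbrs)"
    unfolding root_const[where h="\<lambda>v. if x + v = y then 1 else 0"] by (intro nn_integral_cong) (simp add: indicator_def)
  then show ?thesis by (simp add: nn_integral_nbrs)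
qed

text \<open>Many-to-one: with one child on average, a generation is distributed in the mean like a
  single walk. \<open>Suc n\<close> includes the step to the root of the branch.\<close>

lemma E_Yc: "(\<integral>\<^sup>+\<omega>. Yc y n x \<omega> \<partial>Omega \<mu>) = ennreal (srwn (Suc n) (indicat_real {y}) (x :: int^'d::finite))"
proof (induction n arbitrary: x)
  case 0
  show ?case unfolding Yc_0 using step_0 by simp
next
  case (Suc n)
  define f where "f = srwn (Suc n) (indicat_real {y})"
  have f0: "0 \<le> f z" for z unfolding f_def by (intro srwn_nonneg) simp
  let ?F = "\<lambda>j v \<omega>. if j < nrm_off v then Yc y n (x + incr v) \<omega> else 0"
  have mF: "?F j v \<in> borel_measurable (Omega \<mu>)" for j v
    using measurable_Yc by (cases "j < nrm_off v") auto
  have "(\<integral>\<^sup>+\<omega>. Yc y (Suc n) x \<omega> \<partial>Omega \<mu>) = (\<Sum>j. \<integral>\<^sup>+\<omega>. ?F j (\<omega> []) (sub j \<omega>) \<partial>Omega \<mu>)"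
    unfolding Yc_Suc
  proof (rule nn_integral_suminf)
    fix j
    show "(\<lambda>\<omega>. ?F j (\<omega> []) (sub j \<omega>)) \<in> borel_measurable (Omega \<mu>)"
      by (rule measurable_root[where F="\<lambda>v \<omega>. ?F j v (sub j \<omega>)"]) (rule measurable_sub'[OF mF])
  qed
  also have "\<dots> = (\<Sum>j. \<integral>\<^sup>+v. (\<integral>\<^sup>+\<omega>. ?F j v \<omega> \<partial>Omega \<mu>) \<partial>vlaw \<mu>)"
    by (intro suminf_cong root_single[where j="\<lambda>_. j" for j] mF)
  also have "\<dots> = (\<Sum>j. \<integral>\<^sup>+v. (if j < nrm_off v then ennreal (f (x + incr v)) else 0) \<partial>vlaw \<mu>)"
    by (intro suminf_cong nn_integral_cong) (simp add: Suc f_def del: funpow.simps)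
  also have "\<dots> = (\<integral>\<^sup>+v. (\<Sum>j. if j < nrm_off v then ennreal (f (x + incr v)) else 0) \<partial>vlaw \<mu>)"
    by (rule nn_integral_suminf[symmetric]) simp
  also have "\<dots> = (\<integral>\<^sup>+v. of_nat (nrm_off v) * ennreal (f (x + incr v)) \<partial>vlaw \<mu>)"
    by (simp only: suminf_if_less)
  also have "\<dots> = (\<integral>\<^sup>+v. \<integral>\<^sup>+n. of_nat n * ennreal (f (x + v)) \<partial>measure_pmf \<mu> \<partial>pmf_of_set nbrs)"
    by (rule nn_integral_normal)
  also have "\<dots> = (\<integral>\<^sup>+v. ennreal (f (x + v)) \<partial>pmf_of_set nbrs)"
    by (simp add: nn_integral_multc mean)
  also have "\<dots> = ennreal (srw f x)" by (rule nn_integral_nbrs[OF f0])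
  finally show ?case by (simp add: f_def)
qed

text \<open>At each generation the next spine vertex continues the past, and \<open>C1\<close>
  normal branches start to its left on average; hence the coefficient grows by
  \<open>C1\<close>.\<close>

lemma E_Zc: "(\<integral>\<^sup>+\<omega>. Zc y n x \<omega> \<partial>Omega \<mu>) = ennreal ((1 + n * C1) * srwn (Suc n) (indicat_real {y}) (x :: int^'d::finite))"
proof (induction n arbitrary: x)
  case 0
  show ?case unfolding Zc_0 using step_0 by simp
next
  case (Suc n)
  define f where "f = srwn (Suc n) (indicat_real {y})"
  have f0: "0 \<le> f z" for z unfolding f_def by (intro srwn_nonneg) simp
  have c0: "0 \<le> 1 + real n * C1" using C1_nonneg by simp
  let ?F = "\<lambda>j v \<omega>. if j < sp_idx v then Yc y n (x + incr v) \<omega> else if j = sp_idx v then Zc y n (x + incr v) \<omega> else 0"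
  have mF: "?F j v \<in> borel_measurable (Omega \<mu>)" for j v
    using measurable_Yc measurable_Zc by (cases "j < sp_idx v"; cases "j = sp_idx v") auto
  let ?g = "\<lambda>v. ennreal (f (x + v))" and ?h = "\<lambda>v. ennreal ((1 + n * C1) * f (x + v))"
  have "(\<integral>\<^sup>+\<omega>. Zc y (Suc n) x \<omega> \<partial>Omega \<mu>) = (\<Sum>j. \<integral>\<^sup>+\<omega>. ?F j (\<omega> []) (sub j \<omega>) \<partial>Omega \<mu>)"
    unfolding Zc_Suc
  proof (rule nn_integral_suminf)
    fix j
    show "(\<lambda>\<omega>. ?F j (\<omega> []) (sub j \<omega>)) \<in> borel_measurable (Omega \<mu>)"
      by (rule measurable_root[where F="\<lambda>v \<omega>. ?F j v (sub j \<omega>)"]) (rule measurable_sub'[OF mF])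
  qed
  also have "\<dots> = (\<Sum>j. \<integral>\<^sup>+v. (\<integral>\<^sup>+\<omega>. ?F j v \<omega> \<partial>Omega \<mu>) \<partial>vlaw \<mu>)"
    by (intro suminf_cong root_single[where j="\<lambda>_. j" for j] mF)
  also have "\<dots> = (\<Sum>j. \<integral>\<^sup>+v. (if j < sp_idx v then ?g (incr v) else if j = sp_idx v then ?h (incr v) else 0) \<partial>vlaw \<mu>)"
    by (intro suminf_cong nn_integral_cong) (simp add: Suc E_Yc f_def del: funpow.simps)
  also have "\<dots> = (\<integral>\<^sup>+v. (\<Sum>j. if j < sp_idx v then ?g (incr v) else if j = sp_idx v then ?h (incr v) else 0) \<partial>vlaw \<mu>)"
    by (rule nn_integral_suminf[symmetric]) simp
  also have "\<dots> = (\<integral>\<^sup>+v. of_nat (sp_idx v) * ?g (incr v) + ?h (incr v) \<partial>vlaw \<mu>)"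
    by (simp only: suminf_if_less_eq)
  also have "\<dots> = (\<integral>\<^sup>+v. \<integral>\<^sup>+m. (\<Sum>j<m. of_nat j * ?g v + ?h v) \<partial>measure_pmf \<mu> \<partial>pmf_of_set nbrs)"
    by (rule nn_integral_special)
  also have "\<dots> = (\<integral>\<^sup>+v. ennreal ((1 + real (Suc n) * C1) * f (x + v)) \<partial>pmf_of_set nbrs)"
  proof (rule nn_integral_cong)
    fix v
    have "(\<integral>\<^sup>+m. (\<Sum>j<m. of_nat j * ?g v + ?h v) \<partial>measure_pmf \<mu>) = (\<integral>\<^sup>+m. (\<Sum>j<m. of_nat j) * ?g v + of_nat m * ?h v \<partial>measure_pmf \<mu>)"
      by (simp add: sum.distrib sum_distrib_right)
    also have "\<dots> = ennreal C1 * ?g v + ?h v"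
      by (subst nn_integral_add) (simp_all add: nn_integral_multc mean C1_eq)
    also have "\<dots> = ennreal (C1 * f (x + v) + (1 + n * C1) * f (x + v))"
      using C1_nonneg c0 f0 by (simp add: ennreal_mult[symmetric] ennreal_plus[symmetric] del: ennreal_plus)
    also have "C1 * f (x + v) + (1 + n * C1) * f (x + v) = (1 + real (Suc n) * C1) * f (x + v)" by (simp add: algebra_simps)
    finally show "(\<integral>\<^sup>+m. (\<Sum>j<m. of_nat j * ?g v + ?h v) \<partial>measure_pmf \<mu>) = ennreal ((1 + real (Suc n) * C1) * f (x + v))" .
  qed
  also have "\<dots> = ennreal (srw (\<lambda>z. (1 + real (Suc n) * C1) * f z) x)"
    using C1_nonneg f0 by (intro nn_integral_nbrs) simp
  finally show ?case by (simp add: f_def srw_cmult)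
qed

text \<open>The new root is itself one step away from x, so generation n of the re-rooted past sits
  at n + 1 steps.\<close>

lemma Gf_eq: "Gf \<mu> x y = (\<Sum>n. ennreal ((1 + n * C1) * srwn (Suc n) (indicat_real {y}) (x :: int^'d::finite)))"
proof -
  have "Gf \<mu> x y = (\<integral>\<^sup>+\<omega>. (\<Sum>n. Zc y n x (sub 0 \<omega>)) \<partial>Omega \<mu>)"
    unfolding Gf_def
  proof (rule nn_integral_cong_AE, rule AE_mp[OF AE_proper], rule AE_I2, rule impI)
    fix \<omega> :: "nat list \<Rightarrow> 'd vdata" assume "proper \<omega>"
    then have past: "past \<omega> = Cons 0 ` {u. ltr (sub 0 \<omega>) u}" by (rule past_eq)
    have "(\<integral>\<^sup>+u. indicator {y} (walk \<omega> x u) \<partial>count_space (past \<omega>)) = (\<integral>\<^sup>+u. indicator {y} (walk \<omega> x (0 # u)) \<partial>count_space {u. ltr (sub 0 \<omega>) u})"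
      unfolding past by (rule nn_integral_bij_count_space[symmetric]) (auto simp: bij_betw_def inj_on_def)
    also have "\<dots> = (\<integral>\<^sup>+u. (\<Sum>n. if length u = n \<and> ltr (sub 0 \<omega>) u \<and> pos (sub 0 \<omega>) x u = y then 1 else 0) \<partial>count_space UNIV)"
      unfolding nn_integral_count_space_indicator
    proof (subst nn_integral_count_space_indicator, simp, rule nn_integral_cong)
      fix u
      have "(\<Sum>n. if length u = n \<and> ltr (sub 0 \<omega>) u \<and> pos (sub 0 \<omega>) x u = y then 1 else 0 :: ennreal) = (if ltr (sub 0 \<omega>) u \<and> pos (sub 0 \<omega>) x u = y then 1 else 0)"
        by (subst suminf_finite[of "{length u}"]) auto
      then show "indicator {y} (walk \<omega> x (0 # u)) * indicator {u. ltr (sub 0 \<omega>) u} u = (\<Sum>n. if length u = n \<and> ltr (sub 0 \<omega>) u \<and> pos (sub 0 \<omega>) x u = y then 1 else 0 :: ennreal)"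
        by (auto simp: walk_Cons indicator_def)
    qed
    also have "\<dots> = (\<Sum>n. Zc y n x (sub 0 \<omega>))" unfolding Zc_def by (rule nn_integral_suminf) simp
    finally show "(\<integral>\<^sup>+u. indicator {y} (walk \<omega> x u) \<partial>count_space (past \<omega>)) = (\<Sum>n. Zc y n x (sub 0 \<omega>))" .
  qed
  also have "\<dots> = (\<Sum>n. \<integral>\<^sup>+\<omega>. Zc y n x (sub 0 \<omega>) \<partial>Omega \<mu>)"
    by (rule nn_integral_suminf) (rule measurable_sub'[OF measurable_Zc])
  also have "\<dots> = (\<Sum>n. ennreal ((1 + n * C1) * srwn (Suc n) (indicat_real {y}) x))"
    by (simp only: nn_integral_sub[OF measurable_Zc] E_Zc)
  finally show ?thesis .
qed

end

section \<open>Avoidance events and their recursion at the root\<close>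

lemma all_list: "(\<forall>u. P u) \<longleftrightarrow> P [] \<and> (\<forall>j u. P (j # u))"
proof (intro iffI allI conjI)
  fix u assume "P [] \<and> (\<forall>j u. P (j # u))"
  then show "P u" by (cases u) auto
qed blast+

definition avn :: "(int^'d::finite) set \<Rightarrow> int^'d \<Rightarrow> (nat list \<Rightarrow> 'd vdata) \<Rightarrow> bool" where
  "avn K x \<omega> \<longleftrightarrow> (\<forall>u. ntr \<omega> u \<longrightarrow> pos \<omega> x u \<notin> K)"
definition avl :: "(int^'d::finite) set \<Rightarrow> int^'d \<Rightarrow> (nat list \<Rightarrow> 'd vdata) \<Rightarrow> bool" where
  "avl K x \<omega> \<longleftrightarrow> (\<forall>u. ltr \<omega> u \<longrightarrow> pos \<omega> x u \<notin> K)"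

lemma avn_rec: "avn K x \<omega> \<longleftrightarrow> x + incr (\<omega> []) \<notin> K \<and> (\<forall>j<nrm_off (\<omega> []). avn K (x + incr (\<omega> [])) (sub j \<omega>))"
  unfolding avn_def by (subst all_list) auto

lemma avl_rec: "avl K x \<omega> \<longleftrightarrow> x + incr (\<omega> []) \<notin> K \<and>
   (\<forall>j<Suc (sp_idx (\<omega> [])). if j < sp_idx (\<omega> []) then avn K (x + incr (\<omega> [])) (sub j \<omega>) else avl K (x + incr (\<omega> [])) (sub j \<omega>))"
  unfolding avn_def avl_def by (subst all_list) (auto simp: less_Suc_eq)

lemma prod_if_all: "(\<Prod>j<n. if P j then 1 else 0 :: ennreal) = (if \<forall>j<n. P j then 1 else 0)" for n :: nat
  by (induction n) (auto simp: less_Suc_eq)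

context crit
begin

lemma measurable_ntr: "Measurable.pred (Omega \<mu>) (\<lambda>\<omega>. ntr \<omega> u)"
proof (induction u)
  case (Cons j u)
  have "Measurable.pred (Omega \<mu>) (\<lambda>\<omega> :: nat list \<Rightarrow> 'a vdata. j < nrm_off v \<and> ntr (sub j \<omega>) u)" for v :: "'a vdata"
    using measurable_sub'[OF Cons, of j] by (cases "j < nrm_off v") auto
  then show ?case unfolding ntr.simps by (rule measurable_root[where F="\<lambda>v \<omega>. j < nrm_off v \<and> ntr (sub j \<omega>) u"])
qed simp

lemma measurable_ltr: "Measurable.pred (Omega \<mu>) (\<lambda>\<omega>. ltr \<omega> u)"
proof (induction u)
  case (Cons j u)
  have "Measurable.pred (Omega \<mu>) (\<lambda>\<omega> :: nat list \<Rightarrow> 'a vdata. if j < sp_idx v then ntr (sub j \<omega>) u else j = sp_idx v \<and> ltr (sub j \<omega>) u)" for v :: "'a vdata"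
    using measurable_sub'[OF Cons, of j] measurable_sub'[OF measurable_ntr, of j] by (cases "j < sp_idx v"; cases "j = sp_idx v") auto
  then show ?case unfolding ltr.simps
    by (rule measurable_root[where F="\<lambda>v \<omega>. if j < sp_idx v then ntr (sub j \<omega>) u else j = sp_idx v \<and> ltr (sub j \<omega>) u"])
qed simp

lemma measurable_pos: "(\<lambda>\<omega>. pos \<omega> x u) \<in> Omega \<mu> \<rightarrow>\<^sub>M count_space UNIV"
proof (induction u arbitrary: x)
  case Nil
  show ?case unfolding pos.simps by (rule measurable_root[where F="\<lambda>v _. x + incr v"]) simp
next
  case (Cons j u)
  show ?case unfolding pos.simps
    by (rule measurable_root[where F="\<lambda>v \<omega>. pos (sub j \<omega>) (x + incr v) u"]) (rule measurable_sub'[OF Cons])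
qed

lemma measurable_pos_notin: "Measurable.pred (Omega \<mu>) (\<lambda>\<omega>. pos \<omega> x u \<notin> K)"
  by (rule measurable_compose[OF measurable_pos]) simp

lemma measurable_avn: "Measurable.pred (Omega \<mu>) (avn K x)"
  unfolding avn_def[abs_def] by (intro pred_intros_countable pred_intros_logic measurable_ntr measurable_pos_notin)

lemma measurable_avl: "Measurable.pred (Omega \<mu>) (avl K x)"
  unfolding avl_def[abs_def] by (intro pred_intros_countable pred_intros_logic measurable_ltr measurable_pos_notin)

text \<open>Here x is the position of the parent, since the first vertex already makes a step. The
  hitting function of a branch that starts at a given point is recovered as
  \<open>pp\<close>.\<close>

definition an where "an K x = measure (Omega \<mu>) {\<omega>. avn K x \<omega>}"
definition el where "el K x = measure (Omega \<mu>) {\<omega>. avl K x \<omega>}"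

lemma pred_nn: "Measurable.pred (Omega \<mu>) P \<Longrightarrow> (\<integral>\<^sup>+\<omega>. (if P \<omega> then 1 else 0) \<partial>Omega \<mu>) = ennreal (measure (Omega \<mu>) {\<omega>. P \<omega>})"
proof -
  assume P: "Measurable.pred (Omega \<mu>) P"
  interpret prob_space "Omega \<mu>" by (rule prob_space_Omega)
  have "{\<omega>. P \<omega>} \<in> sets (Omega \<mu>)" using predE[OF P] by simp
  moreover have "(\<integral>\<^sup>+\<omega>. (if P \<omega> then 1 else 0) \<partial>Omega \<mu>) = (\<integral>\<^sup>+\<omega>. indicator {\<omega>. P \<omega>} \<omega> \<partial>Omega \<mu>)"
    by (intro nn_integral_cong) (simp add: indicator_def)
  ultimately show ?thesis by (simp add: emeasure_eq_measure)
qed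

lemma an_nn: "(\<integral>\<^sup>+\<omega>. (if avn K x \<omega> then 1 else 0) \<partial>Omega \<mu>) = ennreal (an K x)"
  unfolding an_def by (rule pred_nn[OF measurable_avn])
lemma el_nn: "(\<integral>\<^sup>+\<omega>. (if avl K x \<omega> then 1 else 0) \<partial>Omega \<mu>) = ennreal (el K x)"
  unfolding el_def by (rule pred_nn[OF measurable_avl])

lemma an_01: "0 \<le> an K x" "an K x \<le> 1" and el_01: "0 \<le> el K x" "el K x \<le> 1"
proof -
  interpret prob_space "Omega \<mu> :: (nat list \<Rightarrow> 'a vdata) measure" by (rule prob_space_Omega)
  show "0 \<le> an K x" "an K x \<le> 1" "0 \<le> el K x" "el K x \<le> 1" by (simp_all add: an_def el_def)
qed

lemma nn_real: "(\<integral>\<^sup>+n. ennreal (real n) \<partial>measure_pmf \<mu>) = 1"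
  using mean by (simp add: ennreal_of_nat_eq_real_of_nat)

lemma integrable_real: "integrable (measure_pmf \<mu>) real"
  by (rule integrableI_bounded) (simp_all add: nn_real)

lemma expectation_real: "measure_pmf.expectation \<mu> real = 1"
  by (subst integral_eq_nn_integral) (simp_all add: nn_real)

lemma nn_tri: "(\<integral>\<^sup>+n. ennreal (\<Sum>j<n. real j) \<partial>measure_pmf \<mu>) = ennreal C1"
  unfolding C1_eq[symmetric] by (intro nn_integral_cong) (simp add: ennreal_of_nat_eq_real_of_nat sum_ennreal)

lemma integrable_tri: "integrable (measure_pmf \<mu>) (\<lambda>n. \<Sum>j<n. real j)"
proof (rule integrableI_bounded)
  have "(\<integral>\<^sup>+n. ennreal (norm (\<Sum>j<n. real j)) \<partial>measure_pmf \<mu>) = ennreal C1"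
    unfolding nn_tri[symmetric] by (intro nn_integral_cong) (simp add: sum_nonneg)
  then show "(\<integral>\<^sup>+n. ennreal (norm (\<Sum>j<n. real j)) \<partial>measure_pmf \<mu>) < \<infinity>" by simp
qed simp

lemma expectation_tri: "measure_pmf.expectation \<mu> (\<lambda>n. \<Sum>j<n. real j) = C1"
  using C1_nonneg by (subst integral_eq_nn_integral) (simp_all add: nn_tri sum_nonneg)

text \<open>Generating function of the number of left siblings at a spine vertex, equal to (1 - E
  r^n)/(1 - r) for r < 1. Comparing 1 - \<Phi>(r) with 1 - r from both sides makes the killing rate
  comparable to Pp.\<close>

definition \<Phi> where "\<Phi> r = measure_pmf.expectation \<mu> (\<lambda>n. \<Sum>i<n. r ^ i)"

context
  fixes r :: real assumes r: "0 \<le> r" "r \<le> 1"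
begin

lemma geo_le: "(\<Sum>i<n. r ^ i) \<le> real n"
  using sum_bounded_above[of "{..<n}" "\<lambda>i. r ^ i" 1] power_le_one[OF r] by simp

lemma geo_nonneg: "0 \<le> (\<Sum>i<n. r ^ i)" using r by (intro sum_nonneg) auto

lemma integrable_geo: "integrable (measure_pmf \<mu>) (\<lambda>n. \<Sum>i<n. r ^ i)"
  by (rule Bochner_Integration.integrable_bound[OF integrable_real]) (simp_all add: geo_le geo_nonneg)

lemma nn_Phi: "(\<integral>\<^sup>+n. ennreal (\<Sum>i<n. r ^ i) \<partial>measure_pmf \<mu>) = ennreal (\<Phi> r)"
  unfolding \<Phi>_def by (rule nn_integral_eq_integral[OF integrable_geo]) (simp add: geo_nonneg)

lemma nn_gen: "(\<integral>\<^sup>+n. ennreal (r ^ n) \<partial>measure_pmf \<mu>) = ennreal (1 - (1 - r) * \<Phi> r)"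
proof -
  have eq: "r ^ n = 1 - (1 - r) * (\<Sum>i<n. r ^ i)" for n using one_diff_power_eq[of r n] by simp
  have int: "integrable (measure_pmf \<mu>) (\<lambda>n. r ^ n)"
    by (rule measure_pmf.integrable_const_bound[where B=1]) (use r in \<open>auto simp: power_le_one\<close>)
  have "measure_pmf.expectation \<mu> (\<lambda>n. r ^ n) = measure_pmf.expectation \<mu> (\<lambda>n. 1 - (1 - r) * (\<Sum>i<n. r ^ i))"
    by (intro Bochner_Integration.integral_cong refl eq)
  also have "\<dots> = 1 - (1 - r) * \<Phi> r"
    unfolding \<Phi>_def using integrable_geo by (subst Bochner_Integration.integral_diff) auto
  finally show ?thesis using nn_integral_eq_integral[OF int] r by simp
qed

lemma Phi_nonneg: "0 \<le> \<Phi> r" unfolding \<Phi>_def by (intro integral_nonneg_AE) (simp add: geo_nonneg)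

lemma Phi_le_1: "\<Phi> r \<le> 1"
  unfolding \<Phi>_def expectation_real[symmetric] by (intro integral_mono integrable_geo integrable_real geo_le)

text \<open>The term i = 0 alone contributes 1 unless n = 0.\<close>

lemma Phi_ge: "1 - pmf \<mu> 0 \<le> \<Phi> r"
proof -
  have "1 - pmf \<mu> 0 = measure_pmf.expectation \<mu> (\<lambda>n. 1 - indicat_real {0} n)"
    by (subst Bochner_Integration.integral_diff) (auto simp: measure_pmf_single intro: measure_pmf.integrable_const_bound[where B=1])
  also have "\<dots> \<le> \<Phi> r"
    unfolding \<Phi>_def
  proof (rule integral_mono[OF _ integrable_geo])
    fix n :: nat
    show "1 - indicat_real {0} n \<le> (\<Sum>i<n. r ^ i)"
    proof (cases n)
      case (Suc k)
      have "0 \<le> (\<Sum>i<k. r ^ Suc i)" using r by (intro sum_nonneg) auto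
      then show ?thesis unfolding Suc sum.lessThan_Suc_shift by simp
    qed simp
  qed (auto intro: measure_pmf.integrable_const_bound[where B=1])
  finally show ?thesis .
qed

lemma one_minus_Phi: "1 - \<Phi> r = measure_pmf.expectation \<mu> (\<lambda>n. real n - (\<Sum>i<n. r ^ i))"
  unfolding \<Phi>_def using expectation_real by (subst Bochner_Integration.integral_diff) (auto simp: integrable_real integrable_geo)

text \<open>Summation of 1 - r^j \<le> (1 - r) j.\<close>

lemma Phi_upper: "1 - \<Phi> r \<le> C1 * (1 - r)"
proof -
  have "1 - \<Phi> r \<le> measure_pmf.expectation \<mu> (\<lambda>n. (1 - r) * (\<Sum>j<n. real j))"
    unfolding one_minus_Phi
  proof (rule integral_mono)
    fix n :: nat
    have "1 - r ^ j \<le> (1 - r) * real j" for j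
      unfolding one_diff_power_eq using r geo_le by (intro mult_left_mono) auto
    then have "(\<Sum>j<n. 1 - r ^ j) \<le> (\<Sum>j<n. (1 - r) * real j)" by (intro sum_mono)
    then show "real n - (\<Sum>i<n. r ^ i) \<le> (1 - r) * (\<Sum>j<n. real j)"
      by (simp add: sum_subtractf sum_distrib_left)
  qed (auto simp: integrable_real integrable_geo integrable_tri)
  also have "\<dots> = C1 * (1 - r)" using expectation_tri by simp
  finally show ?thesis .
qed

text \<open>1 - r^i \<ge> 1 - r for i \<ge> 1 yields the mean of the positive part of n - 1, which
  equals \<mu>(0) because the mean of n is 1.\<close>

lemma Phi_lower: "pmf \<mu> 0 * (1 - r) \<le> 1 - \<Phi> r"
proof -
  have ex: "measure_pmf.expectation \<mu> (\<lambda>n. (1 - r) * ((real n - 1) + indicat_real {0} n)) = (1 - r) * ((1 - 1) + pmf \<mu> 0)"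
    using integrable_real expectation_real
    by (simp add: measure_pmf_single measure_pmf.integrable_const_bound[where B=1])
  have "pmf \<mu> 0 * (1 - r) = measure_pmf.expectation \<mu> (\<lambda>n. (1 - r) * ((real n - 1) + indicat_real {0} n))" unfolding ex by simp
  also have "\<dots> \<le> 1 - \<Phi> r"
    unfolding one_minus_Phi
  proof (rule integral_mono)
    fix n :: nat
    show "(1 - r) * ((real n - 1) + indicat_real {0} n) \<le> real n - (\<Sum>i<n. r ^ i)"
    proof (cases n)
      case (Suc k)
      have "(\<Sum>i<k. r ^ Suc i) \<le> (\<Sum>i<k. r)"
        using r by (intro sum_mono) (simp add: mult_left_le power_le_one)
      then have "(\<Sum>i<n. r ^ i) \<le> 1 + real k * r" unfolding Suc sum.lessThan_Suc_shift by simp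
      then show ?thesis using Suc by (simp add: algebra_simps)
    qed simp
  qed (auto simp: integrable_real integrable_geo measure_pmf.integrable_const_bound[where B=1])
  finally show ?thesis .
qed

end

definition ph where "ph K z = \<Phi> (an K z)"
text \<open>Off K the product equals 1 - E an^n, the probability that some child starts a branch
  that hits; the product form is the equation p = \<phi> Pp.\<close>

definition pp where "pp K z = (if z \<in> K then 1 else (1 - an K z) * ph K z)"

lemma an_rec: "an K x = srw (\<lambda>z. 1 - pp K z) (x :: int^'d::finite)"
proof -
  let ?g = "\<lambda>v :: int^'d. if x + v \<notin> K then 1 else 0 :: ennreal"
  have "ennreal (an K x) = (\<integral>\<^sup>+\<omega>. ?g (incr (\<omega> [])) * (\<Prod>j<nrm_off (\<omega> []). if avn K (x + incr (\<omega> [])) (sub j \<omega>) then 1 else 0) \<partial>Omega \<mu>)"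
    unfolding an_nn[symmetric] prod_if_all by (intro nn_integral_cong, subst avn_rec) simp
  also have "\<dots> = (\<integral>\<^sup>+v. ?g (incr v) * (\<Prod>j<nrm_off v. \<integral>\<^sup>+\<omega>. (if avn K (x + incr v) \<omega> then 1 else 0) \<partial>Omega \<mu>) \<partial>vlaw \<mu>)"
    by (rule root_product[where F="\<lambda>v j \<omega>. if avn K (x + incr v) \<omega> then 1 else 0" and g="\<lambda>v. ?g (incr v)"])
       (intro measurable_If borel_measurable_const predE[OF measurable_avn])
  also have "\<dots> = (\<integral>\<^sup>+v. ?g (incr v) * ennreal (an K (x + incr v)) ^ nrm_off v \<partial>vlaw \<mu>)"
    by (simp add: an_nn)
  also have "\<dots> = (\<integral>\<^sup>+v. \<integral>\<^sup>+n. ?g v * ennreal (an K (x + v)) ^ n \<partial>measure_pmf \<mu> \<partial>pmf_of_set nbrs)"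
    by (rule nn_integral_normal)
  also have "\<dots> = (\<integral>\<^sup>+v. ennreal (1 - pp K (x + v)) \<partial>pmf_of_set nbrs)"
  proof (rule nn_integral_cong)
    fix v
    have "(\<integral>\<^sup>+n. ennreal (an K (x + v)) ^ n \<partial>measure_pmf \<mu>) = ennreal (1 - (1 - an K (x + v)) * \<Phi> (an K (x + v)))"
      using nn_gen[OF an_01] by (simp add: ennreal_power an_01)
    then show "(\<integral>\<^sup>+n. ?g v * ennreal (an K (x + v)) ^ n \<partial>measure_pmf \<mu>) = ennreal (1 - pp K (x + v))"
      by (cases "x + v \<in> K") (simp_all add: pp_def ph_def)
  qed
  also have "\<dots> = ennreal (srw (\<lambda>z. 1 - pp K z) x)"
  proof (rule nn_integral_nbrs)
    fix z
    have "(1 - an K z) * \<Phi> (an K z) \<le> 1 * 1"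
      using an_01[of K z] Phi_le_1[OF an_01, of K z] Phi_nonneg[OF an_01, of K z] by (intro mult_mono) auto
    then show "0 \<le> 1 - pp K z" by (simp add: pp_def ph_def)
  qed
  finally have eq: "ennreal (an K x) = ennreal (srw (\<lambda>z. 1 - pp K z) x)" .
  have "0 \<le> srw (\<lambda>z. 1 - pp K z) x"
  proof (rule srw_nonneg)
    fix v
    have "(1 - an K (x+v)) * \<Phi> (an K (x+v)) \<le> 1 * 1"
      using an_01[of K "x+v"] Phi_le_1[OF an_01, of K "x+v"] Phi_nonneg[OF an_01, of K "x+v"] by (intro mult_mono) auto
    then show "0 \<le> 1 - pp K (x+v)" by (simp add: pp_def ph_def)
  qed
  from ennreal_inj[OF an_01(1) this] show ?thesis using eq by blast
qed

lemma srw_pp: "srw (pp K) x = 1 - an K x"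
  by (simp add: an_rec srw_diff)

text \<open>The past survives a spine vertex if its left branches all avoid K and the rest of the
  spine does. By independence the left branches give \<Phi>(an).\<close>

lemma el_rec: "el K x = srw (\<lambda>w. (if w \<in> K then 0 else ph K w) * el K w) (x :: int^'d::finite)"
proof -
  let ?g = "\<lambda>v :: int^'d. if x + v \<notin> K then 1 else 0 :: ennreal"
  let ?F = "\<lambda>v j \<omega>. if (if j < sp_idx v then avn K (x + incr v) \<omega> else avl K (x + incr v) \<omega>) then 1 else 0 :: ennreal"
  have "ennreal (el K x) = (\<integral>\<^sup>+\<omega>. ?g (incr (\<omega> [])) * (\<Prod>j<Suc (sp_idx (\<omega> [])). ?F (\<omega> []) j (sub j \<omega>)) \<partial>Omega \<mu>)"
    unfolding el_nn[symmetric] prod_if_all by (intro nn_integral_cong, subst avl_rec) simp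
  also have "\<dots> = (\<integral>\<^sup>+v. ?g (incr v) * (\<Prod>j<Suc (sp_idx v). \<integral>\<^sup>+\<omega>. ?F v j \<omega> \<partial>Omega \<mu>) \<partial>vlaw \<mu>)"
  proof (rule root_product[where F="?F" and g="\<lambda>v. ?g (incr v)" and m="\<lambda>v. Suc (sp_idx v)"])
    fix v :: "'d vdata" and j
    have "Measurable.pred (Omega \<mu>) (\<lambda>\<omega>. if j < sp_idx v then avn K (x + incr v) \<omega> else avl K (x + incr v) \<omega>)"
      using measurable_avn measurable_avl by (cases "j < sp_idx v") auto
    then show "?F v j \<in> borel_measurable (Omega \<mu>)" by (rule measurable_If[OF borel_measurable_const borel_measurable_const predE])
  qed
  also have "\<dots> = (\<integral>\<^sup>+v. ?g (incr v) * (ennreal (an K (x + incr v)) ^ sp_idx v * ennreal (el K (x + incr v))) \<partial>vlaw \<mu>)"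
    by (simp add: an_nn el_nn)
  also have "\<dots> = (\<integral>\<^sup>+v. \<integral>\<^sup>+n. (\<Sum>j<n. ?g v * (ennreal (an K (x + v)) ^ j * ennreal (el K (x + v)))) \<partial>measure_pmf \<mu> \<partial>pmf_of_set nbrs)"
    by (rule nn_integral_special)
  also have "\<dots> = (\<integral>\<^sup>+v. ennreal ((if x + v \<in> K then 0 else ph K (x + v)) * el K (x + v)) \<partial>pmf_of_set nbrs)"
  proof (rule nn_integral_cong)
    fix v
    have "(\<Sum>j<n. ennreal (an K (x + v)) ^ j) = ennreal (\<Sum>j<n. an K (x + v) ^ j)" for n
      by (simp add: ennreal_power an_01 sum_ennreal)
    then have "(\<integral>\<^sup>+n. (\<Sum>j<n. ennreal (an K (x + v)) ^ j) \<partial>measure_pmf \<mu>) = ennreal (ph K (x + v))"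
      using nn_Phi[OF an_01, of K "x + v"] by (simp add: ph_def)
    then have "(\<integral>\<^sup>+n. (\<Sum>j<n. ennreal (an K (x + v)) ^ j * ennreal (el K (x + v))) \<partial>measure_pmf \<mu>) = ennreal (ph K (x + v)) * ennreal (el K (x + v))"
      by (simp add: sum_distrib_right[symmetric] nn_integral_multc)
    also have "\<dots> = ennreal (ph K (x + v) * el K (x + v))"
      using Phi_nonneg[OF an_01, of K "x+v"] el_01[of K "x+v"] by (intro ennreal_mult[symmetric]) (auto simp: ph_def)
    finally show "(\<integral>\<^sup>+n. (\<Sum>j<n. ?g v * (ennreal (an K (x + v)) ^ j * ennreal (el K (x + v)))) \<partial>measure_pmf \<mu>)
      = ennreal ((if x + v \<in> K then 0 else ph K (x + v)) * el K (x + v))" by simp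
  qed
  also have "\<dots> = ennreal (srw (\<lambda>w. (if w \<in> K then 0 else ph K w) * el K w) x)"
    by (intro nn_integral_nbrs) (simp add: ph_def Phi_nonneg[OF an_01] el_01)
  finally have eq: "ennreal (el K x) = ennreal (srw (\<lambda>w. (if w \<in> K then 0 else ph K w) * el K w) x)" .
  have "0 \<le> srw (\<lambda>w. (if w \<in> K then 0 else ph K w) * el K w) x"
    by (intro srw_nonneg) (simp add: ph_def Phi_nonneg[OF an_01] el_01)
  from ennreal_inj[OF el_01(1) this] show ?thesis using eq by blast
qed

lemma pp_01: "0 \<le> pp K z" "pp K z \<le> 1"
proof -
  have "(1 - an K z) * \<Phi> (an K z) \<le> 1 * 1"
    using an_01[of K z] Phi_le_1[OF an_01, of K z] Phi_nonneg[OF an_01, of K z] by (intro mult_mono) auto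
  then show "0 \<le> pp K z" "pp K z \<le> 1"
    using an_01[of K z] Phi_nonneg[OF an_01, of K z] by (auto simp: pp_def ph_def)
qed

section \<open>Measurability of the past and the equilibrium measure\<close>

lemma measurable_spine: "(\<lambda>\<omega>. spine \<omega> k) \<in> Omega \<mu> \<rightarrow>\<^sub>M count_space UNIV"
proof (induction k)
  case (Suc k)
  show ?case unfolding spine.simps
  proof (rule measurable_compose_countable[where f="\<lambda>s \<omega>. s @ [if k = 0 then 0 else sp_idx (\<omega> s)]" and g="\<lambda>\<omega>. spine \<omega> k", OF _ Suc])
    fix s
    show "(\<lambda>\<omega> :: nat list \<Rightarrow> 'a vdata. s @ [if k = 0 then 0 else sp_idx (\<omega> s)]) \<in> Omega \<mu> \<rightarrow>\<^sub>M count_space UNIV"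
      by (rule measurable_compose[OF measurable_coord[of s]]) simp
  qed
qed simp

lemma measurable_at_spine:
  "(\<And>s. (\<lambda>\<omega>. F s \<omega>) \<in> Omega \<mu> \<rightarrow>\<^sub>M N) \<Longrightarrow> (\<lambda>\<omega>. F (spine \<omega> k) \<omega>) \<in> Omega \<mu> \<rightarrow>\<^sub>M N"
  by (rule measurable_compose_countable[where f=F and g="\<lambda>\<omega>. spine \<omega> k", OF _ measurable_spine])

lemma measurable_nchildren: "(\<lambda>\<omega>. nchildren \<omega> u) \<in> Omega \<mu> \<rightarrow>\<^sub>M count_space UNIV"
proof -
  have "nchildren \<omega> u = (if u = [] then root_off (\<omega> u) else if u = spine \<omega> (length u) then sp_off (\<omega> u) else nrm_off (\<omega> u))"
    for \<omega> :: "nat list \<Rightarrow> 'a vdata"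
  proof -
    \<comment> \<open>The k-th spine word has length k, which turns membership in the range into a
      single equation.\<close>
    have "u \<in> range (spine \<omega>) \<longleftrightarrow> u = spine \<omega> (length u)"
    proof
      assume "u \<in> range (spine \<omega>)"
      then obtain k where "u = spine \<omega> k" by blast
      then show "u = spine \<omega> (length u)" by simp
    qed (rule range_eqI)
    then show ?thesis by (simp add: nchildren_def)
  qed
  moreover have "(\<lambda>\<omega>. if u = [] then root_off (\<omega> u) else if u = spine \<omega> (length u) then sp_off (\<omega> u) else nrm_off (\<omega> u)) \<in> Omega \<mu> \<rightarrow>\<^sub>M count_space UNIV"
    by (rule measurable_at_spine[where F="\<lambda>s \<omega>. if u = [] then root_off (\<omega> u) else if u = s then sp_off (\<omega> u) else nrm_off (\<omega> u)"],
        rule measurable_compose[OF measurable_coord[of u]]) simp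
  ultimately show ?thesis by simp
qed

lemma measurable_tree: "Measurable.pred (Omega \<mu>) (\<lambda>\<omega>. u \<in> tree \<omega>)"
proof (induction u rule: rev_induct)
  case (snoc i u)
  have "Measurable.pred (Omega \<mu>) (\<lambda>\<omega>. i < nchildren \<omega> u)"
    by (rule measurable_compose[OF measurable_nchildren]) simp
  then show ?case unfolding tree_snoc using snoc by (intro pred_intros_logic)
qed (simp add: tree.root)

lemma measurable_past: "Measurable.pred (Omega \<mu>) (\<lambda>\<omega>. u \<in> past \<omega>)"
proof -
  have 1: "Measurable.pred (Omega \<mu>) (\<lambda>\<omega>. 1 \<le> k \<and> u = spine \<omega> k)" for k
    by (rule measurable_compose[OF measurable_spine[of k]]) simp
  have 2: "Measurable.pred (Omega \<mu>) (\<lambda>\<omega>. 1 \<le> k \<and> (\<exists>j<sp_idx (\<omega> (spine \<omega> k)). \<exists>w. u = spine \<omega> k @ [j] @ w))" for k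
    by (rule measurable_at_spine[where F="\<lambda>s \<omega>. 1 \<le> k \<and> (\<exists>j<sp_idx (\<omega> s). \<exists>w. u = s @ [j] @ w)"],
        rule measurable_compose[OF measurable_coord]) simp
  show ?thesis unfolding past_def mem_Collect_eq
    by (intro pred_intros_logic pred_intros_countable measurable_tree 1 2)
qed

lemma measurable_walk: "Measurable.pred (Omega \<mu>) (\<lambda>\<omega>. walk \<omega> x u \<notin> K)"
proof (cases u)
  case Nil
  then show ?thesis by (simp add: walk_def)
next
  case (Cons i w)
  show ?thesis unfolding Cons walk_Cons by (rule measurable_sub'[OF measurable_pos_notin])
qed

lemma eqm_eq: "eqm \<mu> K x = ennreal (indicat_real K x * el K x)"
proof -
  have m1: "Measurable.pred (Omega \<mu>) (\<lambda>\<omega>. \<forall>u. u \<in> past \<omega> \<longrightarrow> walk \<omega> x u \<notin> K)"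
    by (intro pred_intros_logic pred_intros_countable measurable_past measurable_walk)
  have eq: "{\<omega> \<in> space (Omega \<mu>). walk \<omega> x ` past \<omega> \<inter> K = {}} = {\<omega>. \<forall>u. u \<in> past \<omega> \<longrightarrow> walk \<omega> x u \<notin> K}"
    by auto
  have m2: "Measurable.pred (Omega \<mu>) (\<lambda>\<omega>. avl K x (sub 0 \<omega>))" by (rule measurable_sub'[OF measurable_avl])
  have "emeasure (Omega \<mu>) {\<omega>. \<forall>u. u \<in> past \<omega> \<longrightarrow> walk \<omega> x u \<notin> K} = emeasure (Omega \<mu>) {\<omega>. avl K x (sub 0 \<omega>)}"
  \<comment> \<open>The two events are known to agree on \<open>proper\<close> configurations
    only.\<close>
  proof (rule emeasure_eq_AE)
    show "AE \<omega> in Omega \<mu>. \<omega> \<in> {\<omega>. \<forall>u. u \<in> past \<omega> \<longrightarrow> walk \<omega> x u \<notin> K} \<longleftrightarrow> \<omega> \<in> {\<omega>. avl K x (sub 0 \<omega>)}"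
      by (rule AE_mp[OF AE_proper], rule AE_I2) (auto simp: past_eq avl_def walk_Cons)
    show "{\<omega>. \<forall>u. u \<in> past \<omega> \<longrightarrow> walk \<omega> x u \<notin> K} \<in> sets (Omega \<mu>)" using predE[OF m1] by simp
    show "{\<omega>. avl K x (sub 0 \<omega>)} \<in> sets (Omega \<mu>)" using predE[OF m2] by simp
  qed
  also have "\<dots> = (\<integral>\<^sup>+\<omega>. (if avl K x (sub 0 \<omega>) then 1 else 0) \<partial>Omega \<mu>)"
  proof -
    have "{\<omega>. avl K x (sub 0 \<omega>)} \<in> sets (Omega \<mu>)" using predE[OF m2] by simp
    then have "emeasure (Omega \<mu>) {\<omega>. avl K x (sub 0 \<omega>)} = (\<integral>\<^sup>+\<omega>. indicator {\<omega>. avl K x (sub 0 \<omega>)} \<omega> \<partial>Omega \<mu>)" by simp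
    also have "\<dots> = (\<integral>\<^sup>+\<omega>. (if avl K x (sub 0 \<omega>) then 1 else 0) \<partial>Omega \<mu>)" by (intro nn_integral_cong) (simp add: indicator_def)
    finally show ?thesis .
  qed
  also have "\<dots> = (\<integral>\<^sup>+\<omega>. (if avl K x \<omega> then 1 else 0) \<partial>Omega \<mu>)"
    by (rule nn_integral_sub[where F="\<lambda>\<omega>. if avl K x \<omega> then 1 else 0"]) (intro measurable_If borel_measurable_const predE[OF measurable_avl])
  also have "\<dots> = ennreal (el K x)" by (rule el_nn)
  finally show ?thesis unfolding eqm_def eq by (simp add: indicator_def)
qed

text \<open>A first-moment bound: if the past hits K, its occupation count of K is at least
  1.\<close>

lemma hit_le_Gf: "finite K \<Longrightarrow> ennreal (1 - el K x) \<le> (\<Sum>y\<in>K. \<Sum>n. ennreal ((1 + n * C1) * srwn (Suc n) (indicat_real {y}) (x :: int^'d::finite)))"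
proof -
  assume K: "finite K"
  have "1 - ennreal (el K x) \<le> (\<integral>\<^sup>+\<omega>. (\<Sum>y\<in>K. \<Sum>n. Zc y n x \<omega>) \<partial>Omega \<mu>)"
  proof -
    interpret prob_space "Omega \<mu> :: (nat list \<Rightarrow> 'd vdata) measure" by (rule prob_space_Omega)
    have [measurable]: "Measurable.pred (Omega \<mu>) (avl K x)" by (rule measurable_avl)
    have [measurable]: "Zc y n x \<in> borel_measurable (Omega \<mu>)" for y n by (rule measurable_Zc)
    have "1 = (\<integral>\<^sup>+\<omega>. 1 \<partial>(Omega \<mu> :: (nat list \<Rightarrow> 'd vdata) measure))" using emeasure_space_1 by simp
    also have "\<dots> \<le> (\<integral>\<^sup>+\<omega>. (if avl K x \<omega> then 1 else 0) + (\<Sum>y\<in>K. \<Sum>n. Zc y n x \<omega>) \<partial>Omega \<mu>)"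
    proof (rule nn_integral_mono)
      fix \<omega> :: "nat list \<Rightarrow> 'd vdata"
      show "1 \<le> (if avl K x \<omega> then 1 else 0) + (\<Sum>y\<in>K. \<Sum>n. Zc y n x \<omega>)"
      proof (cases "avl K x \<omega>")
        case False
        then obtain u where u: "ltr \<omega> u" "pos \<omega> x u \<in> K" by (auto simp: avl_def)
        let ?y = "pos \<omega> x u"
        have "1 = (\<integral>\<^sup>+w. indicator {u} w \<partial>count_space UNIV)" by simp
        also have "\<dots> \<le> Zc ?y (length u) x \<omega>"
          unfolding Zc_def using u by (intro nn_integral_mono) (simp add: indicator_def)
        also have "\<dots> = (\<Sum>n\<in>{length u}. Zc ?y n x \<omega>)" by simp
        also have "\<dots> \<le> (\<Sum>n. Zc ?y n x \<omega>)" by (intro sum_le_suminf) auto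
        also have "\<dots> \<le> (\<Sum>y\<in>K. \<Sum>n. Zc y n x \<omega>)" using K u(2) by (intro member_le_sum) auto
        finally show ?thesis using False by simp
      qed simp
    qed
    also have "\<dots> = ennreal (el K x) + (\<integral>\<^sup>+\<omega>. (\<Sum>y\<in>K. \<Sum>n. Zc y n x \<omega>) \<partial>Omega \<mu>)"
      by (subst nn_integral_add) (simp_all add: el_nn)
    finally show ?thesis by (simp add: ennreal_minus_le_iff)
  qed
  also have "\<dots> = (\<Sum>y\<in>K. \<Sum>n. ennreal ((1 + n * C1) * srwn (Suc n) (indicat_real {y}) x))"
    by (subst nn_integral_sum) (simp_all add: nn_integral_suminf measurable_Zc E_Zc borel_measurable_suminf_order del: funpow.simps)
  finally show ?thesis by (simp add: ennreal_minus[symmetric] el_01 del: funpow.simps)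
qed

end

section \<open>The potential of the equilibrium measure\<close>

lemma srw_sums: "(\<And>z. (\<lambda>n. f n z) sums g z) \<Longrightarrow> (\<lambda>n. srw (f n) z) sums srw g z"
  unfolding srw_def by (intro sums_divide sums_sum)

lemma srwn_sums:
  assumes "\<And>z. summable (\<lambda>n. f n z)"
  shows "(\<lambda>n. srwn t (f n) z) sums srwn t (\<lambda>z. \<Sum>n. f n z) z"
proof (induction t arbitrary: z)
  case 0
  show ?case using assms by (simp add: summable_sums)
next
  case (Suc t)
  show ?case unfolding srwn_Suc by (rule srw_sums) (rule Suc)
qed

lemma tail_tendsto_0:
  fixes f :: "nat \<Rightarrow> real"
  assumes "summable f"
  shows "(\<lambda>k. \<Sum>n. f (n + k)) \<longlonglongrightarrow> 0"
proof -
  have "(\<lambda>k. suminf f - (\<Sum>i<k. f i)) \<longlonglongrightarrow> suminf f - suminf f"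
    using summable_LIMSEQ[OF assms] by (intro tendsto_intros)
  then show ?thesis using suminf_minus_initial_segment[OF assms] by simp
qed

lemma srwn_point: "srwn t (indicat_real {y}) x = srwn t (indicat_real {0}) (x - y)"
proof -
  have "indicat_real {y} = (\<lambda>z. indicat_real {0} (z + - y))" by (auto simp: indicator_def)
  then show ?thesis using srwn_shift[where t=t and f="indicat_real {0}" and a="- y" and z=x] by simp
qed

context crit
begin

text \<open>P^t carries the n-th term of the Green series, up to the factor 1 + C1, into the term n
  + t + 1 of a convergent series. The hitting probability seen after t steps is thus bounded by a
  tail that vanishes.\<close>

lemma survival_limit:
  assumes d: "CARD('d::finite) \<ge> 5" and K: "finite K"
  shows "(\<lambda>t. srwn t (el K) (x :: int^'d)) \<longlonglongrightarrow> 1"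
proof -
  define b where "b = (real CARD('d) - 2) / 2"
  obtain C where C: "C > 0" "\<And>n (z::int^'d). (\<Sum>t<n. (real t + 1) * srwn t (indicat_real {0}) z) \<le> C * bar 1 (b - 1) z"
    using green2_upper[OF d b_def] by blast
  define a where "a y n z = (real n + 1) * srwn n (indicat_real {y}) z" for y z :: "int^'d" and n
  define g where "g y n z = (1 + real n * C1) * srwn (Suc n) (indicat_real {y}) z" for y z :: "int^'d" and n
  have pn: "0 \<le> srwn n (indicat_real {y}) z" for n and y z :: "int^'d" by (intro srwn_nonneg) simp
  have a0: "0 \<le> a y n z" for y n z unfolding a_def by (intro mult_nonneg_nonneg pn) simp
  have g0: "0 \<le> g y n z" for y n z unfolding g_def by (intro mult_nonneg_nonneg pn) (simp add: C1_nonneg)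
  have sa: "summable (\<lambda>n. a y n z)" for y z
  proof (rule summableI_nonneg_bounded[OF a0])
    fix n
    have "bar 1 (b - 1) (z - y) \<le> 1" using d by (intro bar_le_1) (auto simp: b_def)
    then have "C * bar 1 (b - 1) (z - y) \<le> C * 1" using C(1) by (intro mult_left_mono) auto
    then show "(\<Sum>i<n. a y i z) \<le> C" using C(2)[of "z - y" n] by (simp add: a_def srwn_point[of _ y])
  qed
  have sa': "summable (\<lambda>n. a y (n + k) z)" for y z k by (rule summable_ignore_initial_segment[OF sa])
  have le: "(1 + real n * C1) * r \<le> (1 + C1) * ((real (n + Suc t) + 1) * r)" if "0 \<le> r" for n t r
  proof -
    have "1 + real n * C1 \<le> (1 + C1) * (real (n + Suc t) + 1)"
      using C1_nonneg by (simp add: algebra_simps add_increasing2)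
    from mult_right_mono[OF this that] show ?thesis by (simp only: mult.assoc)
  qed
  have gt: "srwn t (g y n) z \<le> (1 + C1) * a y (n + Suc t) z" for t y n z
  proof -
    have "srwn t (g y n) z = (1 + real n * C1) * srwn (t + Suc n) (indicat_real {y}) z"
      unfolding g_def[abs_def] by (simp only: srwn_cmult srwn_add_time)
    also have "t + Suc n = n + Suc t" by simp
    finally show ?thesis unfolding a_def by (simp only: le[OF pn])
  qed
  have sg: "summable (\<lambda>n. g y n z)" for y z
    by (rule summable_comparison_test'[OF summable_mult[OF sa'[of y "Suc 0" z], of "1 + C1"], of 0])
       (use gt[of 0 y _ z] g0 in simp)
  have hit: "1 - el K z \<le> (\<Sum>y\<in>K. \<Sum>n. g y n z)" for z
  proof -
    have "ennreal (1 - el K z) \<le> (\<Sum>y\<in>K. \<Sum>n. ennreal (g y n z))"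
      unfolding g_def by (rule hit_le_Gf[OF K])
    also have "\<dots> = (\<Sum>y\<in>K. ennreal (\<Sum>n. g y n z))"
      by (intro sum.cong refl suminf_ennreal2 g0 sg)
    also have "\<dots> = ennreal (\<Sum>y\<in>K. \<Sum>n. g y n z)"
      by (intro sum_ennreal suminf_nonneg sg g0)
    finally show ?thesis by (subst (asm) ennreal_le_iff) (intro sum_nonneg suminf_nonneg sg g0)
  qed
  define R where "R t = (\<Sum>y\<in>K. (1 + C1) * (\<Sum>n. a y (n + Suc t) x))" for t
  have "R \<longlonglongrightarrow> (\<Sum>y\<in>K. (1 + C1) * 0)"
    unfolding R_def using LIMSEQ_Suc[OF tail_tendsto_0[OF sa]] by (intro tendsto_sum tendsto_mult tendsto_const)
  then have R0: "(\<lambda>t. 1 - R t) \<longlonglongrightarrow> 1 - 0" by (intro tendsto_diff tendsto_const) simp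
  have lower: "1 - R t \<le> srwn t (el K) x" for t
  proof -
    have "srwn t (\<lambda>z. 1 - el K z) x \<le> srwn t (\<lambda>z. \<Sum>y\<in>K. \<Sum>n. g y n z) x" by (rule srwn_mono) (rule hit)
    also have "\<dots> = (\<Sum>y\<in>K. \<Sum>n. srwn t (g y n) x)"
      unfolding srwn_sum using srwn_sums[OF sg] by (intro sum.cong refl sums_unique)
    also have "\<dots> \<le> (\<Sum>y\<in>K. \<Sum>n. (1 + C1) * a y (n + Suc t) x)"
      by (intro sum_mono suminf_le gt summable_mult sa' sums_summable[OF srwn_sums[OF sg]])
    also have "\<dots> = R t" unfolding R_def by (intro sum.cong refl suminf_mult sa')
    finally show ?thesis by (simp add: srwn_diff)
  qed
  have upper: "srwn t (el K) x \<le> 1" for t by (intro srwn_le el_01)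
  show ?thesis
    by (rule tendsto_sandwich[OF _ _ R0[simplified] tendsto_const[of 1]]) (auto simp: lower upper)
qed

lemma pp_inside: "z \<in> K \<Longrightarrow> pp K z = 1"
  by (simp add: pp_def)

text \<open>The point x is moved to the origin, where all estimates are centred. The constants come
  from \<open>Phi_lower\<close>, \<open>Phi_upper\<close> and \<open>Phi_ge\<close>; the cap 1/2
  meets the requirement on \<open>c1\<close>.\<close>

lemma brw_centred:
  fixes K :: "(int^'d::finite) set"
  assumes d: "CARD('d) \<ge> 5" and K: "finite K" and C1: "0 < C1" and mu0: "0 < pmf \<mu> 0" "pmf \<mu> 0 < 1"
  shows "brw {z. z + x \<in> K} (\<lambda>z. pp K (z + x)) (\<lambda>z. ph K (z + x)) (\<lambda>z. el K (z + x)) (min (pmf \<mu> 0) (1/2)) C1 (1 - pmf \<mu> 0)"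
proof
  show "finite {z. z + x \<in> K}"
    using finite_vimageI[OF K, of "\<lambda>z. z + x"] by (simp add: vimage_def inj_def)
  fix z :: "int^'d"
  show "min (pmf \<mu> 0) (1/2) * srw (\<lambda>z. pp K (z + x)) z \<le> 1 - ph K (z + x)"
  proof -
    have "min (pmf \<mu> 0) (1/2) * (1 - an K (z + x)) \<le> pmf \<mu> 0 * (1 - an K (z + x))"
      using an_01[of K "z + x"] by (intro mult_right_mono) auto
    also have "\<dots> \<le> 1 - ph K (z + x)" unfolding ph_def by (rule Phi_lower[OF an_01])
    finally show ?thesis by (simp only: srw_shift srw_pp)
  qed
  show "1 - ph K (z + x) \<le> C1 * srw (\<lambda>z. pp K (z + x)) z"
    unfolding srw_shift srw_pp ph_def by (rule Phi_upper[OF an_01])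
  show "el K (z + x) = srw (\<lambda>w. (if w \<in> {z. z + x \<in> K} then 0 else ph K (w + x)) * el K (w + x)) z"
    using srw_shift[of "\<lambda>w. (if w \<in> K then 0 else ph K w) * el K w" x z] el_rec[of K "z + x"] by simp
  assume z: "z \<notin> {z. z + x \<in> K}"
  show "pp K (z + x) = ph K (z + x) * srw (\<lambda>z. pp K (z + x)) z"
    unfolding srw_shift srw_pp using z by (simp add: pp_def)
qed (use d C1 mu0 in \<open>auto simp: ph_def pp_01 el_01 Phi_nonneg[OF an_01] Phi_le_1[OF an_01] Phi_ge[OF an_01] pp_inside\<close>)

lemma Gf_upper:
  assumes C: "\<And>n (z::int^'d::finite). (\<Sum>t<n. (real t + 1) * srwn t (indicat_real {0}) z) \<le> C * bar 1 \<beta> z"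
  shows "Gf \<mu> x y \<le> ennreal ((1 + C1) * C * bar 1 \<beta> (y - x :: int^'d))"
  unfolding Gf_eq suminf_eq_SUP
proof (rule SUP_least)
  fix N
  let ?s = "\<lambda>t. srwn t (indicat_real {0}) (x - y)"
  have s0: "0 \<le> ?s t" for t by (intro srwn_nonneg) simp
  have "(\<Sum>n<N. ennreal ((1 + n * C1) * srwn (Suc n) (indicat_real {y}) x)) = ennreal (\<Sum>n<N. (1 + n * C1) * ?s (Suc n))"
    unfolding srwn_point[of _ y] using C1_nonneg s0 by (intro sum_ennreal mult_nonneg_nonneg) (auto simp del: funpow.simps)
  also have "\<dots> \<le> ennreal ((1 + C1) * C * bar 1 \<beta> (y - x))"
  proof (rule ennreal_leI)
    have "(\<Sum>n<N. (1 + n * C1) * ?s (Suc n)) \<le> (\<Sum>n<N. (1 + C1) * ((real (Suc n) + 1) * ?s (Suc n)))"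
    proof (rule sum_mono)
      fix n
      have "1 + n * C1 \<le> (1 + C1) * (real (Suc n) + 1)" using C1_nonneg by (simp add: algebra_simps)
      from mult_right_mono[OF this s0] show "(1 + n * C1) * ?s (Suc n) \<le> (1 + C1) * ((real (Suc n) + 1) * ?s (Suc n))"
        by (simp only: mult.assoc)
    qed
    also have "\<dots> \<le> (1 + C1) * (\<Sum>t<Suc N. (real t + 1) * ?s t)"
      unfolding sum_distrib_left[symmetric] sum.lessThan_Suc_shift using C1_nonneg s0[of 0] by (intro mult_left_mono) auto
    also have "\<dots> \<le> (1 + C1) * (C * bar 1 \<beta> (x - y))" using C1_nonneg by (intro mult_left_mono C) auto
    also have "bar 1 \<beta> (x - y) = bar 1 \<beta> (y - x)"
      using sq_uminus[of "x - y"] by (simp add: bar_def)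
    finally show "(\<Sum>n<N. (1 + n * C1) * ?s (Suc n)) \<le> (1 + C1) * C * bar 1 \<beta> (y - x)" by (simp only: mult.assoc)
  qed
  finally show "(\<Sum>n<N. ennreal ((1 + n * C1) * srwn (Suc n) (indicat_real {y}) x)) \<le> ennreal ((1 + C1) * C * bar 1 \<beta> (y - x))" .
qed

text \<open>The factor comes from 1 + n C1 \<ge> min 1 C1 (n + 1) and n + 1 \<ge> (n + 2)/2.\<close>

lemma Gf_lower:
  assumes c: "\<And>z::int^'d::finite. \<exists>N. c * bar 1 \<beta> z \<le> (\<Sum>t=1..<N. (real t + 1) * srwn t (indicat_real {0}) z)"
  shows "ennreal (min 1 C1 / 2 * c * bar 1 \<beta> (y - x :: int^'d)) \<le> Gf \<mu> x y"
proof -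
  let ?s = "\<lambda>t. srwn t (indicat_real {0}) (x - y)"
  have s0: "0 \<le> ?s t" for t by (intro srwn_nonneg) simp
  obtain N where N: "c * bar 1 \<beta> (x - y) \<le> (\<Sum>t=1..<N. (real t + 1) * ?s t)" using c by blast
  have "min 1 C1 / 2 * c * bar 1 \<beta> (y - x) = min 1 C1 / 2 * (c * bar 1 \<beta> (x - y))"
    using sq_uminus[of "x - y"] by (simp add: bar_def)
  also have "\<dots> \<le> min 1 C1 / 2 * (\<Sum>t=1..<N. (real t + 1) * ?s t)" using C1_nonneg by (intro mult_left_mono N) auto
  also have "(\<Sum>t=1..<N. (real t + 1) * ?s t) = (\<Sum>n<N-1. (real (Suc n) + 1) * ?s (Suc n))"
    by (rule sum.reindex_bij_witness[of _ Suc "\<lambda>t. t - 1"]) (auto simp del: funpow.simps)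
  also have "min 1 C1 / 2 * \<dots> \<le> (\<Sum>n<N-1. (1 + n * C1) * ?s (Suc n))"
    unfolding sum_distrib_left
  proof (rule sum_mono)
    fix n
    have "min 1 C1 / 2 * (real (Suc n) + 1) \<le> min 1 C1 * (1 + real n)"
    proof -
      have "(real (Suc n) + 1) / 2 \<le> 1 + real n" by simp
      then have "min 1 C1 * ((real (Suc n) + 1) / 2) \<le> min 1 C1 * (1 + real n)" using C1_nonneg by (intro mult_left_mono) auto
      then show ?thesis by simp
    qed
    also have "\<dots> \<le> 1 + n * C1"
      using mult_right_mono[of "min 1 C1" C1 "real n"] by (simp add: distrib_left mult.commute)
    finally have "min 1 C1 / 2 * (real (Suc n) + 1) * ?s (Suc n) \<le> (1 + n * C1) * ?s (Suc n)" by (rule mult_right_mono) (rule s0)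
    then show "min 1 C1 / 2 * ((real (Suc n) + 1) * ?s (Suc n)) \<le> (1 + n * C1) * ?s (Suc n)" by (simp only: mult.assoc)
  qed
  finally have "ennreal (min 1 C1 / 2 * c * bar 1 \<beta> (y - x)) \<le> ennreal (\<Sum>n<N-1. (1 + n * C1) * ?s (Suc n))" by (rule ennreal_leI)
  also have "\<dots> = (\<Sum>n<N-1. ennreal ((1 + n * C1) * ?s (Suc n)))"
    using C1_nonneg s0 by (intro sum_ennreal[symmetric] mult_nonneg_nonneg) (auto simp del: funpow.simps)
  also have "\<dots> \<le> (\<Sum>n. ennreal ((1 + n * C1) * ?s (Suc n)))" by (intro sum_le_suminf) auto
  finally show ?thesis unfolding Gf_eq srwn_point[of _ y] .
qed

lemma tot_centred:
  fixes f :: "int^'d::finite \<Rightarrow> real"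
  assumes "finite K" and f: "\<And>z. 0 \<le> f z"
  shows "tot (\<lambda>z. f z * (indicat_real {z. z + x \<in> K} z * el K (z + x))) = ennreal (\<Sum>y\<in>K. f (y - x) * el K y)"
proof -
  have "tot (\<lambda>z. f z * (indicat_real {z. z + x \<in> K} z * el K (z + x))) = tot (\<lambda>z. (\<lambda>w. f (w - x) * (indicat_real K w * el K w)) (z + x))"
    by (intro arg_cong[of _ _ tot] ext) (simp add: indicator_def)
  also have "\<dots> = tot (\<lambda>w. f (w - x) * (indicat_real K w * el K w))" by (rule tot_shift)
  also have "\<dots> = ennreal (\<Sum>w\<in>K. f (w - x) * (indicat_real K w * el K w))"
    using assms by (intro tot_finite_set) (auto simp: f el_01)
  also have "(\<Sum>w\<in>K. f (w - x) * (indicat_real K w * el K w)) = (\<Sum>w\<in>K. f (w - x) * el K w)"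
    by (intro sum.cong) auto
  finally show ?thesis .
qed

lemma potential_bounds:
  assumes d: "CARD('d::finite) \<ge> 5" and C1: "0 < C1" and mu0: "0 < pmf \<mu> 0" "pmf \<mu> 0 < 1"
  shows "\<exists>c C :: real. c > 0 \<and> C > 0 \<and> (\<forall>K :: (int^'d) set. finite K \<longrightarrow>
        (\<forall>x. (\<Sum>y\<in>K. Gf \<mu> x y * eqm \<mu> K y) \<le> ennreal C) \<and>
        (K \<noteq> {} \<longrightarrow> (\<forall>x\<in>K. (\<Sum>y\<in>K. Gf \<mu> x y * eqm \<mu> K y) \<ge> ennreal c)))"
proof -
  define b where "b = (real CARD('d) - 2) / 2"
  define c1 where "c1 = min (pmf \<mu> 0) (1/2)"
  define f0 where "f0 = 1 - pmf \<mu> 0"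
  obtain Cg where Cg: "0 < Cg" "\<And>n (z::int^'d). (\<Sum>t<n. srwn t (indicat_real {0}) z) \<le> Cg * bar 1 b z"
    using green_upper[OF d b_def] by blast
  obtain C2 where C2: "0 < C2" "\<And>n (z::int^'d). (\<Sum>t<n. (real t + 1) * srwn t (indicat_real {0}) z) \<le> C2 * bar 1 (b - 1) z"
    using green2_upper[OF d b_def] by blast
  obtain cg T where cg: "0 < cg" and cgT: "\<And>n (z::int^'d). 0 < n \<Longrightarrow> 1 + sq z \<le> real n \<Longrightarrow> cg * bar 1 b z \<le> (\<Sum>t<T*n. srwn t (indicat_real {0}) z)"
    using green_lower[OF d b_def] by blast
  have cgN: "\<exists>N. cg * bar 1 b z \<le> (\<Sum>t<N. srwn t (indicat_real {0}) z)" for z :: "int^'d"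
  proof -
    obtain n where "1 + sq z \<le> real n" using real_arch_simple by blast
    moreover from this have "0 < n" using sq_nonneg[of z] by (cases n) auto
    ultimately show ?thesis using cgT by blast
  qed
  obtain cb Bk where cb: "0 < cb" "1 < Bk" "\<And>n (z::int^'d). 0 < n \<Longrightarrow> sq z \<le> 16 * real n \<Longrightarrow> cb * real n powr (-b) \<le> (\<Sum>t=n..<Bk*n. srwn t (indicat_real {0}) z)"
    using block_lower[OF d b_def] by blast
  obtain c2 where c2: "0 < c2" "\<And>z::int^'d. \<exists>N. c2 * bar 1 (b - 1) z \<le> (\<Sum>t=1..<N. (real t + 1) * srwn t (indicat_real {0}) z)"
    using green2_lower[OF d b_def] by blast
  note far = far_test[OF d b_def]
  note near = near_test[OF d b_def]
  from far obtain ct Ct where far: "0 < ct" "0 < Ct" "\<forall>\<rho>\<ge>4. \<forall>w :: int^'d. 16 * \<rho> < sq w \<longrightarrow> (\<exists>T :: int^'d \<Rightarrow> real.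
     (\<forall>z. 0 \<le> T z \<and> T z \<le> 1) \<and> (\<forall>z. sq z \<le> 4 * \<rho> \<longrightarrow> T z = 0) \<and>
     (\<forall>z. (1 - 1 / \<rho>) * srw T z + ct * indicat_real {w} z
        \<le> T z + (if \<rho> \<le> sq z \<and> sq z \<le> 9 * \<rho> then Ct * \<rho> powr (-b-1) * (1 + sq w / \<rho>) powr (- real CARD('d)) else 0)))"
    by blast
  from near obtain cn Cn where near: "0 < cn" "0 < Cn" "\<forall>\<rho>\<ge>1. \<forall>\<rho>'. \<rho> \<le> \<rho>' \<longrightarrow> 4 \<le> \<rho>' \<longrightarrow> (\<exists>T :: int^'d \<Rightarrow> real.
     (\<forall>z. 0 \<le> T z \<and> T z \<le> (\<rho> + sq z) powr (-b)) \<and> (\<forall>z. 5 * \<rho>' \<le> sq z \<longrightarrow> T z = 0) \<and>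
     (\<forall>z. srw T z + (if sq z \<le> 4 * \<rho> then cn * \<rho> powr (-b-1) else 0)
        \<le> T z + (if \<rho>' \<le> sq z \<and> sq z \<le> 9 * \<rho>' then Cn * \<rho>' powr (-b-1) else 0)))"
    by blast
  have test: "brw_test {z. z + x \<in> K} (\<lambda>z. pp K (z + x)) (\<lambda>z. ph K (z + x)) (\<lambda>z. el K (z + x)) c1 C1 f0 b Cg cg cb Bk ct Ct cn Cn"
    if K: "finite K" for K and x :: "int^'d"
  proof (intro brw_test.intro brw_kern.intro)
    show "brw {z. z + x \<in> K} (\<lambda>z. pp K (z + x)) (\<lambda>z. ph K (z + x)) (\<lambda>z. el K (z + x)) c1 C1 f0"
      unfolding c1_def f0_def by (rule brw_centred[OF d K C1 mu0])
    show "brw_kern_axioms TYPE('d) b Cg cg cb Bk"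
      by unfold_locales (rule b_def Cg cg cgN cb; assumption?)+
    show "brw_test_axioms TYPE('d) b ct Ct cn Cn"
      by unfold_locales (rule far near far(3)[rule_format] near(3)[rule_format]; assumption?)+
  qed
  \<comment> \<open>The witness is fixed before K and x are introduced, which succeeds because the
    constant of \<open>upper\<close> is built only from parameters free of K and x.\<close>
  have "\<exists>CU. \<forall>K (x::int^'d). finite K \<longrightarrow> tot (\<lambda>z. bar 1 (b - 1) z * (indicat_real {z. z + x \<in> K} z * el K (z + x))) \<le> ennreal CU"
    by (rule exI, intro allI impI, rule brw_test.upper[OF test])
  then obtain CU where U: "\<And>K (x::int^'d). finite K \<Longrightarrow> tot (\<lambda>z. bar 1 (b - 1) z * (indicat_real {z. z + x \<in> K} z * el K (z + x))) \<le> ennreal CU"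
    by blast
  have lim: "(\<lambda>t. srwn t (\<lambda>z. el K (z + x)) 0) \<longlonglongrightarrow> 1" if "finite K" for K and x :: "int^'d"
    using survival_limit[OF d that, of x] by (simp add: srwn_shift)
  have "\<exists>G B. \<forall>K (x::int^'d) k. finite K \<longrightarrow> x \<in> K \<longrightarrow> 1 \<le> k \<longrightarrow>
     ennreal (1 / (Cg * (1 + C1 / f0))) \<le> ennreal (G k) * tot (\<lambda>z. bar 1 (b - 1) z * (indicat_real {z. z + x \<in> K} z * el K (z + x))) + ennreal (B * (1/2)^k)"
    by (rule exI, rule exI, intro allI impI, rule brw_test.lower[OF test _ lim]) auto
  then obtain G B where L: "\<And>K (x::int^'d) k. finite K \<Longrightarrow> x \<in> K \<Longrightarrow> 1 \<le> k \<Longrightarrow>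
     ennreal (1 / (Cg * (1 + C1 / f0))) \<le> ennreal (G k) * tot (\<lambda>z. bar 1 (b - 1) z * (indicat_real {z. z + x \<in> K} z * el K (z + x))) + ennreal (B * (1/2)^k)"
    by blast
  define c0 where "c0 = 1 / (Cg * (1 + C1 / f0))"
  have c0: "0 < c0" using Cg(1) C1 mu0 by (simp add: c0_def f0_def add_pos_nonneg)
  \<comment> \<open>The existential statements hide the signs of \<open>B\<close> and
    \<open>G k\<close>, hence the absolute values here and in \<open>g\<close>.\<close>
  obtain k where k: "1 \<le> k" "\<bar>B\<bar> * (1/2)^k \<le> c0 / 2"
  proof -
    obtain k where k: "(1/2::real)^k < c0 / 2 / (\<bar>B\<bar> + 1)"
      using real_arch_pow_inv[of "c0 / 2 / (\<bar>B\<bar> + 1)" "1/2"] c0 by (auto simp: add_nonneg_pos)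
    have "(\<bar>B\<bar> + 1) * (1/2)^k \<le> c0 / 2" using k by (simp add: field_simps add_nonneg_pos)
    moreover have "\<bar>B\<bar> * (1/2)^Suc k \<le> (\<bar>B\<bar> + 1) * (1/2)^k" by (intro mult_mono) auto
    ultimately have "\<bar>B\<bar> * (1/2)^Suc k \<le> c0 / 2" by linarith
    then show ?thesis by (intro that[of "Suc k"]) auto
  qed
  define g where "g = \<bar>G k\<bar> + 1"
  have g: "0 < g" by (simp add: g_def)
  define S where "S K x = (\<Sum>y\<in>K. bar 1 (b - 1) (y - x) * el K y)" for K and x :: "int^'d"
  have S0: "0 \<le> S K x" for K x unfolding S_def by (intro sum_nonneg mult_nonneg_nonneg bar_nonneg el_01)
  have totS: "tot (\<lambda>z. bar 1 (b - 1) z * (indicat_real {z. z + x \<in> K} z * el K (z + x))) = ennreal (S K x)" if "finite K" for K and x :: "int^'d"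
    unfolding S_def by (rule tot_centred[OF that]) (simp add: bar_nonneg)
  have SU: "S K x \<le> \<bar>CU\<bar>" if "finite K" for K x
  proof -
    have "ennreal (S K x) \<le> ennreal \<bar>CU\<bar>" using U[OF that, of x] unfolding totS[OF that] by (rule order_trans) (simp add: ennreal_leI)
    then show ?thesis by (simp add: ennreal_le_iff)
  qed
  have SL: "c0 / (2 * g) \<le> S K x" if "finite K" "x \<in> K" for K x
  proof -
    have "ennreal c0 \<le> ennreal (G k) * ennreal (S K x) + ennreal (B * (1/2)^k)"
      using L[OF that k(1)] unfolding totS[OF that(1)] c0_def .
    also have "\<dots> \<le> ennreal g * ennreal (S K x) + ennreal (c0 / 2)"
    proof (intro add_mono mult_right_mono ennreal_leI)
      show "B * (1/2)^k \<le> c0 / 2" using order_trans[OF mult_right_mono[OF abs_ge_self[of B]] k(2)] by simp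
    qed (auto simp: g_def)
    also have "\<dots> = ennreal (g * S K x + c0 / 2)"
      using g c0 S0 by (simp add: ennreal_mult[symmetric] ennreal_plus[symmetric] del: ennreal_plus)
    finally have "c0 \<le> g * S K x + c0 / 2" using g c0 S0 by (subst (asm) ennreal_le_iff) auto
    then have "c0 / 2 \<le> g * S K x" by simp
    then show ?thesis using g by (simp add: field_simps)
  qed
  have prod: "ennreal (\<kappa> * bar 1 (b - 1) (y - x)) * ennreal (indicat_real K y * el K y) = ennreal (\<kappa> * (bar 1 (b - 1) (y - x) * el K y))"
    if "y \<in> K" "0 \<le> \<kappa>" for \<kappa> K and x y :: "int^'d"
    using that by (subst ennreal_mult[symmetric]) (auto simp: bar_nonneg el_01 mult.assoc)
  have sumS: "(\<Sum>y\<in>K. ennreal (\<kappa> * bar 1 (b - 1) (y - x)) * ennreal (indicat_real K y * el K y)) = ennreal (\<kappa> * S K x)"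
    if "0 \<le> \<kappa>" for \<kappa> K x
  proof -
    have "(\<Sum>y\<in>K. ennreal (\<kappa> * bar 1 (b - 1) (y - x)) * ennreal (indicat_real K y * el K y)) = (\<Sum>y\<in>K. ennreal (\<kappa> * (bar 1 (b - 1) (y - x) * el K y)))"
      using that by (intro sum.cong refl prod)
    also have "\<dots> = ennreal (\<Sum>y\<in>K. \<kappa> * (bar 1 (b - 1) (y - x) * el K y))"
      using that by (intro sum_ennreal) (simp add: bar_nonneg el_01)
    finally show ?thesis by (simp add: S_def sum_distrib_left)
  qed
  have k1: "0 \<le> (1 + C1) * C2" using C1 C2(1) by simp
  have k2: "0 < min 1 C1 / 2 * c2" using C1 c2(1) by simp
  show ?thesis
  proof (rule exI[of _ "min 1 C1 / 2 * c2 * (c0 / (2 * g))"], rule exI[of _ "(1 + C1) * C2 * \<bar>CU\<bar> + 1"], intro conjI allI impI ballI)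
    show "0 < min 1 C1 / 2 * c2 * (c0 / (2 * g))" using k2 c0 g by simp
    show "0 < (1 + C1) * C2 * \<bar>CU\<bar> + 1" using k1 by (simp add: add_nonneg_pos)
  next
    fix K :: "(int^'d) set" and x assume K: "finite K"
    have "(\<Sum>y\<in>K. Gf \<mu> x y * eqm \<mu> K y) \<le> (\<Sum>y\<in>K. ennreal ((1 + C1) * C2 * bar 1 (b - 1) (y - x)) * ennreal (indicat_real K y * el K y))"
      unfolding eqm_eq by (intro sum_mono mult_right_mono Gf_upper C2(2)) auto
    also have "\<dots> = ennreal ((1 + C1) * C2 * S K x)" by (rule sumS[OF k1])
    also have "\<dots> \<le> ennreal ((1 + C1) * C2 * \<bar>CU\<bar> + 1)"
      using mult_left_mono[OF SU[OF K, of x] k1] by (intro ennreal_leI) simp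
    finally show "(\<Sum>y\<in>K. Gf \<mu> x y * eqm \<mu> K y) \<le> ennreal ((1 + C1) * C2 * \<bar>CU\<bar> + 1)" .
  next
    fix K :: "(int^'d) set" and x assume K: "finite K" and x: "x \<in> K"
    have "ennreal (min 1 C1 / 2 * c2 * (c0 / (2 * g))) \<le> ennreal (min 1 C1 / 2 * c2 * S K x)"
      using k2 by (intro ennreal_leI mult_left_mono SL K x) auto
    also have "\<dots> = (\<Sum>y\<in>K. ennreal (min 1 C1 / 2 * c2 * bar 1 (b - 1) (y - x)) * ennreal (indicat_real K y * el K y))"
      using k2 by (intro sumS[symmetric]) simp
    also have "\<dots> \<le> (\<Sum>y\<in>K. Gf \<mu> x y * eqm \<mu> K y)"
      unfolding eqm_eq by (intro sum_mono mult_right_mono Gf_lower c2(2)) auto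
    finally show "ennreal (min 1 C1 / 2 * c2 * (c0 / (2 * g))) \<le> (\<Sum>y\<in>K. Gf \<mu> x y * eqm \<mu> K y)" .
  qed
qed

end

theorem theorem1p1:
  fixes \<mu> :: "nat pmf"
  assumes d5: "CARD('d::finite) \<ge> 5"
    and mean1: "measure_pmf.expectation \<mu> real = 1"
    and finvar: "integrable (measure_pmf \<mu>) (\<lambda>n. (real n)^2)"
    and varpos: "measure_pmf.variance \<mu> real > 0"
  shows "\<exists>c C :: real. c > 0 \<and> C > 0 \<and>
     (\<forall>K :: (int^'d) set. finite K \<longrightarrow>
        (\<forall>x. (\<Sum>y\<in>K. Gf \<mu> x y * eqm \<mu> K y) \<le> ennreal C) \<and>
        (K \<noteq> {} \<longrightarrow> (\<forall>x\<in>K. (\<Sum>y\<in>K. Gf \<mu> x y * eqm \<mu> K y) \<ge> ennreal c)))"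
proof -
  \<comment> \<open>A non-integrable function would have integral 0 by convention, contradicting
    mean 1.\<close>
  have int: "integrable (measure_pmf \<mu>) real"
  proof (rule ccontr)
    assume "\<not> integrable (measure_pmf \<mu>) real"
    then show False using mean1 by (simp add: not_integrable_integral_eq)
  qed
  have tri: "(\<Sum>j<n. real j) = ((real n)^2 - real n) / 2" for n
    by (induction n) (auto simp: power2_eq_square field_simps)
  \<comment> \<open>As j is summed below n this is the mean of n(n-1)/2, half of the
    variance.\<close>
  define C1 where "C1 = measure_pmf.expectation \<mu> (\<lambda>n. \<Sum>j<n. real j)"
  have itri: "integrable (measure_pmf \<mu>) (\<lambda>n. \<Sum>j<n. real j)"
    unfolding tri using int finvar by auto
  have "C1 = (measure_pmf.expectation \<mu> (\<lambda>n. (real n)^2) - 1) / 2"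
    unfolding C1_def tri using int finvar mean1 by simp
  then have C1: "0 < C1"
    using varpos int finvar mean1 by (subst (asm) measure_pmf.variance_eq) auto
  have crit: "crit \<mu> C1"
  proof
    have "(\<integral>\<^sup>+n. of_nat n \<partial>measure_pmf \<mu>) = (\<integral>\<^sup>+n. ennreal (real n) \<partial>measure_pmf \<mu>)"
      by (simp add: ennreal_of_nat_eq_real_of_nat)
    also have "\<dots> = 1" using nn_integral_eq_integral[OF int] mean1 by simp
    finally show "(\<integral>\<^sup>+n. of_nat n \<partial>measure_pmf \<mu>) = 1" .
    have "(\<integral>\<^sup>+n. (\<Sum>j<n. of_nat j) \<partial>measure_pmf \<mu>) = (\<integral>\<^sup>+n. ennreal (\<Sum>j<n. real j) \<partial>measure_pmf \<mu>)"
      by (intro nn_integral_cong) (simp add: ennreal_of_nat_eq_real_of_nat sum_ennreal)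
    also have "\<dots> = ennreal C1" unfolding C1_def by (rule nn_integral_eq_integral[OF itri]) (simp add: sum_nonneg)
    finally show "(\<integral>\<^sup>+n. (\<Sum>j<n. of_nat j) \<partial>measure_pmf \<mu>) = ennreal C1" .
  qed (use C1 in simp)
  have i0: "integrable (measure_pmf \<mu>) (indicat_real {0})" by (rule measure_pmf.integrable_const_bound[where B=1]) auto
  \<comment> \<open>Without an atom at 0 the offspring number would be at least 1 with mean 1, hence
    constant, against the positive variance.\<close>
  have "pmf \<mu> 0 \<noteq> 0"
  proof
    assume z: "pmf \<mu> 0 = 0"
    have n0: "n \<noteq> 0" if "n \<in> set_pmf \<mu>" for n
      using z that by (cases "n = 0") (simp_all add: set_pmf_iff)
    have "measure_pmf.expectation \<mu> (\<lambda>n. real n - 1) = 0" using int mean1 by simp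
    moreover have "AE n in measure_pmf \<mu>. 0 \<le> real n - 1" 
    proof (rule AE_pmfI)
      fix n assume "n \<in> set_pmf \<mu>"
      then show "0 \<le> real n - 1" using n0[of n] by (cases n) auto
    qed
    ultimately have "AE n in measure_pmf \<mu>. real n - 1 = 0"
      using int by (subst (asm) integral_nonneg_eq_0_iff_AE) auto
    then have "AE n in measure_pmf \<mu>. (\<Sum>j<n. real j) = 0" by eventually_elim (simp add: tri)
    then have "C1 = 0" unfolding C1_def by (intro integral_eq_zero_AE)
    then show False using C1 by simp
  qed
  moreover have "pmf \<mu> 0 \<noteq> 1"
  proof
    assume "pmf \<mu> 0 = 1"
    then have "AE n in measure_pmf \<mu>. n \<in> {0}" by (intro measure_pmf.AE_prob_1) (simp add: measure_pmf_single)
    then have "measure_pmf.expectation \<mu> real = 0" by (intro integral_eq_zero_AE) (auto elim!: eventually_mono)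
    then show False using mean1 by simp
  qed
  ultimately have "0 < pmf \<mu> 0" "pmf \<mu> 0 < 1"
    using pmf_nonneg[of \<mu> 0] pmf_le_1[of \<mu> 0] by linarith+
  then show ?thesis by (rule crit.potential_bounds[OF crit d5 C1])
qed

end
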